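(* Let $d\ge1$ and let $g(n)=\beta_dn^d+\cdots+\beta_1n+\beta_0$ be a real polynomial of degree $d$. Assume that for every $\varepsilon>0$ there exists $C=C(g,\varepsilon)>0$ such that for every nonzero integer $q$, $$\max_{1\le i\le d}\|q\beta_i\|_{\mathbb{R}/\mathbb{Z}}\ge C\exp\bigl(-|q|^{\varepsilon}\bigr).$$ Let $f$ be a Steinhaus random multiplicative function and let $S_N=\frac1{\sqrt N}\sum_{n\le N}f(n)\,e(g(n))$. Then, as $N\to\infty$, $S_N$ converges in law to a complex normal distribution with mean $0$ and variance $1$.
   Context: Notation: $e(x)=\exp(2\pi i x)$; $\|x\|_{\mathbb{R}/\mathbb{Z}}$ is the distance from $x\in\mathbb R$ to the nearest integer. Sums $\sum_{n\le N}$ run over positive integers $n\le N$. Steinhaus random multiplicative function: let $\{f(p)\}_{p\text{ prime}}$ be independent random variables, each uniformly distributed on the complex unit circle, and extend to all natural numbers by complete multiplicativity, $f(n)=\prod_{p^k\parallel n}f(p)^k$, where $p^k\parallel n$ means $p^k$ is the highest power of $p$ dividing $n$. The complex normal distribution with mean $0$ and variance $1$ is the standard (circularly symmetric) one, i.e. the law of $X+iY$ with $X,Y$ independent real Gaussians of mean $0$ and variance $1/2$. *)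

theory Defs
  imports "HOL-Probability.Probability" "HOL-Computational_Algebra.Computational_Algebra"
begin

definition unit_exp :: "real \<Rightarrow> complex" where
  "unit_exp x = exp (2 * of_real pi * \<i> * of_real x)"

definition dist_int :: "real \<Rightarrow> real" where
  "dist_int x = infdist x \<int>"

definition unit_circle_measure :: "complex measure" where
  "unit_circle_measure = distr (uniform_measure lborel {0..1}) borel unit_exp"

text \<open>Only the values of \<open>f\<close> at positive integers matter; \<open>f 0\<close> is left unconstrained.\<close>

definition steinhaus :: "'a measure \<Rightarrow> (nat \<Rightarrow> 'a \<Rightarrow> complex) \<Rightarrow> bool" where
  "steinhaus M f \<longleftrightarrow>
     prob_space M \<and>
     prob_space.indep_vars M (\<lambda>_. borel) f {p. prime p} \<and>
     (\<forall>p. prime p \<longrightarrow> distr M borel (f p) = unit_circle_measure) \<and>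
     (\<forall>n>0. \<forall>\<omega>\<in>space M. f n \<omega> = (\<Prod>p\<in>prime_factors n. f p \<omega> ^ multiplicity p n))"

text \<open>The standard deviation of each real coordinate is \<open>sqrt (1/2)\<close>, so that the total
  variance is 1.\<close>

definition complex_std_normal :: "complex measure" where
  "complex_std_normal =
     distr (density lborel (normal_density 0 (sqrt (1/2))) \<Otimes>\<^sub>M
            density lborel (normal_density 0 (sqrt (1/2))))
           borel (\<lambda>(x, y). Complex x y)"

text \<open>The library's \<open>weak_conv_m\<close> is tied to distribution functions on the real line, so
  convergence in law of complex random variables is defined by bounded continuous test functions.\<close>

definition converges_in_law ::
    "'a measure \<Rightarrow> (nat \<Rightarrow> 'a \<Rightarrow> complex) \<Rightarrow> complex measure \<Rightarrow> bool" where
  "converges_in_law M X \<mu> \<longleftrightarrow>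
     (\<forall>n. X n \<in> borel_measurable M) \<and>
     (\<forall>h :: complex \<Rightarrow> real. continuous_on UNIV h \<and> bounded (range h) \<longrightarrow>
        (\<lambda>n. \<integral>z. h z \<partial>distr M borel (X n)) \<longlonglongrightarrow> (\<integral>z. h z \<partial>\<mu>))"

definition twisted_sum :: "(nat \<Rightarrow> 'a \<Rightarrow> complex) \<Rightarrow> real poly \<Rightarrow> nat \<Rightarrow> 'a \<Rightarrow> complex" where
  "twisted_sum f g N \<omega> = 1 / of_real (sqrt (real N)) * (\<Sum>n=1..N. f n \<omega> * unit_exp (poly g (real n)))"

lemma unit_exp_measurable [measurable]: "unit_exp \<in> borel_measurable borel"
  unfolding unit_exp_def by (intro borel_measurable_continuous_onI continuous_intros)

lemma prob_space_unit_circle_measure: "prob_space unit_circle_measure"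
proof -
  interpret prob_space "uniform_measure lborel {0..1::real}"
    by (rule prob_space_uniform_measure) auto
  show ?thesis
    unfolding unit_circle_measure_def by (rule prob_space_distr) simp
qed

lemma prob_space_complex_std_normal: "prob_space complex_std_normal"
proof -
  let ?D = "density lborel (\<lambda>x. ennreal (normal_density 0 (sqrt (1/2)) x))"
  interpret D: prob_space ?D
    by (rule prob_space_normal_density) simp
  interpret P: pair_prob_space ?D ?D ..
  have "(\<lambda>(x, y). Complex x y) \<in> borel_measurable (borel \<Otimes>\<^sub>M borel)"
    unfolding borel_prod complex_eq case_prod_beta
    by (intro borel_measurable_continuous_onI continuous_intros)
  moreover have "sets (?D \<Otimes>\<^sub>M ?D) = sets (borel \<Otimes>\<^sub>M borel)"
    by (intro sets_pair_measure_cong) auto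
  ultimately show ?thesis
    unfolding complex_std_normal_def
    by (intro P.prob_space_distr) (simp cong: measurable_cong_sets)
qed

end

theory Submission
  imports Defs "HOL-Real_Asymp.Real_Asymp"
begin

text \<open>
  Group the integers \<open>n \<le> N\<close> by their largest prime factor \<open>p\<close>, writing \<open>n = p * m\<close>.  The sum becomes
  \<open>\<Sum>p. A p * f p\<close>, where \<open>A p\<close> depends only on the values of \<open>f\<close> at primes smaller than \<open>p\<close>, and
  \<open>f p\<close> is uniform on the circle and independent of these values.  This is a martingale, and
  Taylor expansion of one factor at a time shows that its characteristic function at \<open>\<xi>\<close> differs
  from \<open>exp (-|\<xi>|^2 / 4)\<close> by at most a constant times \<open>E |V - 1| + (\<Sum>p. E |A p|^4)\<close>, where
  \<open>V = (\<Sum>p. |A p|^2)\<close> (lemma \<open>characteristic_function_close_to_gaussian\<close>).  Convergence of characteristic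
  functions together with \<open>E |S|^2 = 1\<close> gives convergence in law
  (\<open>weak_convergence_of_characteristic_functions\<close>).  It remains to make both error terms small.

  The fourth moments are a matter of counting: \<open>E |A p|^4\<close> is at most \<open>1 / N^2\<close> times the number of
  solutions of \<open>a * b = a' * b'\<close> in integers up to \<open>N / p\<close>, which is \<open>(N / p)^2\<close> up to logarithms, and the sum
  over large \<open>p\<close> is negligible (\<open>adm_energy_tendsto_0\<close>).

  The variance of \<open>V\<close> carries the arithmetic.  Since \<open>f m * cnj (f m')\<close> depends only on the reduced fraction
  \<open>a / b = m / m'\<close>, and different reduced fractions give orthogonal random variables,
  \<open>E (V - 1)^2\<close> equals, up to the contribution of the diagonal \<open>a = b = 1\<close>, the sum of \<open>|T a b|^2 / N^2\<close> with
  \<open>T a b = (\<Sum>p h. e (g (p * a * h) - g (p * b * h)))\<close> (\<open>quadratic_variation_deviation\<close>).  Trivially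
  \<open>|T a b| \<le> N / max a b\<close>, and the squares of this bound sum to about \<open>N^2 * ln N\<close>: the trivial bound is
  too large only by a logarithm, so it is enough to save a power of \<open>ln N\<close>, and to do so for most pairs.

  The sum \<open>T a b\<close> is bilinear in \<open>p\<close> and \<open>h\<close>, with a polynomial phase of coefficients
  \<open>\<beta> i * (a^i - b^i)\<close>.  By the Cauchy-Schwarz inequality the primes disappear, and Weyl's method shows that
  there is a saving unless all these coefficients have a common denominator \<open>q \<le> (ln N)^K\<close>, up to an error
  \<open>(ln N)^K * exp (- (ln N)^(1/10))\<close> (\<open>bilinear_inverse\<close>, \<open>large_cofactor_sum\<close>).  If this happens for
  a proportion \<open>(ln N)^(-2)\<close> of the \<open>b < a\<close>, then the polynomial \<open>b \<mapsto> q * \<beta> i * b^i\<close> is too often close to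
  a fixed number modulo one, and the \<open>\<beta> i\<close> themselves have a common denominator of the same kind.
  The hypothesis on \<open>g\<close>, applied with a small \<open>\<epsilon>\<close>, excludes that (\<open>phase_bad_sparse\<close>).  The
  exceptional pairs are thus so rare that the trivial bound suffices for them.

  Two technical choices make this work.  The dependence on primes is organised in short
  multiplicative blocks: only \<open>n\<close> whose largest prime factor lies in a strictly higher block than all
  other prime factors are kept.  Inside a block, the condition on the
  prime factors of \<open>h\<close> is then the same for all \<open>p\<close>, which makes \<open>T a b\<close> bilinear.  Also \<open>p\<close> is required to be large.
  Almost all integers have both properties (\<open>adm_density\<close>), and the others contribute little in mean square.
\<close>

section \<open>Distance to the nearest integer and phases\<close>

lemma dist_int_eq_round: "dist_int x = \<bar>x - of_int (round x)\<bar>"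
proof (rule antisym)
  show "dist_int x \<le> \<bar>x - of_int (round x)\<bar>"
    unfolding dist_int_def by (rule infdist_le2[of "of_int (round x)"]) (auto simp: dist_real_def)
  show "\<bar>x - of_int (round x)\<bar> \<le> dist_int x"
    unfolding dist_int_def infdist_def
    using round_diff_minimal[of x]
    by (auto intro!: cINF_greatest simp: dist_real_def Ints_def abs_minus_commute)
qed

lemma dist_int_nonneg [simp]: "dist_int x \<ge> 0"
  by (simp add: dist_int_eq_round)

lemma dist_int_obtain:
  obtains k :: int where "dist_int x = \<bar>x - of_int k\<bar>"
  using dist_int_eq_round by blast

lemma dist_int_le: "dist_int x \<le> \<bar>x - of_int k\<bar>"
  unfolding dist_int_eq_round by (metis abs_minus_commute round_diff_minimal)

lemma dist_int_le_half: "dist_int x \<le> 1/2"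
  unfolding dist_int_eq_round by (metis abs_minus_commute of_int_round_abs_le)

lemma dist_int_le_abs: "dist_int x \<le> \<bar>x\<bar>"
  using dist_int_le[of x 0] by simp

lemma dist_int_triangle: "dist_int (x + y) \<le> dist_int x + dist_int y"
proof -
  have "dist_int (x + y) \<le> \<bar>x + y - of_int (round x + round y)\<bar>" by (rule dist_int_le)
  also have "\<dots> \<le> dist_int x + dist_int y" unfolding dist_int_eq_round by simp
  finally show ?thesis .
qed

lemma dist_int_minus [simp]: "dist_int (- x) = dist_int x"
proof -
  have "dist_int (- x) \<le> dist_int x" for x
    using dist_int_le[of "-x" "- round x"] by (simp add: dist_int_eq_round)
  from this[of x] this[of "-x"] show ?thesis by simp
qed

lemma dist_int_diff: "dist_int (x - y) \<le> dist_int x + dist_int y"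
  using dist_int_triangle[of x "-y"] by simp

lemma dist_int_add_int [simp]: "dist_int (x + of_int k) = dist_int x"
proof -
  have "dist_int (x + of_int k) \<le> dist_int x" for x k
    using dist_int_le[of "x + of_int k" "round x + k"] by (simp add: dist_int_eq_round)
  from this[of x k] this[of "x + of_int k" "-k"] show ?thesis by simp
qed

lemma dist_int_of_int_mult: "dist_int (of_int k * x) \<le> \<bar>of_int k\<bar> * dist_int x"
proof -
  have "dist_int (of_int k * x) \<le> \<bar>of_int k * x - of_int (k * round x)\<bar>" by (rule dist_int_le)
  also have "\<dots> = \<bar>of_int k\<bar> * dist_int x"
    by (simp add: dist_int_eq_round right_diff_distrib flip: abs_mult)
  finally show ?thesis .
qed

lemma dist_int_of_nat_mult: "dist_int (of_nat k * x) \<le> of_nat k * dist_int x"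
  using dist_int_of_int_mult[of "int k" x] by simp

lemma dist_int_sum: "dist_int (\<Sum>i\<in>S. f i) \<le> (\<Sum>i\<in>S. dist_int (f i))"
proof (induction S rule: infinite_finite_induct)
  case (insert x F)
  then show ?case using dist_int_triangle[of "f x" "sum f F"] by auto
qed (use dist_int_le_abs[of 0] in auto)

lemma unit_exp_cis: "unit_exp x = cis (2 * pi * x)"
  by (simp add: unit_exp_def cis_conv_exp mult_ac)

lemma norm_unit_exp [simp]: "norm (unit_exp x) = 1"
  by (simp add: unit_exp_cis)

lemma unit_exp_add: "unit_exp (x + y) = unit_exp x * unit_exp y"
  by (simp add: unit_exp_cis cis_mult ring_distribs)

lemma unit_exp_cnj: "cnj (unit_exp x) = unit_exp (- x)"
  by (simp add: unit_exp_cis cis_cnj)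

lemma unit_exp_diff: "unit_exp (x - y) = unit_exp x * cnj (unit_exp y)"
  using unit_exp_add[of x "-y"] by (simp add: unit_exp_cnj)

lemma unit_exp_of_int [simp]: "unit_exp (of_int k) = 1"
  using cis_multiple_2pi[of "of_int k"] by (simp add: unit_exp_cis)

lemma unit_exp_of_nat_mult: "unit_exp (of_nat n * x) = unit_exp x ^ n"
  unfolding unit_exp_cis Complex.DeMoivre by (simp add: mult_ac)

lemma unit_exp_diff_int: "unit_exp (x - of_int k) = unit_exp x"
  using unit_exp_add[of x "of_int (-k)"] unit_exp_of_int[of "-k"] by simp

lemma norm_unit_exp_minus_1: "norm (unit_exp x - 1) = 2 * \<bar>sin (pi * dist_int x)\<bar>"
proof -
  have sgn: "\<bar>sin (pi * \<bar>t\<bar>)\<bar> = \<bar>sin (pi * t)\<bar>" for t :: real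
    by (cases "t \<ge> 0") auto
  have "norm (unit_exp t - 1) = 2 * \<bar>sin (pi * t)\<bar>" for t
    using dist_exp_i_1[of "2 * pi * t"] by (simp add: unit_exp_def mult_ac)
  from this[of "x - of_int (round x)"] show ?thesis
    by (simp add: unit_exp_diff_int dist_int_eq_round sgn)
qed

text \<open>The chord is \<open>2 * sin t\<close> with \<open>t = \<pi> * dist_int x \<le> \<pi> / 2\<close>, and
  \<open>sin t \<ge> t / 2\<close> there; the constant comes from \<open>\<pi> > 3\<close>.\<close>
lemma norm_unit_exp_minus_1_ge: "norm (unit_exp x - 1) \<ge> 3 * dist_int x"
proof -
  define t where "t = pi * dist_int x"
  have t: "0 \<le> t" "t \<le> 1.6" 
    using mult_mono[of pi "3.2" "dist_int x" "1/2"] dist_int_le_half[of x] pi_approx by (auto simp: t_def)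
  have "\<bar>sin t - (\<Sum>m<3. sin_coeff m * t ^ m)\<bar> \<le> inverse (fact 3) * \<bar>t\<bar> ^ 3"
    by (rule Maclaurin_sin_bound)
  hence "sin t \<ge> t - t ^ 3 / 6" using t by (simp add: sin_coeff_def eval_nat_numeral abs_if split: if_splits)
  moreover have "t ^ 3 \<le> 2.6 * t"
  proof -
    have "t * t \<le> 1.6 * 1.6" using t by (intro mult_mono) auto
    hence "t * (t * t) \<le> t * 2.6" using t by (intro mult_left_mono) auto
    thus ?thesis by (simp add: eval_nat_numeral)
  qed
  ultimately have "sin t \<ge> t / 2" using t by linarith
  hence "2 * \<bar>sin t\<bar> \<ge> t" by linarith
  moreover have "t \<ge> 3 * dist_int x" unfolding t_def using pi_gt3 by (intro mult_right_mono) auto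
  ultimately show ?thesis by (simp add: norm_unit_exp_minus_1 t_def)
qed

lemma norm_unit_exp_diff_le: "norm (unit_exp x - unit_exp y) \<le> 2 * pi * dist_int (x - y)"
proof -
  have "unit_exp x - unit_exp y = unit_exp y * (unit_exp (x - y) - 1)"
    using unit_exp_add[of y "x - y"] by (simp add: ring_distribs)
  hence "norm (unit_exp x - unit_exp y) = 2 * \<bar>sin (pi * dist_int (x - y))\<bar>"
    by (simp add: norm_mult norm_unit_exp_minus_1)
  also have "\<dots> \<le> 2 * \<bar>pi * dist_int (x - y)\<bar>"
    using abs_sin_x_le_abs_x[of "pi * dist_int (x - y)"] by linarith
  finally show ?thesis by (simp add: abs_mult)
qed

section \<open>Linear phases that are often close to integers\<close>

text \<open>The second Bonferroni inequality, by adding the sets one at a time.\<close>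
lemma card_UN_ge_pairwise:
  fixes A :: "nat \<Rightarrow> 'b set"
  assumes "\<And>i. i < n \<Longrightarrow> finite (A i)"
  shows "(\<Sum>i<n. card (A i)) \<le> card (\<Union>i<n. A i) + (\<Sum>i<n. \<Sum>j<i. card (A i \<inter> A j))"
  using assms
proof (induction n)
  case (Suc n)
  have fin: "finite (\<Union>i<n. A i)" using Suc.prems by auto
  have "card (A n) + card (\<Union>i<n. A i) = card (A n \<union> (\<Union>i<n. A i)) + card (A n \<inter> (\<Union>i<n. A i))"
    by (rule card_Un_Int) (use Suc.prems fin in auto)
  moreover have "card (A n \<inter> (\<Union>i<n. A i)) \<le> (\<Sum>j<n. card (A n \<inter> A j))"
    unfolding Int_UN_distrib by (rule card_UN_le) auto
  moreover have "(\<Union>i<Suc n. A i) = A n \<union> (\<Union>i<n. A i)"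
    by (auto simp: lessThan_Suc)
  ultimately show ?case using Suc.IH Suc.prems by simp
qed simp

text \<open>If the shifts \<open>S + i\<close> with \<open>i < H\<close> overlapped little, their union would have more
  than \<open>Z + H\<close> elements, the length of the interval that contains it.  So two of them overlap, and
  \<open>h\<close> is the difference of the shifts.\<close>
lemma shifted_overlap:
  fixes S :: "nat set" and D :: real
  assumes S: "S \<subseteq> {u..<u+Z}" and D: "D \<ge> 1" and card: "real Z \<le> D * real (card S)"
    and H: "4 * D \<le> real H" "H \<le> Z"
  obtains h where "1 \<le> h" "h < H" "real Z / real H ^ 2 \<le> real (card {s\<in>S. s + h \<in> S})"
proof (rule ccontr)
  note obt = that
  assume neg: "\<not> thesis"
  define m where "m = real Z / real H ^ 2"
  have small: "real (card {s\<in>S. s + h \<in> S}) \<le> m" if "1 \<le> h" "h < H" for h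
    using neg obt[of h] that unfolding m_def by (meson leI less_imp_le)
  have fin: "finite S" using S finite_subset by blast
  have Hpos: "real H \<ge> 4" using H D by linarith
  define A where "A = (\<lambda>i. (\<lambda>s. s + i) ` S)"
  have cA: "card (A i) = card S" for i unfolding A_def by (rule card_image) auto
  have int: "real (card (A i \<inter> A j)) \<le> m" if "j < i" "i < H" for i j
  proof -
    have "A i \<inter> A j \<subseteq> (\<lambda>s. s + i) ` {s\<in>S. s + (i - j) \<in> S}"
    proof
      fix x assume "x \<in> A i \<inter> A j"
      then obtain s t where "s \<in> S" "t \<in> S" "x = s + i" "x = t + j" unfolding A_def by auto
      moreover from this have "t = s + (i - j)" using that by linarith
      ultimately show "x \<in> (\<lambda>s. s + i) ` {s\<in>S. s + (i - j) \<in> S}" by auto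
    qed
    hence "card (A i \<inter> A j) \<le> card ((\<lambda>s. s + i) ` {s\<in>S. s + (i - j) \<in> S})"
      using fin by (intro card_mono) auto
    also have "\<dots> \<le> card {s\<in>S. s + (i - j) \<in> S}" using fin by (intro card_image_le) auto
    finally show ?thesis using small[of "i - j"] that by linarith
  qed
  have "(\<Union>i<H. A i) \<subseteq> {u..<u + Z + H}" using S unfolding A_def by force
  hence "card (\<Union>i<H. A i) \<le> card {u..<u + Z + H}" by (rule card_mono[rotated]) simp
  hence "card (\<Union>i<H. A i) \<le> Z + H" by simp
  moreover have "(\<Sum>i<H. card (A i)) \<le> card (\<Union>i<H. A i) + (\<Sum>i<H. \<Sum>j<i. card (A i \<inter> A j))"
    by (rule card_UN_ge_pairwise) (simp add: A_def fin)
  ultimately have "H * card S \<le> 2 * Z + (\<Sum>i<H. \<Sum>j<i. card (A i \<inter> A j))"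
    using H by (simp add: cA)
  hence "real H * real (card S) \<le> 2 * real Z + (\<Sum>i<H. \<Sum>j<i. real (card (A i \<inter> A j)))"
    by (simp flip: of_nat_sum of_nat_mult of_nat_add)
  also have "(\<Sum>i<H. \<Sum>j<i. real (card (A i \<inter> A j))) \<le> (\<Sum>i<H. real H * m)"
  proof (rule sum_mono)
    fix i assume i: "i \<in> {..<H}"
    have "(\<Sum>j<i. real (card (A i \<inter> A j))) \<le> (\<Sum>j<i. m)" using int i by (intro sum_mono) auto
    also have "\<dots> = real i * m" by simp
    also have "\<dots> \<le> real H * m" using i by (intro mult_right_mono) (auto simp: m_def)
    finally show "(\<Sum>j<i. real (card (A i \<inter> A j))) \<le> real H * m" .
  qed
  also have "\<dots> = real Z" using Hpos by (simp add: m_def power2_eq_square)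
  finally have "real H * real (card S) \<le> 3 * real Z" by linarith
  moreover have "4 * real Z \<le> real H * real (card S)"
  proof -
    have "4 * real Z \<le> 4 * D * real (card S)" using card by simp
    also have "\<dots> \<le> real H * real (card S)" using H by (intro mult_right_mono) auto
    finally show ?thesis .
  qed
  moreover have "real Z > 0" using H Hpos by linarith
  ultimately show False by linarith
qed

text \<open>The progression passes close to about \<open>N * \<theta>\<close> integers, and each of them it sees at most
  \<open>2 * \<eta> / \<theta> + 1\<close> times.\<close>
lemma card_close_to_int_pos:
  fixes c \<theta> \<eta> :: real
  assumes "\<theta> > 0" "\<eta> \<ge> 0"
  shows "real (card {m::nat. m < N \<and> dist_int (c + real m * \<theta>) \<le> \<eta>}) \<le> (2 * \<eta> / \<theta> + 1) * (real N * \<theta> + 2 * \<eta> + 1)"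
proof -
  define T where "T = {\<lceil>c - \<eta>\<rceil>..\<lfloor>c + real N * \<theta> + \<eta>\<rfloor>}"
  define B where "B = (\<lambda>t::int. {m::nat. \<bar>c + real m * \<theta> - of_int t\<bar> \<le> \<eta>})"
  have Bsub: "B t \<subseteq> nat ` {\<lceil>(of_int t - c - \<eta>) / \<theta>\<rceil>..\<lfloor>(of_int t - c + \<eta>) / \<theta>\<rfloor>}" for t
  proof
    fix m assume "m \<in> B t"
    hence "(of_int t - c - \<eta>) / \<theta> \<le> real m" "real m \<le> (of_int t - c + \<eta>) / \<theta>"
      using assms by (auto simp: B_def abs_le_iff field_simps)
    hence "int m \<in> {\<lceil>(of_int t - c - \<eta>) / \<theta>\<rceil>..\<lfloor>(of_int t - c + \<eta>) / \<theta>\<rfloor>}"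
      by (auto simp: ceiling_le_iff le_floor_iff)
    thus "m \<in> nat ` {\<lceil>(of_int t - c - \<eta>) / \<theta>\<rceil>..\<lfloor>(of_int t - c + \<eta>) / \<theta>\<rfloor>}" by force
  qed
  have card_int: "real (card {\<lceil>a\<rceil>..\<lfloor>b\<rfloor>}) \<le> b - a + 1" if "a \<le> b" for a b :: real
    using that by (simp, linarith)
  have cB: "real (card (B t)) \<le> 2 * \<eta> / \<theta> + 1" for t
  proof -
    have "card (B t) \<le> card {\<lceil>(of_int t - c - \<eta>) / \<theta>\<rceil>..\<lfloor>(of_int t - c + \<eta>) / \<theta>\<rfloor>}"
      using card_mono[OF _ Bsub[of t]] card_image_le[of "{\<lceil>(of_int t - c - \<eta>) / \<theta>\<rceil>..\<lfloor>(of_int t - c + \<eta>) / \<theta>\<rfloor>}" nat]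
      by fastforce
    also have "real \<dots> \<le> (of_int t - c + \<eta>) / \<theta> - (of_int t - c - \<eta>) / \<theta> + 1"
      using assms by (intro card_int divide_right_mono) auto
    also have "\<dots> = 2 * \<eta> / \<theta> + 1" using assms by (simp add: field_simps)
    finally show ?thesis by simp
  qed
  have finB: "finite (B t)" for t using finite_subset[OF Bsub] by blast
  have "{m::nat. m < N \<and> dist_int (c + real m * \<theta>) \<le> \<eta>} \<subseteq> (\<Union>t\<in>T. B t)"
  proof
    fix m assume "m \<in> {m::nat. m < N \<and> dist_int (c + real m * \<theta>) \<le> \<eta>}"
    hence m: "m < N" "dist_int (c + real m * \<theta>) \<le> \<eta>" by auto
    obtain t where t: "dist_int (c + real m * \<theta>) = \<bar>c + real m * \<theta> - of_int t\<bar>" by (rule dist_int_obtain)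
    have "real m * \<theta> \<le> real N * \<theta>" "0 \<le> real m * \<theta>" using m assms by (auto intro!: mult_right_mono)
    hence "t \<in> T" using m t by (auto simp: T_def abs_le_iff ceiling_le_iff le_floor_iff)
    thus "m \<in> (\<Union>t\<in>T. B t)" using m t by (auto simp: B_def)
  qed
  hence "card {m::nat. m < N \<and> dist_int (c + real m * \<theta>) \<le> \<eta>} \<le> card (\<Union>t\<in>T. B t)"
    by (rule card_mono[rotated]) (use finB in \<open>auto simp: T_def\<close>)
  also have "\<dots> \<le> (\<Sum>t\<in>T. card (B t))" by (rule card_UN_le) (simp add: T_def)
  finally have "real (card {m::nat. m < N \<and> dist_int (c + real m * \<theta>) \<le> \<eta>}) \<le> (\<Sum>t\<in>T. real (card (B t)))"
    by (simp flip: of_nat_sum)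
  also have "\<dots> \<le> (\<Sum>t\<in>T. 2 * \<eta> / \<theta> + 1)" by (intro sum_mono cB)
  also have "\<dots> = real (card T) * (2 * \<eta> / \<theta> + 1)" by simp
  also have "\<dots> \<le> (c + real N * \<theta> + \<eta> - (c - \<eta>) + 1) * (2 * \<eta> / \<theta> + 1)"
    unfolding T_def using assms by (intro mult_right_mono card_int add_nonneg_nonneg divide_nonneg_nonneg) auto
  finally show ?thesis by (simp add: algebra_simps)
qed

lemma card_close_to_int:
  fixes c \<theta> \<eta> :: real
  assumes "\<theta> \<noteq> 0" "\<eta> \<ge> 0"
  shows "real (card {m::nat. m < N \<and> dist_int (c + real m * \<theta>) \<le> \<eta>}) \<le> (2 * \<eta> / \<bar>\<theta>\<bar> + 1) * (real N * \<bar>\<theta>\<bar> + 2 * \<eta> + 1)"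
proof (cases "\<theta> > 0")
  case True
  then show ?thesis using card_close_to_int_pos[OF True assms(2), of N c] by simp
next
  case False
  hence pos: "- \<theta> > 0" using assms by simp
  have "dist_int (- c + real m * (- \<theta>)) = dist_int (c + real m * \<theta>)" for m
    using dist_int_minus[of "c + real m * \<theta>"] by simp
  thus ?thesis using card_close_to_int_pos[OF pos assms(2), of N "-c"] False by simp
qed

text \<open>Two elements of \<open>S\<close> differ by some \<open>q = O(D)\<close>, so \<open>\<tau> = dist_int (q *
  \<alpha>)\<close> is at most \<open>2 * \<eta>\<close>.  Along each residue class modulo \<open>q\<close> the
  multiples of \<open>\<alpha>\<close> move by steps of size \<open>\<tau>\<close>.  Had they completed many
  turns, only a proportion of order \<open>\<eta>\<close> of them would be close to integers, less than the
  density \<open>1 / D\<close> of \<open>S\<close>.  Counting the close ones therefore bounds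
  \<open>\<tau>\<close>, with the gain \<open>1 / X\<close>.\<close>
lemma vinogradov_recurrence:
  fixes \<alpha> \<eta> D :: real
  assumes S: "S \<subseteq> {..<X}" and D: "D \<ge> 1" and card: "real X \<le> D * real (card S)"
    and \<eta>: "\<eta> \<ge> 0" "8 * \<eta> * D \<le> 1" and X: "16 * D \<le> real X"
    and close: "\<And>h. h \<in> S \<Longrightarrow> dist_int (real h * \<alpha>) \<le> \<eta>"
  obtains q :: nat where "1 \<le> q" "real q \<le> 5 * D" "dist_int (real q * \<alpha>) \<le> 160 * \<eta> * D\<^sup>2 / real X"
proof -
  define H where "H = nat \<lceil>4 * D\<rceil>"
  have H: "4 * D \<le> real H" "real H \<le> 5 * D" using D unfolding H_def by linarith+
  have "H \<le> X" using H X D by linarith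
  from shifted_overlap[of S 0 X D H] S D card H this
  obtain q where q: "1 \<le> q" "q < H" "real X / real H ^ 2 \<le> real (card {s\<in>S. s + q \<in> S})"
    by (auto simp: atLeast0LessThan)
  have Xpos: "real X > 0" using X D by linarith
  have "real X / real H ^ 2 > 0" using Xpos q by simp
  hence "card {s\<in>S. s + q \<in> S} > 0" using q by linarith
  then obtain s where s: "s \<in> S" "s + q \<in> S" by (metis (mono_tags, lifting) card_gt_0_iff empty_Collect_eq)
  have q5: "real q \<le> 5 * D" using q H by linarith
  define \<tau> where "\<tau> = dist_int (real q * \<alpha>)"
  have \<tau>2: "\<tau> \<le> 2 * \<eta>"
    using dist_int_diff[of "real (s+q) * \<alpha>" "real s * \<alpha>"] close[OF s(1)] close[OF s(2)]
    by (simp add: \<tau>_def algebra_simps)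
  have "\<tau> \<le> 160 * \<eta> * D\<^sup>2 / real X"
  proof (cases "\<tau> = 0")
    case False
    hence \<tau>: "\<tau> > 0" unfolding \<tau>_def using dist_int_nonneg[of "real q * \<alpha>"] by linarith
    obtain k where k: "dist_int (real q * \<alpha>) = \<bar>real q * \<alpha> - of_int k\<bar>" by (rule dist_int_obtain)
    define \<theta> where "\<theta> = real q * \<alpha> - of_int k"
    have \<theta>: "\<bar>\<theta>\<bar> = \<tau>" using k by (simp add: \<theta>_def \<tau>_def)
    define M where "M = X div q + 1"
    have M: "real M \<le> real X / real q + 1" unfolding M_def by (simp add: of_nat_div_le_of_nat)
    define C where "C = (\<lambda>r. {m. m < M \<and> dist_int (real r * \<alpha> + real m * \<theta>) \<le> \<eta>})"
    have "S \<subseteq> (\<Union>r<q. (\<lambda>m. r + q * m) ` C r)"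
    proof
      fix h assume h: "h \<in> S"
      have "real h * \<alpha> = real (h mod q) * \<alpha> + real (h div q) * (real q * \<alpha>)"
        by (metis distrib_right mod_mult_div_eq mult.assoc mult.commute of_nat_add of_nat_mult)
      also have "\<dots> = real (h mod q) * \<alpha> + real (h div q) * \<theta> + of_int (int (h div q) * k)"
        by (simp add: \<theta>_def algebra_simps)
      finally have "dist_int (real (h mod q) * \<alpha> + real (h div q) * \<theta>) \<le> \<eta>"
        using close[OF h] by (metis dist_int_add_int)
      moreover have "h div q < M" using h S unfolding M_def
        by (metis Suc_eq_plus1 div_le_mono less_Suc_eq_le lessThan_iff less_imp_le_nat subset_iff)
      moreover have "h mod q < q" using q by simp
      ultimately show "h \<in> (\<Union>r<q. (\<lambda>m. r + q * m) ` C r)"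
        by (intro UN_I[of "h mod q"]) (auto simp: C_def image_iff intro!: exI[of _ "h div q"])
    qed
    hence "card S \<le> card (\<Union>r<q. (\<lambda>m. r + q * m) ` C r)"
      by (rule card_mono[rotated]) (auto simp: C_def)
    also have "\<dots> \<le> (\<Sum>r<q. card ((\<lambda>m. r + q * m) ` C r))" by (rule card_UN_le) simp
    also have "\<dots> \<le> (\<Sum>r<q. card (C r))" by (intro sum_mono card_image_le) (simp add: C_def)
    finally have "real (card S) \<le> (\<Sum>r<q. real (card (C r)))" by (simp flip: of_nat_sum)
    also have "\<dots> \<le> (\<Sum>r<q. (2 * \<eta> / \<tau> + 1) * (real M * \<tau> + 2 * \<eta> + 1))"
      unfolding C_def using card_close_to_int[of \<theta> \<eta>] \<theta> \<tau> \<eta> by (intro sum_mono) auto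
    also have "\<dots> = real q * ((2 * \<eta> / \<tau> + 1) * (real M * \<tau> + 2 * \<eta> + 1))" by simp
    also have "\<dots> \<le> real q * ((4 * \<eta> / \<tau>) * ((real X / real q + 1) * \<tau> + 2))"
    proof (intro mult_left_mono mult_mono)
      show "2 * \<eta> / \<tau> + 1 \<le> 4 * \<eta> / \<tau>" using \<tau> \<tau>2 by (simp add: field_simps)
      have "2 * \<eta> * 1 \<le> 8 * \<eta> * D" using \<eta> D by (intro mult_mono) auto
      hence "2 * \<eta> \<le> 1" using \<eta> by linarith
      moreover have "real M * \<tau> \<le> (real X / real q + 1) * \<tau>" using M \<tau> by (intro mult_right_mono) auto
      ultimately show "real M * \<tau> + 2 * \<eta> + 1 \<le> (real X / real q + 1) * \<tau> + 2" by linarith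
    qed (use \<tau> \<eta> in auto)
    also have "\<dots> = 4 * \<eta> * real X + 4 * \<eta> * real q + 8 * \<eta> * real q / \<tau>"
      using \<tau> q by (simp add: field_simps)
    finally have "real X \<le> D * (4 * \<eta> * real X + 4 * \<eta> * real q + 8 * \<eta> * real q / \<tau>)"
      using card D by (smt (verit) mult_left_mono)
    also have "\<dots> = (8 * \<eta> * D) / 2 * real X + (8 * \<eta> * D) / 2 * real q + 8 * D * \<eta> * real q / \<tau>"
      by (simp add: algebra_simps)
    also have "\<dots> \<le> 1 / 2 * real X + 1 / 2 * real q + 8 * D * \<eta> * real q / \<tau>"
      using \<eta> by (intro add_mono mult_right_mono order_refl divide_right_mono) auto
    finally have "real X \<le> 1 / 2 * real X + 1 / 2 * real q + 8 * D * \<eta> * real q / \<tau>" .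
    moreover have "real q \<le> real X / 2" using q5 X D by linarith
    ultimately have "real X / 4 \<le> 8 * D * \<eta> * real q / \<tau>" by linarith
    hence "\<tau> * real X \<le> 32 * D * \<eta> * real q" using \<tau> by (simp add: field_simps)
    also have "\<dots> \<le> 32 * D * \<eta> * (5 * D)" using q5 D \<eta> by (intro mult_left_mono) auto
    finally show ?thesis using Xpos by (simp add: field_simps power2_eq_square)
  qed (use \<eta> in auto)
  thus ?thesis using that[of q] q q5 by (simp add: \<tau>_def)
qed

section \<open>Polynomial-like functions and differencing\<close>

text \<open>\<open>F\<close> has degree \<open>k\<close> and \<open>k\<close>-th coefficient \<open>\<beta>\<close> in the
  sense that matters for Weyl differencing: the difference with step \<open>h\<close> has degree one less, and
  leading coefficient \<open>k * h * \<beta>\<close>.  The lower coefficients are left free, as they change with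
  every difference.\<close>
primrec lead :: "nat \<Rightarrow> real \<Rightarrow> (nat \<Rightarrow> real) \<Rightarrow> bool" where
  "lead 0 \<beta> F \<longleftrightarrow> (\<forall>n. F n = \<beta>)"
| "lead (Suc k) \<beta> F \<longleftrightarrow> (\<forall>h. lead k (real (Suc k) * real h * \<beta>) (\<lambda>n. F (n + h) - F n))"

lemma lead_add: "lead k \<beta> F \<Longrightarrow> lead k \<gamma> G \<Longrightarrow> lead k (\<beta> + \<gamma>) (\<lambda>n. F n + G n)"
proof (induction k arbitrary: \<beta> \<gamma> F G)
  case (Suc k)
  show ?case unfolding lead.simps
  proof
    fix h
    have "lead k (real (Suc k) * real h * \<beta> + real (Suc k) * real h * \<gamma>) (\<lambda>n. (F (n + h) - F n) + (G (n + h) - G n))"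
      using Suc by (intro Suc.IH) auto
    thus "lead k (real (Suc k) * real h * (\<beta> + \<gamma>)) (\<lambda>n. F (n + h) + G (n + h) - (F n + G n))"
      by (simp add: distrib_left add_diff_add)
  qed
qed simp

lemma lead_scale: "lead k \<beta> F \<Longrightarrow> lead k (c * \<beta>) (\<lambda>n. c * F n)"
proof (induction k arbitrary: \<beta> F)
  case (Suc k)
  show ?case unfolding lead.simps
  proof
    fix h
    have "lead k (c * (real (Suc k) * real h * \<beta>)) (\<lambda>n. c * (F (n + h) - F n))"
      using Suc by (intro Suc.IH) auto
    thus "lead k (real (Suc k) * real h * (c * \<beta>)) (\<lambda>n. c * F (n + h) - c * F n)"
      by (simp add: right_diff_distrib mult_ac)
  qed
qed simp

lemma lead_shift: "lead k \<beta> F \<Longrightarrow> lead k \<beta> (\<lambda>n. F (n + h))"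
proof (induction k arbitrary: \<beta> F)
  case (Suc k)
  show ?case unfolding lead.simps
  proof
    fix h'
    have "lead k (real (Suc k) * real h' * \<beta>) (\<lambda>n. F (n + h + h') - F (n + h))"
      using Suc.IH[of "real (Suc k) * real h' * \<beta>" "\<lambda>n. F (n + h') - F n"] Suc.prems by simp
    thus "lead k (real (Suc k) * real h' * \<beta>) (\<lambda>n. F (n + h' + h) - F (n + h))" by (simp add: add_ac)
  qed
qed simp

lemma lead_Suc_zero: "lead k \<beta> F \<Longrightarrow> lead (Suc k) 0 F"
proof (induction k arbitrary: \<beta> F)
  case (Suc k)
  show ?case unfolding lead.simps(2)[of "Suc k"]
  proof
    fix h
    have "lead k (real (Suc k) * real h * \<beta>) (\<lambda>n. F (n + h) - F n)" using Suc.prems by simp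
    from Suc.IH[OF this] show "lead (Suc k) (real (Suc (Suc k)) * real h * 0) (\<lambda>n. F (n + h) - F n)" by simp
  qed
qed simp

lemma lead_zero_higher: "lead j \<beta> F \<Longrightarrow> j < k \<Longrightarrow> lead k 0 F"
proof (induction k)
  case (Suc k)
  thus ?case by (cases "j = k") (auto intro: lead_Suc_zero simp del: lead.simps)
qed simp

lemma lead_const: "lead 0 c (\<lambda>_. c)" by simp

text \<open>The product rule for differences.  It yields the leading coefficients of powers of \<open>n + q * m\<close>, a
  polynomial restricted to a progression.\<close>
lemma lead_times_affine: "lead k \<beta> F \<Longrightarrow> lead (Suc k) (real q * \<beta>) (\<lambda>m. real (n + q * m) * F m)"
proof (induction k arbitrary: \<beta> F)
  case 0
  then show ?case by (simp add: algebra_simps)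
next
  case (Suc k)
  show ?case unfolding lead.simps(2)[of "Suc k"]
  proof
    fix h
    have "lead k (real (Suc k) * real h * \<beta>) (\<lambda>n. F (n + h) - F n)" using Suc.prems by simp
    from Suc.IH[OF this] have 1: "lead (Suc k) (real q * (real (Suc k) * real h * \<beta>)) (\<lambda>m. real (n + q * m) * (F (m + h) - F m))" .
    have 2: "lead (Suc k) (real q * real h * \<beta>) (\<lambda>m. real q * real h * F (m + h))"
      by (intro lead_scale lead_shift Suc.prems)
    have "(\<lambda>m. real (n + q * m) * (F (m + h) - F m) + real q * real h * F (m + h)) =
          (\<lambda>m. real (n + q * (m + h)) * F (m + h) - real (n + q * m) * F m)"
      by (rule ext) (simp add: algebra_simps)
    moreover have "real q * (real (Suc k) * real h * \<beta>) + real q * real h * \<beta> = real (Suc (Suc k)) * real h * (real q * \<beta>)"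
      by (simp add: algebra_simps)
    ultimately show "lead (Suc k) (real (Suc (Suc k)) * real h * (real q * \<beta>))
                   (\<lambda>m. real (n + q * (m + h)) * F (m + h) - real (n + q * m) * F m)"
      using lead_add[OF 1 2] by (simp del: lead.simps)
  qed
qed

lemma lead_affine_power: "lead k (c * real q ^ k) (\<lambda>m. c * real (n + q * m) ^ k)"
proof (induction k)
  case (Suc k)
  from lead_times_affine[OF this, of q n] show ?case by (simp add: mult_ac del: lead.simps)
qed simp

lemma lead_poly_affine:
  assumes "k \<ge> 1"
  shows "lead k (\<gamma> k * real q ^ k) (\<lambda>m. \<Sum>i\<in>{1..k}. \<gamma> i * real (n + q * m) ^ i)"
proof -
  have lower: "lead k 0 (\<lambda>m. \<Sum>i\<in>S. \<gamma> i * real (n + q * m) ^ i)" if "finite S" "S \<subseteq> {..<k}" for S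
    using that
  proof (induction S)
    case empty
    show ?case using lead_zero_higher[OF lead_const[of 0], of k] assms by simp
  next
    case (insert i S)
    have "lead k 0 (\<lambda>m. \<gamma> i * real (n + q * m) ^ i)"
      using insert by (intro lead_zero_higher[OF lead_affine_power]) auto
    from lead_add[OF this insert.IH] insert show ?case by (simp del: lead.simps)
  qed
  have "lead k 0 (\<lambda>m. \<Sum>i\<in>{1..<k}. \<gamma> i * real (n + q * m) ^ i)" by (rule lower) auto
  from lead_add[OF lead_affine_power[of k "\<gamma> k" q n] this]
  have "lead k (\<gamma> k * real q ^ k) (\<lambda>m. \<gamma> k * real (n + q * m) ^ k + (\<Sum>i\<in>{1..<k}. \<gamma> i * real (n + q * m) ^ i))"
    by (simp del: lead.simps)
  moreover have "{1..k} = insert k {1..<k}" using assms by auto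
  ultimately show ?thesis by (simp del: lead.simps)
qed

lemma pigeonhole_bounded:
  fixes f :: "'b \<Rightarrow> nat"
  assumes "finite S" "S \<noteq> {}" "\<And>s. s \<in> S \<Longrightarrow> f s \<ge> 1 \<and> real (f s) \<le> Q"
  obtains q where "q \<ge> 1" "real q \<le> Q" "real (card S) \<le> Q * real (card {s\<in>S. f s = q})"
proof -
  define T where "T = {1..nat \<lfloor>Q\<rfloor>}"
  have T: "f s \<in> T" if "s \<in> S" for s using assms(3)[OF that] by (auto simp: T_def le_nat_floor)
  have finT: "finite T" by (simp add: T_def)
  have Tne: "T \<noteq> {}" using T assms(2) by blast
  obtain q where q: "q \<in> T" "\<And>r. r \<in> T \<Longrightarrow> card {s\<in>S. f s = r} \<le> card {s\<in>S. f s = q}"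
  proof -
    let ?g = "\<lambda>r. card {s\<in>S. f s = r}"
    have "Max (?g ` T) \<in> ?g ` T" using finT Tne by (intro Max_in) auto
    then obtain q where "q \<in> T" "Max (?g ` T) = ?g q" by blast
    moreover have "?g r \<le> Max (?g ` T)" if "r \<in> T" for r using finT that by (intro Max_ge) auto
    ultimately show ?thesis by (intro that[of q]) auto
  qed
  have "S = (\<Union>r\<in>T. {s\<in>S. f s = r})" using T by auto
  hence "card S = card (\<Union>r\<in>T. {s\<in>S. f s = r})" by (rule arg_cong)
  also have "\<dots> \<le> (\<Sum>r\<in>T. card {s\<in>S. f s = r})" by (rule card_UN_le[OF finT])
  also have "\<dots> \<le> (\<Sum>r\<in>T. card {s\<in>S. f s = q})" using q by (intro sum_mono) auto
  also have "\<dots> = card T * card {s\<in>S. f s = q}" by simp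
  finally have "real (card S) \<le> real (card T) * real (card {s\<in>S. f s = q})" by (simp flip: of_nat_mult)
  also have "\<dots> \<le> Q * real (card {s\<in>S. f s = q})"
  proof (intro mult_right_mono)
    obtain s where "s \<in> S" using assms(2) by blast
    hence "Q \<ge> 0" using assms(3)[of s] by (meson of_nat_0_le_iff order_trans)
    thus "real (card T) \<le> Q" by (simp add: T_def)
  qed auto
  finally have "real (card S) \<le> Q * real (card {s\<in>S. f s = q})" .
  moreover have "q \<ge> 1" "q \<le> nat \<lfloor>Q\<rfloor>" using q(1) by (auto simp: T_def)
  moreover from this have "real q \<le> Q" by linarith
  ultimately show ?thesis using that by blast
qed

text \<open>The values below half the mean contribute at most half of the sum.\<close>
lemma dense_large_values:
  fixes a :: "'b \<Rightarrow> real"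
  assumes "finite T" "real (card T) \<le> Z" "Z > 0" "\<And>t. t \<in> T \<Longrightarrow> 0 \<le> a t \<and> a t \<le> G" "G > 0"
    and "\<theta> * G * Z \<le> (\<Sum>t\<in>T. a t)"
  shows "\<theta> / 2 * Z \<le> real (card {t\<in>T. \<theta> / 2 * G \<le> a t})"
proof -
  let ?B = "{t\<in>T. \<theta> / 2 * G \<le> a t}"
  show ?thesis
  proof (cases "\<theta> \<ge> 0")
    case True
    have "(\<Sum>t\<in>T. a t) \<le> (\<Sum>t\<in>T. \<theta> / 2 * G + (if t \<in> ?B then G else 0))"
    proof (rule sum_mono)
      fix t assume t: "t \<in> T"
      have "0 \<le> \<theta> / 2 * G" using True assms by simp
      thus "a t \<le> \<theta> / 2 * G + (if t \<in> ?B then G else 0)"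
        using assms(4)[OF t] t by (cases "t \<in> ?B") auto
    qed
    also have "\<dots> = real (card T) * (\<theta> / 2 * G) + real (card ?B) * G"
    proof -
      have "(\<Sum>t\<in>T. if t \<in> ?B then G else 0) = (\<Sum>t\<in>?B. G)"
        using assms(1) by (intro sum.mono_neutral_cong_right) auto
      thus ?thesis by (simp add: sum.distrib)
    qed
    also have "\<dots> \<le> Z * (\<theta> / 2 * G) + real (card ?B) * G"
      using assms True by (intro add_right_mono mult_right_mono) auto
    finally have "\<theta> * G * Z \<le> Z * (\<theta> / 2 * G) + real (card ?B) * G" using assms(6) by linarith
    hence "G * (\<theta> / 2 * Z) \<le> G * real (card ?B)" by (simp add: algebra_simps)
    thus ?thesis using \<open>G > 0\<close> by (simp only: mult_le_cancel_left_pos)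
  next
    case False
    hence "\<theta> / 2 * Z \<le> 0" using assms by (intro mult_nonpos_nonneg) auto
    thus ?thesis by (rule order_trans) simp
  qed
qed

text \<open>After expanding the square, the diagonal gives the number of terms, and the pairs at distances
  \<open>h\<close> and \<open>-h\<close> are complex conjugate.\<close>
lemma van_der_corput:
  fixes c :: "nat \<Rightarrow> complex"
  assumes "\<And>n. norm (c n) = 1"
  shows "norm (\<Sum>n\<in>{u..<v}. c n) ^ 2 \<le> real (v - u) + 2 * (\<Sum>h\<in>{1..<v-u}. norm (\<Sum>n\<in>{u..<v-h}. c (n + h) * cnj (c n)))"
proof -
  let ?J = "{u..<v}"
  define \<phi> where "\<phi> = (\<lambda>n n'. c n' * cnj (c n))"
  have 1: "complex_of_real (norm (sum c ?J)^2) = (\<Sum>(n,n')\<in>?J \<times> ?J. \<phi> n n')"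
  proof -
    have "complex_of_real (norm (sum c ?J)^2) = cnj (sum c ?J) * sum c ?J"
      using complex_norm_square[of "sum c ?J"] by (simp add: mult.commute)
    also have "\<dots> = (\<Sum>n\<in>?J. \<Sum>n'\<in>?J. cnj (c n) * c n')"
      unfolding cnj_sum sum_product ..
    also have "\<dots> = (\<Sum>(n,n')\<in>?J \<times> ?J. cnj (c n) * c n')" by (rule sum.cartesian_product)
    finally show ?thesis by (simp add: \<phi>_def mult.commute)
  qed
  define P where "P = (\<lambda>R::nat \<Rightarrow> nat \<Rightarrow> bool. {(n,n')\<in>?J \<times> ?J. R n n'})"
  have dec: "?J \<times> ?J = P (<) \<union> (P (=) \<union> P (>))" by (auto simp: P_def)
  have fin: "finite (P R)" for R by (rule finite_subset[of _ "?J \<times> ?J"]) (auto simp: P_def)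
  have "(\<Sum>(n,n')\<in>?J \<times> ?J. \<phi> n n') = (\<Sum>(n,n')\<in>P (<). \<phi> n n') + ((\<Sum>(n,n')\<in>P (=). \<phi> n n') + (\<Sum>(n,n')\<in>P (>). \<phi> n n'))"
  proof -
    have d1: "P (<) \<inter> (P (=) \<union> P (>)) = {}" and d2: "P (=) \<inter> P (>) = {}" by (auto simp: P_def)
    show ?thesis unfolding dec sum.union_disjoint[OF fin finite_UnI[OF fin fin] d1] sum.union_disjoint[OF fin fin d2] ..
  qed
  moreover have "(\<Sum>(n,n')\<in>P (=). \<phi> n n') = of_nat (v - u)"
  proof -
    have "(\<Sum>(n,n')\<in>P (=). \<phi> n n') = (\<Sum>n\<in>?J. \<phi> n n)"
      by (rule sum.reindex_bij_witness[of _ "\<lambda>n. (n,n)" fst]) (auto simp: P_def)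
    also have "\<dots> = (\<Sum>n\<in>?J. 1)"
    proof (rule sum.cong)
      fix n show "\<phi> n n = 1" using complex_norm_square[of "c n"] assms[of n] by (simp add: \<phi>_def)
    qed simp
    finally show ?thesis by simp
  qed
  moreover have lt: "(\<Sum>(n,n')\<in>P (<). \<phi> n n') = (\<Sum>h\<in>{1..<v-u}. \<Sum>n\<in>{u..<v-h}. c (n + h) * cnj (c n))"
    unfolding sum.Sigma[OF finite_atLeastLessThan ballI[OF finite_atLeastLessThan]]
    by (rule sum.reindex_bij_witness[of _ "\<lambda>(h,n). (n,n+h)" "\<lambda>(n,n'). (n'-n,n)"]) (auto simp: P_def \<phi>_def)
  moreover have "(\<Sum>(n,n')\<in>P (>). \<phi> n n') = cnj (\<Sum>(n,n')\<in>P (<). \<phi> n n')"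
    unfolding cnj_sum
    by (rule sum.reindex_bij_witness[of _ "\<lambda>(a,b). (b,a)" "\<lambda>(a,b). (b,a)"]) (auto simp: P_def \<phi>_def)
  ultimately have "complex_of_real (norm (sum c ?J)^2) = (\<Sum>(n,n')\<in>P (<). \<phi> n n') + (of_nat (v - u) + cnj (\<Sum>(n,n')\<in>P (<). \<phi> n n'))"
    using 1 by simp
  moreover have "norm (z + (of_nat (v - u) + cnj z)) \<le> norm z + (real (v - u) + norm z)" for z :: complex
    using norm_triangle_ineq[of z "of_nat (v - u) + cnj z"] norm_triangle_ineq[of "of_nat (v - u)" "cnj z"]
    by (simp del: of_nat_diff)
  ultimately have "norm (complex_of_real (norm (sum c ?J)^2)) \<le> norm (\<Sum>(n,n')\<in>P (<). \<phi> n n') + (real (v - u) + norm (\<Sum>(n,n')\<in>P (<). \<phi> n n'))"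
    by (simp only:)
  moreover have "norm (\<Sum>(n,n')\<in>P (<). \<phi> n n') \<le> (\<Sum>h\<in>{1..<v-u}. norm (\<Sum>n\<in>{u..<v-h}. c (n + h) * cnj (c n)))"
    unfolding lt by (rule norm_sum)
  ultimately show ?thesis by (simp add: norm_power)
qed

section \<open>Weyl sums: the leading coefficient\<close>

text \<open>All losses in the Weyl arguments are powers of \<open>D \<ge> 2\<close>.  Numerical constants are absorbed
  into such powers too.\<close>
lemma pow_base:
  fixes D :: real
  assumes "D \<ge> 2"
  shows "2 ^ n \<le> D ^ n" "D ^ n \<ge> 1" "m \<le> n \<Longrightarrow> D ^ m \<le> D ^ n" "D > 0" "real n \<le> D ^ n"
proof -
  show 1: "2 ^ n \<le> D ^ n" using assms by (intro power_mono) auto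
  show "D ^ n \<ge> 1" using assms by simp
  show "m \<le> n \<Longrightarrow> D ^ m \<le> D ^ n" using assms by (intro power_increasing) auto
  have "real n \<le> 2 ^ n" by (metis less_imp_le of_nat_less_two_power)
  thus "real n \<le> D ^ n" using 1 by linarith
  show "D > 0" using assms by simp
qed

text \<open>When \<open>X\<close> is at most a power of \<open>D\<close>, the claimed approximation is weaker than
  \<open>dist_int x \<le> 1/2\<close>.  This allows \<open>X\<close> to be taken large in the inductions.\<close>
lemma trivial_denominator:
  fixes D :: real
  assumes D: "D \<ge> 2" and X: "1 \<le> X" "real X \<le> D ^ E" and E: "E * i \<le> C"
  shows "dist_int (real 1 * x) \<le> D ^ C / real X ^ i"
proof -
  have "real X ^ i \<le> (D ^ E) ^ i" using X by (intro power_mono) auto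
  also have "\<dots> \<le> D ^ C" using pow_base(3)[OF D E] by (simp add: power_mult)
  finally have "1 \<le> D ^ C / real X ^ i" using X by (simp add: field_simps)
  thus ?thesis using dist_int_le_half[of x] by simp
qed

text \<open>The geometric series, multiplied by \<open>unit_exp \<beta> - 1\<close>.\<close>
lemma geometric_phase_sum:
  assumes "lead 1 \<beta> F"
  shows "3 * dist_int \<beta> * norm (\<Sum>n\<in>{u..<v}. unit_exp (F n)) \<le> 2"
proof -
  have F: "F n = F 0 + real n * \<beta>" for n
  proof -
    have "\<forall>m. F (m + n) - F m = real (Suc 0) * real n * \<beta>"
      using assms unfolding One_nat_def lead.simps by blast
    from spec[OF this, of 0] show ?thesis by simp
  qed
  define z where "z = unit_exp \<beta>"
  have e: "unit_exp (F n) = unit_exp (F 0) * z ^ n" for n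
    unfolding z_def by (subst F) (simp only: unit_exp_add unit_exp_of_nat_mult)
  have nz: "norm z = 1" by (simp add: z_def)
  have "norm ((\<Sum>n\<in>{u..<v}. unit_exp (F n)) * (z - 1)) \<le> 2"
  proof (cases "u \<le> v")
    case True
    have "(\<Sum>n\<in>{u..<v}. unit_exp (F n)) * (z - 1) = unit_exp (F 0) * (\<Sum>n\<in>{u..<v}. z ^ Suc n - z ^ n)"
      by (subst sum.cong[OF refl e]) (simp add: sum_distrib_left sum_distrib_right algebra_simps)
    also have "\<dots> = unit_exp (F 0) * (z ^ v - z ^ u)" using sum_Suc_diff'[OF True, of "\<lambda>n. z ^ n"] by simp
    finally show ?thesis using norm_triangle_ineq4[of "z ^ v" "z ^ u"] by (simp add: norm_mult norm_power nz)
  qed simp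
  hence "norm (z - 1) * norm (\<Sum>n\<in>{u..<v}. unit_exp (F n)) \<le> 2" by (simp add: norm_mult mult.commute)
  moreover have "3 * dist_int \<beta> * norm (\<Sum>n\<in>{u..<v}. unit_exp (F n)) \<le> norm (z - 1) * norm (\<Sum>n\<in>{u..<v}. unit_exp (F n))"
    unfolding z_def using norm_unit_exp_minus_1_ge by (intro mult_right_mono) auto
  ultimately show ?thesis by linarith
qed

text \<open>Weyl's inequality in inverse form: an exponential sum that is smaller than trivial by at most a factor
  \<open>D\<close> can only come from a leading coefficient that is close to a rational number of denominator at
  most \<open>D ^ C\<close>.\<close>
abbreviation weyl_leading_with :: "nat \<Rightarrow> nat \<Rightarrow> bool" where
  "weyl_leading_with k C \<equiv>
    \<forall>D \<beta> F u v X. 2 \<le> D \<longrightarrow> lead k \<beta> F \<longrightarrow>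
     1 \<le> X \<longrightarrow> v \<le> u + X \<longrightarrow>
     real X \<le> D * norm (\<Sum>n\<in>{u..<v}. unit_exp (F n)) \<longrightarrow>
     (\<exists>q::nat. 1 \<le> q \<and> real q \<le> D ^ C \<and> dist_int (real q * \<beta>) \<le> D ^ C / real X ^ k)"

text \<open>By induction on the degree.  After \<open>van_der_corput\<close>, the differenced sums are large for a
  proportion of order \<open>1 / D\<^sup>2\<close> of the steps \<open>h\<close>; for these, \<open>h *
  \<beta>\<close> has a small denominator, the same one for many \<open>h\<close> by the pigeonhole principle.
  Then \<open>vinogradov_recurrence\<close> removes \<open>h\<close>.\<close>
lemma weyl_leading:
  "\<exists>C::nat. weyl_leading_with (Suc k) C"
proof (induction k)
  case 0
  show ?case
  proof (rule exI[of _ 1], intro allI impI)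
    fix D \<beta> :: real and F u v and X :: nat
    assume D: "2 \<le> D" and F: "lead (Suc 0) \<beta> F" and X: "1 \<le> X" and "v \<le> u + X"
      and big: "real X \<le> D * norm (\<Sum>n\<in>{u..<v}. unit_exp (F n))"
    have "3 * dist_int \<beta> * real X \<le> 3 * dist_int \<beta> * (D * norm (\<Sum>n\<in>{u..<v}. unit_exp (F n)))"
      using big by (intro mult_left_mono) auto
    also have "\<dots> = D * (3 * dist_int \<beta> * norm (\<Sum>n\<in>{u..<v}. unit_exp (F n)))" by simp
    also have "\<dots> \<le> D * 2" using geometric_phase_sum[of \<beta> F u v] F D by (intro mult_left_mono) auto
    finally have "dist_int \<beta> \<le> D / real X" using X D by (simp add: field_simps)
    thus "\<exists>q::nat. 1 \<le> q \<and> real q \<le> D ^ 1 \<and> dist_int (real q * \<beta>) \<le> D ^ 1 / real X ^ Suc 0"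
      using D by (intro exI[of _ 1]) auto
  qed
next
  case (Suc k)
  then obtain C where IH0: "weyl_leading_with (Suc k) C" ..
  note IH = IH0[rule_format]
  (* Below D ^ E the claim is trivial.  Above it, X dominates all the powers of D that arise in the induction step. *)
  define E where "E = 10 * C + 10"
  define C' where "C' = E * (k + 2) + 15 * C + 28 + k"
  show ?case
  proof (rule exI[of _ C'], intro allI impI)
    fix D \<beta> :: real and F u v and X :: nat
    assume D: "2 \<le> D" and F: "lead (Suc (Suc k)) \<beta> F" and X: "1 \<le> X" and v: "v \<le> u + X"
      and big: "real X \<le> D * norm (\<Sum>n\<in>{u..<v}. unit_exp (F n))"
    note pb = pow_base[OF D]
    show "\<exists>q::nat. 1 \<le> q \<and> real q \<le> D ^ C' \<and> dist_int (real q * \<beta>) \<le> D ^ C' / real X ^ Suc (Suc k)"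
    proof (cases "real X \<le> D ^ E")
      case True
      have "dist_int (real 1 * \<beta>) \<le> D ^ C' / real X ^ Suc (Suc k)"
        by (rule trivial_denominator[OF D X True]) (simp add: C'_def)
      thus ?thesis using pb(2)[of C'] by (intro exI[of _ 1]) auto
    next
      case False
      hence XE: "D ^ E \<le> real X" by simp
      define a where "a = (\<lambda>h. norm (\<Sum>n\<in>{u..<v-h}. unit_exp (F (n + h) - F n)))"
      (* The differenced sums lose at most D1 against the trivial bound, for at least X / D1 of the steps. *)
      define D1 where "D1 = 8 * D\<^sup>2"
      have D1: "D1 \<ge> 2" "D1 \<le> D ^ 5" "D1 > 0"
      proof -
        have "2 ^ 2 \<le> D\<^sup>2" by (rule pb(1))
        thus "D1 \<ge> 2" "D1 > 0" unfolding D1_def by auto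
        have "8 * D\<^sup>2 \<le> D ^ 3 * D\<^sup>2" using pb(1)[of 3] by (intro mult_right_mono) auto
        thus "D1 \<le> D ^ 5" by (simp add: D1_def flip: power_add)
      qed
      define Q where "Q = D1 ^ C"
      define D2 where "D2 = D1 * Q"
      have Q: "Q \<ge> 1" "Q \<le> D ^ (5 * C)"
        unfolding Q_def power_mult using D1 by (auto intro: power_mono)
      have D2: "D2 \<ge> 1" "D2 \<le> D ^ (5 * C + 5)"
      proof -
        have "1 * 1 \<le> D1 * Q" using D1 Q by (intro mult_mono) auto
        thus "D2 \<ge> 1" by (simp add: D2_def)
        have "D1 * Q \<le> D ^ 5 * D ^ (5 * C)" using D1 Q pb by (intro mult_mono) auto
        thus "D2 \<le> D ^ (5 * C + 5)" by (simp add: D2_def power_add mult.commute)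
      qed
      have "norm (\<Sum>n\<in>{u..<v}. unit_exp (F n)) ^ 2 \<le> real (v - u) + 2 * (\<Sum>h\<in>{1..<v-u}. a h)"
        unfolding a_def unit_exp_diff by (rule van_der_corput) simp
      also have "real (v - u) \<le> real X" using v by linarith
      finally have vdc: "norm (\<Sum>n\<in>{u..<v}. unit_exp (F n)) ^ 2 \<le> real X + 2 * (\<Sum>h\<in>{1..<v-u}. a h)" by simp
      have "2 * D\<^sup>2 \<le> real X"
      proof -
        have "2 * D\<^sup>2 \<le> D ^ 3" using D by (simp add: power_numeral_reduce)
        also have "\<dots> \<le> D ^ E" by (rule pb(3)) (simp add: E_def)
        finally show ?thesis using XE by linarith
      qed
      have "real X ^ 2 \<le> (D * norm (\<Sum>n\<in>{u..<v}. unit_exp (F n))) ^ 2" using big by (intro power_mono) auto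
      also have "\<dots> \<le> D ^ 2 * (real X + 2 * (\<Sum>h\<in>{1..<v-u}. a h))"
        unfolding power_mult_distrib using vdc by (intro mult_left_mono) auto
      also have "\<dots> = (2 * D\<^sup>2) / 2 * real X + 2 * D\<^sup>2 * (\<Sum>h\<in>{1..<v-u}. a h)" by (simp add: algebra_simps)
      also have "\<dots> \<le> real X / 2 * real X + 2 * D\<^sup>2 * (\<Sum>h\<in>{1..<v-u}. a h)"
        using \<open>2 * D\<^sup>2 \<le> real X\<close> by (intro add_right_mono mult_right_mono divide_right_mono) auto
      finally have "real X * real X \<le> 4 * D\<^sup>2 * (\<Sum>h\<in>{1..<v-u}. a h)" by (simp add: power2_eq_square)
      hence sum_big: "1 / (4 * D\<^sup>2) * real X * real X \<le> (\<Sum>h\<in>{1..<v-u}. a h)"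
        using D by (simp add: field_simps)
      define S where "S = {h\<in>{1..<v-u}. 1 / (4 * D\<^sup>2) / 2 * real X \<le> a h}"
      have "1 / (4 * D\<^sup>2) / 2 * real X \<le> real (card S)"
        unfolding S_def
      proof (rule dense_large_values)
        show "1 / (4 * D\<^sup>2) * real X * real X \<le> (\<Sum>h\<in>{1..<v-u}. a h)" by (rule sum_big)
        show "0 \<le> a h \<and> a h \<le> real X" for h
        proof
          have "a h \<le> (\<Sum>n\<in>{u..<v-h}. norm (unit_exp (F (n + h) - F n)))" unfolding a_def by (rule norm_sum)
          also have "\<dots> = real (v - h - u)" by simp
          also have "\<dots> \<le> real X" using v by linarith
          finally show "a h \<le> real X" .
        qed (simp add: a_def)
      qed (use v X in auto)
      hence cardS: "real X \<le> D1 * real (card S)" using D by (simp add: D1_def field_simps)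
      have finS: "finite S" by (simp add: S_def)
      have Sne: "S \<noteq> {}" using cardS X by auto
      have "\<exists>q. 1 \<le> q \<and> real q \<le> Q \<and> dist_int (real q * (real (Suc (Suc k)) * real h * \<beta>)) \<le> Q / real X ^ Suc k"
        if h: "h \<in> S" for h
        unfolding Q_def
      proof (rule IH[OF D1(1) _ X])
        show "lead (Suc k) (real (Suc (Suc k)) * real h * \<beta>) (\<lambda>n. F (n + h) - F n)"
          using F unfolding lead.simps(2)[of "Suc k"] by blast
        show "v - h \<le> u + X" using v by simp
        have "real X \<le> D1 * a h" using h D by (simp add: S_def D1_def field_simps)
        thus "real X \<le> D1 * norm (\<Sum>n\<in>{u..<v-h}. unit_exp (F (n + h) - F n))" by (simp add: a_def)
      qed
      then obtain f where f: "\<And>h. h \<in> S \<Longrightarrow> 1 \<le> f h \<and> real (f h) \<le> Q \<and>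
          dist_int (real (f h) * (real (Suc (Suc k)) * real h * \<beta>)) \<le> Q / real X ^ Suc k" by metis
      obtain q where q: "1 \<le> q" "real q \<le> Q" "real (card S) \<le> Q * real (card {h\<in>S. f h = q})"
        using pigeonhole_bounded[OF finS Sne, of f Q] f by blast
      (* The factor Suc (Suc k) comes from differencing and ends up in the denominator. *)
      define \<alpha> where "\<alpha> = real q * real (Suc (Suc k)) * \<beta>"
      define \<eta> where "\<eta> = Q / real X ^ Suc k"
      have XE1: "D ^ m \<le> real X" if "m \<le> E" for m using pb(3)[OF that] XE by linarith
      have "\<eta> \<ge> 0" using Q by (simp add: \<eta>_def)
      obtain r where r: "1 \<le> r" "real r \<le> 5 * D2" "dist_int (real r * \<alpha>) \<le> 160 * \<eta> * D2\<^sup>2 / real X"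
      proof (rule vinogradov_recurrence)
        show "{h\<in>S. f h = q} \<subseteq> {..<X}" using v by (auto simp: S_def)
        have "real X \<le> D1 * real (card S)" by (rule cardS)
        also have "\<dots> \<le> D1 * (Q * real (card {h\<in>S. f h = q}))" using q D1 by (intro mult_left_mono) auto
        finally show "real X \<le> D2 * real (card {h\<in>S. f h = q})" by (simp add: D2_def)
        show "D2 \<ge> 1" "\<eta> \<ge> 0" by fact+
        have "16 * D2 \<le> D ^ 4 * D ^ (5 * C + 5)" using D D2 pb(1)[of 4] pb(2) by (intro mult_mono) auto
        also have "\<dots> = D ^ (5 * C + 9)" by (simp add: add.commute flip: power_add)
        also have "\<dots> \<le> real X" by (rule XE1) (simp add: E_def)
        finally show "16 * D2 \<le> real X" .
        have "8 * Q * D2 \<le> D ^ 3 * D ^ (5 * C) * D ^ (5 * C + 5)"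
          using D D2 Q pb(1)[of 3] pb(2) by (intro mult_mono) auto
        also have "\<dots> = D ^ (10 * C + 8)" by (simp flip: power_add)
        also have "\<dots> \<le> real X" by (rule XE1) (simp add: E_def)
        also have "\<dots> \<le> real X ^ Suc k" using X by (intro self_le_power) auto
        finally show "8 * \<eta> * D2 \<le> 1" using X by (simp add: \<eta>_def field_simps del: power_Suc)
        show "dist_int (real h * \<alpha>) \<le> \<eta>" if "h \<in> {h\<in>S. f h = q}" for h
          using f[of h] that by (auto simp: \<alpha>_def \<eta>_def mult_ac simp del: of_nat_Suc power_Suc)
      qed
      have Sk: "real (Suc (Suc k)) \<le> D ^ (k + 2)" using pb(5)[of "k+2"] by simp
      show ?thesis
      proof (intro exI[of _ "r * q * Suc (Suc k)"] conjI)
        show "1 \<le> r * q * Suc (Suc k)" using r q by (simp add: Suc_le_eq del: mult_Suc_right)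
        have "real (r * q * Suc (Suc k)) = real r * real q * real (Suc (Suc k))" by (simp only: of_nat_mult)
        also have "\<dots> \<le> (D ^ 3 * D ^ (5 * C + 5)) * D ^ (5 * C) * D ^ (k + 2)"
        proof (intro mult_mono Sk)
          have "5 * D2 \<le> D ^ 3 * D ^ (5 * C + 5)" using D D2 pb(1)[of 3] pb(2) by (intro mult_mono) auto
          thus "real r \<le> D ^ 3 * D ^ (5 * C + 5)" using r by linarith
          show "real q \<le> D ^ (5 * C)" using q Q by linarith
        qed (use pb in auto)
        also have "\<dots> = D ^ (10 * C + 10 + k)"
          unfolding power_add[symmetric] by (rule arg_cong[where f = "\<lambda>n. D ^ n"]) simp
        also have "\<dots> \<le> D ^ C'" by (rule pb(3)) (simp add: C'_def)
        finally show "real (r * q * Suc (Suc k)) \<le> D ^ C'" .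
        have "dist_int (real (r * q * Suc (Suc k)) * \<beta>) \<le> 160 * \<eta> * D2\<^sup>2 / real X"
          using r(3) unfolding \<alpha>_def of_nat_mult by (simp only: mult.assoc)
        also have "\<dots> = 160 * Q * D2\<^sup>2 / real X ^ Suc (Suc k)" by (simp add: \<eta>_def)
        also have "160 * Q * D2\<^sup>2 \<le> D ^ 8 * D ^ (5 * C) * (D ^ (5 * C + 5))\<^sup>2"
          using D D2 Q pb(1)[of 8] pb(2) by (intro mult_mono power_mono) auto
        also have "\<dots> = D ^ (15 * C + 18)" by (simp flip: power_add power_mult)
        also have "\<dots> \<le> D ^ C'" by (rule pb(3)) (simp add: C'_def)
        finally show "dist_int (real (r * q * Suc (Suc k)) * \<beta>) \<le> D ^ C' / real X ^ Suc (Suc k)"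
          by (simp add: divide_right_mono)
      qed
    qed
  qed
qed

section \<open>Weyl sums: all coefficients at once\<close>

text \<open>The difference of the two powers is divisible by \<open>q\<close>; the factor \<open>q\<close> is paired with
  \<open>\<gamma>\<close>, and the cofactor is an integer bounded in size.\<close>
lemma dist_int_power_shift:
  assumes "n + q * m \<le> B" "B > 0" "i \<ge> 1"
  shows "dist_int (\<gamma> * real (n + q * m) ^ i - \<gamma> * real n ^ i) \<le> real m * real i * real B ^ (i - 1) * dist_int (real q * \<gamma>)"
proof -
  define W where "W = (\<Sum>j<i. (n + q * m) ^ j * n ^ (i - Suc j))"
  have "real (n + q * m) ^ i - real n ^ i = (real (n + q * m) - real n) * (\<Sum>j<i. real (n + q * m) ^ j * real n ^ (i - Suc j))"
    by (rule power_diff_sumr2[THEN trans]) (simp add: mult.commute)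
  also have "\<dots> = real q * real m * real W" by (simp add: W_def)
  finally have "\<gamma> * real (n + q * m) ^ i - \<gamma> * real n ^ i = real (m * W) * (real q * \<gamma>)"
    by (simp add: mult_ac flip: right_diff_distrib)
  hence "dist_int (\<gamma> * real (n + q * m) ^ i - \<gamma> * real n ^ i) \<le> real (m * W) * dist_int (real q * \<gamma>)"
    using dist_int_of_nat_mult by metis
  also have "W \<le> (\<Sum>j<i. B ^ (i - 1))"
    unfolding W_def
  proof (rule sum_mono)
    fix j assume j: "j \<in> {..<i}"
    have "(n + q * m) ^ j * n ^ (i - Suc j) \<le> B ^ j * B ^ (i - Suc j)"
      using assms by (intro mult_mono power_mono) auto
    also have "\<dots> = B ^ (i - 1)" using j by (simp flip: power_add)
    finally show "(n + q * m) ^ j * n ^ (i - Suc j) \<le> B ^ (i - 1)" .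
  qed
  hence "real W \<le> real (i * B ^ (i - 1))" by (simp only: sum_constant card_lessThan of_nat_le_iff of_nat_id)
  hence "real (m * W) * dist_int (real q * \<gamma>) \<le> (real m * (real i * real B ^ (i - 1))) * dist_int (real q * \<gamma>)"
    by (intro mult_right_mono) (auto intro: mult_left_mono)
  finally show ?thesis by (simp add: mult_ac)
qed

lemma sum_shift_diff:
  fixes \<phi> :: "nat \<Rightarrow> complex"
  assumes "\<And>n. norm (\<phi> n) \<le> 1"
  shows "norm ((\<Sum>n\<in>{u..<v}. \<phi> n) - (\<Sum>n\<in>{u..<v}. \<phi> (n + s))) \<le> 2 * real s"
proof (induction s)
  case (Suc s)
  have "norm ((\<Sum>n\<in>{u..<v}. \<phi> (n + s)) - (\<Sum>n\<in>{u..<v}. \<phi> (n + Suc s))) \<le> 2"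
  proof (cases "u \<le> v")
    case True
    have "(\<Sum>n\<in>{u..<v}. \<phi> (Suc n + s) - \<phi> (n + s)) = \<phi> (v + s) - \<phi> (u + s)"
      using sum_Suc_diff'[OF True, of "\<lambda>n. \<phi> (n + s)"] by simp
    hence "(\<Sum>n\<in>{u..<v}. \<phi> (n + s)) - (\<Sum>n\<in>{u..<v}. \<phi> (n + Suc s)) = \<phi> (u + s) - \<phi> (v + s)"
      by (simp add: sum_subtractf algebra_simps)
    thus ?thesis using norm_triangle_ineq4[of "\<phi> (u + s)" "\<phi> (v + s)"] assms[of "u + s"] assms[of "v + s"] by simp
  qed simp
  thus ?case using Suc.IH norm_triangle_ineq[of "(\<Sum>n\<in>{u..<v}. \<phi> n) - (\<Sum>n\<in>{u..<v}. \<phi> (n + s))"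
     "(\<Sum>n\<in>{u..<v}. \<phi> (n + s)) - (\<Sum>n\<in>{u..<v}. \<phi> (n + Suc s))"] by simp
qed simp

text \<open>Averaging the sum over \<open>l\<close> shifts by multiples of \<open>q\<close> changes it by at most \<open>2
  * q * l\<close>, which is at most half of its size.  The average is a mean of sums over progressions.\<close>
lemma large_sum_progression:
  fixes \<phi> :: "nat \<Rightarrow> complex"
  assumes \<phi>: "\<And>n. norm (\<phi> n) \<le> 1" and v: "v \<le> X" and X: "X > 0" and D: "D > 0"
    and big: "real X \<le> D * norm (\<Sum>n\<in>{u..<v}. \<phi> n)" and l: "l > 0" "4 * D * real q * real l \<le> real X"
  obtains n where "n < X" "real l \<le> 2 * D * norm (\<Sum>m<l. \<phi> (n + q * m))"
proof (rule ccontr)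
  note obt = that
  assume "\<not> thesis"
  hence small: "2 * D * norm (\<Sum>m<l. \<phi> (n + q * m)) < real l" if "n < X" for n
    using obt[of n] that by force
  have Suv: "{u..<v} \<noteq> {}"
  proof
    assume "{u..<v} = {}"
    hence "sum \<phi> {u..<v} = 0" by (simp only: sum.empty)
    thus False using big X by simp
  qed
  have "norm (of_nat l * (\<Sum>n\<in>{u..<v}. \<phi> n) - (\<Sum>n\<in>{u..<v}. \<Sum>m<l. \<phi> (n + q * m)))
      = norm (\<Sum>m<l. (\<Sum>n\<in>{u..<v}. \<phi> n) - (\<Sum>n\<in>{u..<v}. \<phi> (n + q * m)))"
    by (subst sum.swap) (simp add: sum_subtractf)
  also have "\<dots> \<le> (\<Sum>m<l. 2 * real (q * l))"
  proof (rule sum_norm_le)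
    fix m assume m: "m \<in> {..<l}"
    have "norm ((\<Sum>n\<in>{u..<v}. \<phi> n) - (\<Sum>n\<in>{u..<v}. \<phi> (n + q * m))) \<le> 2 * real (q * m)" by (rule sum_shift_diff[OF \<phi>])
    also have "\<dots> \<le> 2 * real (q * l)" using m by (intro mult_left_mono of_nat_mono mult_le_mono) auto
    finally show "norm ((\<Sum>n\<in>{u..<v}. \<phi> n) - (\<Sum>n\<in>{u..<v}. \<phi> (n + q * m))) \<le> 2 * real (q * l)" .
  qed
  also have "\<dots> = real l * (2 * real q * real l)" by simp
  finally have 1: "norm (of_nat l * (\<Sum>n\<in>{u..<v}. \<phi> n) - (\<Sum>n\<in>{u..<v}. \<Sum>m<l. \<phi> (n + q * m))) \<le> real l * (2 * real q * real l)" .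
  have "2 * D * norm (\<Sum>n\<in>{u..<v}. \<Sum>m<l. \<phi> (n + q * m)) \<le> 2 * D * (\<Sum>n\<in>{u..<v}. norm (\<Sum>m<l. \<phi> (n + q * m)))"
    using D by (intro mult_left_mono norm_sum) auto
  also have "\<dots> = (\<Sum>n\<in>{u..<v}. 2 * D * norm (\<Sum>m<l. \<phi> (n + q * m)))" by (simp add: sum_distrib_left)
  also have "\<dots> < (\<Sum>n\<in>{u..<v}. real l)" using small v Suv by (intro sum_strict_mono) auto
  also have "\<dots> \<le> real X * real l" using v by (auto intro: mult_right_mono)
  finally have 2: "2 * D * norm (\<Sum>n\<in>{u..<v}. \<Sum>m<l. \<phi> (n + q * m)) < real X * real l" .
  have "real l * norm (\<Sum>n\<in>{u..<v}. \<phi> n) \<le> norm (\<Sum>n\<in>{u..<v}. \<Sum>m<l. \<phi> (n + q * m)) + real l * (2 * real q * real l)"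
    using 1 norm_triangle_sub[of "of_nat l * (\<Sum>n\<in>{u..<v}. \<phi> n)" "\<Sum>n\<in>{u..<v}. \<Sum>m<l. \<phi> (n + q * m)"]
    by (simp add: norm_mult)
  hence "2 * D * (real l * norm (\<Sum>n\<in>{u..<v}. \<phi> n)) \<le> 2 * D * (norm (\<Sum>n\<in>{u..<v}. \<Sum>m<l. \<phi> (n + q * m)) + real l * (2 * real q * real l))"
    using D by (intro mult_left_mono) auto
  also have "\<dots> < real X * real l + real l * (4 * D * real q * real l)"
    using 2 by (simp add: algebra_simps)
  also have "\<dots> \<le> real X * real l + real l * real X" using l by (intro add_left_mono mult_left_mono) auto
  finally have "real l * (2 * (D * norm (\<Sum>n\<in>{u..<v}. \<phi> n))) < real l * (2 * real X)" by (simp add: algebra_simps)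
  hence "D * norm (\<Sum>n\<in>{u..<v}. \<phi> n) < real X" using l by simp
  thus False using big by linarith
qed

text \<open>The inverse theorem for the coefficients of index at least \<open>m\<close> of a polynomial of degree
  \<open>d\<close>, with one denominator common to all of them.\<close>
abbreviation weyl_simultaneous_with :: "nat \<Rightarrow> nat \<Rightarrow> nat \<Rightarrow> bool" where
  "weyl_simultaneous_with d m C \<equiv>
    \<forall>D \<gamma> u v X. 2 \<le> D \<longrightarrow> 1 \<le> X \<longrightarrow>
     v \<le> X \<longrightarrow> real X \<le> D * norm (\<Sum>n\<in>{u..<v}. unit_exp (\<Sum>i\<in>{1..d}. \<gamma> i * real n ^ i)) \<longrightarrow>
     (\<exists>q::nat. 1 \<le> q \<and> real q \<le> D ^ C \<and> (\<forall>i\<in>{m..d}. dist_int (real q * \<gamma> i) \<le> D ^ C / real X ^ i))"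

text \<open>Descent from the coefficients above \<open>k\<close> to the \<open>k\<close>-th.  On progressions whose step
  \<open>q\<close> is the common denominator of the higher coefficients, and whose length is \<open>X / D ^
  E\<close>, the part of degree above \<open>k\<close> is almost constant.  What remains is a large sum of a
  polynomial of degree \<open>k\<close>, and \<open>weyl_leading\<close> applies to its leading coefficient
  \<open>\<gamma> k * q ^ k\<close>.\<close>
lemma weyl_simultaneous_step:
  assumes td: "t < d" and k: "k = d - t"
    and IH: "\<And>D \<gamma> u v X. 2 \<le> D \<Longrightarrow> 1 \<le> X \<Longrightarrow> v \<le> X \<Longrightarrow>
     real X \<le> D * norm (\<Sum>n\<in>{u..<v}. unit_exp (\<Sum>i\<in>{1..d}. \<gamma> i * real n ^ i)) \<Longrightarrow>
     \<exists>q::nat. 1 \<le> q \<and> real q \<le> D ^ C \<and> (\<forall>i\<in>{Suc k..d}. dist_int (real q * \<gamma> i) \<le> D ^ C / real X ^ i)"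
    and lead: "\<And>D \<beta> F u v X. 2 \<le> D \<Longrightarrow> lead k \<beta> F \<Longrightarrow> 1 \<le> X \<Longrightarrow> v \<le> u + X \<Longrightarrow>
     real X \<le> D * norm (\<Sum>n\<in>{u..<v}. unit_exp (F n)) \<Longrightarrow>
     (\<exists>q::nat. 1 \<le> q \<and> real q \<le> D ^ Ck \<and> dist_int (real q * \<beta>) \<le> D ^ Ck / real X ^ k)"
    and E: "E = C + 3 * d + 6" and C': "C' = 3 * Ck + C * d + (E + 1) * d"
    and D: "2 \<le> D" and X: "1 \<le> X" and v: "v \<le> X"
    and big: "real X \<le> D * norm (\<Sum>n\<in>{u..<v}. unit_exp (\<Sum>i\<in>{1..d}. \<gamma> i * real n ^ i))"
  shows "\<exists>q::nat. 1 \<le> q \<and> real q \<le> D ^ C' \<and> (\<forall>i\<in>{k..d}. dist_int (real q * \<gamma> i) \<le> D ^ C' / real X ^ i)"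
proof (cases "real X \<le> D ^ (E + 1)")
  case True
  have "dist_int (real 1 * \<gamma> i) \<le> D ^ C' / real X ^ i" if "i \<in> {k..d}" for i
  proof (rule trivial_denominator[OF D X True])
    have "(E + 1) * i \<le> (E + 1) * d" using that by (intro mult_le_mono2) auto
    thus "(E + 1) * i \<le> C'" by (simp add: C')
  qed
  thus ?thesis using pow_base(2)[OF D, of C'] by (intro exI[of _ 1]) auto
next
  case False
  note pb = pow_base[OF D]
  have k1: "k \<ge> 1" "k \<le> d" using td k by auto
  obtain q where q: "1 \<le> q" "real q \<le> D ^ C" "\<And>i. i \<in> {Suc k..d} \<Longrightarrow> dist_int (real q * \<gamma> i) \<le> D ^ C / real X ^ i"
    using IH[OF D X v big] by blast
  define l where "l = nat \<lfloor>real X / D ^ E\<rfloor>"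
  have Xpos: "real X > 0" using X by simp
  have XE: "real X / D ^ E \<ge> 2"
  proof -
    have "D ^ E * 2 \<le> D ^ E * D" using D by (intro mult_left_mono) auto
    also have "\<dots> < real X" using False by (simp add: mult.commute)
    finally show ?thesis using pb(4) by (simp add: pos_le_divide_eq mult.commute)
  qed
  have l: "real l \<le> real X / D ^ E" "real X / D ^ (E + 1) \<le> real l" "l \<ge> 1"
  proof -
    show "real l \<le> real X / D ^ E" unfolding l_def using XE by simp
    show "l \<ge> 1" unfolding l_def using XE by linarith
    have "real X / D ^ (E + 1) = (real X / D ^ E) / D" by simp
    also have "\<dots> \<le> (real X / D ^ E) / 2" using D by (intro divide_left_mono) auto
    also have "t / 2 \<le> real (nat \<lfloor>t\<rfloor>)" if "t \<ge> 2" for t :: real using that by linarith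
    hence "(real X / D ^ E) / 2 \<le> real l" unfolding l_def using XE by blast
    finally show "real X / D ^ (E + 1) \<le> real l" .
  qed
  define \<phi> where "\<phi> = (\<lambda>n. unit_exp (\<Sum>i\<in>{1..d}. \<gamma> i * real n ^ i))"
  have ql: "real q * real l * D ^ 3 \<le> real X"
  proof -
    have "real q * real l * D ^ 3 \<le> D ^ C * (real X / D ^ E) * D ^ 3"
      using q l D by (intro mult_mono mult_right_mono) auto
    also have "\<dots> = real X * (D ^ (C + 3) / D ^ E)" by (simp add: power_add)
    also have "\<dots> \<le> real X * 1" using pb(3)[of "C+3" E] pb(4) by (intro mult_left_mono) (auto simp: E)
    finally show ?thesis by simp
  qed
  have qlX: "q * l \<le> X"
  proof -
    have "real q * real l * 1 \<le> real q * real l * D ^ 3" using pb(2) by (intro mult_left_mono) auto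
    hence "real (q * l) \<le> real X" using ql by simp
    thus ?thesis by (simp only: of_nat_le_iff)
  qed
  (* Pass to a progression with step q: there the higher coefficients, multiplied by q, are close to integers. *)
  obtain n where n: "n < X" "real l \<le> 2 * D * norm (\<Sum>m<l. \<phi> (n + q * m))"
  proof (rule large_sum_progression[of \<phi> v X D u l q])
    show "norm (\<phi> n) \<le> 1" for n by (simp add: \<phi>_def)
    show "real X \<le> D * norm (sum \<phi> {u..<v})" using big by (simp add: \<phi>_def)
    have "4 * D * real q * real l = real q * real l * (4 * D)" by simp
    also have "\<dots> \<le> real q * real l * D ^ 3"
    proof (intro mult_left_mono)
      have "4 * D \<le> D ^ 2 * D" using pb(1)[of 2] D by (intro mult_right_mono) auto
      thus "4 * D \<le> D ^ 3" by (simp add: power_numeral_reduce)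
    qed simp
    finally show "4 * D * real q * real l \<le> real X" using ql by linarith
  qed (use v X D l in auto)
  define A where "A = (\<lambda>m. \<Sum>i\<in>{1..k}. \<gamma> i * real (n + q * m) ^ i)"
  define B where "B = (\<lambda>m. \<Sum>i\<in>{Suc k..d}. \<gamma> i * real (n + q * m) ^ i)"
  have split: "{1..d} = {1..k} \<union> {Suc k..d}" using k1 by auto
  have \<phi>AB: "\<phi> (n + q * m) = unit_exp (A m) * unit_exp (B m)" for m
    unfolding \<phi>_def A_def B_def unit_exp_add[symmetric] split
    by (subst sum.union_disjoint) auto
  (* Along the progression the higher part of the phase moves by at most D ^ (3 * d + C) / D ^ E; the choice of E makes this small even against the factor 1 / D. *)
  have devB: "norm (unit_exp (B m) - unit_exp (B 0)) \<le> 1 / (4 * D)" if m: "m < l" for m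
  proof -
    have "dist_int (B m - B 0) = dist_int (\<Sum>i\<in>{Suc k..d}. \<gamma> i * real (n + q * m) ^ i - \<gamma> i * real n ^ i)"
      by (simp add: B_def sum_subtractf)
    also have "\<dots> \<le> (\<Sum>i\<in>{Suc k..d}. dist_int (\<gamma> i * real (n + q * m) ^ i - \<gamma> i * real n ^ i))" by (rule dist_int_sum)
    also have "\<dots> \<le> (\<Sum>i\<in>{Suc k..d}. real d * 2 ^ d * D ^ C / D ^ E)"
    proof (rule sum_mono)
      fix i assume i: "i \<in> {Suc k..d}"
      have nm: "n + q * m \<le> 2 * X" using n qlX m
        by (metis add_mono less_imp_le_nat mult_2 mult_le_mono2 order_trans)
      have "dist_int (\<gamma> i * real (n + q * m) ^ i - \<gamma> i * real n ^ i)
          \<le> real m * real i * real (2 * X) ^ (i - 1) * dist_int (real q * \<gamma> i)"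
        by (rule dist_int_power_shift[OF nm]) (use X i in auto)
      also have "\<dots> \<le> (real X / D ^ E) * real d * (2 ^ d * real X ^ (i - 1)) * (D ^ C / real X ^ i)"
      proof (intro mult_mono q(3) i)
        show "real m \<le> real X / D ^ E" using m l by linarith
        have "(2::real) ^ (i - 1) \<le> 2 ^ d" using i by (intro power_increasing) auto
        thus "real (2 * X) ^ (i - 1) \<le> 2 ^ d * real X ^ (i - 1)"
          by (simp add: power_mult_distrib mult_right_mono)
      qed (use i pb(4) in auto)
      also have "\<dots> = real d * 2 ^ d * D ^ C / D ^ E"
      proof -
        have "real X ^ i = real X * real X ^ (i - 1)" using i by (cases i) auto
        thus ?thesis using Xpos pb(4) by (simp add: field_simps)
      qed
      finally show "dist_int (\<gamma> i * real (n + q * m) ^ i - \<gamma> i * real n ^ i) \<le> real d * 2 ^ d * D ^ C / D ^ E" .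
    qed
    also have "\<dots> = real (d - k) * (real d * 2 ^ d * D ^ C / D ^ E)" by simp
    also have "\<dots> \<le> real d * (real d * 2 ^ d * D ^ C / D ^ E)" using pb(4) by (intro mult_right_mono) auto
    finally have dB: "dist_int (B m - B 0) \<le> real d * (real d * 2 ^ d * D ^ C / D ^ E)" .
    have "norm (unit_exp (B m) - unit_exp (B 0)) \<le> 2 * pi * dist_int (B m - B 0)" by (rule norm_unit_exp_diff_le)
    also have "\<dots> \<le> D ^ 3 * (D ^ d * (D ^ d * D ^ d * D ^ C / D ^ E))"
    proof (intro mult_mono order_trans[OF dB] divide_right_mono mult_right_mono)
      show "2 * pi \<le> D ^ 3" using pb(1)[of 3] pi_less_4 by simp
    qed (use pb(1,2,4,5) in \<open>auto intro: less_imp_le\<close>)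
    also have "\<dots> = D ^ (3 * d + C + 3) / D ^ E" by (simp add: power_add power3_eq_cube power_mult[symmetric] mult_ac numeral_3_eq_3)
    also have "\<dots> = 1 / D ^ 3" unfolding E using pb(4) by (simp add: power_add field_simps)
    also have "\<dots> \<le> 1 / (4 * D)"
    proof (intro divide_left_mono)
      have "4 * D \<le> D ^ 2 * D" using pb(1)[of 2] D by (intro mult_right_mono) auto
      thus "4 * D \<le> D ^ 3" by (simp add: power_numeral_reduce)
    qed (use pb(4) in auto)
    finally show ?thesis .
  qed
  have "norm (\<Sum>m<l. \<phi> (n + q * m)) \<le> norm (\<Sum>m<l. unit_exp (A m)) + real l / (4 * D)"
  proof -
    have "(\<Sum>m<l. \<phi> (n + q * m)) = (\<Sum>m<l. unit_exp (A m)) * unit_exp (B 0) + (\<Sum>m<l. unit_exp (A m) * (unit_exp (B m) - unit_exp (B 0)))"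
      unfolding \<phi>AB by (simp add: sum_distrib_left algebra_simps sum_subtractf)
    also have "norm \<dots> \<le> norm ((\<Sum>m<l. unit_exp (A m)) * unit_exp (B 0)) + norm (\<Sum>m<l. unit_exp (A m) * (unit_exp (B m) - unit_exp (B 0)))"
      by (rule norm_triangle_ineq)
    also have "norm (\<Sum>m<l. unit_exp (A m) * (unit_exp (B m) - unit_exp (B 0))) \<le> (\<Sum>m<l. 1 / (4 * D))"
      using devB by (intro sum_norm_le) (auto simp: norm_mult)
    finally show ?thesis by (simp add: norm_mult)
  qed
  hence "2 * D * norm (\<Sum>m<l. \<phi> (n + q * m)) \<le> 2 * D * (norm (\<Sum>m<l. unit_exp (A m)) + real l / (4 * D))"
    using pb(4) by (intro mult_left_mono) auto
  also have "\<dots> = 2 * D * norm (\<Sum>m<l. unit_exp (A m)) + real l / 2" using pb(4) by (simp add: field_simps)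
  finally have bigA: "real l \<le> (4 * D) * norm (\<Sum>m\<in>{0..<l}. unit_exp (A m))" using n by (simp add: atLeast0LessThan)
  have "\<exists>q2::nat. 1 \<le> q2 \<and> real q2 \<le> (4 * D) ^ Ck \<and> dist_int (real q2 * (\<gamma> k * real q ^ k)) \<le> (4 * D) ^ Ck / real l ^ k"
    by (rule lead[OF _ _ _ _ bigA]) (use D l lead_poly_affine[OF k1(1), of \<gamma> q n] in \<open>auto simp: A_def\<close>)
  then obtain q2 where q2: "1 \<le> q2" "real q2 \<le> (4 * D) ^ Ck" "dist_int (real q2 * (\<gamma> k * real q ^ k)) \<le> (4 * D) ^ Ck / real l ^ k"
    by blast
  have D4: "(4 * D) ^ Ck \<le> D ^ (3 * Ck)"
  proof -
    have "4 * D \<le> D ^ 2 * D" using pb(1)[of 2] D by (intro mult_right_mono) auto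
    hence "4 * D \<le> D ^ 3" by (simp add: power_numeral_reduce)
    thus ?thesis unfolding power_mult using D by (intro power_mono) auto
  qed
  have qpow: "real q ^ j \<le> D ^ (C * j)" for j unfolding power_mult using q by (intro power_mono) auto
  show ?thesis
  proof (intro exI[of _ "q2 * q ^ k"] conjI ballI)
    show "1 \<le> q2 * q ^ k" using q q2 by simp
    have "real (q2 * q ^ k) = real q2 * real q ^ k" by simp
    also have "\<dots> \<le> D ^ (3 * Ck) * D ^ (C * k)" using q2 D4 qpow pb by (intro mult_mono) auto
    also have "\<dots> = D ^ (3 * Ck + C * k)" by (simp add: power_add)
    also have "\<dots> \<le> D ^ C'" by (rule pb(3)) (use k1 in \<open>auto simp: C' intro: trans_le_add1 mult_le_mono\<close>)
    finally show "real (q2 * q ^ k) \<le> D ^ C'" .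
    fix i assume i: "i \<in> {k..d}"
    show "dist_int (real (q2 * q ^ k) * \<gamma> i) \<le> D ^ C' / real X ^ i"
    proof (cases "i = k")
      case True
      have "dist_int (real (q2 * q ^ k) * \<gamma> i) \<le> (4 * D) ^ Ck / real l ^ k" using q2 True by (simp add: mult_ac)
      also have "\<dots> \<le> D ^ (3 * Ck) / (real X / D ^ (E + 1)) ^ k"
        using D4 l Xpos pb(4) by (intro frac_le power_mono) auto
      also have "\<dots> = D ^ (3 * Ck + (E + 1) * k) / real X ^ k"
        using Xpos by (simp only: power_divide power_mult power_add) simp
      also have "\<dots> \<le> D ^ C' / real X ^ i" unfolding True
      proof (intro divide_right_mono pb(3))
        have "(E + 1) * k \<le> (E + 1) * d" using k1 by (intro mult_le_mono2) auto
        thus "3 * Ck + (E + 1) * k \<le> C'" by (simp add: C')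
      qed simp
      finally show ?thesis .
    next
      case False
      hence i': "i \<in> {Suc k..d}" using i by auto
      have "real (q2 * q ^ k) * \<gamma> i = real (q2 * q ^ (k - 1)) * (real q * \<gamma> i)"
        using k1 by (cases k) auto
      hence "dist_int (real (q2 * q ^ k) * \<gamma> i) \<le> real (q2 * q ^ (k - 1)) * dist_int (real q * \<gamma> i)"
        using dist_int_of_nat_mult by metis
      also have "\<dots> \<le> (D ^ (3 * Ck) * D ^ (C * (k - 1))) * (D ^ C / real X ^ i)"
        unfolding of_nat_mult of_nat_power
        using q(3)[OF i'] q2 D4 qpow[of "k-1"] pb by (intro mult_mono) auto
      also have "\<dots> = D ^ (3 * Ck + C * (k - 1) + C) / real X ^ i" by (simp add: power_add)
      also have "3 * Ck + C * (k - 1) + C = 3 * Ck + C * k" using k1 by (cases k) auto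
      also have "D ^ (3 * Ck + C * k) / real X ^ i \<le> D ^ C' / real X ^ i"
        by (intro divide_right_mono pb(3)) (use k1 in \<open>auto simp: C' intro: trans_le_add1 mult_le_mono\<close>)
      finally show ?thesis .
    qed
  qed
qed

lemma weyl_simultaneous:
  "\<exists>C::nat. weyl_simultaneous_with d 1 C"
proof -
  have "t \<le> d \<Longrightarrow> \<exists>C::nat. weyl_simultaneous_with d (Suc (d - t)) C" for t
  proof (induction t)
    case 0
    show ?case by (rule exI[of _ 0], intro allI impI, rule exI[of _ 1]) auto
  next
    case (Suc t)
    define k where "k = d - t"
    have t: "t < d" using Suc.prems by simp
    obtain C where IH: "weyl_simultaneous_with d (Suc k) C"
      using Suc.IH t unfolding k_def by auto
    have "Suc (k - 1) = k" using t by (simp add: k_def)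
    then obtain Ck where lead: "weyl_leading_with k Ck"
      using weyl_leading[of "k - 1"] by metis
    have k': "Suc (d - Suc t) = k" using t by (simp add: k_def)
    show ?case unfolding k'
      by (rule exI, intro allI impI, rule weyl_simultaneous_step[OF t k_def IH[rule_format] lead[rule_format] refl refl])
  qed
  from this[of d] show ?thesis by simp
qed

section \<open>Recurrence of polynomials and bilinear sums\<close>

text \<open>A function of degree \<open>k\<close> that is \<open>\<eta>\<close>-close to integers on a subset of density
  \<open>1 / D\<close> of an interval has a leading coefficient that is almost as close to a rational of small
  denominator.\<close>
abbreviation poly_recurrence_with :: "nat \<Rightarrow> nat \<Rightarrow> bool" where
  "poly_recurrence_with k C \<equiv>
    \<forall>D S u Z F \<beta> \<eta>. 2 \<le> D \<longrightarrow>
     lead k \<beta> F \<longrightarrow> S \<subseteq> {u..<u+Z} \<longrightarrow>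
     real Z \<le> D * real (card S) \<longrightarrow> D ^ C \<le> real Z \<longrightarrow>
     (\<forall>s\<in>S. dist_int (F s) \<le> \<eta>) \<longrightarrow>
     (\<exists>q::nat. 1 \<le> q \<and> real q \<le> D ^ C \<and> dist_int (real q * \<beta>) \<le> D ^ C * \<eta>)"

text \<open>By induction on the degree.  Two short shifts of \<open>S\<close> overlap substantially, so \<open>F (n + h) -
  F n\<close> is close to integers on a set of density \<open>1 / D ^ 8\<close> for some \<open>h \<le> D ^
  4\<close>.\<close>
lemma poly_recurrence:
  "\<exists>C::nat. poly_recurrence_with k C"
proof (induction k)
  case 0
  show ?case
  proof (rule exI[of _ 0], intro allI impI)
    fix D \<beta> \<eta> :: real and S u Z F
    assume *: "2 \<le> D" "lead 0 \<beta> F" "S \<subseteq> {u..<u+Z}" "real Z \<le> D * real (card S)" "D ^ 0 \<le> real Z"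
      "\<forall>s\<in>S. dist_int (F s) \<le> \<eta>"
    hence "S \<noteq> {}" by auto
    then obtain s where "s \<in> S" by blast
    thus "\<exists>q::nat. 1 \<le> q \<and> real q \<le> D ^ 0 \<and> dist_int (real q * \<beta>) \<le> D ^ 0 * \<eta>"
      using * by (intro exI[of _ 1]) auto
  qed
next
  case (Suc k)
  then obtain C where IH0: "poly_recurrence_with k C" ..
  note IH = IH0[rule_format]
  define C' where "C' = 8 * C + k + 6"
  show ?case
  proof (rule exI[of _ C'], intro allI impI)
    fix D \<beta> \<eta> :: real and S u Z F
    assume D: "2 \<le> D" and F: "lead (Suc k) \<beta> F" and S: "S \<subseteq> {u..<u+Z}" and card: "real Z \<le> D * real (card S)"
      and Z: "D ^ C' \<le> real Z" and close: "\<forall>s\<in>S. dist_int (F s) \<le> \<eta>"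
    note pb = pow_base[OF D]
    define H where "H = nat \<lceil>4 * D\<rceil>"
    have H: "4 * D \<le> real H" "real H \<le> D ^ 4"
    proof -
      show "4 * D \<le> real H" unfolding H_def by linarith
      have "real H \<le> 5 * D" unfolding H_def using D by linarith
      also have "\<dots> \<le> D ^ 3 * D" using pb(1)[of 3] D by (intro mult_right_mono) auto
      finally show "real H \<le> D ^ 4" by (simp add: power_numeral_reduce mult_ac)
    qed
    have "D ^ 4 \<le> real Z" using pb(3)[of 4 C'] Z by (simp add: C'_def)
    hence HZ: "H \<le> Z" using H by linarith
    have "1 \<le> D" using D by simp
    then obtain h where h: "1 \<le> h" "h < H" "real Z / real H ^ 2 \<le> real (card {s\<in>S. s + h \<in> S})"
      using shifted_overlap[OF S _ card H(1) HZ] by blast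
    have Hpos: "real H > 0" using h by simp
    define S' where "S' = {s\<in>S. s + h \<in> S}"
    have "S \<noteq> {}" using card Z pb(2)[of C'] by auto
    then obtain s0 where "s0 \<in> S" by blast
    hence \<eta>: "\<eta> \<ge> 0" using close dist_int_nonneg order_trans by blast
    have "\<exists>q::nat. 1 \<le> q \<and> real q \<le> (D ^ 8) ^ C \<and> dist_int (real q * (real (Suc k) * real h * \<beta>)) \<le> (D ^ 8) ^ C * (2 * \<eta>)"
    proof (rule IH)
      show "2 \<le> D ^ 8" using pb(3)[of 1 8] D by simp
      show "lead k (real (Suc k) * real h * \<beta>) (\<lambda>n. F (n + h) - F n)" using F by simp
      show "S' \<subseteq> {u..<u+Z}" using S by (auto simp: S'_def)
      have "real Z \<le> real H ^ 2 * real (card S')" using h Hpos by (simp add: S'_def field_simps)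
      also have "\<dots> \<le> (D ^ 4) ^ 2 * real (card S')" using H by (intro mult_right_mono power_mono) auto
      finally show "real Z \<le> D ^ 8 * real (card S')" by (simp flip: power_mult)
      show "(D ^ 8) ^ C \<le> real Z" using pb(3)[of "8 * C" C'] Z by (simp add: C'_def power_mult)
      show "dist_int (F (s + h) - F s) \<le> 2 * \<eta>" if "s \<in> S'" for s
      proof -
        have "dist_int (F (s + h)) \<le> \<eta>" "dist_int (F s) \<le> \<eta>" using that close by (auto simp: S'_def)
        thus ?thesis using dist_int_diff[of "F (s + h)" "F s"] by linarith
      qed
    qed
    then obtain q where q: "1 \<le> q" "real q \<le> D ^ (8 * C)"
        "dist_int (real q * (real (Suc k) * real h * \<beta>)) \<le> D ^ (8 * C) * (2 * \<eta>)"
      by (auto simp: power_mult)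
    show "\<exists>q::nat. 1 \<le> q \<and> real q \<le> D ^ C' \<and> dist_int (real q * \<beta>) \<le> D ^ C' * \<eta>"
    proof (intro exI[of _ "q * Suc k * h"] conjI)
      show "1 \<le> q * Suc k * h" using q h by (simp add: Suc_le_eq)
      have "real (q * Suc k * h) = real q * real (Suc k) * real h" by (simp only: of_nat_mult)
      also have "\<dots> \<le> D ^ (8 * C) * D ^ Suc k * D ^ 4"
        using q h H pb(5)[of "Suc k"] pb(2) by (intro mult_mono) auto
      also have "\<dots> = D ^ (8 * C + Suc k + 4)" by (simp only: power_add)
      also have "\<dots> \<le> D ^ C'" by (rule pb(3)) (simp add: C'_def)
      finally show "real (q * Suc k * h) \<le> D ^ C'" .
      have "dist_int (real (q * Suc k * h) * \<beta>) \<le> D ^ (8 * C) * 2 * \<eta>" using q(3) by (simp add: algebra_simps)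
      also have "\<dots> \<le> D ^ (8 * C) * D * \<eta>" using D \<eta> by (intro mult_right_mono mult_left_mono) auto
      also have "D ^ (8 * C) * D = D ^ (8 * C + 1)" by simp
      also have "\<dots> * \<eta> \<le> D ^ C' * \<eta>" by (intro mult_right_mono pb(3) \<eta>) (simp add: C'_def)
      finally show "dist_int (real (q * Suc k * h) * \<beta>) \<le> D ^ C' * \<eta>" .
    qed
  qed
qed

lemma common_denominator:
  fixes x :: "nat \<Rightarrow> real"
  assumes fin: "finite S" and Q: "Q \<ge> 1" and \<eta>: "\<eta> \<ge> 0"
    and ex: "\<And>i. i \<in> S \<Longrightarrow> \<exists>q::nat. 1 \<le> q \<and> real q \<le> Q \<and> dist_int (real q * x i) \<le> Q * \<eta>"
  shows "\<exists>q::nat. 1 \<le> q \<and> real q \<le> Q ^ card S \<and> (\<forall>i\<in>S. dist_int (real q * x i) \<le> Q ^ card S * \<eta>)"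
  using fin ex
proof (induction S)
  case (insert j S)
  obtain q where q: "1 \<le> q" "real q \<le> Q ^ card S" "\<forall>i\<in>S. dist_int (real q * x i) \<le> Q ^ card S * \<eta>"
    using insert by auto
  obtain r :: nat where r: "1 \<le> r" "real r \<le> Q" "dist_int (real r * x j) \<le> Q * \<eta>" using insert.prems by auto
  have card: "card (insert j S) = Suc (card S)" using insert by simp
  have Qp: "0 \<le> Q" "0 \<le> Q ^ card S" "1 \<le> Q ^ card S" using Q by auto
  show ?case
  proof (intro exI[of _ "q * r"] conjI ballI)
    show "1 \<le> q * r" using q r by simp
    show "real (q * r) \<le> Q ^ card (insert j S)" unfolding card of_nat_mult power_Suc2
      using q r Qp by (intro mult_mono) auto
    fix i assume i: "i \<in> insert j S"
    show "dist_int (real (q * r) * x i) \<le> Q ^ card (insert j S) * \<eta>"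
    proof (cases "i = j")
      case True
      have "dist_int (real (q * r) * x i) \<le> real q * dist_int (real r * x j)"
        using dist_int_of_nat_mult[of q "real r * x j"] True by (simp add: mult.assoc)
      also have "\<dots> \<le> Q ^ card S * (Q * \<eta>)" using q r Qp by (intro mult_mono) auto
      finally show ?thesis unfolding card by (simp add: mult_ac)
    next
      case False
      have "dist_int (real (q * r) * x i) \<le> real r * dist_int (real q * x i)"
        using dist_int_of_nat_mult[of r "real q * x i"] by (simp add: mult_ac)
      also have "\<dots> \<le> Q * (Q ^ card S * \<eta>)" using q r Qp i False by (intro mult_mono) auto
      finally show ?thesis unfolding card by (simp add: mult_ac)
    qed
  qed
qed auto

text \<open>The exponent can be chosen independently of the degree, as the sum of the exponents for all degrees up to
  \<open>d\<close>.\<close>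
lemma uniform_poly_recurrence:
  "\<exists>C::nat. \<forall>k\<le>d. \<forall>D S u Z F \<beta> \<eta>. 2 \<le> D \<longrightarrow> lead k \<beta> F \<longrightarrow> S \<subseteq> {u..<u+Z} \<longrightarrow> real Z \<le> D * real (card S) \<longrightarrow>
     D ^ C \<le> real Z \<longrightarrow> 0 \<le> \<eta> \<longrightarrow> (\<forall>s\<in>S. dist_int (F s) \<le> \<eta>) \<longrightarrow>
     (\<exists>q::nat. 1 \<le> q \<and> real q \<le> D ^ C \<and> dist_int (real q * \<beta>) \<le> D ^ C * \<eta>)"
proof -
  have "\<forall>k. \<exists>C. poly_recurrence_with k C"
    using poly_recurrence by blast
  from choice[OF this] obtain C where C: "\<forall>k. poly_recurrence_with k (C k)" ..
  define C' where "C' = (\<Sum>k\<le>d. C k)"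
  show ?thesis
  proof (rule exI[of _ C'], intro allI impI)
    fix k D S u Z F and \<beta> \<eta> :: real
    assume k: "k \<le> d" and D: "2 \<le> D" and a: "lead k \<beta> F" "S \<subseteq> {u..<u+Z}" "real Z \<le> D * real (card S)"
      and Z: "D ^ C' \<le> real Z" and \<eta>: "0 \<le> \<eta>" and cl: "\<forall>s\<in>S. dist_int (F s) \<le> \<eta>"
    have "C k \<le> C'" unfolding C'_def using k by (intro member_le_sum) auto
    hence le: "D ^ C k \<le> D ^ C'" by (rule pow_base(3)[OF D])
    hence "D ^ C k \<le> real Z" using Z by linarith
    from C[rule_format, OF D a this] cl obtain q where q: "1 \<le> q" "real q \<le> D ^ C k" "dist_int (real q * \<beta>) \<le> D ^ C k * \<eta>" by blast
    have "D ^ C k * \<eta> \<le> D ^ C' * \<eta>" using le \<eta> by (rule mult_right_mono)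
    thus "\<exists>q::nat. 1 \<le> q \<and> real q \<le> D ^ C' \<and> dist_int (real q * \<beta>) \<le> D ^ C' * \<eta>"
      using q le by (intro exI[of _ q]) auto
  qed
qed

text \<open>The form of polynomial recurrence that is used below: if the monomials \<open>x i * s ^ i\<close> are close to
  fixed numbers modulo one for many \<open>s\<close>, then the \<open>x i\<close> have a common small
  denominator.\<close>
abbreviation coefficient_recurrence_with :: "nat \<Rightarrow> nat \<Rightarrow> bool" where
  "coefficient_recurrence_with d C \<equiv>
    \<forall>D S u Z x c \<eta>. 2 \<le> D \<longrightarrow>
     S \<subseteq> {u..<u+Z} \<longrightarrow> real Z \<le> D * real (card S) \<longrightarrow>
     D ^ C \<le> real Z \<longrightarrow> 0 \<le> \<eta> \<longrightarrow>
     (\<forall>i\<in>{1..d}. \<forall>s\<in>S. dist_int (x i * real s ^ i - c i) \<le> \<eta>) \<longrightarrow>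
     (\<exists>q::nat. 1 \<le> q \<and> real q \<le> D ^ C \<and> (\<forall>i\<in>{1..d}. dist_int (real q * x i) \<le> D ^ C * \<eta>))"

lemma coefficient_recurrence:
  "\<exists>C::nat. coefficient_recurrence_with d C"
proof -
  obtain C where C: "\<forall>k\<le>d. \<forall>D S u Z F \<beta> \<eta>. 2 \<le> D \<longrightarrow> lead k \<beta> F \<longrightarrow> S \<subseteq> {u..<u+Z} \<longrightarrow> real Z \<le> D * real (card S) \<longrightarrow>
     D ^ C \<le> real Z \<longrightarrow> 0 \<le> \<eta> \<longrightarrow> (\<forall>s\<in>S. dist_int (F s) \<le> \<eta>) \<longrightarrow>
     (\<exists>q::nat. 1 \<le> q \<and> real q \<le> D ^ C \<and> dist_int (real q * \<beta>) \<le> D ^ C * \<eta>)"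
    using uniform_poly_recurrence by blast
  show ?thesis
  proof (rule exI[of _ "C * (d + 1)"], intro allI impI)
    fix D S u Z and x c :: "nat \<Rightarrow> real" and \<eta> :: real
    assume D: "2 \<le> D" and S: "S \<subseteq> {u..<u+Z}" and card: "real Z \<le> D * real (card S)" and Z: "D ^ (C * (d + 1)) \<le> real Z"
      and \<eta>: "0 \<le> \<eta>" and cl: "\<forall>i\<in>{1..d}. \<forall>s\<in>S. dist_int (x i * real s ^ i - c i) \<le> \<eta>"
    have DC: "D ^ C \<le> D ^ (C * (d + 1))" "D ^ (C * d) \<le> D ^ (C * (d + 1))" by (rule pow_base(3)[OF D]; simp)+
    have single: "\<exists>q::nat. 1 \<le> q \<and> real q \<le> D ^ C \<and> dist_int (real q * x i) \<le> D ^ C * \<eta>" if i: "i \<in> {1..d}" for i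
    proof -
      have "lead i (x i + 0) (\<lambda>n. x i * real n ^ i + (- c i))"
      proof (rule lead_add)
        show "lead i (x i) (\<lambda>n. x i * real n ^ i)" using lead_affine_power[of i "x i" 1 0] by simp
        show "lead i 0 (\<lambda>n. - c i)" using i by (intro lead_zero_higher[OF lead_const]) auto
      qed
      hence "lead i (x i) (\<lambda>n. x i * real n ^ i - c i)" by simp
      moreover have "i \<le> d" using i by simp
      ultimately show ?thesis using C[rule_format, OF _ D _ S card _ \<eta>] cl i Z DC(1) by (meson order_trans)
    qed
    obtain q where q: "1 \<le> q" "real q \<le> (D ^ C) ^ card {1..d}" "\<forall>i\<in>{1..d}. dist_int (real q * x i) \<le> (D ^ C) ^ card {1..d} * \<eta>"
      using common_denominator[of "{1..d}" "D ^ C" \<eta> x, OF finite_atLeastAtMost pow_base(2)[OF D] \<eta> single] by blast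
    have "(D ^ C) ^ card {1..d} \<le> D ^ (C * (d + 1))" using DC by (simp add: power_mult)
    moreover from this have "(D ^ C) ^ card {1..d} * \<eta> \<le> D ^ (C * (d + 1)) * \<eta>" using \<eta> by (rule mult_right_mono)
    ultimately show "\<exists>q::nat. 1 \<le> q \<and> real q \<le> D ^ (C * (d + 1)) \<and> (\<forall>i\<in>{1..d}. dist_int (real q * x i) \<le> D ^ (C * (d + 1)) * \<eta>)"
      using q by (intro exI[of _ q]) (auto intro: order_trans)
  qed
qed

lemma norm_sum_square_le:
  fixes f :: "'b \<Rightarrow> complex"
  assumes "finite S"
  shows "(norm (\<Sum>s\<in>S. f s))\<^sup>2 \<le> real (card S) * (\<Sum>s\<in>S. (norm (f s))\<^sup>2)"
proof -
  have "norm (\<Sum>s\<in>S. f s) \<le> (\<Sum>s\<in>S. 1 * norm (f s))" by (simp add: norm_sum)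
  hence "(norm (\<Sum>s\<in>S. f s))\<^sup>2 \<le> (\<Sum>s\<in>S. 1 * norm (f s))\<^sup>2" by (intro power_mono) auto
  also have "\<dots> \<le> (\<Sum>s\<in>S. 1\<^sup>2) * (\<Sum>s\<in>S. (norm (f s))\<^sup>2)" by (rule Cauchy_Schwarz_ineq_sum)
  finally show ?thesis by simp
qed

text \<open>The Cauchy-Schwarz inequality over \<open>h\<close> permits \<open>H\<close> to be replaced by the whole
  interval.  After expanding the square and taking absolute values, \<open>P\<close> may be replaced by an
  interval as well.  The inner sums are then exponential sums over full intervals.\<close>
lemma bilinear_to_pairs:
  fixes \<Theta> :: "nat \<Rightarrow> real" and u Z Y Lo :: nat
  assumes P: "P \<subseteq> {u..<u+Z}" and H: "H \<subseteq> {Lo..G}" and Lo: "Lo \<ge> 1" and u: "u \<ge> 1" and G: "G = Y div u"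
  defines "T \<equiv> \<Sum>h\<in>H. \<Sum>p\<in>{p\<in>P. p * h \<le> Y}. unit_exp (\<Theta> (p * h))"
  shows "(norm T)\<^sup>2 \<le> real G * (\<Sum>(p, p')\<in>{u..<u+Z} \<times> {u..<u+Z}.
     norm (\<Sum>h\<in>{Lo..<Y div max p p' + 1}. unit_exp (\<Theta> (p * h) - \<Theta> (p' * h))))"
proof -
  have finP: "finite P" "finite H" using P H finite_subset by blast+
  have "card H \<le> card {Lo..G}" using H by (intro card_mono) auto
  hence cH: "card H \<le> G" using Lo by simp
  define f where "f = (\<lambda>h. \<Sum>p\<in>{p\<in>P. p * h \<le> Y}. unit_exp (\<Theta> (p * h)))"
  have "(norm T)\<^sup>2 \<le> real (card H) * (\<Sum>h\<in>H. (norm (f h))\<^sup>2)"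
    unfolding T_def f_def by (rule norm_sum_square_le[OF finP(2)])
  also have "\<dots> \<le> real G * (\<Sum>h\<in>{Lo..G}. (norm (f h))\<^sup>2)"
    using cH H by (intro mult_mono sum_mono2 sum_nonneg) auto
  also have "(\<Sum>h\<in>{Lo..G}. (norm (f h))\<^sup>2) \<le> (\<Sum>(p, p')\<in>{u..<u+Z} \<times> {u..<u+Z}.
     norm (\<Sum>h\<in>{Lo..<Y div max p p' + 1}. unit_exp (\<Theta> (p * h) - \<Theta> (p' * h))))"
  proof -
    have "complex_of_real (\<Sum>h\<in>{Lo..G}. (norm (f h))\<^sup>2)
      = (\<Sum>h\<in>{Lo..G}. \<Sum>(p, p')\<in>P \<times> P. if p * h \<le> Y \<and> p' * h \<le> Y then unit_exp (\<Theta> (p * h) - \<Theta> (p' * h)) else 0)"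
      unfolding of_real_sum
    proof (rule sum.cong[OF refl])
      fix h
      have f_if: "f h = (\<Sum>p\<in>P. if p * h \<le> Y then unit_exp (\<Theta> (p * h)) else 0)"
        unfolding f_def using finP by (intro sum.mono_neutral_cong_left) auto
      have "complex_of_real ((norm (f h))\<^sup>2) = f h * cnj (f h)" by (rule complex_norm_square)
      also have "\<dots> = (\<Sum>p\<in>P. \<Sum>p'\<in>P. (if p * h \<le> Y then unit_exp (\<Theta> (p * h)) else 0) * cnj (if p' * h \<le> Y then unit_exp (\<Theta> (p' * h)) else 0))"
        unfolding f_if cnj_sum sum_product ..
      also have "\<dots> = (\<Sum>(p, p')\<in>P \<times> P. (if p * h \<le> Y then unit_exp (\<Theta> (p * h)) else 0) * cnj (if p' * h \<le> Y then unit_exp (\<Theta> (p' * h)) else 0))"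
        by (rule sum.cartesian_product)
      also have "\<dots> = (\<Sum>(p, p')\<in>P \<times> P. if p * h \<le> Y \<and> p' * h \<le> Y then unit_exp (\<Theta> (p * h) - \<Theta> (p' * h)) else 0)"
        by (intro sum.cong refl) (auto simp: unit_exp_diff)
      finally show "complex_of_real ((norm (f h))\<^sup>2) = (\<Sum>(p, p')\<in>P \<times> P. if p * h \<le> Y \<and> p' * h \<le> Y then unit_exp (\<Theta> (p * h) - \<Theta> (p' * h)) else 0)" .
    qed
    also have "\<dots> = (\<Sum>x\<in>P \<times> P. \<Sum>h\<in>{Lo..G}. case x of (p, p') \<Rightarrow> if p * h \<le> Y \<and> p' * h \<le> Y then unit_exp (\<Theta> (p * h) - \<Theta> (p' * h)) else 0)"
      by (rule sum.swap)
    finally have eqc: "complex_of_real (\<Sum>h\<in>{Lo..G}. (norm (f h))\<^sup>2) = (\<Sum>x\<in>P \<times> P. \<Sum>h\<in>{Lo..G}. case x of (p, p') \<Rightarrow> if p * h \<le> Y \<and> p' * h \<le> Y then unit_exp (\<Theta> (p * h) - \<Theta> (p' * h)) else 0)" .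
    have "(\<Sum>h\<in>{Lo..G}. (norm (f h))\<^sup>2) = norm (complex_of_real (\<Sum>h\<in>{Lo..G}. (norm (f h))\<^sup>2))"
      unfolding norm_of_real by (simp add: sum_nonneg)
    also have "\<dots> = norm (\<Sum>x\<in>P \<times> P. \<Sum>h\<in>{Lo..G}. case x of (p, p') \<Rightarrow> if p * h \<le> Y \<and> p' * h \<le> Y then unit_exp (\<Theta> (p * h) - \<Theta> (p' * h)) else 0)"
      unfolding eqc ..
    also have "\<dots> \<le> (\<Sum>x\<in>P \<times> P. norm (\<Sum>h\<in>{Lo..G}. case x of (p, p') \<Rightarrow> if p * h \<le> Y \<and> p' * h \<le> Y then unit_exp (\<Theta> (p * h) - \<Theta> (p' * h)) else 0))"
      by (rule norm_sum)
    also have "\<dots> = (\<Sum>x\<in>P \<times> P. case x of (p, p') \<Rightarrow> norm (\<Sum>h\<in>{Lo..<Y div max p p' + 1}. unit_exp (\<Theta> (p * h) - \<Theta> (p' * h))))"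
    proof (rule sum.cong[OF refl])
      fix x assume "x \<in> P \<times> P"
      then obtain p p' where x: "x = (p, p')" and pp: "p \<in> P" "p' \<in> P" by blast
      hence x: "x = (p, p')" "u \<le> p" "u \<le> p'" using P by auto
      have iff: "p * h \<le> Y \<and> p' * h \<le> Y \<longleftrightarrow> h \<le> Y div max p p'" for h
      proof -
        have "p * h \<le> Y \<and> p' * h \<le> Y \<longleftrightarrow> max p p' * h \<le> Y"
        proof (cases "p \<le> p'")
          case True
          hence "p * h \<le> p' * h" by (rule mult_le_mono1)
          thus ?thesis unfolding max.absorb2[OF True] by linarith
        next
          case False
          hence "p' \<le> p" by simp
          moreover from this have "p' * h \<le> p * h" by (rule mult_le_mono1)
          ultimately show ?thesis unfolding max.absorb1[OF \<open>p' \<le> p\<close>] by linarith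
        qed
        thus ?thesis using x u by (simp add: less_eq_div_iff_mult_less_eq mult.commute)
      qed
      have "Y div max p p' \<le> G" unfolding G using x u by (intro div_le_mono2) auto
      hence "{h\<in>{Lo..G}. h \<le> Y div max p p'} = {Lo..<Y div max p p' + 1}" by auto
      hence "(\<Sum>h\<in>{Lo..G}. if p * h \<le> Y \<and> p' * h \<le> Y then unit_exp (\<Theta> (p * h) - \<Theta> (p' * h)) else 0)
          = (\<Sum>h\<in>{Lo..<Y div max p p' + 1}. unit_exp (\<Theta> (p * h) - \<Theta> (p' * h)))"
        unfolding iff by (simp add: sum.inter_filter[symmetric])
      thus "norm (\<Sum>h\<in>{Lo..G}. case x of (p, p') \<Rightarrow> if p * h \<le> Y \<and> p' * h \<le> Y then unit_exp (\<Theta> (p * h) - \<Theta> (p' * h)) else 0)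
        = (case x of (p, p') \<Rightarrow> norm (\<Sum>h\<in>{Lo..<Y div max p p' + 1}. unit_exp (\<Theta> (p * h) - \<Theta> (p' * h))))"
        by (simp only: x(1) case_prod_conv)
    qed
    also have "\<dots> \<le> (\<Sum>x\<in>{u..<u+Z} \<times> {u..<u+Z}. case x of (p, p') \<Rightarrow> norm (\<Sum>h\<in>{Lo..<Y div max p p' + 1}. unit_exp (\<Theta> (p * h) - \<Theta> (p' * h))))"
      using P by (intro sum_mono2) auto
    finally show ?thesis .
  qed
  finally show ?thesis by (simp add: mult_left_mono)
qed

lemma dense_fibre:
  fixes B :: "('b \<times> 'b) set" and \<theta> :: real
  assumes I: "finite I" "card I = Z" and B: "B \<subseteq> I \<times> I" and big: "\<theta> * (real Z)\<^sup>2 \<le> real (card B)" and Z: "Z > 0"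
  obtains y where "y \<in> I" "\<theta> * real Z \<le> real (card {x\<in>I. (x, y) \<in> B})"
proof (rule ccontr)
  note obt = that
  assume "\<not> thesis"
  hence small: "real (card {x\<in>I. (x, y) \<in> B}) < \<theta> * real Z" if "y \<in> I" for y using obt that by force
  have Ine: "I \<noteq> {}" using I Z by auto
  have "B = (\<Union>y\<in>I. (\<lambda>x. (x, y)) ` {x\<in>I. (x, y) \<in> B})" using B by auto
  hence "card B = card (\<Union>y\<in>I. (\<lambda>x. (x, y)) ` {x\<in>I. (x, y) \<in> B})" by (rule arg_cong)
  also have "\<dots> \<le> (\<Sum>y\<in>I. card ((\<lambda>x. (x, y)) ` {x\<in>I. (x, y) \<in> B}))" by (rule card_UN_le[OF I(1)])
  also have "\<dots> \<le> (\<Sum>y\<in>I. card {x\<in>I. (x, y) \<in> B})" using I by (intro sum_mono card_image_le) auto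
  finally have "real (card B) \<le> (\<Sum>y\<in>I. real (card {x\<in>I. (x, y) \<in> B}))" by (simp flip: of_nat_sum)
  also have "\<dots> < (\<Sum>y\<in>I. \<theta> * real Z)" using small I Ine by (intro sum_strict_mono) auto
  also have "\<dots> = \<theta> * (real Z)\<^sup>2" using I by (simp add: power2_eq_square)
  finally show False using big by linarith
qed

text \<open>A bilinear sum over the region \<open>p * h \<le> Y\<close>, with \<open>p\<close> in an arbitrary subset of a
  long enough interval and \<open>h\<close> in an arbitrary set, is large only if the coefficients of the polynomial
  have a common small denominator.\<close>
abbreviation bilinear_inverse_with :: "nat \<Rightarrow> nat \<Rightarrow> bool" where
  "bilinear_inverse_with d C \<equiv>
    \<forall>D \<gamma> P H u Z Y Lo. 2 \<le> D \<longrightarrow>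
     P \<subseteq> {u..<u+Z} \<longrightarrow> H \<subseteq> {Lo..Y div u} \<longrightarrow>
     1 \<le> Lo \<longrightarrow> Lo \<le> Y div u \<longrightarrow>
     1 \<le> u \<longrightarrow> D ^ C \<le> real Z \<longrightarrow>
     real (Y div u) * real Z \<le> D * norm (\<Sum>h\<in>H. \<Sum>p\<in>{p\<in>P. p * h \<le> Y}. unit_exp (\<Sum>i\<in>{1..d}. \<gamma> i * real (p * h) ^ i)) \<longrightarrow>
     (\<exists>q::nat. 1 \<le> q \<and> real q \<le> D ^ C \<and> (\<forall>i\<in>{1..d}. dist_int (real q * \<gamma> i) \<le> D ^ C / real (Y div u)))"

text \<open>By \<open>bilinear_to_pairs\<close> many pairs \<open>p, p'\<close> have large inner sums, so one
  \<open>p'\<close> can be fixed.  Weyl's theorem provides small denominators for \<open>\<gamma> i * (p ^ i -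
  p' ^ i)\<close>, with one denominator for many \<open>p\<close>, and \<open>coefficient_recurrence\<close> in
  the variable \<open>p\<close> removes the powers.\<close>
lemma bilinear_inverse:
  "\<exists>C::nat. bilinear_inverse_with d C"
proof -
  obtain Cw where Cw0: "weyl_simultaneous_with d 1 Cw"
    using weyl_simultaneous[of d] by blast
  note Cw = Cw0[rule_format]
  obtain Cr where Cr0: "coefficient_recurrence_with d Cr"
    using coefficient_recurrence[of d] by blast
  note Cr = Cr0[rule_format]
  define E where "E = 4 * Cw + 3"
  define C where "C = E * Cr + 4 * Cw"
  show ?thesis
  proof (rule exI[of _ C], intro allI impI)
    fix D :: real and \<gamma> P H u Z Y and Lo :: nat
    assume D: "2 \<le> D" and P: "P \<subseteq> {u..<u+Z}" and H: "H \<subseteq> {Lo..Y div u}" and Lo: "1 \<le> Lo" "Lo \<le> Y div u" and u: "1 \<le> u"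
      and ZC: "D ^ C \<le> real Z"
      and big: "real (Y div u) * real Z \<le> D * norm (\<Sum>h\<in>H. \<Sum>p\<in>{p\<in>P. p * h \<le> Y}. unit_exp (\<Sum>i\<in>{1..d}. \<gamma> i * real (p * h) ^ i))"
    note pb = pow_base[OF D]
    define G where "G = Y div u"
    define I where "I = {u..<u+Z}"
    define \<Theta> where "\<Theta> = (\<lambda>n. \<Sum>i\<in>{1..d}. \<gamma> i * real n ^ i)"
    define S where "S = (\<lambda>(p, p'). norm (\<Sum>h\<in>{Lo..<Y div max p p' + 1}. unit_exp (\<Theta> (p * h) - \<Theta> (p' * h))))"
    have Gpos: "real G > 0" "G \<ge> 1" using Lo by (auto simp: G_def)
    have Zpos: "real Z > 0" using ZC pb(2)[of C] by linarith
    have cI: "card I = Z" "finite I" by (auto simp: I_def)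
    have "(real G * real Z)\<^sup>2 \<le> (D * norm (\<Sum>h\<in>H. \<Sum>p\<in>{p\<in>P. p * h \<le> Y}. unit_exp (\<Theta> (p * h))))\<^sup>2"
      using big unfolding G_def \<Theta>_def by (intro power_mono) auto
    also have "\<dots> \<le> D\<^sup>2 * (real G * (\<Sum>x\<in>I \<times> I. S x))"
      unfolding power_mult_distrib I_def S_def
      by (intro mult_left_mono bilinear_to_pairs[OF P _ Lo(1) u]) (use H in \<open>auto simp: G_def\<close>)
    finally have "real G * (real G * (real Z)\<^sup>2) \<le> real G * (D\<^sup>2 * (\<Sum>x\<in>I \<times> I. S x))"
      by (simp add: power2_eq_square mult_ac)
    hence "real G * (real Z)\<^sup>2 \<le> D\<^sup>2 * (\<Sum>x\<in>I \<times> I. S x)" using Gpos by (simp only: mult_le_cancel_left_pos)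
    hence sumS: "1 / D\<^sup>2 * real G * (real Z)\<^sup>2 \<le> (\<Sum>x\<in>I \<times> I. S x)" using D by (simp add: field_simps)
    define B where "B = {x\<in>I \<times> I. 1 / D\<^sup>2 / 2 * real G \<le> S x}"
    have "1 / D\<^sup>2 / 2 * (real Z)\<^sup>2 \<le> real (card B)"
      unfolding B_def
    proof (rule dense_large_values)
      show "0 \<le> S x \<and> S x \<le> real G" if x: "x \<in> I \<times> I" for x
      proof -
        obtain p p' where xp: "x = (p, p')" "u \<le> p" "u \<le> p'" using x by (auto simp: I_def)
        have "S x \<le> (\<Sum>h\<in>{Lo..<Y div max p p' + 1}. 1)" unfolding S_def xp(1) case_prod_conv
          by (intro sum_norm_le) simp
        also have "\<dots> \<le> real (Y div max p p')" using Lo by simp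
        also have "\<dots> \<le> real G" unfolding G_def using xp u by (intro of_nat_mono div_le_mono2) auto
        finally show ?thesis by (simp add: S_def xp(1))
      qed
    qed (use sumS cI Gpos Zpos in \<open>auto simp: card_cartesian_product power2_eq_square\<close>)
    note Bbig = this
    have Bsub: "B \<subseteq> I \<times> I" by (auto simp: B_def)
    have Z0: "Z > 0" using Zpos by simp
    (* Freeze p' and use that many p have a large inner sum with it. *)
    obtain p' where p': "p' \<in> I" "1 / D\<^sup>2 / 2 * real Z \<le> real (card {p\<in>I. (p, p') \<in> B})"
      by (rule dense_fibre[OF cI(2,1) Bsub Bbig Z0])
    define R where "R = {p\<in>I. (p, p') \<in> B}"
    have R: "finite R" "R \<subseteq> {u..<u+Z}" by (auto simp: R_def I_def)
    have Rcard: "real Z \<le> 2 * D\<^sup>2 * real (card R)" using p'(2) D by (simp add: R_def field_simps)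
    hence Rne: "R \<noteq> {}" using Zpos by auto
    define Q where "Q = D ^ (4 * Cw)"
    have D4: "4 * D\<^sup>2 \<le> D ^ 4" "2 \<le> 4 * D\<^sup>2"
    proof -
      have "4 * D\<^sup>2 \<le> D\<^sup>2 * D\<^sup>2" using pb(1)[of 2] by (intro mult_right_mono) auto
      thus "4 * D\<^sup>2 \<le> D ^ 4" by (simp flip: power_add)
      show "2 \<le> 4 * D\<^sup>2" using pb(2)[of 2] by linarith
    qed
    have QW: "(4 * D\<^sup>2) ^ Cw \<le> Q" unfolding Q_def power_mult using D4 by (intro power_mono) auto
    have "\<exists>q::nat. 1 \<le> q \<and> real q \<le> Q \<and> (\<forall>i\<in>{1..d}. dist_int (real q * (\<gamma> i * (real p ^ i - real p' ^ i))) \<le> Q / real G)"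
      if p: "p \<in> R" for p
    proof -
      have pB: "real G \<le> 2 * D\<^sup>2 * S (p, p')" using p D by (simp add: R_def B_def field_simps)
      have "real (G + 1) \<le> 2 * real G" using Gpos by simp
      also have "\<dots> \<le> (4 * D\<^sup>2) * S (p, p')" using pB by (simp add: algebra_simps)
      also have "S (p, p') = norm (\<Sum>h\<in>{Lo..<Y div max p p' + 1}. unit_exp (\<Sum>i\<in>{1..d}. (\<gamma> i * (real p ^ i - real p' ^ i)) * real h ^ i))"
        unfolding S_def case_prod_conv \<Theta>_def
        by (intro arg_cong[where f = norm] sum.cong refl arg_cong[where f = unit_exp])
           (simp add: power_mult_distrib algebra_simps flip: sum_subtractf)
      finally have w: "real (G + 1) \<le> (4 * D\<^sup>2) * norm (\<Sum>h\<in>{Lo..<Y div max p p' + 1}. unit_exp (\<Sum>i\<in>{1..d}. (\<gamma> i * (real p ^ i - real p' ^ i)) * real h ^ i))" .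
      have "Y div max p p' \<le> G" unfolding G_def using p u by (intro div_le_mono2) (auto simp: R_def I_def)
      hence vG: "Y div max p p' + 1 \<le> G + 1" by simp
      have G1: "1 \<le> G + 1" by simp
      obtain q where q: "1 \<le> q" "real q \<le> (4 * D\<^sup>2) ^ Cw"
         "\<forall>i\<in>{1..d}. dist_int (real q * (\<gamma> i * (real p ^ i - real p' ^ i))) \<le> (4 * D\<^sup>2) ^ Cw / real (G + 1) ^ i"
        using Cw[OF D4(2) G1 vG w] by blast
      have "(4 * D\<^sup>2) ^ Cw / real (G + 1) ^ i \<le> Q / real G" if "i \<in> {1..d}" for i
      proof (rule frac_le)
        have "real G \<le> real (G + 1) ^ 1" by simp
        also have "\<dots> \<le> real (G + 1) ^ i" using that by (intro power_increasing) auto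
        finally show "real G \<le> real (G + 1) ^ i" .
      qed (use QW Gpos pb in \<open>auto simp: Q_def\<close>)
      thus ?thesis using q QW by (intro exI[of _ q]) (auto intro: order_trans)
    qed
    then obtain f where f: "\<And>p. p \<in> R \<Longrightarrow> 1 \<le> f p \<and> real (f p) \<le> Q \<and>
        (\<forall>i\<in>{1..d}. dist_int (real (f p) * (\<gamma> i * (real p ^ i - real p' ^ i))) \<le> Q / real G)" by metis
    obtain q where q: "q \<ge> 1" "real q \<le> Q" "real (card R) \<le> Q * real (card {p\<in>R. f p = q})"
      using pigeonhole_bounded[OF R(1) Rne, of f Q] f by blast
    have Q1: "Q \<ge> 1" unfolding Q_def by (rule pb)
    have "\<exists>r::nat. 1 \<le> r \<and> real r \<le> (D ^ E) ^ Cr \<and> (\<forall>i\<in>{1..d}. dist_int (real r * (real q * \<gamma> i)) \<le> (D ^ E) ^ Cr * (Q / real G))"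
    proof (rule Cr)
      show "2 \<le> D ^ E" using pb(3)[of 1 E] D by (simp add: E_def)
      show "{p\<in>R. f p = q} \<subseteq> {u..<u+Z}" using R by auto
      have "real Z \<le> 2 * D\<^sup>2 * real (card R)" by (rule Rcard)
      also have "\<dots> \<le> 2 * D\<^sup>2 * (Q * real (card {p\<in>R. f p = q}))" using q D by (intro mult_left_mono) auto
      also have "\<dots> = 2 * D\<^sup>2 * Q * real (card {p\<in>R. f p = q})" by simp
      also have "2 * D\<^sup>2 * Q \<le> D * D\<^sup>2 * Q" using D Q1 by (intro mult_right_mono) auto
      also have "D * D\<^sup>2 * Q = D ^ E" by (simp add: E_def Q_def power_add power3_eq_cube power2_eq_square)
      finally show "real Z \<le> D ^ E * real (card {p\<in>R. f p = q})" by (simp add: mult_right_mono)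
      show "(D ^ E) ^ Cr \<le> real Z" using pb(3)[of "E * Cr" C] ZC by (simp add: C_def power_mult)
      show "0 \<le> Q / real G" using Q1 by simp
      show "dist_int (real q * \<gamma> i * real s ^ i - real q * \<gamma> i * real p' ^ i) \<le> Q / real G"
        if "i \<in> {1..d}" "s \<in> {p\<in>R. f p = q}" for i s
        using f[of s] that by (auto simp: algebra_simps)
    qed
    then obtain r where r: "1 \<le> r" "real r \<le> D ^ (E * Cr)" "\<forall>i\<in>{1..d}. dist_int (real r * (real q * \<gamma> i)) \<le> D ^ (E * Cr) * (Q / real G)"
      by (auto simp: power_mult)
    have CE: "D ^ (E * Cr) * Q = D ^ C" by (simp add: C_def Q_def power_add)
    show "\<exists>q::nat. 1 \<le> q \<and> real q \<le> D ^ C \<and> (\<forall>i\<in>{1..d}. dist_int (real q * \<gamma> i) \<le> D ^ C / real (Y div u))"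
    proof (intro exI[of _ "r * q"] conjI ballI)
      show "1 \<le> r * q" using r q by simp
      show "real (r * q) \<le> D ^ C" unfolding CE[symmetric] of_nat_mult using r q pb(4) by (intro mult_mono) auto
      fix i assume "i \<in> {1..d}"
      thus "dist_int (real (r * q) * \<gamma> i) \<le> D ^ C / real (Y div u)"
        using r(3) unfolding CE[symmetric] G_def[symmetric] by (simp add: mult.assoc)
    qed
  qed
qed

section \<open>Convergence in law from characteristic functions\<close>

text \<open>Finite sums of plane waves.  Their integrals are finite linear combinations of values of the characteristic
  function.\<close>
inductive_set trig :: "(complex \<Rightarrow> complex) set" where
  wave: "(\<lambda>z. c * cis (\<xi> \<bullet> z)) \<in> trig"
| add: "f \<in> trig \<Longrightarrow> g \<in> trig \<Longrightarrow> (\<lambda>z. f z + g z) \<in> trig"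

lemma trig_const: "(\<lambda>_. c) \<in> trig"
  using trig.wave[of c 0] by simp

lemma trig_mult:
  assumes "f \<in> trig" "g \<in> trig"
  shows "(\<lambda>z. f z * g z) \<in> trig"
  using assms(1)
proof induction
  case (wave c \<xi>)
  show ?case using assms(2)
  proof induction
    case (wave c' \<xi>')
    have "(\<lambda>z. c * cis (\<xi> \<bullet> z) * (c' * cis (\<xi>' \<bullet> z))) = (\<lambda>z. (c * c') * cis ((\<xi> + \<xi>') \<bullet> z))"
      by (rule ext) (simp add: inner_add_left flip: cis_mult)
    thus ?case using trig.wave by simp
  next
    case (add f' g')
    thus ?case using trig.add by (fastforce simp: distrib_left)
  qed
next
  case (add f1 f2)
  thus ?case using trig.add by (fastforce simp: distrib_right)
qed

lemma trig_cos_sin: "(\<lambda>z. of_real (cos (\<xi> \<bullet> z))) \<in> trig" "(\<lambda>z. of_real (sin (\<xi> \<bullet> z))) \<in> trig"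
proof -
  have cos_eq: "(\<lambda>z. complex_of_real (cos (\<xi> \<bullet> z))) = (\<lambda>z. 1/2 * cis (\<xi> \<bullet> z) + 1/2 * cis ((- \<xi>) \<bullet> z))"
    by (rule ext) (simp add: complex_eq_iff)
  show "(\<lambda>z. of_real (cos (\<xi> \<bullet> z))) \<in> trig" unfolding cos_eq by (rule trig.add[OF trig.wave trig.wave])
  have sin_eq: "(\<lambda>z. complex_of_real (sin (\<xi> \<bullet> z))) = (\<lambda>z. (- \<i>/2) * cis (\<xi> \<bullet> z) + (\<i>/2) * cis ((- \<xi>) \<bullet> z))"
    by (rule ext) (simp add: complex_eq_iff)
  show "(\<lambda>z. of_real (sin (\<xi> \<bullet> z))) \<in> trig" unfolding sin_eq by (rule trig.add[OF trig.wave trig.wave])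
qed

lemma trig_scale: "f \<in> trig \<Longrightarrow> (\<lambda>z. c * f z) \<in> trig"
  using trig_mult[OF trig_const] by blast

text \<open>The Stone-Weierstrass theorem provides polynomials on the torus; in two plane waves as coordinates these are
  trigonometric polynomials.\<close>
lemma trig_polynomial:
  fixes p :: "complex \<times> complex \<Rightarrow> real"
  assumes "real_polynomial_function p"
  shows "(\<lambda>z. complex_of_real (p (cis (\<xi> \<bullet> z), cis (\<zeta> \<bullet> z)))) \<in> trig"
  using assms
proof induction
  case (linear h)
  interpret bounded_linear h by fact
  have heq: "h (u, v) = Re u * h (1, 0) + Im u * h (\<i>, 0) + Re v * h (0, 1) + Im v * h (0, \<i>)" for u v
  proof -
    have "(u, v) = Re u *\<^sub>R (1, 0) + Im u *\<^sub>R (\<i>, 0) + Re v *\<^sub>R (0, 1) + Im v *\<^sub>R (0, \<i>)"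
      by (simp add: complex_eq_iff)
    hence "h (u, v) = h (Re u *\<^sub>R (1, 0) + Im u *\<^sub>R (\<i>, 0) + Re v *\<^sub>R (0, 1) + Im v *\<^sub>R (0, \<i>))"
      by (rule arg_cong)
    also have "\<dots> = Re u * h (1, 0) + Im u * h (\<i>, 0) + Re v * h (0, 1) + Im v * h (0, \<i>)"
      unfolding add scaleR real_scaleR_def ..
    finally show ?thesis .
  qed
  have "(\<lambda>z. complex_of_real (h (cis (\<xi> \<bullet> z), cis (\<zeta> \<bullet> z)))) =
     (\<lambda>z. ((of_real (h (1, 0)) * of_real (cos (\<xi> \<bullet> z)) + of_real (h (\<i>, 0)) * of_real (sin (\<xi> \<bullet> z)))
         + of_real (h (0, 1)) * of_real (cos (\<zeta> \<bullet> z))) + of_real (h (0, \<i>)) * of_real (sin (\<zeta> \<bullet> z)))"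
    by (rule ext, subst heq) (simp add: mult.commute)
  also have "\<dots> \<in> trig" by (intro trig.add trig_scale trig_cos_sin)
  finally show ?case .
next
  case (const c)
  show ?case by (rule trig_const)
next
  case (add f g)
  thus ?case using trig.add by fastforce
next
  case (mult f g)
  thus ?case using trig_mult by fastforce
qed

text \<open>The square of half side \<open>2 * r\<close> is wrapped onto the torus by means of \<open>Arg\<close>.  The
  branch cut does no harm, because \<open>h\<close> vanishes on the outer half of the square, which is where
  \<open>Arg\<close> jumps.\<close>
lemma continuous_on_torus_lift:
  fixes h :: "complex \<Rightarrow> real"
  assumes cont: "continuous_on UNIV h" and r: "r > 0"
    and vanish: "\<And>z. r \<le> \<bar>Re z\<bar> \<or> r \<le> \<bar>Im z\<bar> \<Longrightarrow> h z = 0"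
  shows "continuous_on (sphere 0 1 \<times> sphere 0 1) (\<lambda>(u, v). h (Complex (2 * r / pi * Arg u) (2 * r / pi * Arg v)))"
proof -
  let ?H = "\<lambda>(u, v). h (Complex (2 * r / pi * Arg u) (2 * r / pi * Arg v))"
  define U1 where "U1 = (- \<real>\<^sub>\<le>\<^sub>0 :: complex set) \<times> (- \<real>\<^sub>\<le>\<^sub>0 :: complex set)"
  define U2 where "U2 = {z :: complex. Re z < 0} \<times> UNIV \<union> UNIV \<times> {z :: complex. Re z < 0}"
  have o1: "open U1" unfolding U1_def by (intro open_Times open_Compl closed_nonpos_Reals_complex)
  have o2: "open U2" unfolding U2_def by (intro open_Un open_Times open_halfspace_Re_lt open_UNIV)
  have "continuous_on (- \<real>\<^sub>\<le>\<^sub>0) Arg"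
    by (intro continuous_at_imp_continuous_on ballI continuous_at_Arg) auto
  hence A1: "continuous_on U1 (\<lambda>x. Arg (fst x))" and A2: "continuous_on U1 (\<lambda>x. Arg (snd x))"
    by (auto simp: U1_def intro!: continuous_on_compose2[where g = Arg] continuous_intros)
  have "continuous_on U1 (\<lambda>x. h (Complex (2 * r / pi * Arg (fst x)) (2 * r / pi * Arg (snd x))))"
    by (rule continuous_on_compose2[OF cont]) (auto simp: complex_eq intro!: continuous_intros A1 A2)
  hence c1: "continuous_on U1 ?H" by (simp add: case_prod_beta')
  have neg: "r \<le> \<bar>2 * r / pi * Arg z\<bar>" if "Re z < 0" for z
  proof -
    have "\<bar>Arg z\<bar> > pi / 2" using Arg_Re_nonneg[of z] that by linarith
    thus ?thesis using r by (simp add: abs_mult field_simps)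
  qed
  have "?H x = 0" if "x \<in> U2" for x
    using that neg by (auto simp: U2_def intro!: vanish)
  hence c2: "continuous_on U2 ?H" by (subst continuous_on_cong[OF refl, where g = "\<lambda>_. 0"]) auto
  have "sphere 0 1 \<times> sphere 0 1 \<subseteq> U1 \<union> U2"
    by (auto simp: U1_def U2_def elim!: nonpos_Reals_cases)
  with continuous_on_open_Un[OF o1 o2 c1 c2] show ?thesis by (rule continuous_on_subset)
qed

text \<open>The approximation is good on one period only, but being periodic it is bounded on the whole plane by the bound
  of \<open>h\<close> plus \<open>e\<close>.\<close>
lemma trig_approximation:
  fixes h :: "complex \<Rightarrow> real"
  assumes cont: "continuous_on UNIV h" and r: "r > 0" and e: "e > 0"
    and vanish: "\<And>z. r \<le> \<bar>Re z\<bar> \<or> r \<le> \<bar>Im z\<bar> \<Longrightarrow> h z = 0"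
    and bdd: "\<And>z. \<bar>h z\<bar> \<le> B"
  obtains t where "t \<in> trig" "\<And>z. norm (t z) \<le> B + e"
    "\<And>z. \<bar>Re z\<bar> < 2 * r \<Longrightarrow> \<bar>Im z\<bar> < 2 * r \<Longrightarrow> norm (of_real (h z) - t z) \<le> e"
proof -
  let ?H = "\<lambda>(u, v). h (Complex (2 * r / pi * Arg u) (2 * r / pi * Arg v))"
  have "compact (sphere (0::complex) 1 \<times> sphere (0::complex) 1)" by (intro compact_Times compact_sphere)
  then obtain p where p: "real_polynomial_function p"
      "\<And>x. x \<in> sphere 0 1 \<times> sphere 0 1 \<Longrightarrow> \<bar>?H x - p x\<bar> < e"
    using Stone_Weierstrass_real_polynomial_function[OF _ continuous_on_torus_lift[OF cont r vanish] e] by metis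
  define \<xi> where "\<xi> = complex_of_real (pi / (2 * r))"
  define \<zeta> where "\<zeta> = \<i> * complex_of_real (pi / (2 * r))"
  have in1: "\<xi> \<bullet> z = pi / (2 * r) * Re z" and in2: "\<zeta> \<bullet> z = pi / (2 * r) * Im z" for z
    by (simp_all add: \<xi>_def \<zeta>_def inner_complex_def)
  define t where "t = (\<lambda>z. complex_of_real (p (cis (\<xi> \<bullet> z), cis (\<zeta> \<bullet> z))))"
  have close: "\<bar>?H (cis (\<xi> \<bullet> z), cis (\<zeta> \<bullet> z)) - p (cis (\<xi> \<bullet> z), cis (\<zeta> \<bullet> z))\<bar> < e" for z
    by (rule p(2)) auto
  show ?thesis
  proof (rule that[of t])
    show "t \<in> trig" unfolding t_def by (rule trig_polynomial[OF p(1)])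
    fix z :: complex
    have "\<bar>?H (cis (\<xi> \<bullet> z), cis (\<zeta> \<bullet> z))\<bar> \<le> B" using bdd by simp
    thus "norm (t z) \<le> B + e" using close[of z] by (simp add: t_def)
    assume z: "\<bar>Re z\<bar> < 2 * r" "\<bar>Im z\<bar> < 2 * r"
    have A: "2 * r / pi * Arg (cis (pi / (2 * r) * x)) = x" if "\<bar>x\<bar> < 2 * r" for x
    proof -
      have "\<bar>pi / (2 * r) * x\<bar> = pi * (\<bar>x\<bar> / (2 * r))" using r by (simp add: abs_mult)
      also have "\<dots> < pi * 1" using that r by (intro mult_strict_left_mono) auto
      finally have "\<bar>pi / (2 * r) * x\<bar> < pi" by simp
      hence "pi / (2 * r) * x \<in> {-pi<..pi}" unfolding abs_less_iff greaterThanAtMost_iff by linarith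
      hence "Arg (cis (pi / (2 * r) * x)) = pi / (2 * r) * x" by (rule Arg_cis)
      thus ?thesis using r by simp
    qed
    have "?H (cis (\<xi> \<bullet> z), cis (\<zeta> \<bullet> z)) = h z" using A[OF z(1)] A[OF z(2)] by (simp add: in1 in2)
    moreover have "norm (of_real (h z) - t z) = \<bar>h z - p (cis (\<xi> \<bullet> z), cis (\<zeta> \<bullet> z))\<bar>"
      unfolding t_def of_real_diff[symmetric] by (rule norm_of_real)
    ultimately show "norm (of_real (h z) - t z) \<le> e" using close[of z] by simp
  qed
qed

lemma trig_continuous: "f \<in> trig \<Longrightarrow> continuous_on UNIV f"
  by (induction rule: trig.induct) (auto intro!: continuous_intros)

lemma trig_bounded: "f \<in> trig \<Longrightarrow> \<exists>B. \<forall>z. norm (f z) \<le> B"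
proof (induction rule: trig.induct)
  case (wave c \<xi>)
  show ?case by (intro exI[of _ "norm c"]) (simp add: norm_mult)
next
  case (add f g)
  then obtain B1 B2 where "\<forall>z. norm (f z) \<le> B1" "\<forall>z. norm (g z) \<le> B2" by blast
  thus ?case by (intro exI[of _ "B1 + B2"]) (meson add_mono norm_triangle_le)
qed

lemma trig_integrable:
  assumes "f \<in> trig" "prob_space \<nu>" "sets \<nu> = sets borel"
  shows "integrable \<nu> f"
proof -
  interpret prob_space \<nu> by fact
  obtain B where "\<forall>z. norm (f z) \<le> B" using trig_bounded[OF assms(1)] by blast
  moreover have "f \<in> borel_measurable \<nu>"
    using borel_measurable_continuous_onI[OF trig_continuous[OF assms(1)]] assms(3)
    by (simp cong: measurable_cong_sets)
  ultimately show ?thesis by (intro integrable_const_bound[of _ B]) auto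
qed

lemma trig_integral_converges:
  fixes \<mu> :: "nat \<Rightarrow> complex measure"
  assumes "f \<in> trig" "\<And>n. prob_space (\<mu> n)" "\<And>n. sets (\<mu> n) = sets borel"
    "prob_space \<nu>" "sets \<nu> = sets borel"
    "\<And>\<xi>. (\<lambda>n. \<integral>z. cis (\<xi> \<bullet> z) \<partial>\<mu> n) \<longlonglongrightarrow> (\<integral>z. cis (\<xi> \<bullet> z) \<partial>\<nu>)"
  shows "(\<lambda>n. \<integral>z. f z \<partial>\<mu> n) \<longlonglongrightarrow> (\<integral>z. f z \<partial>\<nu>)"
  using assms(1)
proof induction
  case (wave c \<xi>)
  show ?case using tendsto_mult_left[OF assms(6)[of \<xi>], of c] by simp
next
  case (add f g)
  have "(\<integral>z. f z + g z \<partial>\<mu>') = (\<integral>z. f z \<partial>\<mu>') + (\<integral>z. g z \<partial>\<mu>')" if "prob_space \<mu>'" "sets \<mu>' = sets borel" for \<mu>'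
    by (intro Bochner_Integration.integral_add trig_integrable add.hyps that)
  thus ?case using tendsto_add[OF add.IH] assms by simp
qed

text \<open>Inside the disc the two functions are close, outside it both are bounded and the measure is small.\<close>
lemma integral_approx_tight:
  fixes h :: "complex \<Rightarrow> real"
  assumes \<nu>: "prob_space \<nu>" "sets \<nu> = sets borel" and h: "continuous_on UNIV h" "\<And>z. \<bar>h z\<bar> \<le> B"
    and t: "t \<in> trig" "\<And>z. norm (t z) \<le> B + e" "\<And>z. norm z < r \<Longrightarrow> norm (of_real (h z) - t z) \<le> e"
    and tail: "measure \<nu> {z. r \<le> norm z} \<le> \<delta>" and e: "e > 0"
  shows "norm (of_real (\<integral>z. h z \<partial>\<nu>) - (\<integral>z. t z \<partial>\<nu>)) \<le> e + (2 * B + e) * \<delta>"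
proof -
  interpret prob_space \<nu> by fact
  have B: "B \<ge> 0" using h(2)[of 0] by linarith
  have hm: "h \<in> borel_measurable \<nu>"
    using borel_measurable_continuous_onI[OF h(1)] \<nu>(2) by (simp cong: measurable_cong_sets)
  have hi: "integrable \<nu> h" by (rule integrable_const_bound[of _ B]) (use h hm in auto)
  have ti: "integrable \<nu> t" by (rule trig_integrable[OF t(1) \<nu>])
  have meas: "{z. r \<le> norm z} \<in> sets \<nu>" unfolding \<nu>(2) by measurable
  have "of_real (\<integral>z. h z \<partial>\<nu>) - (\<integral>z. t z \<partial>\<nu>) = (\<integral>z. of_real (h z) - t z \<partial>\<nu>)"
    using hi ti by (simp add: Bochner_Integration.integral_diff)
  also have "norm \<dots> \<le> (\<integral>z. norm (of_real (h z) - t z) \<partial>\<nu>)" by (rule integral_norm_bound)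
  also have "\<dots> \<le> (\<integral>z. e + (2 * B + e) * indicator {z. r \<le> norm z} z \<partial>\<nu>)"
  proof (rule integral_mono)
    show "integrable \<nu> (\<lambda>z. norm (of_real (h z) - t z))" using hi ti by (intro integrable_norm Bochner_Integration.integrable_diff) auto
    show "integrable \<nu> (\<lambda>z. e + (2 * B + e) * indicator {z. r \<le> norm z} z)"
      using meas by (intro Bochner_Integration.integrable_add integrable_const integrable_mult_right integrable_real_indicator) (auto simp: emeasure_eq_measure)
    fix z
    show "norm (of_real (h z) - t z) \<le> e + (2 * B + e) * indicator {z. r \<le> norm z} z"
    proof (cases "norm z < r")
      case True
      thus ?thesis using t(3)[OF True] by simp
    next
      case False
      have "norm (of_real (h z) - t z) \<le> \<bar>h z\<bar> + norm (t z)" using norm_triangle_ineq4[of "complex_of_real (h z)" "t z"] by simp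
      thus ?thesis using False t(2)[of z] h(2)[of z] e by simp
    qed
  qed
  also have "\<dots> = e + (2 * B + e) * measure \<nu> {z. r \<le> norm z}"
    using meas by (subst Bochner_Integration.integral_add) (auto simp: prob_space emeasure_eq_measure)
  also have "\<dots> \<le> e + (2 * B + e) * \<delta>" using tail B e by (intro add_left_mono mult_left_mono) auto
  finally show ?thesis .
qed

text \<open>The continuity theorem in the plane, for a tight sequence.  A bounded continuous function is cut off outside a
  large disc, where all measures are small, and then replaced by a trigonometric polynomial, for which the
  convergence is the assumption.\<close>
lemma weak_convergence_of_characteristic_functions:
  fixes \<mu> :: "nat \<Rightarrow> complex measure" and h :: "complex \<Rightarrow> real"
  assumes \<mu>: "\<And>n. prob_space (\<mu> n)" "\<And>n. sets (\<mu> n) = sets borel"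
    and \<nu>: "prob_space \<nu>" "sets \<nu> = sets borel"
    and char: "\<And>\<xi>. (\<lambda>n. \<integral>z. cis (\<xi> \<bullet> z) \<partial>\<mu> n) \<longlonglongrightarrow> (\<integral>z. cis (\<xi> \<bullet> z) \<partial>\<nu>)"
    and tight: "\<And>\<delta>. \<delta> > 0 \<Longrightarrow> \<exists>r. \<forall>n. measure (\<mu> n) {z. r \<le> norm z} \<le> \<delta>"
    and h: "continuous_on UNIV h" "bounded (range h)"
  shows "(\<lambda>n. \<integral>z. h z \<partial>\<mu> n) \<longlonglongrightarrow> (\<integral>z. h z \<partial>\<nu>)"
proof (rule LIMSEQ_I)
  fix \<epsilon> :: real assume \<epsilon>: "\<epsilon> > 0"
  interpret N: prob_space \<nu> by fact
  obtain B where B: "B > 0" "\<And>z. \<bar>h z\<bar> \<le> B" using h(2) by (auto simp: bounded_pos)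
  define e where "e = min 1 (\<epsilon> / 8)"
  define \<delta> where "\<delta> = \<epsilon> / (8 * (2 * B + 1))"
  have e: "e > 0" "e \<le> 1" "e \<le> \<epsilon> / 8" using \<epsilon> by (auto simp: e_def)
  have \<delta>: "\<delta> > 0" using \<epsilon> B by (simp add: \<delta>_def)
  obtain r1 where r1: "\<And>n. measure (\<mu> n) {z. r1 \<le> norm z} \<le> \<delta>" using tight[OF \<delta>] by blast
  have "(\<lambda>k::nat. measure \<nu> {z. real k \<le> norm z}) \<longlonglongrightarrow> measure \<nu> (\<Inter>k::nat. {z. real k \<le> norm z})"
  proof (rule N.finite_Lim_measure_decseq)
    show "range (\<lambda>k::nat. {z. real k \<le> norm z}) \<subseteq> sets \<nu>" unfolding \<nu>(2) by auto
    show "decseq (\<lambda>k::nat. {z::complex. real k \<le> norm z})" by (auto simp: decseq_def)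
  qed
  moreover have "(\<Inter>k::nat. {z::complex. real k \<le> norm z}) = {}"
  proof -
    have "z \<notin> (\<Inter>k::nat. {z::complex. real k \<le> norm z})" for z
      using reals_Archimedean2[of "norm z"] by (auto simp: not_le)
    thus ?thesis by blast
  qed
  ultimately have "(\<lambda>k::nat. measure \<nu> {z. real k \<le> norm z}) \<longlonglongrightarrow> 0" by simp
  from LIMSEQ_D[OF this \<delta>] obtain k where "norm (measure \<nu> {z. real k \<le> norm z} - 0) < \<delta>" by blast
  hence k: "measure \<nu> {z. real k \<le> norm z} \<le> \<delta>" by simp
  define r where "r = max 1 (max r1 (real k))"
  have mono: "measure \<nu>' {z. r \<le> norm z} \<le> \<delta>" if "prob_space \<nu>'" "sets \<nu>' = sets borel" "measure \<nu>' {z. s \<le> norm z} \<le> \<delta>" "s \<le> r" for \<nu>' :: "complex measure" and s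
  proof -
    interpret P: prob_space \<nu>' by fact
    have "measure \<nu>' {z. r \<le> norm z} \<le> measure \<nu>' {z. s \<le> norm z}"
      by (rule P.finite_measure_mono) (use that in auto)
    thus ?thesis using that by linarith
  qed
  have tail: "measure (\<mu> n) {z. r \<le> norm z} \<le> \<delta>" for n by (rule mono[OF \<mu> r1]) (simp add: r_def)
  have tail': "measure \<nu> {z. r \<le> norm z} \<le> \<delta>" by (rule mono[OF \<nu> k]) (simp add: r_def)
  have r: "r > 0" by (simp add: r_def)
  (* Cut-off function: 1 on the disc of radius r and 0 outside the disc of radius 2 r. *)
  define \<kappa> where "\<kappa> = (\<lambda>z::complex. max 0 (min 1 (2 - norm z / r)))"
  have \<kappa>: "0 \<le> \<kappa> z" "\<kappa> z \<le> 1" for z by (auto simp: \<kappa>_def)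
  define h1 where "h1 = (\<lambda>z. h z * \<kappa> z)"
  have h1c: "continuous_on UNIV h1" unfolding h1_def \<kappa>_def by (intro continuous_intros h) (use r in auto)
  have h1b: "\<bar>h1 z\<bar> \<le> B" for z
    using mult_mono[OF B(2)[of z] \<kappa>(2)[of z]] B \<kappa>(1)[of z] by (simp add: h1_def abs_mult)
  have h1v: "h1 z = 0" if "2 * r \<le> \<bar>Re z\<bar> \<or> 2 * r \<le> \<bar>Im z\<bar>" for z
  proof -
    have "2 * r \<le> norm z" using that abs_Re_le_cmod[of z] abs_Im_le_cmod[of z] by linarith
    hence "\<kappa> z = 0" using r by (simp add: \<kappa>_def field_simps)
    thus ?thesis by (simp add: h1_def)
  qed
  obtain t where t: "t \<in> trig" "\<And>z. norm (t z) \<le> B + e"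
    "\<And>z. \<bar>Re z\<bar> < 2 * (2 * r) \<Longrightarrow> \<bar>Im z\<bar> < 2 * (2 * r) \<Longrightarrow> norm (of_real (h1 z) - t z) \<le> e"
    using trig_approximation[OF h1c _ e(1) h1v h1b] r by (metis mult_pos_pos zero_less_numeral)
  have t3: "norm (of_real (h z) - t z) \<le> e" if "norm z < r" for z
  proof -
    have "\<kappa> z = 1" using that r by (simp add: \<kappa>_def field_simps)
    moreover have "norm (of_real (h1 z) - t z) \<le> e"
      using that r abs_Re_le_cmod[of z] abs_Im_le_cmod[of z] by (intro t(3)) linarith+
    ultimately show ?thesis by (simp add: h1_def)
  qed
  have bound: "e + (2 * B + e) * \<delta> \<le> \<epsilon> / 4"
  proof -
    have "(2 * B + e) * \<delta> \<le> (2 * B + 1) * \<delta>" using e \<delta> by (intro mult_right_mono) auto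
    also have "\<dots> = \<epsilon> / 8" using B(1) by (simp add: \<delta>_def field_simps)
    finally show ?thesis using e by linarith
  qed
  have an: "norm (of_real (\<integral>z. h z \<partial>\<mu> n) - (\<integral>z. t z \<partial>\<mu> n)) \<le> \<epsilon> / 4" for n
    using integral_approx_tight[OF \<mu> h(1) B(2) t(1,2) t3 tail e(1)] bound by (meson order_trans)
  have a: "norm (of_real (\<integral>z. h z \<partial>\<nu>) - (\<integral>z. t z \<partial>\<nu>)) \<le> \<epsilon> / 4"
    using integral_approx_tight[OF \<nu> h(1) B(2) t(1,2) t3 tail' e(1)] bound by (meson order_trans)
  have "(\<lambda>n. \<integral>z. t z \<partial>\<mu> n) \<longlonglongrightarrow> (\<integral>z. t z \<partial>\<nu>)" by (rule trig_integral_converges[OF t(1) \<mu> \<nu> char])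
  from LIMSEQ_D[OF this, of "\<epsilon> / 4"] \<epsilon> obtain N where N: "\<And>n. n \<ge> N \<Longrightarrow> norm ((\<integral>z. t z \<partial>\<mu> n) - (\<integral>z. t z \<partial>\<nu>)) < \<epsilon> / 4" by auto
  have "norm ((\<integral>z. h z \<partial>\<mu> n) - (\<integral>z. h z \<partial>\<nu>)) < \<epsilon>" if "n \<ge> N" for n
  proof -
    have "norm ((\<integral>z. h z \<partial>\<mu> n) - (\<integral>z. h z \<partial>\<nu>)) = norm (complex_of_real (\<integral>z. h z \<partial>\<mu> n) - of_real (\<integral>z. h z \<partial>\<nu>))"
      by (metis norm_of_real of_real_diff real_norm_def)
    also have "complex_of_real (\<integral>z. h z \<partial>\<mu> n) - of_real (\<integral>z. h z \<partial>\<nu>) =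
       (of_real (\<integral>z. h z \<partial>\<mu> n) - (\<integral>z. t z \<partial>\<mu> n)) + (((\<integral>z. t z \<partial>\<mu> n) - (\<integral>z. t z \<partial>\<nu>)) - (of_real (\<integral>z. h z \<partial>\<nu>) - (\<integral>z. t z \<partial>\<nu>)))" by simp
    also have "norm \<dots> \<le> \<epsilon> / 4 + (norm ((\<integral>z. t z \<partial>\<mu> n) - (\<integral>z. t z \<partial>\<nu>)) + \<epsilon> / 4)"
    proof -
      have tri: "norm (x + (y - w)) \<le> norm x + (norm y + norm w)" for x y w :: complex
        using norm_triangle_ineq[of x "y - w"] norm_triangle_ineq4[of y w] by linarith
      show ?thesis by (rule order_trans[OF tri]) (use an[of n] a in linarith)
    qed
    also have "\<dots> < \<epsilon>" using N[OF that] \<epsilon> by simp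
    finally show ?thesis .
  qed
  thus "\<exists>no. \<forall>n\<ge>no. norm ((\<integral>z. h z \<partial>\<mu> n) - (\<integral>z. h z \<partial>\<nu>)) < \<epsilon>" by blast
qed

lemma char_normal:
  assumes "\<sigma> > 0"
  shows "(\<integral>x. cis (t * x) \<partial>density lborel (normal_density 0 \<sigma>)) = of_real (exp (- (\<sigma> * t)\<^sup>2 / 2))"
proof -
  have "(\<integral>x. cis (t * x) \<partial>density lborel (normal_density 0 \<sigma>)) = (\<integral>x. normal_density 0 \<sigma> x *\<^sub>R cis (t * x) \<partial>lborel)"
    by (subst integral_density) (auto simp: normal_density_nonneg cis_conv_exp)
  also have "\<dots> = \<bar>\<sigma>\<bar> *\<^sub>R (\<integral>x. normal_density 0 \<sigma> (0 + \<sigma> * x) *\<^sub>R cis (t * (0 + \<sigma> * x)) \<partial>lborel)"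
    using assms by (intro lborel_integral_real_affine) auto
  also have "\<dots> = (\<integral>x. \<sigma> *\<^sub>R (normal_density 0 \<sigma> (\<sigma> * x) *\<^sub>R cis (t * (\<sigma> * x))) \<partial>lborel)"
    using assms by (subst integral_scaleR_right) simp
  also have "\<dots> = (\<integral>x. std_normal_density x *\<^sub>R cis ((\<sigma> * t) * x) \<partial>lborel)"
  proof (rule Bochner_Integration.integral_cong[OF refl])
    fix x
    have "\<sigma> * normal_density 0 \<sigma> (\<sigma> * x) = std_normal_density x"
      using assms by (simp add: normal_density_def real_sqrt_mult power_mult_distrib)
    thus "\<sigma> *\<^sub>R (normal_density 0 \<sigma> (\<sigma> * x) *\<^sub>R cis (t * (\<sigma> * x))) = std_normal_density x *\<^sub>R cis ((\<sigma> * t) * x)"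
      by (simp add: mult_ac)
  qed
  also have "\<dots> = char std_normal_distribution (\<sigma> * t)"
    unfolding char_def by (subst integral_density) (auto simp: normal_density_nonneg cis_conv_exp)
  finally show ?thesis by (simp add: char_std_normal_distribution)
qed

lemma char_complex_std_normal:
  "(\<integral>z. cis (\<xi> \<bullet> z) \<partial>complex_std_normal) = of_real (exp (- (norm \<xi>)\<^sup>2 / 4))"
proof -
  let ?D = "density lborel (\<lambda>x. ennreal (normal_density 0 (sqrt (1/2)) x))"
  interpret D: prob_space ?D by (rule prob_space_normal_density) simp
  interpret P: pair_prob_space ?D ?D ..
  have m: "(\<lambda>(x, y). Complex x y) \<in> borel_measurable (borel \<Otimes>\<^sub>M borel)"
    unfolding borel_prod complex_eq case_prod_beta
    by (intro borel_measurable_continuous_onI continuous_intros)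
  have s: "sets (?D \<Otimes>\<^sub>M ?D) = sets (borel \<Otimes>\<^sub>M borel)" by (intro sets_pair_measure_cong) auto
  have m': "(\<lambda>(x, y). Complex x y) \<in> borel_measurable (?D \<Otimes>\<^sub>M ?D)" using m s by (simp cong: measurable_cong_sets)
  have cm: "(\<lambda>x. cis (t * x)) \<in> borel_measurable borel" for t
    by (intro borel_measurable_continuous_onI continuous_intros)
  have ci: "(\<lambda>z. cis (\<xi> \<bullet> z)) \<in> borel_measurable borel"
    by (intro borel_measurable_continuous_onI continuous_intros)
  have int1: "integrable ?D (\<lambda>x. cis (t * x))" for t
    by (rule D.integrable_const_bound[of _ 1]) (use cm in auto)
  have "(\<integral>z. cis (\<xi> \<bullet> z) \<partial>complex_std_normal) = (\<integral>p. cis (\<xi> \<bullet> (case p of (x, y) \<Rightarrow> Complex x y)) \<partial>(?D \<Otimes>\<^sub>M ?D))"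
    unfolding complex_std_normal_def by (rule integral_distr[OF m' ci])
  also have "\<dots> = (\<integral>p. cis (Re \<xi> * fst p) * cis (Im \<xi> * snd p) \<partial>(?D \<Otimes>\<^sub>M ?D))"
    by (intro Bochner_Integration.integral_cong) (auto simp: inner_complex_def cis_mult)
  also have "\<dots> = (\<integral>x. (\<integral>y. cis (Re \<xi> * x) * cis (Im \<xi> * y) \<partial>?D) \<partial>?D)"
  proof (subst P.integral_fst'[symmetric])
    show "integrable (?D \<Otimes>\<^sub>M ?D) (\<lambda>p. cis (Re \<xi> * fst p) * cis (Im \<xi> * snd p))"
    proof (rule P.integrable_const_bound[of _ 1])
      have "(\<lambda>p. cis (Re \<xi> * fst p) * cis (Im \<xi> * snd p)) \<in> borel_measurable (borel \<Otimes>\<^sub>M borel)"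
        unfolding borel_prod by (intro borel_measurable_continuous_onI continuous_intros)
      thus "(\<lambda>p. cis (Re \<xi> * fst p) * cis (Im \<xi> * snd p)) \<in> borel_measurable (?D \<Otimes>\<^sub>M ?D)"
        using s by (simp cong: measurable_cong_sets)
    qed (simp add: norm_mult)
  qed simp
  also have "\<dots> = (\<integral>x. cis (Re \<xi> * x) \<partial>?D) * (\<integral>y. cis (Im \<xi> * y) \<partial>?D)" by simp
  also have "\<dots> = of_real (exp (- (sqrt (1/2) * Re \<xi>)\<^sup>2 / 2)) * of_real (exp (- (sqrt (1/2) * Im \<xi>)\<^sup>2 / 2))"
    by (subst (1 2) char_normal) simp_all
  also have "\<dots> = of_real (exp (- (norm \<xi>)\<^sup>2 / 4))"
    unfolding of_real_mult[symmetric] mult_exp_exp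
    by (simp add: power_mult_distrib cmod_power2 field_simps)
  finally show ?thesis .
qed

section \<open>Elementary estimates for primes and smooth numbers\<close>

lemma prod_primes_dvd:
  fixes n :: nat
  assumes "finite P" "\<And>p. p \<in> P \<Longrightarrow> prime p \<and> p dvd n"
  shows "\<Prod>P dvd n"
  using assms
proof (induction P)
  case (insert p P)
  have "coprime p (\<Prod>P)"
    using insert by (intro prod_coprime_right primes_coprime) auto
  thus ?case using insert by (auto intro: divides_mult)
qed simp

text \<open>The argument of Erdos: for odd \<open>n = 2 * m + 1\<close>, all primes in \<open>(m + 1, n]\<close> divide a
  binomial coefficient that is at most \<open>4 ^ m\<close>.\<close>
lemma primorial_le: "\<Prod>{p::nat. prime p \<and> p \<le> n} \<le> 4 ^ n"
proof (induction n rule: less_induct)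
  case (less n)
  have fin: "finite {p::nat. prime p \<and> p \<le> n}" for n by simp
  consider "n \<le> 1" | "n = 2" | "n > 2" "even n" | m where "m \<ge> 1" "n = 2 * m + 1"
  proof (cases "even n")
    case True
    consider "n \<le> 1" | "n = 2" | "n > 2" by linarith
    thus ?thesis by cases (use True that(1-3) in blast)+
  next
    case False
    then obtain m where "n = 2 * m + 1" by (rule oddE)
    show ?thesis
    proof (cases "m = 0")
      case True
      thus ?thesis using \<open>n = 2 * m + 1\<close> by (intro that(1)) simp
    next
      case False
      thus ?thesis using \<open>n = 2 * m + 1\<close> by (intro that(4)) simp_all
    qed
  qed
  thus ?case
  proof cases
    case 1
    hence empty: "{p::nat. prime p \<and> p \<le> n} = {}" by (auto dest!: prime_gt_1_nat)
    show ?thesis unfolding empty by simp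
  next
    case 2
    have "{p::nat. prime p \<and> p \<le> 2} = {2}" by (auto dest: prime_ge_2_nat)
    thus ?thesis unfolding 2 by simp
  next
    case 3
    have "\<not> prime n" using 3 prime_odd_nat by auto
    hence "{p::nat. prime p \<and> p \<le> n} = {p. prime p \<and> p \<le> n - 1}"
      using 3 by (auto simp: le_less)
    also have "\<Prod>\<dots> \<le> 4 ^ (n - 1)" by (rule less) (use 3 in auto)
    also have "(4::nat) ^ (n - 1) \<le> 4 ^ n" by (intro power_increasing) auto
    finally show ?thesis .
  next
    case (4 m)
    define Q where "Q = {p::nat. prime p \<and> m + 1 < p \<and> p \<le> n}"
    have eq: "{p::nat. prime p \<and> p \<le> n} = {p. prime p \<and> p \<le> m + 1} \<union> Q" using 4 by (auto simp: Q_def)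
    have finQ: "finite Q" by (simp add: Q_def)
    have "\<Prod>{p::nat. prime p \<and> p \<le> n} = \<Prod>{p. prime p \<and> p \<le> m + 1} * \<Prod>Q"
      unfolding eq by (rule prod.union_disjoint) (auto simp: Q_def)
    also have "\<dots> \<le> 4 ^ (m + 1) * 4 ^ m"
    proof (rule mult_mono)
      show "\<Prod>{p::nat. prime p \<and> p \<le> m + 1} \<le> 4 ^ (m + 1)" by (rule less) (use 4 in auto)
      have "\<Prod>Q dvd (2 * m + 1 choose m)"
      proof (rule prod_primes_dvd[OF finQ])
        fix p assume p: "p \<in> Q"
        hence pp: "prime p" "m + 1 < p" "p \<le> 2 * m + 1" using 4 by (auto simp: Q_def)
        have "p dvd fact (2 * m + 1)" using pp prime_dvd_fact_iff[of p "2 * m + 1"] by simp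
        also have "fact (2 * m + 1) = fact m * fact (m + 1) * (2 * m + 1 choose m)"
          using binomial_fact_lemma[of m "2 * m + 1"] by simp
        finally have "p dvd fact m \<or> p dvd fact (m + 1) \<or> p dvd (2 * m + 1 choose m)"
          using pp(1) by (metis prime_dvd_mult_iff)
        thus "prime p \<and> p dvd (2 * m + 1 choose m)" using pp by (auto simp: prime_dvd_fact_iff simp del: fact_Suc)
      qed
      hence "\<Prod>Q \<le> (2 * m + 1 choose m)" by (rule dvd_imp_le) simp
      also have "\<dots> \<le> 4 ^ m"
      proof -
        have "2 * (2 * m + 1 choose m) = (2 * m + 1 choose m) + (2 * m + 1 choose (m + 1))"
          using binomial_symmetric[of m "2 * m + 1"] by simp
        also have "\<dots> = (\<Sum>k\<in>{m, m + 1}. (2 * m + 1 choose k))" by simp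
        also have "\<dots> \<le> (\<Sum>k\<le>2 * m + 1. (2 * m + 1 choose k))" by (rule sum_mono2) auto
        also have "\<dots> = 2 ^ (2 * m + 1)" by (rule choose_row_sum)
        also have "\<dots> = 2 * 4 ^ m" by (simp add: power_mult)
        finally show ?thesis by simp
      qed
      finally show "\<Prod>Q \<le> 4 ^ m" .
    qed auto
    also have "\<dots> = 4 ^ n" using 4 by (simp add: power_add[symmetric] mult_2)
    finally show ?thesis .
  qed
qed

lemma chebyshev_theta_le: "(\<Sum>p\<in>{p. prime p \<and> p \<le> n}. ln (real p)) \<le> real n * ln 4"
proof -
  have "(\<Sum>p\<in>{p. prime p \<and> p \<le> n}. ln (real p)) = ln (\<Prod>p\<in>{p. prime p \<and> p \<le> n}. real p)"
    by (rule ln_prod[symmetric]) (auto simp: prime_gt_0_nat)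
  also have "(\<Prod>p\<in>{p. prime p \<and> p \<le> n}. real p) = real (\<Prod>{p. prime p \<and> p \<le> n})" by simp
  also have "ln \<dots> \<le> ln (real (4 ^ n))"
  proof (subst ln_le_cancel_iff)
    have "0 < \<Prod>{p. prime p \<and> p \<le> n}" by (rule prod_pos) (auto simp: prime_gt_0_nat)
    thus "0 < real (\<Prod>{p. prime p \<and> p \<le> n})" by (simp only: of_nat_0_less_iff)
    show "real (\<Prod>{p. prime p \<and> p \<le> n}) \<le> real (4 ^ n)" using primorial_le[of n] by (simp only: of_nat_le_iff)
  qed simp
  also have "\<dots> = real n * ln 4" by (simp add: ln_realpow)
  finally show ?thesis .
qed

lemma ln_4_le: "ln 4 \<le> (3/2 :: real)"
proof -
  have "ln (4::real) \<le> 2 * ln 2" using ln_realpow[of 2 2] by simp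
  thus ?thesis using ln2_le_25_over_36 by linarith
qed

text \<open>From \<open>chebyshev_theta_le\<close>: the primes above \<open>sqrt n\<close> have \<open>ln p \<ge> ln n /
  2\<close>, and there are few others.\<close>
lemma chebyshev_prime_count:
  assumes "n \<ge> 2"
  shows "real (card {p. prime p \<and> p \<le> n}) * ln (real n) \<le> 5 * real n"
proof -
  define s where "s = sqrt (real n)"
  have s: "s \<ge> 1" "s * s = real n" using assms by (auto simp: s_def)
  have lnn: "ln (real n) = 2 * ln s" using s by (metis ln_mult mult_2 not_one_le_zero order_less_le zero_less_one order_less_le_trans)
  have lns: "0 \<le> ln s" "ln s \<le> s" using s ln_le_minus_one[of s] by auto
  define P where "P = {p. prime p \<and> p \<le> n}"
  have P: "finite P" by (simp add: P_def)
  have "real (card P) * ln s = (\<Sum>p\<in>P. ln s)" by simp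
  also have "\<dots> \<le> (\<Sum>p\<in>P. ln (real p) + (if real p \<le> s then ln s else 0))"
    using s lns by (intro sum_mono) (auto simp: P_def not_le Suc_le_eq dest: prime_gt_0_nat)
  also have "\<dots> = (\<Sum>p\<in>P. ln (real p)) + real (card {p\<in>P. real p \<le> s}) * ln s"
    using P by (simp add: sum.distrib sum.If_cases Int_def)
  also have "\<dots> \<le> real n * ln 4 + s * s"
  proof (intro add_mono mult_mono)
    show "(\<Sum>p\<in>P. ln (real p)) \<le> real n * ln 4" unfolding P_def by (rule chebyshev_theta_le)
    have "{p\<in>P. real p \<le> s} \<subseteq> {1..nat \<lfloor>s\<rfloor>}" by (auto simp: P_def le_nat_floor Suc_le_eq dest: prime_gt_0_nat)
    hence "card {p\<in>P. real p \<le> s} \<le> card {1..nat \<lfloor>s\<rfloor>}" by (rule card_mono[rotated]) simp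
    hence "card {p\<in>P. real p \<le> s} \<le> nat \<lfloor>s\<rfloor>" by simp
    thus "real (card {p\<in>P. real p \<le> s}) \<le> s" using s by linarith
  qed (use lns s in auto)
  also have "\<dots> \<le> real n * (3/2) + real n" using ln_4_le s by (intro add_mono mult_left_mono) auto
  finally show ?thesis unfolding lnn P_def by simp
qed

text \<open>Count the sum of \<open>ln p\<close> over \<open>p dvd m \<le> n\<close> in two ways.  Replacing the number of
  multiples of \<open>p\<close> by \<open>n / p - 1\<close> costs \<open>chebyshev_theta_le\<close>.\<close>
lemma mertens_upper: "(\<Sum>p\<in>{p. prime p \<and> p \<le> n}. ln (real p) / real p) \<le> ln (real n) + ln 4"
proof (cases "n = 0")
  case False
  define P where "P = {p. prime p \<and> p \<le> n}"
  have P: "finite P" by (simp add: P_def)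
  have "(\<Sum>p\<in>P. ln (real p) * (real n / real p - 1)) \<le> (\<Sum>p\<in>P. ln (real p) * real (card {m\<in>{1..n}. p dvd m}))"
  proof (intro sum_mono mult_left_mono)
    fix p assume p: "p \<in> P"
    hence pp: "p \<ge> 1" by (auto simp: P_def prime_gt_0_nat Suc_le_eq)
    thus "0 \<le> ln (real p)" by simp
    have "n < (n div p + 1) * p" using pp by (metis add.commute dividend_less_times_div mult.commute mult_Suc plus_1_eq_Suc less_le_trans zero_less_one)
    hence "real n < (real (n div p) + 1) * real p" by (metis of_nat_1 of_nat_add of_nat_less_iff of_nat_mult)
    hence "real n / real p < real (n div p) + 1" using pp by (simp add: pos_divide_less_eq)
    hence "real n / real p - 1 \<le> real (n div p)" by linarith
    also have "n div p = card ((\<lambda>k. p * k) ` {1..n div p})" using pp by (subst card_image) (auto simp: inj_on_def)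
    also have "\<dots> \<le> card {m\<in>{1..n}. p dvd m}"
    proof (rule card_mono)
      show "(\<lambda>k. p * k) ` {1..n div p} \<subseteq> {m\<in>{1..n}. p dvd m}"
        using pp by (auto simp: Suc_le_eq less_eq_div_iff_mult_less_eq mult.commute)
    qed simp
    finally show "real n / real p - 1 \<le> real (card {m\<in>{1..n}. p dvd m})" by simp
  qed
  also have "\<dots> = (\<Sum>p\<in>P. \<Sum>m\<in>{1..n}. if p dvd m then ln (real p) else 0)"
    by (intro sum.cong refl) (simp add: sum.If_cases Int_def mult.commute)
  also have "\<dots> = (\<Sum>m\<in>{1..n}. \<Sum>p\<in>P. if p dvd m then ln (real p) else 0)" by (rule sum.swap)
  also have "\<dots> \<le> (\<Sum>m\<in>{1..n}. ln (real n))"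
  proof (rule sum_mono)
    fix m assume m: "m \<in> {1..n}"
    have "(\<Sum>p\<in>P. if p dvd m then ln (real p) else 0) = (\<Sum>p\<in>{p\<in>P. p dvd m}. ln (real p))"
      using P by (simp add: sum.If_cases Int_def)
    also have "\<dots> = ln (\<Prod>p\<in>{p\<in>P. p dvd m}. real p)"
      by (rule ln_prod[symmetric]) (use P in \<open>auto simp: P_def prime_gt_0_nat\<close>)
    also have "(\<Prod>p\<in>{p\<in>P. p dvd m}. real p) = real (\<Prod>{p\<in>P. p dvd m})" by simp
    also have "ln \<dots> \<le> ln (real n)"
    proof (subst ln_le_cancel_iff)
      have "0 < \<Prod>{p\<in>P. p dvd m}" by (rule prod_pos) (auto simp: P_def prime_gt_0_nat)
      thus "0 < real (\<Prod>{p\<in>P. p dvd m})" by (simp only: of_nat_0_less_iff)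
      have "\<Prod>{p\<in>P. p dvd m} dvd m" by (rule prod_primes_dvd) (use P in \<open>auto simp: P_def\<close>)
      hence "\<Prod>{p\<in>P. p dvd m} \<le> n" using m dvd_imp_le[of _ m] by fastforce
      thus "real (\<Prod>{p\<in>P. p dvd m}) \<le> real n" by (simp only: of_nat_le_iff)
    qed (use False in simp)
    finally show "(\<Sum>p\<in>P. if p dvd m then ln (real p) else 0) \<le> ln (real n)" .
  qed
  also have "\<dots> = real n * ln (real n)" by simp
  finally have "real n * (\<Sum>p\<in>P. ln (real p) / real p) - (\<Sum>p\<in>P. ln (real p)) \<le> real n * ln (real n)"
    by (simp add: right_diff_distrib sum_subtractf sum_distrib_left mult_ac)
  hence "real n * (\<Sum>p\<in>P. ln (real p) / real p) \<le> real n * (ln (real n) + ln 4)"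
    using chebyshev_theta_le[of n] unfolding P_def[symmetric] by (simp add: distrib_left)
  thus ?thesis using False unfolding P_def[symmetric] by simp
qed simp

lemma sum_reciprocal_le: "n \<ge> 1 \<Longrightarrow> (\<Sum>k\<in>{1..n}. 1 / real k) \<le> 1 + ln (real n)"
  using euler_mascheroni_sequence_decreasing[of 1 n] by (simp add: harm_def divide_inverse)

lemma geometric_tail:
  fixes p :: real
  assumes "p \<ge> 2"
  shows "(\<Sum>k\<in>{1..K::nat}. 1 / p ^ k) \<le> 2 / p"
proof -
  have "(\<Sum>k\<in>{1..K}. 1 / p ^ k) \<le> 2 / p - 1 / p ^ K * (1 / (p - 1))" if "K \<ge> 1"
    using that
  proof (induction K rule: dec_induct)
    case base
    have "1 / p + 1 / p * (1 / (p - 1)) = 1 / (p - 1)" using assms by (simp add: field_simps)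
    also have "\<dots> \<le> 2 / p" using assms by (simp add: field_simps)
    finally show ?case by simp
  next
    case (step K)
    have "1 / p ^ Suc K + 1 / p ^ Suc K * (1 / (p - 1)) = 1 / p ^ K * (1 / (p - 1))" using assms by (simp add: field_simps)
    thus ?case using step by simp
  qed
  moreover have "0 \<le> 1 / p ^ K * (1 / (p - 1))" using assms by simp
  ultimately show ?thesis using assms by (cases "K \<ge> 1") (auto simp: not_le intro: order_trans)
qed

lemma card_multiples_le: "d \<ge> 1 \<Longrightarrow> real (card {n\<in>{1..N}. d dvd n}) \<le> real N / real d"
proof -
  assume d: "d \<ge> 1"
  have "{n\<in>{1..N}. d dvd n} \<subseteq> (\<lambda>k. d * k) ` {1..N div d}"
  proof
    fix n assume "n \<in> {n\<in>{1..N}. d dvd n}"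
    then obtain k where "n = d * k" "1 \<le> n" "n \<le> N" by auto
    moreover from this have "k \<ge> 1" "k \<le> N div d" using d
      by (auto simp: less_eq_div_iff_mult_less_eq mult.commute Suc_le_eq)
    ultimately show "n \<in> (\<lambda>k. d * k) ` {1..N div d}" by auto
  qed
  hence "card {n\<in>{1..N}. d dvd n} \<le> card {1..N div d}" by (meson card_image_le card_mono finite_atLeastAtMost finite_imageI order_trans)
  hence "real (card {n\<in>{1..N}. d dvd n}) \<le> real (N div d)" by simp
  also have "\<dots> \<le> real N / real d" by (rule of_nat_div_le_of_nat)
  finally show ?thesis .
qed

text \<open>Decomposing \<open>ln n\<close> over prime powers shows that the sum of \<open>ln n\<close> over the
  \<open>z\<close>-smooth \<open>n \<le> N\<close> is \<open>O(N * ln z)\<close>.  Each such \<open>n\<close>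
  above \<open>sqrt N\<close> contributes at least \<open>ln N / 2\<close>.\<close>
lemma smooth_count:
  assumes N: "N \<ge> 2" and z: "z \<ge> 1"
  shows "real (card {n\<in>{1..N}. \<forall>p\<in>prime_factors n. p \<le> z}) \<le> sqrt (real N) + 4 * real N * (ln (real z) + ln 4) / ln (real N)"
proof -
  define S where "S = {n\<in>{1..N}. \<forall>p\<in>prime_factors n. p \<le> z}"
  define P where "P = {p. prime p \<and> p \<le> z}"
  have P: "finite P" by (simp add: P_def)
  have S: "finite S" by (simp add: S_def)
  have lnN: "ln (real N) > 0" using N by simp
  have ln_n: "ln (real n) = (\<Sum>p\<in>P. \<Sum>k\<in>{1..N}. if p ^ k dvd n then ln (real p) else 0)" if n: "n \<in> S" for n
  proof -
    have n': "1 \<le> n" "n \<le> N" "prime_factors n \<subseteq> P" using n by (auto simp: S_def P_def)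
    have "real n = real (\<Prod>p\<in>prime_factors n. p ^ multiplicity p n)"
      using n' prime_factorization_nat[of n] by simp
    also have "\<dots> = (\<Prod>p\<in>prime_factors n. real p ^ multiplicity p n)" by simp
    also have "ln \<dots> = (\<Sum>p\<in>prime_factors n. ln (real p ^ multiplicity p n))"
      by (rule ln_prod) (auto intro!: prime_gt_0_nat zero_less_power dest: in_prime_factors_imp_prime)
    also have "\<dots> = (\<Sum>p\<in>prime_factors n. real (multiplicity p n) * ln (real p))"
      by (intro sum.cong refl) (simp add: ln_realpow prime_gt_0_nat)
    also have "\<dots> = (\<Sum>p\<in>P. real (multiplicity p n) * ln (real p))"
    proof (rule sum.mono_neutral_left[OF P n'(3)], rule ballI)
      fix p assume "p \<in> P - prime_factors n"
      hence "\<not> p dvd n" using n' by (auto simp: in_prime_factors_iff P_def)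
      thus "real (multiplicity p n) * ln (real p) = 0" by (simp add: not_dvd_imp_multiplicity_0)
    qed
    also have "\<dots> = (\<Sum>p\<in>P. \<Sum>k\<in>{1..N}. if p ^ k dvd n then ln (real p) else 0)"
    proof (intro sum.cong refl)
      fix p assume p: "p \<in> P"
      hence pp: "prime p" by (simp add: P_def)
      have pk: "p ^ k dvd n \<longleftrightarrow> k \<le> multiplicity p n" for k
        using pp n' by (intro power_dvd_iff_le_multiplicity) (auto simp: prime_gt_Suc_0_nat)
      have "multiplicity p n < 2 ^ multiplicity p n" by (rule less_exp)
      also have "\<dots> \<le> p ^ multiplicity p n" using pp by (intro power_mono) (auto simp: prime_ge_2_nat)
      also have "\<dots> \<le> n" using n' by (intro dvd_imp_le multiplicity_dvd) auto
      finally have "multiplicity p n \<le> N" using n' by simp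
      hence "{k\<in>{1..N}. p ^ k dvd n} = {1..multiplicity p n}" unfolding pk by auto
      thus "real (multiplicity p n) * ln (real p) = (\<Sum>k\<in>{1..N}. if p ^ k dvd n then ln (real p) else 0)"
        by (simp add: sum.If_cases Int_def)
    qed
    finally show ?thesis .
  qed
  have count: "real (card {n\<in>S. d dvd n}) \<le> real N / real d" if "d \<ge> 1" for d
  proof -
    have "card {n\<in>S. d dvd n} \<le> card {n\<in>{1..N}. d dvd n}" by (rule card_mono) (auto simp: S_def)
    thus ?thesis using card_multiples_le[OF that, of N] by linarith
  qed
  have "(\<Sum>n\<in>S. ln (real n)) = (\<Sum>n\<in>S. \<Sum>p\<in>P. \<Sum>k\<in>{1..N}. if p ^ k dvd n then ln (real p) else 0)"
    using ln_n by simp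
  also have "\<dots> = (\<Sum>p\<in>P. \<Sum>n\<in>S. \<Sum>k\<in>{1..N}. if p ^ k dvd n then ln (real p) else 0)" by (rule sum.swap)
  also have "\<dots> = (\<Sum>p\<in>P. \<Sum>k\<in>{1..N}. \<Sum>n\<in>S. if p ^ k dvd n then ln (real p) else 0)"
    by (intro sum.cong refl sum.swap)
  also have "\<dots> = (\<Sum>p\<in>P. \<Sum>k\<in>{1..N}. real (card {n\<in>S. p ^ k dvd n}) * ln (real p))"
    using S by (simp add: sum.If_cases Int_def)
  also have "\<dots> \<le> (\<Sum>p\<in>P. \<Sum>k\<in>{1..N}. real N * ln (real p) * (1 / real p ^ k))"
  proof (intro sum_mono)
    fix p k assume "p \<in> P"
    hence p: "p \<ge> 1" by (auto simp: P_def prime_gt_0_nat Suc_le_eq)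
    have "real (card {n\<in>S. p ^ k dvd n}) * ln (real p) \<le> (real N / real (p ^ k)) * ln (real p)"
      using p by (intro mult_right_mono count) auto
    thus "real (card {n\<in>S. p ^ k dvd n}) * ln (real p) \<le> real N * ln (real p) * (1 / real p ^ k)" by simp
  qed
  also have "\<dots> = (\<Sum>p\<in>P. real N * ln (real p) * (\<Sum>k\<in>{1..N}. 1 / real p ^ k))" by (simp add: sum_distrib_left)
  also have "\<dots> \<le> (\<Sum>p\<in>P. real N * ln (real p) * (2 / real p))"
  proof (intro sum_mono mult_left_mono geometric_tail)
    fix p assume "p \<in> P"
    hence p: "p \<ge> 2" by (auto simp: P_def prime_ge_2_nat)
    thus "2 \<le> real p" "0 \<le> real N * ln (real p)" by auto
  qed
  also have "\<dots> = 2 * real N * (\<Sum>p\<in>P. ln (real p) / real p)" by (simp add: sum_distrib_left mult_ac)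
  also have "\<dots> \<le> 2 * real N * (ln (real z) + ln 4)" unfolding P_def by (intro mult_left_mono mertens_upper) auto
  finally have sum_ln: "(\<Sum>n\<in>S. ln (real n)) \<le> 2 * real N * (ln (real z) + ln 4)" .
  (* The smooth numbers above sqrt N, each of which has a large logarithm. *)
  define L where "L = {n\<in>S. sqrt (real N) < real n}"
  have "real (card L) * (ln (real N) / 2) = (\<Sum>n\<in>L. ln (real N) / 2)" by simp
  also have "\<dots> \<le> (\<Sum>n\<in>L. ln (real n))"
  proof (rule sum_mono)
    fix n assume n: "n \<in> L"
    have "ln (real N) / 2 = ln (sqrt (real N))" using N by (simp add: ln_sqrt)
    also have "\<dots> \<le> ln (real n)" using n N by (subst ln_le_cancel_iff) (auto simp: L_def S_def)
    finally show "ln (real N) / 2 \<le> ln (real n)" .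
  qed
  also have "\<dots> \<le> (\<Sum>n\<in>S. ln (real n))" using S by (intro sum_mono2) (auto simp: L_def S_def)
  finally have "real (card L) * (ln (real N) / 2) \<le> 2 * real N * (ln (real z) + ln 4)" using sum_ln by linarith
  hence cL: "real (card L) \<le> 4 * real N * (ln (real z) + ln 4) / ln (real N)" using lnN by (simp add: field_simps)
  have "S \<subseteq> {1..nat \<lfloor>sqrt (real N)\<rfloor>} \<union> L"
  proof
    fix n assume n: "n \<in> S"
    show "n \<in> {1..nat \<lfloor>sqrt (real N)\<rfloor>} \<union> L"
    proof (cases "sqrt (real N) < real n")
      case False
      hence "n \<le> nat \<lfloor>sqrt (real N)\<rfloor>" by (intro le_nat_floor) simp
      thus ?thesis using n by (simp add: S_def)
    qed (use n in \<open>simp add: L_def\<close>)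
  qed
  hence "card S \<le> card ({1..nat \<lfloor>sqrt (real N)\<rfloor>} \<union> L)" using S by (intro card_mono) (auto simp: L_def)
  also have "\<dots> \<le> nat \<lfloor>sqrt (real N)\<rfloor> + card L" using card_Un_le[of "{1..nat \<lfloor>sqrt (real N)\<rfloor>}" L] by simp
  finally have "real (card S) \<le> real (nat \<lfloor>sqrt (real N)\<rfloor>) + real (card L)" by linarith
  also have "real (nat \<lfloor>sqrt (real N)\<rfloor>) \<le> sqrt (real N)" by simp
  finally show ?thesis using cL unfolding S_def[symmetric] by linarith
qed

section \<open>Multiplicative energy\<close>

text \<open>The number of solutions of \<open>a * b = a' * b'\<close> in \<open>S\<close>.\<close>
abbreviation mult_energy :: "nat set \<Rightarrow> real" where
  "mult_energy S \<equiv>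
    real (card {x \<in> (S \<times> S) \<times> (S \<times> S). fst (fst x) * snd (fst x) = fst (snd x) * snd (snd x)})"

lemma equal_products_factor:
  fixes a b a' b' :: nat
  assumes "a > 0" "b > 0" "a' > 0" "b' > 0" "a * b = a' * b'"
  obtains r s t u where "a = r * s" "b = t * u" "a' = r * t" "b' = s * u" "r > 0" "s > 0" "t > 0" "u > 0"
proof -
  define r where "r = gcd a a'"
  obtain s t where st: "a = r * s" "a' = r * t" "coprime s t"
    using gcd_coprime_exists[of a a'] assms by (metis gcd_eq_0_iff mult.commute r_def less_numeral_extra(3))
  have r: "r > 0" using assms st by (metis mult_0 neq0_conv)
  have eq: "s * b = t * b'" using assms(5) r by (simp add: st)
  hence "t dvd b" using st(3) by (metis coprime_commute coprime_dvd_mult_right_iff dvd_triv_left)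
  then obtain u where u: "b = t * u" by blast
  have t: "t > 0" using assms st by (metis mult_0_right neq0_conv)
  have "b' = s * u" using eq t by (simp add: u)
  moreover from this have "s > 0" "u > 0" using assms by auto
  ultimately show ?thesis using that st u r t by blast
qed

lemma card_hyperbola_le:
  assumes "Y \<ge> 1"
  shows "real (card {(r, s). 1 \<le> r \<and> 1 \<le> s \<and> r * s \<le> Y}) \<le> real Y * (1 + ln (real Y))"
proof -
  have "{(r, s). 1 \<le> r \<and> 1 \<le> s \<and> r * s \<le> Y} \<subseteq> (SIGMA r:{1..Y}. {1..Y div r})"
  proof (clarify, intro conjI)
    fix r s :: nat assume rs: "1 \<le> r" "1 \<le> s" "r * s \<le> Y"
    have "r * 1 \<le> r * s" using rs by (intro mult_le_mono) auto
    hence "r \<le> Y" using rs(3) by linarith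
    thus "r \<in> {1..Y}" "s \<in> {1..Y div r}" using rs
      by (simp_all add: less_eq_div_iff_mult_less_eq mult.commute)
  qed
  hence "card {(r, s). 1 \<le> r \<and> 1 \<le> s \<and> r * s \<le> Y} \<le> card (SIGMA r:{1..Y}. {1..Y div r})"
    by (rule card_mono[rotated]) auto
  also have "\<dots> = (\<Sum>r\<in>{1..Y}. Y div r)" by simp
  finally have "real (card {(r, s). 1 \<le> r \<and> 1 \<le> s \<and> r * s \<le> Y}) \<le> (\<Sum>r\<in>{1..Y}. real (Y div r))" by (simp flip: of_nat_sum)
  also have "\<dots> \<le> (\<Sum>r\<in>{1..Y}. real Y * (1 / real r))" using of_nat_div_le_of_nat by (intro sum_mono) auto
  also have "\<dots> = real Y * (\<Sum>r\<in>{1..Y}. 1 / real r)" by (simp add: sum_distrib_left)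
  also have "\<dots> \<le> real Y * (1 + ln (real Y))" using assms by (intro mult_left_mono sum_reciprocal_le) auto
  finally show ?thesis .
qed

text \<open>A solution of \<open>a * b = a' * b'\<close> is parametrised by four integers with \<open>a = r * s\<close>
  and \<open>b = t * u\<close>, hence by two points under a hyperbola.\<close>
lemma multiplicative_energy_le:
  fixes S :: "nat set"
  assumes S: "S \<subseteq> {1..Y}" and Y: "Y \<ge> 1"
  shows "mult_energy S \<le> (real Y * (1 + ln (real Y)))\<^sup>2"
proof -
  define H where "H = {(r, s). 1 \<le> r \<and> 1 \<le> s \<and> r * s \<le> Y}"
  have H: "finite H"
  proof (rule finite_subset)
    show "H \<subseteq> {1..Y} \<times> {1..Y}"
    proof
      fix x assume "x \<in> H"
      then obtain r s where x: "x = (r, s)" "1 \<le> r" "1 \<le> s" "r * s \<le> Y" by (auto simp: H_def)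
      have "r * 1 \<le> r * s" "1 * s \<le> r * s" using x by (intro mult_le_mono; simp)+
      hence "r \<le> Y" "s \<le> Y" using x(4) by linarith+
      thus "x \<in> {1..Y} \<times> {1..Y}" using x by simp
    qed
  qed simp
  let ?Q = "{x \<in> (S \<times> S) \<times> (S \<times> S). fst (fst x) * snd (fst x) = fst (snd x) * snd (snd x)}"
  have "?Q \<subseteq> (\<lambda>x. ((fst (fst x) * snd (fst x), fst (snd x) * snd (snd x)), (fst (fst x) * fst (snd x), snd (fst x) * snd (snd x)))) ` (H \<times> H)"
  proof
    fix x assume x: "x \<in> ?Q"
    obtain a b a' b' where ab: "x = ((a, b), (a', b'))" by (metis prod.collapse)
    have pos: "a > 0" "b > 0" "a' > 0" "b' > 0" "a * b = a' * b'" "a \<le> Y" "b \<le> Y" using x S unfolding ab by auto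
    from equal_products_factor[OF pos(1-5)]
    obtain r s t u where r: "a = r * s" "b = t * u" "a' = r * t" "b' = s * u" "r > 0" "s > 0" "t > 0" "u > 0" .
    have "((r, s), (t, u)) \<in> H \<times> H" using r pos by (simp add: H_def Suc_le_eq)
    thus "x \<in> (\<lambda>x. ((fst (fst x) * snd (fst x), fst (snd x) * snd (snd x)), (fst (fst x) * fst (snd x), snd (fst x) * snd (snd x)))) ` (H \<times> H)"
      by (rule rev_image_eqI) (simp add: ab r(1-4))
  qed
  hence "card ?Q \<le> card (H \<times> H)" using H by (meson card_image_le card_mono finite_SigmaI finite_imageI order_trans)
  hence "real (card ?Q) \<le> (real (card H))\<^sup>2" by (simp add: card_cartesian_product power2_eq_square flip: of_nat_mult)
  also have "\<dots> \<le> (real Y * (1 + ln (real Y)))\<^sup>2" unfolding H_def by (intro power_mono card_hyperbola_le Y) auto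
  finally show ?thesis .
qed

section \<open>A central limit theorem for independent phases\<close>

text \<open>Nonconstant characters of the circle have mean zero.\<close>
lemma integral_unit_exp:
  assumes "k \<ge> 1"
  shows "(\<integral>x. indicator {0..1} x *\<^sub>R unit_exp x ^ k \<partial>lborel) = 0"
proof -
  let ?c = "2 * of_real pi * \<i> * of_nat k"
  let ?F = "\<lambda>x::real. exp (?c * of_real x) / ?c"
  have c: "?c \<noteq> 0" using assms by simp
  have pow: "unit_exp x ^ k = exp (?c * of_real x)" for x
    unfolding unit_exp_def exp_of_nat_mult[symmetric] by (simp add: mult_ac)
  have "(\<integral>x. indicator {0..1} x *\<^sub>R unit_exp x ^ k \<partial>lborel) = ?F 1 - ?F 0"
    unfolding pow
  proof (rule integral_FTC_atLeastAtMost)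
    show "(?F has_vector_derivative exp (?c * of_real x)) (at x within {0..1})" if "0 \<le> x" "x \<le> 1" for x
    proof -
      have "((\<lambda>z. exp (?c * z) / ?c) has_field_derivative exp (?c * of_real x)) (at (of_real x))"
        using c by (auto intro!: derivative_eq_intros)
      hence "((\<lambda>x. exp (?c * of_real x) / ?c) has_vector_derivative exp (?c * of_real x)) (at x)"
        by (rule has_vector_derivative_real_field)
      thus ?thesis by (rule has_vector_derivative_at_within)
    qed
  qed (auto intro!: continuous_intros)
  also have "exp ?c = 1" using exp_two_pi_i by (metis (no_types, opaque_lifting) exp_of_nat_mult mult.assoc mult.commute power_one)
  hence "?F 1 - ?F 0 = 0" by simp
  finally show ?thesis .
qed

lemma cnj_measurable: "Y \<in> borel_measurable N \<Longrightarrow> (\<lambda>\<omega>. cnj (Y \<omega>)) \<in> borel_measurable N"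
  by (rule borel_measurable_continuous_on[where f = cnj]) (auto intro: continuous_intros)

text \<open>To first order the factor \<open>exp s\<close> cancels the factor \<open>1 - s\<close>, with a quadratic
  error.\<close>
lemma exp_times_one_minus:
  fixes s :: real
  assumes "s \<ge> 0"
  shows "\<bar>exp s * (1 - s) - 1\<bar> \<le> exp s * s\<^sup>2"
proof -
  have a: "1 - s \<le> exp (- s)" using exp_ge_add_one_self[of "-s"] by simp
  hence "exp s * (1 - s) \<le> exp s * exp (-s)" by (intro mult_left_mono) auto
  hence up: "exp s * (1 - s) \<le> 1" by (simp flip: exp_add)
  have "exp s * (1 - exp (- s)) \<le> exp s * s" using a by (intro mult_left_mono) auto
  hence "exp s - 1 \<le> exp s * s" by (simp add: right_diff_distrib flip: exp_add)
  hence "s * (exp s - 1) \<le> s * (exp s * s)" using assms by (intro mult_left_mono) auto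
  moreover have "1 + s \<le> exp s" by (rule exp_ge_add_one_self)
  ultimately have "1 - exp s * (1 - s) \<le> exp s * s\<^sup>2"
    unfolding power2_eq_square right_diff_distrib by (simp only: mult_1_right mult.commute mult.left_commute)
  thus ?thesis using up by simp
qed

lemma cis_taylor: "norm (cis \<rho> - (1 + \<i> * of_real \<rho> - of_real (\<rho>\<^sup>2 / 2) - \<i> * of_real (\<rho> ^ 3 / 6))) \<le> \<rho> ^ 4 / 24"
proof -
  have "norm (iexp \<rho> - (\<Sum>k\<le>3. (\<i> * \<rho>) ^ k / fact k)) \<le> \<bar>\<rho>\<bar> ^ Suc 3 / fact (Suc 3)" by (rule iexp_approx1)
  moreover have "(\<Sum>k\<le>3. (\<i> * \<rho>) ^ k / fact k) = 1 + \<i> * of_real \<rho> - of_real (\<rho>\<^sup>2 / 2) - \<i> * of_real (\<rho> ^ 3 / 6)"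
    by (simp add: eval_nat_numeral algebra_simps)
  moreover have "\<bar>\<rho>\<bar> ^ Suc 3 = \<rho> ^ 4" by (simp add: power_even_abs)
  moreover have "fact (Suc 3) = (24::real)" by (simp add: eval_nat_numeral)
  ultimately show ?thesis by (simp add: cis_conv_exp)
qed

lemma cis_measurable: "f \<in> borel_measurable N \<Longrightarrow> (\<lambda>\<omega>. cis (f \<omega>)) \<in> borel_measurable N"
  by (rule borel_measurable_continuous_on[where f = cis]) (intro continuous_intros)

lemma of_real_exp_measurable:
  fixes f :: "'b \<Rightarrow> real"
  shows "f \<in> borel_measurable N \<Longrightarrow> (\<lambda>\<omega>. complex_of_real (exp (f \<omega>))) \<in> borel_measurable N"
  by (rule borel_measurable_continuous_on[where f = "\<lambda>x. complex_of_real (exp x)"]) (intro continuous_intros)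

lemma norm_measurable:
  fixes f :: "'b \<Rightarrow> complex"
  shows "f \<in> borel_measurable N \<Longrightarrow> (\<lambda>\<omega>. norm (f \<omega>)) \<in> borel_measurable N"
  by (rule borel_measurable_continuous_on[where f = norm]) (intro continuous_intros)

lemma Re_measurable: "f \<in> borel_measurable N \<Longrightarrow> (\<lambda>\<omega>. Re (f \<omega>)) \<in> borel_measurable N"
  by (rule borel_measurable_continuous_on[where f = Re]) (intro continuous_intros)

text \<open>The sum is stopped just before its total exceeds \<open>c\<close>.\<close>
lemma stopped_sum_le:
  fixes a :: "nat \<Rightarrow> real"
  assumes "\<And>k. a k \<ge> 0" "c \<ge> 0"
  shows "(\<Sum>k<n. a k * (if (\<Sum>r\<le>k. a r) \<le> c then 1 else 0)) \<le> c"
proof (induction n)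
  case (Suc n)
  show ?case
  proof (cases "(\<Sum>r\<le>n. a r) \<le> c")
    case True
    have "(\<Sum>k<Suc n. a k * (if (\<Sum>r\<le>k. a r) \<le> c then 1 else 0)) \<le> (\<Sum>k<Suc n. a k)"
      using assms by (intro sum_mono) auto
    thus ?thesis using True by (simp add: lessThan_Suc_atMost)
  next
    case False
    thus ?thesis using Suc.IH by simp
  qed
qed (use assms in simp)

lemma norm_cis_diff_le: "norm (cis a - cis b) \<le> \<bar>a - b\<bar>"
proof -
  have u: "unit_exp (t / (2 * pi)) = cis t" for t by (simp add: unit_exp_cis)
  have "norm (cis a - cis b) \<le> 2 * pi * dist_int (a / (2 * pi) - b / (2 * pi))"
    using norm_unit_exp_diff_le[of "a / (2 * pi)" "b / (2 * pi)"] by (simp only: u)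
  also have "\<dots> \<le> 2 * pi * \<bar>a / (2 * pi) - b / (2 * pi)\<bar>" by (intro mult_left_mono dist_int_le_abs) simp
  also have "\<dots> = \<bar>a - b\<bar>" unfolding diff_divide_distrib[symmetric] by (simp add: abs_divide)
  finally show ?thesis .
qed

lemma (in prob_space) bounded_integrable:
  fixes Z :: "'a \<Rightarrow> 'c::{banach, second_countable_topology}"
  shows "Z \<in> borel_measurable M \<Longrightarrow> (\<And>\<omega>. norm (Z \<omega>) \<le> b) \<Longrightarrow> integrable M Z"
  by (rule integrable_const_bound[of _ b]) auto

lemma (in prob_space) expectation_abs_le_sqrt:
  fixes Y :: "'a \<Rightarrow> real"
  assumes "integrable M Y" "integrable M (\<lambda>\<omega>. (Y \<omega>)\<^sup>2)"
  shows "expectation (\<lambda>\<omega>. \<bar>Y \<omega>\<bar>) \<le> sqrt (expectation (\<lambda>\<omega>. (Y \<omega>)\<^sup>2))"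
proof -
  have "0 \<le> variance (\<lambda>\<omega>. \<bar>Y \<omega>\<bar>)" by (rule variance_positive)
  also have "\<dots> = expectation (\<lambda>\<omega>. \<bar>Y \<omega>\<bar>\<^sup>2) - (expectation (\<lambda>\<omega>. \<bar>Y \<omega>\<bar>))\<^sup>2"
    using assms by (intro variance_eq) auto
  finally show ?thesis by (intro real_le_rsqrt) simp
qed

text \<open>Parseval for finitely many orthogonal unimodular random variables.\<close>
lemma (in prob_space) expectation_square_orthonormal:
  fixes h :: "'i \<Rightarrow> 'a \<Rightarrow> complex" and d :: "'i \<Rightarrow> complex"
  assumes R: "finite R" and hm: "\<And>i. i \<in> R \<Longrightarrow> h i \<in> borel_measurable M" and hn: "\<And>i \<omega>. i \<in> R \<Longrightarrow> norm (h i \<omega>) = 1"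
    and orth: "\<And>i j. i \<in> R \<Longrightarrow> j \<in> R \<Longrightarrow> i \<noteq> j \<Longrightarrow> expectation (\<lambda>\<omega>. h i \<omega> * cnj (h j \<omega>)) = 0"
  shows "integrable M (\<lambda>\<omega>. (norm (\<Sum>i\<in>R. d i * h i \<omega>))\<^sup>2)"
    and "expectation (\<lambda>\<omega>. (norm (\<Sum>i\<in>R. d i * h i \<omega>))\<^sup>2) = (\<Sum>i\<in>R. (norm (d i))\<^sup>2)"
proof -
  let ?S = "\<lambda>\<omega>. \<Sum>i\<in>R. d i * h i \<omega>"
  have Sm: "?S \<in> borel_measurable M" using hm by (intro borel_measurable_sum borel_measurable_times) auto
  show "integrable M (\<lambda>\<omega>. (norm (?S \<omega>))\<^sup>2)"
  proof (rule bounded_integrable)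
    show "(\<lambda>\<omega>. (norm (?S \<omega>))\<^sup>2) \<in> borel_measurable M" using Sm by (intro borel_measurable_power norm_measurable)
    fix \<omega>
    have "norm (?S \<omega>) \<le> (\<Sum>i\<in>R. norm (d i))" by (rule sum_norm_le) (simp add: norm_mult hn)
    thus "norm ((norm (?S \<omega>))\<^sup>2) \<le> (\<Sum>i\<in>R. norm (d i))\<^sup>2" by (simp add: power_mono)
  qed
  have int: "integrable M (\<lambda>\<omega>. d i * cnj (d j) * (h i \<omega> * cnj (h j \<omega>)))" if "i \<in> R" "j \<in> R" for i j
    by (rule bounded_integrable[of _ "norm (d i * cnj (d j))"])
       (use that hm hn in \<open>auto simp: norm_mult intro!: borel_measurable_times cnj_measurable\<close>)
  have diag: "expectation (\<lambda>\<omega>. h i \<omega> * cnj (h i \<omega>)) = 1" if "i \<in> R" for i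
  proof -
    have "h i \<omega> * cnj (h i \<omega>) = 1" for \<omega> using hn[OF that] by (simp flip: complex_norm_square)
    thus ?thesis by (simp add: prob_space)
  qed
  have "complex_of_real (expectation (\<lambda>\<omega>. (norm (?S \<omega>))\<^sup>2)) = expectation (\<lambda>\<omega>. complex_of_real ((norm (?S \<omega>))\<^sup>2))"
    by (rule integral_complex_of_real[symmetric])
  also have "\<dots> = expectation (\<lambda>\<omega>. \<Sum>i\<in>R. \<Sum>j\<in>R. d i * cnj (d j) * (h i \<omega> * cnj (h j \<omega>)))"
    unfolding complex_norm_square cnj_sum sum_product by (simp add: mult_ac)
  also have "\<dots> = (\<Sum>i\<in>R. \<Sum>j\<in>R. expectation (\<lambda>\<omega>. d i * cnj (d j) * (h i \<omega> * cnj (h j \<omega>))))"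
  proof (subst Bochner_Integration.integral_sum)
    show "integrable M (\<lambda>\<omega>. \<Sum>j\<in>R. d i * cnj (d j) * (h i \<omega> * cnj (h j \<omega>)))" if "i \<in> R" for i
      using that by (intro Bochner_Integration.integrable_sum int)
    show "(\<Sum>i\<in>R. expectation (\<lambda>\<omega>. \<Sum>j\<in>R. d i * cnj (d j) * (h i \<omega> * cnj (h j \<omega>))))
      = (\<Sum>i\<in>R. \<Sum>j\<in>R. expectation (\<lambda>\<omega>. d i * cnj (d j) * (h i \<omega> * cnj (h j \<omega>))))"
      by (intro sum.cong refl Bochner_Integration.integral_sum int)
  qed
  also have "\<dots> = (\<Sum>i\<in>R. \<Sum>j\<in>R. if i = j then d i * cnj (d i) else 0)"
  proof (intro sum.cong refl)
    fix i j assume "i \<in> R" "j \<in> R"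
    thus "expectation (\<lambda>\<omega>. d i * cnj (d j) * (h i \<omega> * cnj (h j \<omega>))) = (if i = j then d i * cnj (d i) else 0)"
      using orth[of i j] diag[of i] by (cases "i = j") simp_all
  qed
  also have "\<dots> = (\<Sum>i\<in>R. d i * cnj (d i))" using R by simp
  also have "\<dots> = complex_of_real (\<Sum>i\<in>R. (norm (d i))\<^sup>2)" by (simp add: complex_norm_square del: of_real_power)
  finally show "expectation (\<lambda>\<omega>. (norm (?S \<omega>))\<^sup>2) = (\<Sum>i\<in>R. (norm (d i))\<^sup>2)" by (simp only: of_real_eq_iff)
qed

text \<open>\<open>X p\<close> is the value of a Steinhaus function at the prime \<open>p\<close>.  Its modulus is one at
  every point, and not only almost surely, so that all random variables built from finitely many values are
  bounded and hence integrable.\<close>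
locale steinhaus_phases = prob_space M for M :: "'a measure" +
  fixes X :: "nat \<Rightarrow> 'a \<Rightarrow> complex"
  assumes indep: "indep_vars (\<lambda>_. borel) X {p. prime p}"
    and uniform: "prime p \<Longrightarrow> distr M borel (X p) = unit_circle_measure"
    and norm_X [simp]: "norm (X p \<omega>) = 1"
begin

lemma X_measurable: "prime p \<Longrightarrow> X p \<in> borel_measurable M"
  using indep by (auto simp: indep_vars_def)

lemma expectation_X_power:
  assumes p: "prime p" and k: "k \<ge> 1"
  shows "expectation (\<lambda>\<omega>. X p \<omega> ^ k) = 0"
proof -
  have "expectation (\<lambda>\<omega>. X p \<omega> ^ k) = (\<integral>z. z ^ k \<partial>distr M borel (X p))"
    using X_measurable[OF p] by (subst integral_distr) auto
  also have "\<dots> = (\<integral>x. unit_exp x ^ k \<partial>uniform_measure lborel {0..1})"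
    unfolding uniform[OF p] unit_circle_measure_def by (subst integral_distr) auto
  also have "uniform_measure lborel {0..1::real} = density lborel (\<lambda>x. ennreal (indicator {0..1} x))"
    unfolding uniform_measure_def by (rule density_cong) (auto simp: divide_ennreal_def ennreal_indicator)
  also have "(\<integral>x. unit_exp x ^ k \<partial>\<dots>) = (\<integral>x. indicator {0..1} x *\<^sub>R unit_exp x ^ k \<partial>lborel)"
    by (subst integral_density) auto
  finally show ?thesis using integral_unit_exp[OF k] by simp
qed

text \<open>The sigma-algebra generated by the values at the primes below \<open>p\<close>.\<close>
definition past :: "nat \<Rightarrow> 'a measure" where
  "past p = vimage_algebra (space M) (\<lambda>\<omega>. restrict (\<lambda>r. X r \<omega>) {r. prime r \<and> r < p}) (PiM {r. prime r \<and> r < p} (\<lambda>_. borel))"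

lemma space_past [simp]: "space (past p) = space M"
  by (simp add: past_def)

lemma past_map_measurable:
  "(\<lambda>\<omega>. restrict (\<lambda>r. X r \<omega>) {r. prime r \<and> r < p}) \<in> measurable M (PiM {r. prime r \<and> r < p} (\<lambda>_. borel))"
  by (intro measurable_restrict X_measurable) auto

lemma subalgebra_past: "subalgebra M (past p)"
  unfolding subalgebra_def past_def
  using past_map_measurable[of p]
  by (auto simp: sets_vimage_algebra intro!: sets.sigma_sets_subset measurable_sets)

lemma past_measurable_M: "Z \<in> borel_measurable (past p) \<Longrightarrow> Z \<in> borel_measurable M"
  by (rule measurable_from_subalg[OF subalgebra_past])

lemma X_past_measurable:
  assumes "prime r" "r < p"
  shows "X r \<in> borel_measurable (past p)"
proof -
  let ?A = "{r. prime r \<and> r < p}"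
  have "(\<lambda>\<omega>. restrict (\<lambda>r. X r \<omega>) ?A) \<in> measurable (past p) (PiM ?A (\<lambda>_. borel))"
    unfolding past_def by (rule measurable_vimage_algebra1) (auto simp: space_PiM)
  moreover have "(\<lambda>f. f r) \<in> measurable (PiM ?A (\<lambda>_. borel)) borel"
    using assms by (intro measurable_component_singleton) auto
  ultimately have "(\<lambda>\<omega>. restrict (\<lambda>r. X r \<omega>) ?A r) \<in> borel_measurable (past p)"
    by (rule measurable_compose)
  thus ?thesis using assms by simp
qed

text \<open>The phase at \<open>p\<close> involves a coordinate that is disjoint from those generating the past.\<close>
lemma past_indep:
  fixes Z :: "'a \<Rightarrow> complex"
  assumes p: "prime p" and Z: "Z \<in> borel_measurable (past p)"
  shows "indep_var borel Z borel (\<lambda>\<omega>. X p \<omega> ^ k)"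
proof -
  let ?A = "{r. prime r \<and> r < p}"
  let ?R = "\<lambda>\<omega>. restrict (\<lambda>r. X r \<omega>) ?A"
  let ?P = "PiM ?A (\<lambda>_. borel) :: (nat \<Rightarrow> complex) measure"
  let ?S = "\<lambda>\<omega>. restrict (\<lambda>r. X r \<omega>) {p}"
  have ind: "indep_var ?P ?R (PiM {p} (\<lambda>_. borel)) ?S"
    using p by (intro indep_var_restrict[OF indep]) auto
  have sub: "sigma_sets (space M) {Y -` A \<inter> space M |A. A \<in> sets borel} \<subseteq> sigma_sets (space M) {T -` A \<inter> space M |A. A \<in> sets Q}"
    if Y: "Y \<in> borel_measurable (vimage_algebra (space M) T Q)" for Y :: "'a \<Rightarrow> complex" and T :: "'a \<Rightarrow> nat \<Rightarrow> complex" and Q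
  proof -
    have "sigma_sets (space (vimage_algebra (space M) T Q)) {Y -` A \<inter> space M |A. A \<in> sets borel} \<subseteq> sets (vimage_algebra (space M) T Q)"
      by (rule sets.sigma_sets_subset) (use measurable_sets[OF Y] in auto)
    thus ?thesis by (simp add: sets_vimage_algebra)
  qed
  have XS: "(\<lambda>\<omega>. X p \<omega> ^ k) \<in> borel_measurable (vimage_algebra (space M) ?S (PiM {p} (\<lambda>_. borel)))"
  proof -
    have "?S \<in> measurable (vimage_algebra (space M) ?S (PiM {p} (\<lambda>_. borel))) (PiM {p} (\<lambda>_. borel))"
      by (rule measurable_vimage_algebra1) (auto simp: space_PiM)
    hence "(\<lambda>\<omega>. ?S \<omega> p) \<in> borel_measurable (vimage_algebra (space M) ?S (PiM {p} (\<lambda>_. borel)))"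
      by (rule measurable_compose) (rule measurable_component_singleton, simp)
    thus ?thesis by simp
  qed
  have Xm: "(\<lambda>\<omega>. X p \<omega> ^ k) \<in> borel_measurable M" using X_measurable[OF p] by simp
  have mono: "indep_set A' B'" if "indep_set A B" "A' \<subseteq> A" "B' \<subseteq> B" for A A' B B'
    using that unfolding indep_sets2_eq by blast
  show ?thesis
    unfolding indep_var_eq
    by (intro conjI past_measurable_M[OF Z] Xm mono[OF _ sub[OF Z[unfolded past_def]] sub[OF XS]])
       (rule ind[unfolded indep_var_eq, THEN conjunct2])
qed

definition bounded_past :: "nat \<Rightarrow> ('a \<Rightarrow> complex) \<Rightarrow> bool" where
  "bounded_past p Z \<longleftrightarrow> Z \<in> borel_measurable (past p) \<and> (\<exists>b. \<forall>\<omega>. norm (Z \<omega>) \<le> b)"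

lemma bounded_past_mult: "bounded_past p Y \<Longrightarrow> bounded_past p Z \<Longrightarrow> bounded_past p (\<lambda>\<omega>. Y \<omega> * Z \<omega>)"
proof -
  assume a: "bounded_past p Y" "bounded_past p Z"
  then obtain b c where bc: "\<And>\<omega>. norm (Y \<omega>) \<le> b" "\<And>\<omega>. norm (Z \<omega>) \<le> c" by (auto simp: bounded_past_def)
  have "norm (Y \<omega> * Z \<omega>) \<le> b * c" for \<omega>
    unfolding norm_mult by (intro mult_mono bc norm_ge_zero order_trans[OF norm_ge_zero bc(1)])
  thus ?thesis using a by (auto simp: bounded_past_def)
qed

lemma bounded_past_add: "bounded_past p Y \<Longrightarrow> bounded_past p Z \<Longrightarrow> bounded_past p (\<lambda>\<omega>. Y \<omega> + Z \<omega>)"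
proof -
  assume a: "bounded_past p Y" "bounded_past p Z"
  then obtain b c where bc: "\<And>\<omega>. norm (Y \<omega>) \<le> b" "\<And>\<omega>. norm (Z \<omega>) \<le> c" by (auto simp: bounded_past_def)
  have "norm (Y \<omega> + Z \<omega>) \<le> b + c" for \<omega> using bc norm_triangle_mono by blast
  thus ?thesis using a by (auto simp: bounded_past_def)
qed

lemma bounded_past_const: "bounded_past p (\<lambda>_. c)"
  by (auto simp: bounded_past_def)

lemma bounded_past_power: "bounded_past p Y \<Longrightarrow> bounded_past p (\<lambda>\<omega>. Y \<omega> ^ n)"
  by (induction n) (auto intro: bounded_past_const bounded_past_mult)

lemma bounded_past_cnj: "bounded_past p Y \<Longrightarrow> bounded_past p (\<lambda>\<omega>. cnj (Y \<omega>))"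
  by (auto simp: bounded_past_def intro: cnj_measurable)

lemma bounded_past_integrable: "bounded_past p Z \<Longrightarrow> integrable M Z"
  unfolding bounded_past_def using bounded_integrable past_measurable_M by blast

lemma expectation_past_times_phase:
  assumes p: "prime p" and k: "k \<ge> 1" and Z: "bounded_past p Z"
  shows "integrable M (\<lambda>\<omega>. Z \<omega> * X p \<omega> ^ k)" "expectation (\<lambda>\<omega>. Z \<omega> * X p \<omega> ^ k) = 0"
proof -
  have ind: "indep_var borel Z borel (\<lambda>\<omega>. X p \<omega> ^ k)" using past_indep[OF p] Z by (auto simp: bounded_past_def)
  have iX: "integrable M (\<lambda>\<omega>. X p \<omega> ^ k)"
    using X_measurable[OF p] by (intro bounded_integrable[of _ 1]) (auto simp: norm_power)
  show "integrable M (\<lambda>\<omega>. Z \<omega> * X p \<omega> ^ k)" by (rule indep_var_integrable[OF ind bounded_past_integrable[OF Z] iX])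
  show "expectation (\<lambda>\<omega>. Z \<omega> * X p \<omega> ^ k) = 0"
    using indep_var_lebesgue_integral[OF ind bounded_past_integrable[OF Z] iX] expectation_X_power[OF p k] by simp
qed

lemma expectation_past_times_cnj_phase:
  assumes p: "prime p" and k: "k \<ge> 1" and Z: "bounded_past p Z"
  shows "integrable M (\<lambda>\<omega>. Z \<omega> * cnj (X p \<omega>) ^ k)" "expectation (\<lambda>\<omega>. Z \<omega> * cnj (X p \<omega>) ^ k) = 0"
proof -
  have eq: "Z \<omega> * cnj (X p \<omega>) ^ k = cnj (cnj (Z \<omega>) * X p \<omega> ^ k)" for \<omega> by simp
  show "integrable M (\<lambda>\<omega>. Z \<omega> * cnj (X p \<omega>) ^ k)"
    unfolding eq using integrable_cnj[OF expectation_past_times_phase(1)[OF p k bounded_past_cnj[OF Z]]] by simp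
  have "expectation (\<lambda>\<omega>. Z \<omega> * cnj (X p \<omega>) ^ k) = expectation (\<lambda>\<omega>. cnj (cnj (Z \<omega>) * X p \<omega> ^ k))"
    by (simp only: eq)
  also have "\<dots> = cnj (expectation (\<lambda>\<omega>. cnj (Z \<omega>) * X p \<omega> ^ k))" by (rule Bochner_Integration.integral_cnj)
  also have "\<dots> = 0" using expectation_past_times_phase(2)[OF p k bounded_past_cnj[OF Z]] by simp
  finally show "expectation (\<lambda>\<omega>. Z \<omega> * cnj (X p \<omega>) ^ k) = 0" .
qed

text \<open>Expand \<open>cis \<rho>\<close> to third order.  With \<open>\<rho> = (W * X p + cnj (W * X p)) / 2\<close>,
  every power of \<open>\<rho>\<close> is a polynomial in \<open>X p\<close> and its conjugate with coefficients
  from the past, and all terms of nonzero frequency have mean zero.  What is left of the expansion up to third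
  order is \<open>1 - |W|^2 / 4\<close>.\<close>
lemma phase_step:
  assumes p: "prime p" and \<phi>: "bounded_past p \<phi>" and W: "bounded_past p W"
  defines "\<rho> \<equiv> \<lambda>\<omega>. Re (W \<omega> * X p \<omega>)"
  shows "norm (expectation (\<lambda>\<omega>. \<phi> \<omega> * cis (\<rho> \<omega>)) - expectation (\<lambda>\<omega>. \<phi> \<omega> * of_real (1 - (norm (W \<omega>))\<^sup>2 / 4)))
       \<le> expectation (\<lambda>\<omega>. norm (\<phi> \<omega>) * norm (W \<omega>) ^ 4 / 24)"
proof -
  note bp = bounded_past_mult bounded_past_add bounded_past_const bounded_past_power bounded_past_cnj \<phi> W
  (* The coefficients of the frequencies 1, 2, 3 and -1, -2, -3 in the Taylor polynomial of \<phi> * cis \<rho>. *)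
  define P1 where "P1 = (\<lambda>\<omega>. \<phi> \<omega> * (\<i> / 2 * W \<omega> + (- \<i> / 16) * (W \<omega> ^ 2 * cnj (W \<omega>))))"
  define P2 where "P2 = (\<lambda>\<omega>. \<phi> \<omega> * ((- 1 / 8) * W \<omega> ^ 2))"
  define P3 where "P3 = (\<lambda>\<omega>. \<phi> \<omega> * ((- \<i> / 48) * W \<omega> ^ 3))"
  define Q1 where "Q1 = (\<lambda>\<omega>. \<phi> \<omega> * (\<i> / 2 * cnj (W \<omega>) + (- \<i> / 16) * (W \<omega> * cnj (W \<omega>) ^ 2)))"
  define Q2 where "Q2 = (\<lambda>\<omega>. \<phi> \<omega> * ((- 1 / 8) * cnj (W \<omega>) ^ 2))"
  define Q3 where "Q3 = (\<lambda>\<omega>. \<phi> \<omega> * ((- \<i> / 48) * cnj (W \<omega>) ^ 3))"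
  have b: "bounded_past p P1" "bounded_past p P2" "bounded_past p P3" "bounded_past p Q1" "bounded_past p Q2" "bounded_past p Q3"
    unfolding P1_def P2_def P3_def Q1_def Q2_def Q3_def by (intro bp)+
  define G where "G = (\<lambda>\<omega>. P1 \<omega> * X p \<omega> ^ 1 + P2 \<omega> * X p \<omega> ^ 2 + P3 \<omega> * X p \<omega> ^ 3 +
      Q1 \<omega> * cnj (X p \<omega>) ^ 1 + Q2 \<omega> * cnj (X p \<omega>) ^ 2 + Q3 \<omega> * cnj (X p \<omega>) ^ 3)"
  have ints: "integrable M (\<lambda>\<omega>. P1 \<omega> * X p \<omega> ^ 1)" "integrable M (\<lambda>\<omega>. P2 \<omega> * X p \<omega> ^ 2)" "integrable M (\<lambda>\<omega>. P3 \<omega> * X p \<omega> ^ 3)"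
     "integrable M (\<lambda>\<omega>. Q1 \<omega> * cnj (X p \<omega>) ^ 1)" "integrable M (\<lambda>\<omega>. Q2 \<omega> * cnj (X p \<omega>) ^ 2)" "integrable M (\<lambda>\<omega>. Q3 \<omega> * cnj (X p \<omega>) ^ 3)"
    by (intro expectation_past_times_phase(1)[OF p] expectation_past_times_cnj_phase(1)[OF p] b; simp)+
  have zeros: "expectation (\<lambda>\<omega>. P1 \<omega> * X p \<omega> ^ 1) = 0" "expectation (\<lambda>\<omega>. P2 \<omega> * X p \<omega> ^ 2) = 0" "expectation (\<lambda>\<omega>. P3 \<omega> * X p \<omega> ^ 3) = 0"
     "expectation (\<lambda>\<omega>. Q1 \<omega> * cnj (X p \<omega>) ^ 1) = 0" "expectation (\<lambda>\<omega>. Q2 \<omega> * cnj (X p \<omega>) ^ 2) = 0" "expectation (\<lambda>\<omega>. Q3 \<omega> * cnj (X p \<omega>) ^ 3) = 0"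
    by (intro expectation_past_times_phase(2)[OF p] expectation_past_times_cnj_phase(2)[OF p] b; simp)+
  have Gi: "integrable M G" unfolding G_def by (intro Bochner_Integration.integrable_add ints)
  have G0: "expectation G = 0"
    unfolding G_def
    by (simp only: Bochner_Integration.integral_add ints Bochner_Integration.integrable_add zeros add_0)
  have Xc: "X p \<omega> * cnj (X p \<omega>) = 1" for \<omega> by (simp flip: complex_norm_square)
  have W2: "of_real ((norm w)\<^sup>2) = w * cnj w" for w by (rule complex_norm_square)
  have G_eq: "G \<omega> = \<phi> \<omega> * (\<i> * of_real (\<rho> \<omega>) - of_real ((\<rho> \<omega>)\<^sup>2 / 2) - \<i> * of_real (\<rho> \<omega> ^ 3 / 6) + of_real ((norm (W \<omega>))\<^sup>2 / 4))" for \<omega>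
  proof -
    define w x where "w = W \<omega>" and "x = X p \<omega>"
    have x: "x * cnj x = 1" using Xc by (simp add: x_def)
    have r: "complex_of_real (\<rho> \<omega>) = (w * x + cnj w * cnj x) / 2"
      using complex_add_cnj[of "w * x"] by (simp add: \<rho>_def w_def x_def)
    have r2: "(w * x + cnj w * cnj x)\<^sup>2 = w\<^sup>2 * x\<^sup>2 + 2 * (w * cnj w) + cnj w ^ 2 * cnj x ^ 2"
      using x by algebra
    have r3: "(w * x + cnj w * cnj x) ^ 3 = w ^ 3 * x ^ 3 + 3 * (w ^ 2 * cnj w) * x + 3 * (w * cnj w ^ 2) * cnj x + cnj w ^ 3 * cnj x ^ 3"
      using x by algebra
    have taylor: "\<i> * of_real (\<rho> \<omega>) - of_real ((\<rho> \<omega>)\<^sup>2 / 2) - \<i> * of_real (\<rho> \<omega> ^ 3 / 6) + of_real ((norm (W \<omega>))\<^sup>2 / 4)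
       = \<i> * ((w * x + cnj w * cnj x) / 2) - (w * x + cnj w * cnj x)\<^sup>2 / 8 - \<i> * ((w * x + cnj w * cnj x) ^ 3 / 48) + (w * cnj w) / 4"
    proof -
      have "complex_of_real ((norm (W \<omega>))\<^sup>2 / 4) = (w * cnj w) / 4"
        unfolding of_real_divide W2 w_def by simp
      thus ?thesis by (simp only: of_real_power of_real_divide r power_divide) simp
    qed
    have "G \<omega> = \<phi> \<omega> * (\<i> * ((w * x + cnj w * cnj x) / 2) - (w * x + cnj w * cnj x)\<^sup>2 / 8 - \<i> * ((w * x + cnj w * cnj x) ^ 3 / 48) + (w * cnj w) / 4)"
      unfolding G_def P1_def P2_def P3_def Q1_def Q2_def Q3_def r2 r3 w_def[symmetric] x_def[symmetric]
      by (simp add: algebra_simps add_divide_distrib diff_divide_distrib)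
    thus ?thesis unfolding taylor .
  qed
  obtain bW where bW: "\<And>\<omega>. norm (W \<omega>) \<le> bW" using W by (auto simp: bounded_past_def)
  obtain b\<phi> where b\<phi>: "\<And>\<omega>. norm (\<phi> \<omega>) \<le> b\<phi>" using \<phi> by (auto simp: bounded_past_def)
  have m: "\<phi> \<in> borel_measurable M" "W \<in> borel_measurable M" "X p \<in> borel_measurable M"
    using \<phi> W past_measurable_M X_measurable[OF p] by (auto simp: bounded_past_def)
  have \<rho>m: "\<rho> \<in> borel_measurable M" unfolding \<rho>_def using m by measurable
  have cm: "(\<lambda>\<omega>. cis (\<rho> \<omega>)) \<in> borel_measurable M"
    by (rule borel_measurable_continuous_on[where f = cis, OF _ \<rho>m]) (intro continuous_intros)
  have i1: "integrable M (\<lambda>\<omega>. \<phi> \<omega> * cis (\<rho> \<omega>))"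
    by (rule bounded_integrable[of _ b\<phi>]) (use m cm b\<phi> in \<open>auto simp: norm_mult\<close>)
  have i2: "integrable M (\<lambda>\<omega>. \<phi> \<omega> * of_real (1 - (norm (W \<omega>))\<^sup>2 / 4))"
  proof (rule bounded_past_integrable[of p])
    have "bounded_past p (\<lambda>\<omega>. \<phi> \<omega> * (1 + (- 1/4) * (W \<omega> * cnj (W \<omega>))))" by (intro bp)
    moreover have "complex_of_real (1 - (norm w)\<^sup>2 / 4) = 1 + (- 1/4) * (w * cnj w)" for w
      unfolding of_real_diff of_real_divide W2 by simp
    ultimately show "bounded_past p (\<lambda>\<omega>. \<phi> \<omega> * of_real (1 - (norm (W \<omega>))\<^sup>2 / 4))" by simp
  qed
  have "expectation (\<lambda>\<omega>. \<phi> \<omega> * cis (\<rho> \<omega>)) - expectation (\<lambda>\<omega>. \<phi> \<omega> * of_real (1 - (norm (W \<omega>))\<^sup>2 / 4))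
     = expectation (\<lambda>\<omega>. \<phi> \<omega> * cis (\<rho> \<omega>) - \<phi> \<omega> * of_real (1 - (norm (W \<omega>))\<^sup>2 / 4)) - expectation G"
    using i1 i2 G0 by (simp add: Bochner_Integration.integral_diff)
  also have "\<dots> = expectation (\<lambda>\<omega>. (\<phi> \<omega> * cis (\<rho> \<omega>) - \<phi> \<omega> * of_real (1 - (norm (W \<omega>))\<^sup>2 / 4)) - G \<omega>)"
    by (intro Bochner_Integration.integral_diff[symmetric] Bochner_Integration.integrable_diff i1 i2 Gi)
  also have "norm \<dots> \<le> expectation (\<lambda>\<omega>. norm ((\<phi> \<omega> * cis (\<rho> \<omega>) - \<phi> \<omega> * of_real (1 - (norm (W \<omega>))\<^sup>2 / 4)) - G \<omega>))"
    by (rule integral_norm_bound)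
  also have "\<dots> \<le> expectation (\<lambda>\<omega>. norm (\<phi> \<omega>) * norm (W \<omega>) ^ 4 / 24)"
  proof (rule integral_mono)
    show "integrable M (\<lambda>\<omega>. norm ((\<phi> \<omega> * cis (\<rho> \<omega>) - \<phi> \<omega> * of_real (1 - (norm (W \<omega>))\<^sup>2 / 4)) - G \<omega>))"
      by (intro integrable_norm Bochner_Integration.integrable_diff i1 i2 Gi)
    have "bounded_past p (\<lambda>\<omega>. \<phi> \<omega> * W \<omega> ^ 4 * (1/24))" by (intro bp)
    from integrable_norm[OF bounded_past_integrable[OF this]]
    show "integrable M (\<lambda>\<omega>. norm (\<phi> \<omega>) * norm (W \<omega>) ^ 4 / 24)" by (simp add: norm_mult norm_power)
    fix \<omega>
    have "(\<phi> \<omega> * cis (\<rho> \<omega>) - \<phi> \<omega> * of_real (1 - (norm (W \<omega>))\<^sup>2 / 4)) - G \<omega>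
      = \<phi> \<omega> * (cis (\<rho> \<omega>) - (1 + \<i> * of_real (\<rho> \<omega>) - of_real ((\<rho> \<omega>)\<^sup>2 / 2) - \<i> * of_real (\<rho> \<omega> ^ 3 / 6)))"
      unfolding G_eq by (simp add: algebra_simps)
    hence "norm ((\<phi> \<omega> * cis (\<rho> \<omega>) - \<phi> \<omega> * of_real (1 - (norm (W \<omega>))\<^sup>2 / 4)) - G \<omega>)
      = norm (\<phi> \<omega>) * norm (cis (\<rho> \<omega>) - (1 + \<i> * of_real (\<rho> \<omega>) - of_real ((\<rho> \<omega>)\<^sup>2 / 2) - \<i> * of_real (\<rho> \<omega> ^ 3 / 6)))"
      by (simp only: norm_mult)
    also have "\<dots> \<le> norm (\<phi> \<omega>) * (\<rho> \<omega> ^ 4 / 24)" by (intro mult_left_mono cis_taylor norm_ge_zero)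
    also have "\<dots> \<le> norm (\<phi> \<omega>) * (norm (W \<omega>) ^ 4 / 24)"
    proof -
      have "\<bar>\<rho> \<omega>\<bar> \<le> norm (W \<omega>)" using abs_Re_le_cmod[of "W \<omega> * X p \<omega>"] by (simp add: \<rho>_def norm_mult)
      hence "\<bar>\<rho> \<omega>\<bar> ^ 4 \<le> norm (W \<omega>) ^ 4" by (intro power_mono) auto
      hence "\<rho> \<omega> ^ 4 \<le> norm (W \<omega>) ^ 4" by (simp add: power_even_abs)
      thus ?thesis by (intro mult_left_mono divide_right_mono) auto
    qed
    finally show "norm ((\<phi> \<omega> * cis (\<rho> \<omega>) - \<phi> \<omega> * of_real (1 - (norm (W \<omega>))\<^sup>2 / 4)) - G \<omega>) \<le> norm (\<phi> \<omega>) * norm (W \<omega>) ^ 4 / 24" by simp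
  qed
  finally show ?thesis .
qed

lemma past_mono:
  assumes "k \<le> p" "Z \<in> borel_measurable (past k)"
  shows "Z \<in> borel_measurable (past p)"
proof (rule measurable_from_subalg[OF _ assms(2)])
  let ?A = "{r. prime r \<and> r < k}"
  let ?R = "\<lambda>\<omega>. restrict (\<lambda>r. X r \<omega>) ?A"
  have R: "?R \<in> measurable (past p) (PiM ?A (\<lambda>_. borel))"
    using assms(1) by (intro measurable_restrict X_past_measurable) auto
  have "sigma_sets (space (past p)) {?R -` A \<inter> space (past p) |A. A \<in> sets (PiM ?A (\<lambda>_. borel))} \<subseteq> sets (past p)"
    by (rule sets.sigma_sets_subset) (use measurable_sets[OF R] in auto)
  thus "subalgebra (past p) (past k)"
    unfolding subalgebra_def by (simp add: past_def[of k] sets_vimage_algebra)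
qed

lemma bounded_past_mono: "k \<le> p \<Longrightarrow> bounded_past k Z \<Longrightarrow> bounded_past p Z"
  using past_mono by (auto simp: bounded_past_def)

text \<open>\<open>X k\<close> belongs to the past when \<open>k\<close> is prime; at the other indices the product is
  zero.\<close>
lemma predictable_times_phase_measurable:
  assumes "bounded_past k W" "\<And>\<omega>. \<not> prime k \<Longrightarrow> W \<omega> = 0" "k < p"
  shows "(\<lambda>\<omega>. W \<omega> * X k \<omega>) \<in> borel_measurable (past p)"
proof (cases "prime k")
  case True
  have "W \<in> borel_measurable (past p)"
    by (rule past_mono[of k]) (use assms(1,3) in \<open>simp_all only: bounded_past_def less_imp_le\<close>)
  thus ?thesis by (rule borel_measurable_times[OF _ X_past_measurable[OF True assms(3)]])
next
  case False
  thus ?thesis by (simp add: assms(2))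
qed

text \<open>The process \<open>T\<close> compensates the characteristic function by the exponential of the quadratic
  variation.  In each step, \<open>phase_step\<close> produces the factor \<open>1 - s\<close> with \<open>s =
  |A m|^2 / 4\<close>, and the compensator the factor \<open>exp s\<close>, so that the mean changes only by
  fourth-order terms.  The bound \<open>B\<close> keeps the compensator under control.\<close>
lemma bounded_martingale_transform:
  fixes A :: "nat \<Rightarrow> 'a \<Rightarrow> complex"
  assumes A: "\<And>k. k < n \<Longrightarrow> bounded_past k (A k)"
    and np: "\<And>k \<omega>. k < n \<Longrightarrow> \<not> prime k \<Longrightarrow> A k \<omega> = 0"
    and B: "\<And>\<omega>. (\<Sum>k<n. (norm (A k \<omega>))\<^sup>2) \<le> B"
  defines "T \<equiv> \<lambda>m \<omega>. cis (\<Sum>k<m. Re (A k \<omega> * X k \<omega>)) * of_real (exp (\<Sum>k<m. (norm (A k \<omega>))\<^sup>2 / 4))"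
  shows "bounded_past n (T n)"
    and "norm (expectation (T n) - 1) \<le> exp (B / 4) * (\<Sum>k<n. expectation (\<lambda>\<omega>. norm (A k \<omega>) ^ 4))"
proof -
  have Bm: "(\<Sum>k<m. (norm (A k \<omega>))\<^sup>2 / 4) \<le> B / 4" if "m \<le> n" for m \<omega>
  proof -
    have "(\<Sum>k<m. (norm (A k \<omega>))\<^sup>2) \<le> (\<Sum>k<n. (norm (A k \<omega>))\<^sup>2)" using that by (intro sum_mono2) auto
    thus ?thesis using B[of \<omega>] by (simp flip: sum_divide_distrib)
  qed
  have normT: "norm (T m \<omega>) = exp (\<Sum>k<m. (norm (A k \<omega>))\<^sup>2 / 4)" for m \<omega> by (simp add: T_def norm_mult)
  have Am: "A k \<in> borel_measurable (past m)" if "k \<le> m" "k < n" for k m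
    using A[OF that(2)] past_mono[OF that(1)] by (auto simp: bounded_past_def)
  have Tb: "bounded_past m (T m)" if m: "m \<le> n" for m
    unfolding bounded_past_def
  proof (intro conjI exI allI)
    have "(\<lambda>\<omega>. \<Sum>k<m. Re (A k \<omega> * X k \<omega>)) \<in> borel_measurable (past m)"
    proof (rule borel_measurable_sum, rule Re_measurable)
      fix k assume "k \<in> {..<m}"
      thus "(\<lambda>\<omega>. A k \<omega> * X k \<omega>) \<in> borel_measurable (past m)"
        using m by (intro predictable_times_phase_measurable A np) auto
    qed
    moreover have "(\<lambda>\<omega>. complex_of_real (exp (\<Sum>k<m. (norm (A k \<omega>))\<^sup>2 / 4))) \<in> borel_measurable (past m)"
      using m by (intro of_real_exp_measurable borel_measurable_sum borel_measurable_divide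
           borel_measurable_power norm_measurable borel_measurable_const Am) auto
    ultimately show "T m \<in> borel_measurable (past m)"
      unfolding T_def by (intro borel_measurable_times cis_measurable)
    show "norm (T m \<omega>) \<le> exp (B / 4)" for \<omega> using Bm[OF m] by (simp add: normT)
  qed
  thus "bounded_past n (T n)" by simp
  have "m \<le> n \<Longrightarrow> norm (expectation (T m) - 1) \<le> exp (B / 4) * (\<Sum>k<m. expectation (\<lambda>\<omega>. norm (A k \<omega>) ^ 4))" for m
  proof (induction m)
    case 0
    show ?case by (simp add: T_def prob_space)
  next
    case (Suc m)
    hence m: "m < n" by simp
    have i4: "integrable M (\<lambda>\<omega>. norm (A m \<omega>) ^ 4)"
      using integrable_norm[OF bounded_past_integrable[OF bounded_past_power[OF A[OF m], of 4]]] by (simp add: norm_power)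
    define s where "s = (\<lambda>\<omega>. (norm (A m \<omega>))\<^sup>2 / 4)"
    have s2: "(s \<omega>)\<^sup>2 = norm (A m \<omega>) ^ 4 / 16" "0 \<le> s \<omega>" for \<omega>
      by (simp_all add: s_def power_divide flip: power_mult)
    define \<phi> where "\<phi> = (\<lambda>\<omega>. T m \<omega> * of_real (exp (s \<omega>)))"
    have n\<phi>: "norm (\<phi> \<omega>) = exp (\<Sum>k<Suc m. (norm (A k \<omega>))\<^sup>2 / 4)" for \<omega>
      by (simp add: \<phi>_def norm_mult normT s_def exp_add)
    have n\<phi>B: "norm (\<phi> \<omega>) \<le> exp (B / 4)" for \<omega> unfolding n\<phi> using Bm[OF Suc.prems] by simp
    have "bounded_past m \<phi>"
      unfolding bounded_past_def
    proof (intro conjI exI allI)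
      show "norm (\<phi> \<omega>) \<le> exp (B / 4)" for \<omega> by (rule n\<phi>B)
      have "(\<lambda>\<omega>. complex_of_real (exp (s \<omega>))) \<in> borel_measurable (past m)"
        unfolding s_def
        by (intro of_real_exp_measurable borel_measurable_divide borel_measurable_power norm_measurable
            borel_measurable_const Am order_refl m)
      thus "\<phi> \<in> borel_measurable (past m)"
        unfolding \<phi>_def using Tb[of m] m by (intro borel_measurable_times) (auto simp: bounded_past_def)
    qed
    note \<phi>b = this
    have TS: "T (Suc m) \<omega> = \<phi> \<omega> * cis (Re (A m \<omega> * X m \<omega>))" for \<omega>
      by (simp add: T_def \<phi>_def s_def exp_add mult_ac flip: cis_mult)
    have TSf: "T (Suc m) = (\<lambda>\<omega>. \<phi> \<omega> * cis (Re (A m \<omega> * X m \<omega>)))" by (rule ext) (rule TS)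
    have step1: "norm (expectation (T (Suc m)) - expectation (\<lambda>\<omega>. \<phi> \<omega> * of_real (1 - s \<omega>)))
        \<le> expectation (\<lambda>\<omega>. norm (\<phi> \<omega>) * norm (A m \<omega>) ^ 4 / 24)"
    proof (cases "prime m")
      case True
      show ?thesis unfolding TSf s_def by (rule phase_step[OF True \<phi>b A[OF m]])
    next
      case False
      hence "A m \<omega> = 0" for \<omega> using np[OF m] by blast
      thus ?thesis unfolding TSf s_def by simp
    qed
    also have step1': "\<dots> \<le> expectation (\<lambda>\<omega>. exp (B / 4) * norm (A m \<omega>) ^ 4 / 24)"
    proof (rule integral_mono)
      have "bounded_past m (\<lambda>\<omega>. \<phi> \<omega> * A m \<omega> ^ 4 * (1 / 24))"
        by (intro bounded_past_mult \<phi>b bounded_past_power A m bounded_past_const)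
      from integrable_norm[OF bounded_past_integrable[OF this]]
      show "integrable M (\<lambda>\<omega>. norm (\<phi> \<omega>) * norm (A m \<omega>) ^ 4 / 24)" by (simp add: norm_mult norm_power)
      show "integrable M (\<lambda>\<omega>. exp (B / 4) * norm (A m \<omega>) ^ 4 / 24)" using i4 by simp
      show "norm (\<phi> \<omega>) * norm (A m \<omega>) ^ 4 / 24 \<le> exp (B / 4) * norm (A m \<omega>) ^ 4 / 24" for \<omega>
        using n\<phi>B by (intro divide_right_mono mult_right_mono) auto
    qed
    finally have 1: "norm (expectation (T (Suc m)) - expectation (\<lambda>\<omega>. \<phi> \<omega> * of_real (1 - s \<omega>)))
        \<le> exp (B / 4) * expectation (\<lambda>\<omega>. norm (A m \<omega>) ^ 4) / 24" by simp
    have bs: "bounded_past m (\<lambda>\<omega>. \<phi> \<omega> * of_real (1 - s \<omega>))"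
    proof -
      have "bounded_past m (\<lambda>\<omega>. \<phi> \<omega> * (1 + (- 1/4) * (A m \<omega> * cnj (A m \<omega>))))"
        by (intro bounded_past_mult bounded_past_add bounded_past_const bounded_past_cnj \<phi>b A m)
      moreover have "complex_of_real (1 - s \<omega>) = 1 + (- 1/4) * (A m \<omega> * cnj (A m \<omega>))" for \<omega>
        unfolding s_def of_real_diff of_real_divide complex_norm_square by simp
      ultimately show ?thesis by (simp only:)
    qed
    have Ti: "integrable M (T m)" using Tb[of m] m by (intro bounded_past_integrable[of m]) auto
    have "expectation (\<lambda>\<omega>. \<phi> \<omega> * of_real (1 - s \<omega>)) - expectation (T m) = expectation (\<lambda>\<omega>. \<phi> \<omega> * of_real (1 - s \<omega>) - T m \<omega>)"
      by (intro Bochner_Integration.integral_diff[symmetric] bounded_past_integrable[OF bs] Ti)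
    also have "norm \<dots> \<le> expectation (\<lambda>\<omega>. norm (\<phi> \<omega> * of_real (1 - s \<omega>) - T m \<omega>))" by (rule integral_norm_bound)
    also have "\<dots> \<le> expectation (\<lambda>\<omega>. exp (B / 4) * norm (A m \<omega>) ^ 4 / 16)"
    proof (rule integral_mono)
      show "integrable M (\<lambda>\<omega>. norm (\<phi> \<omega> * of_real (1 - s \<omega>) - T m \<omega>))"
        by (intro integrable_norm Bochner_Integration.integrable_diff bounded_past_integrable[OF bs] Ti)
      show "integrable M (\<lambda>\<omega>. exp (B / 4) * norm (A m \<omega>) ^ 4 / 16)" using i4 by simp
      fix \<omega>
      have "\<phi> \<omega> * of_real (1 - s \<omega>) - T m \<omega> = T m \<omega> * of_real (exp (s \<omega>) * (1 - s \<omega>) - 1)"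
        by (simp add: \<phi>_def algebra_simps)
      hence "norm (\<phi> \<omega> * of_real (1 - s \<omega>) - T m \<omega>) = norm (T m \<omega>) * \<bar>exp (s \<omega>) * (1 - s \<omega>) - 1\<bar>"
        by (metis norm_mult norm_of_real real_norm_def)
      also have "\<dots> \<le> norm (T m \<omega>) * (exp (s \<omega>) * (s \<omega>)\<^sup>2)" by (intro mult_left_mono exp_times_one_minus s2) auto
      also have "\<dots> = norm (\<phi> \<omega>) * (norm (A m \<omega>) ^ 4 / 16)" by (simp add: \<phi>_def norm_mult s2)
      also have "\<dots> \<le> exp (B / 4) * (norm (A m \<omega>) ^ 4 / 16)" using n\<phi>B by (intro mult_right_mono) auto
      finally show "norm (\<phi> \<omega> * of_real (1 - s \<omega>) - T m \<omega>) \<le> exp (B / 4) * norm (A m \<omega>) ^ 4 / 16" by simp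
    qed
    finally have 2: "norm (expectation (\<lambda>\<omega>. \<phi> \<omega> * of_real (1 - s \<omega>)) - expectation (T m))
        \<le> exp (B / 4) * expectation (\<lambda>\<omega>. norm (A m \<omega>) ^ 4) / 16" by simp
    have E0: "0 \<le> exp (B / 4) * expectation (\<lambda>\<omega>. norm (A m \<omega>) ^ 4)" by (intro mult_nonneg_nonneg integral_nonneg_AE) auto
    have tri: "norm (a - 1) \<le> norm (a - b) + norm (b - c) + norm (c - 1)" for a b c :: complex
      using norm_triangle_ineq[of "a - b" "b - c"] norm_triangle_ineq[of "a - c" "c - 1"] by simp
    have "norm (expectation (T (Suc m)) - 1) \<le> exp (B / 4) * expectation (\<lambda>\<omega>. norm (A m \<omega>) ^ 4) / 24
       + exp (B / 4) * expectation (\<lambda>\<omega>. norm (A m \<omega>) ^ 4) / 16 + exp (B / 4) * (\<Sum>k<m. expectation (\<lambda>\<omega>. norm (A k \<omega>) ^ 4))"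
      using tri[of "expectation (T (Suc m))" "expectation (\<lambda>\<omega>. \<phi> \<omega> * of_real (1 - s \<omega>))" "expectation (T m)"] 1 2 Suc.IH m by simp
    also have "\<dots> \<le> exp (B / 4) * (\<Sum>k<Suc m. expectation (\<lambda>\<omega>. norm (A k \<omega>) ^ 4))"
      using E0 by (simp add: distrib_left)
    finally show ?case .
  qed
  thus "norm (expectation (T n) - 1) \<le> exp (B / 4) * (\<Sum>k<n. expectation (\<lambda>\<omega>. norm (A k \<omega>) ^ 4))" by simp
qed

text \<open>A quantitative central limit theorem.  To make the quadratic variation bounded, the coefficients are switched
  off as soon as it would exceed 2; this decision depends only on the past.  If \<open>V \<le> 2\<close> nothing
  has been switched off, and the compensator \<open>exp (a * V / 4)\<close> differs from \<open>exp (a /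
  4)\<close> by \<open>O(|V - 1|)\<close>.  If \<open>V > 2\<close> a trivial bound is enough, since then
  \<open>|V - 1| > 1\<close>.\<close>
lemma characteristic_function_close_to_gaussian:
  fixes A :: "nat \<Rightarrow> 'a \<Rightarrow> complex" and \<xi> :: complex
  assumes A: "\<And>k. k < n \<Longrightarrow> bounded_past k (A k)"
    and np: "\<And>k \<omega>. k < n \<Longrightarrow> \<not> prime k \<Longrightarrow> A k \<omega> = 0"
  defines "V \<equiv> \<lambda>\<omega>. \<Sum>k<n. (norm (A k \<omega>))\<^sup>2" and "a \<equiv> (norm \<xi>)\<^sup>2"
  shows "norm (expectation (\<lambda>\<omega>. cis (\<xi> \<bullet> (\<Sum>k<n. A k \<omega> * X k \<omega>))) - of_real (exp (- a / 4)))
     \<le> (2 + a)\<^sup>2 * exp a * (expectation (\<lambda>\<omega>. \<bar>V \<omega> - 1\<bar>) + (\<Sum>k<n. expectation (\<lambda>\<omega>. norm (A k \<omega>) ^ 4)))"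
proof -
  (* The switch: the total up to and including k is known before X k is revealed. *)
  define J where "J = (\<lambda>k \<omega>. if (\<Sum>r\<le>k. (norm (A r \<omega>))\<^sup>2) \<le> 2 then 1 else (0::complex))"
  define A' where "A' = (\<lambda>k \<omega>. cnj \<xi> * A k \<omega> * J k \<omega>)"
  have a0: "a \<ge> 0" by (simp add: a_def)
  have normA': "(norm (A' k \<omega>))\<^sup>2 = a * ((norm (A k \<omega>))\<^sup>2 * (if (\<Sum>r\<le>k. (norm (A r \<omega>))\<^sup>2) \<le> 2 then 1 else 0))" for k \<omega>
    by (simp add: A'_def J_def a_def norm_mult power_mult_distrib)
  have Am: "A k \<in> borel_measurable (past m)" if "k \<le> m" "k < n" for k m
    using A[OF that(2)] past_mono[OF that(1)] by (auto simp: bounded_past_def)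
  have A'b: "bounded_past k (A' k)" if k: "k < n" for k
  proof -
    have "bounded_past k (J k)"
      unfolding bounded_past_def
    proof (intro conjI exI allI)
      have "(\<lambda>\<omega>. \<Sum>r\<le>k. (norm (A r \<omega>))\<^sup>2) \<in> borel_measurable (past k)"
        using k by (intro borel_measurable_sum borel_measurable_power norm_measurable Am) auto
      hence "{\<omega> \<in> space (past k). (\<Sum>r\<le>k. (norm (A r \<omega>))\<^sup>2) \<le> 2} \<in> sets (past k)" by measurable
      thus "J k \<in> borel_measurable (past k)" unfolding J_def by (intro measurable_If measurable_const) auto
      show "norm (J k \<omega>) \<le> 1" for \<omega> by (simp add: J_def)
    qed
    thus ?thesis unfolding A'_def by (intro bounded_past_mult bounded_past_const A k)
  qed
  have sumA': "(\<Sum>k<n. (norm (A' k \<omega>))\<^sup>2) \<le> 2 * a" for \<omega>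
    unfolding normA' sum_distrib_left[symmetric]
    using mult_left_mono[OF stopped_sum_le[of "\<lambda>k. (norm (A k \<omega>))\<^sup>2" 2 n] a0] by simp
  define T where "T = (\<lambda>\<omega>. cis (\<Sum>k<n. Re (A' k \<omega> * X k \<omega>)) * of_real (exp (\<Sum>k<n. (norm (A' k \<omega>))\<^sup>2 / 4)))"
  have np': "A' k \<omega> = 0" if "k < n" "\<not> prime k" for k \<omega> using np[OF that] by (simp add: A'_def)
  note bmt = bounded_martingale_transform[of n A' "2 * a", OF A'b np' sumA', folded T_def]
  have Ti: "integrable M T" by (rule bounded_past_integrable[OF bmt(1)])
  have i4: "integrable M (\<lambda>\<omega>. norm (A k \<omega>) ^ 4)" if "k < n" for k
    using integrable_norm[OF bounded_past_integrable[OF bounded_past_power[OF A[OF that], of 4]]] by (simp add: norm_power)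
  have "norm (expectation T - 1) \<le> exp (2 * a / 4) * (\<Sum>k<n. expectation (\<lambda>\<omega>. norm (A' k \<omega>) ^ 4))" by (rule bmt(2))
  also have "\<dots> \<le> exp (2 * a / 4) * (\<Sum>k<n. a\<^sup>2 * expectation (\<lambda>\<omega>. norm (A k \<omega>) ^ 4))"
  proof (intro mult_left_mono sum_mono)
    fix k assume k: "k \<in> {..<n}"
    have "expectation (\<lambda>\<omega>. norm (A' k \<omega>) ^ 4) \<le> expectation (\<lambda>\<omega>. a\<^sup>2 * norm (A k \<omega>) ^ 4)"
    proof (rule integral_mono)
      show "integrable M (\<lambda>\<omega>. norm (A' k \<omega>) ^ 4)"
        using integrable_norm[OF bounded_past_integrable[OF bounded_past_power[OF A'b, of k 4]]] k by (simp add: norm_power)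
      show "integrable M (\<lambda>\<omega>. a\<^sup>2 * norm (A k \<omega>) ^ 4)" using i4 k by simp
      fix \<omega>
      have "norm (A' k \<omega>) ^ 4 = ((norm (A' k \<omega>))\<^sup>2)\<^sup>2" by simp
      also have "\<dots> \<le> (a * (norm (A k \<omega>))\<^sup>2)\<^sup>2" unfolding normA' using a0 by (intro power_mono mult_left_mono) auto
      also have "\<dots> = a\<^sup>2 * norm (A k \<omega>) ^ 4" by (simp add: power_mult_distrib)
      finally show "norm (A' k \<omega>) ^ 4 \<le> a\<^sup>2 * norm (A k \<omega>) ^ 4" .
    qed
    thus "expectation (\<lambda>\<omega>. norm (A' k \<omega>) ^ 4) \<le> a\<^sup>2 * expectation (\<lambda>\<omega>. norm (A k \<omega>) ^ 4)" by simp
  qed simp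
  also have "\<dots> = exp (a / 2) * a\<^sup>2 * (\<Sum>k<n. expectation (\<lambda>\<omega>. norm (A k \<omega>) ^ 4))" by (simp add: sum_distrib_left mult.assoc)
  finally have T1: "norm (expectation T - 1) \<le> exp (a / 2) * a\<^sup>2 * (\<Sum>k<n. expectation (\<lambda>\<omega>. norm (A k \<omega>) ^ 4))" .
  define c where "c = complex_of_real (exp (- a / 4))"
  have normc: "norm c \<le> 1" using a0 by (simp add: c_def)
  define S where "S = (\<lambda>\<omega>. \<Sum>k<n. A k \<omega> * X k \<omega>)"
  have Sm: "S \<in> borel_measurable M"
    unfolding S_def using np by (intro borel_measurable_sum past_measurable_M[of _ n] predictable_times_phase_measurable A) auto
  have cS: "(\<lambda>\<omega>. cis (\<xi> \<bullet> S \<omega>)) \<in> borel_measurable M"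
    by (rule borel_measurable_continuous_on[OF _ Sm]) (intro continuous_intros)
  have iS: "integrable M (\<lambda>\<omega>. cis (\<xi> \<bullet> S \<omega>))" by (rule bounded_integrable[of _ 1]) (use cS in auto)
  have Vb: "integrable M V"
  proof -
    have "integrable M (\<lambda>\<omega>. (norm (A k \<omega>))\<^sup>2)" if "k < n" for k
      using integrable_norm[OF bounded_past_integrable[OF bounded_past_power[OF A[OF that], of 2]]] by (simp add: norm_power)
    thus ?thesis unfolding V_def by (intro Bochner_Integration.integrable_sum) auto
  qed
  have V0: "V \<omega> \<ge> 0" for \<omega> by (simp add: V_def sum_nonneg)
  have K1: "1 \<le> exp a" "exp (a / 2) \<le> exp a" "exp (a / 4) \<le> exp a" using a0 by auto
  (* T * c is the compensated exponential, normalised to have mean close to c. *)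
  have pt: "norm (cis (\<xi> \<bullet> S \<omega>) - T \<omega> * c) \<le> (2 + a) * exp a * \<bar>V \<omega> - 1\<bar>" for \<omega>
  proof (cases "V \<omega> \<le> 2")
    case True
    have J1: "J k \<omega> = 1" if "k < n" for k
    proof -
      have "(\<Sum>r\<le>k. (norm (A r \<omega>))\<^sup>2) \<le> V \<omega>" unfolding V_def using that by (intro sum_mono2) auto
      thus ?thesis using True by (simp add: J_def)
    qed
    have "Re (A' k \<omega> * X k \<omega>) = \<xi> \<bullet> (A k \<omega> * X k \<omega>)" if "k < n" for k
      using J1[OF that] by (simp add: A'_def inner_complex_def algebra_simps)
    hence "(\<Sum>k<n. Re (A' k \<omega> * X k \<omega>)) = \<xi> \<bullet> S \<omega>" by (simp add: S_def inner_sum_right)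
    moreover have "(\<Sum>k<n. (norm (A' k \<omega>))\<^sup>2 / 4) = a * V \<omega> / 4"
      by (simp add: A'_def J1 norm_mult power_mult_distrib a_def V_def sum_distrib_left sum_divide_distrib)
    ultimately have "T \<omega> * c = cis (\<xi> \<bullet> S \<omega>) * of_real (exp (a * V \<omega> / 4) * exp (- a / 4))"
      by (simp add: T_def c_def)
    also have "exp (a * V \<omega> / 4) * exp (- a / 4) = exp (a * (V \<omega> - 1) / 4)"
      unfolding mult_exp_exp by (simp add: right_diff_distrib diff_divide_distrib)
    finally have "T \<omega> * c = cis (\<xi> \<bullet> S \<omega>) * of_real (exp (a * (V \<omega> - 1) / 4))" .
    hence "cis (\<xi> \<bullet> S \<omega>) - T \<omega> * c = cis (\<xi> \<bullet> S \<omega>) * of_real (1 - exp (a * (V \<omega> - 1) / 4))"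
      by (simp add: algebra_simps)
    hence "norm (cis (\<xi> \<bullet> S \<omega>) - T \<omega> * c) = \<bar>1 - exp (a * (V \<omega> - 1) / 4)\<bar>"
      by (metis mult_1 norm_cis norm_mult norm_of_real real_norm_def)
    also have "\<dots> \<le> \<bar>a * (V \<omega> - 1) / 4\<bar> * exp \<bar>a * (V \<omega> - 1) / 4\<bar>"
    proof -
      have "\<bar>1 - exp x\<bar> \<le> \<bar>x\<bar> * exp \<bar>x\<bar>" for x :: real
      proof (cases "x \<ge> 0")
        case True
        have "exp x * (1 - x) \<le> exp x * exp (- x)" using exp_ge_add_one_self[of "-x"] by (intro mult_left_mono) auto
        hence "exp x - 1 \<le> x * exp x" by (simp add: algebra_simps flip: exp_add)
        thus ?thesis using True by simp
      next
        case False
        have "1 - exp x \<le> - x" using exp_ge_add_one_self[of x] by linarith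
        also have "\<dots> \<le> - x * exp (- x)" using False by (simp add: mult_le_cancel_left1)
        finally show ?thesis using False by simp
      qed
      thus ?thesis .
    qed
    also have "\<dots> \<le> (a * \<bar>V \<omega> - 1\<bar>) * exp a"
    proof (intro mult_mono)
      show "\<bar>a * (V \<omega> - 1) / 4\<bar> \<le> a * \<bar>V \<omega> - 1\<bar>" using a0 by (simp add: abs_mult)
      have "\<bar>V \<omega> - 1\<bar> \<le> 1" using True V0[of \<omega>] by linarith
      hence "a * \<bar>V \<omega> - 1\<bar> \<le> a * 1" using a0 by (intro mult_left_mono)
      thus "exp \<bar>a * (V \<omega> - 1) / 4\<bar> \<le> exp a" using a0 by (simp add: abs_mult)
    qed (use a0 in auto)
    also have "\<dots> \<le> (2 + a) * exp a * \<bar>V \<omega> - 1\<bar>" by (simp add: algebra_simps)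
    finally show ?thesis .
  next
    case False
    have "norm (T \<omega>) \<le> exp (a / 2)"
      using sumA'[of \<omega>] by (simp add: T_def norm_mult flip: sum_divide_distrib)
    hence "norm (T \<omega>) \<le> exp a" using K1(2) by linarith
    hence "norm (T \<omega> * c) \<le> exp a * 1" unfolding norm_mult using normc by (intro mult_mono) auto
    hence "norm (cis (\<xi> \<bullet> S \<omega>) - T \<omega> * c) \<le> 1 + exp a"
      using norm_triangle_ineq4[of "cis (\<xi> \<bullet> S \<omega>)" "T \<omega> * c"] by simp
    also have "\<dots> \<le> (2 + a) * exp a"
    proof -
      have "0 \<le> a * exp a" using a0 by simp
      moreover have "(2 + a) * exp a = 2 * exp a + a * exp a" by (rule distrib_right)
      ultimately show ?thesis using K1(1) by linarith
    qed
    also have "(2 + a) * exp a * 1 \<le> (2 + a) * exp a * \<bar>V \<omega> - 1\<bar>"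
      using False a0 by (intro mult_left_mono) auto
    hence "(2 + a) * exp a \<le> (2 + a) * exp a * \<bar>V \<omega> - 1\<bar>" by simp
    finally show ?thesis .
  qed
  have "expectation (\<lambda>\<omega>. cis (\<xi> \<bullet> S \<omega>)) - c = expectation (\<lambda>\<omega>. cis (\<xi> \<bullet> S \<omega>) - T \<omega> * c) + (expectation T - 1) * c"
    using iS Ti by (simp add: Bochner_Integration.integral_diff algebra_simps)
  also have "norm \<dots> \<le> norm (expectation (\<lambda>\<omega>. cis (\<xi> \<bullet> S \<omega>) - T \<omega> * c)) + norm (expectation T - 1) * norm c"
    using norm_triangle_ineq[of "expectation (\<lambda>\<omega>. cis (\<xi> \<bullet> S \<omega>) - T \<omega> * c)" "(expectation T - 1) * c"]
    by (simp only: norm_mult)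
  also have "norm (expectation (\<lambda>\<omega>. cis (\<xi> \<bullet> S \<omega>) - T \<omega> * c)) \<le> expectation (\<lambda>\<omega>. norm (cis (\<xi> \<bullet> S \<omega>) - T \<omega> * c))"
    by (rule integral_norm_bound)
  also have "\<dots> \<le> expectation (\<lambda>\<omega>. (2 + a) * exp a * \<bar>V \<omega> - 1\<bar>)"
    using iS Ti Vb pt by (intro integral_mono) auto
  also have "\<dots> = (2 + a) * exp a * expectation (\<lambda>\<omega>. \<bar>V \<omega> - 1\<bar>)" by simp
  also have "\<dots> \<le> (2 + a)\<^sup>2 * exp a * expectation (\<lambda>\<omega>. \<bar>V \<omega> - 1\<bar>)"
  proof (intro mult_right_mono)
    show "2 + a \<le> (2 + a)\<^sup>2" using a0 by (simp add: self_le_power)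
  qed auto
  also have "norm (expectation T - 1) * norm c \<le> (2 + a)\<^sup>2 * exp a * (\<Sum>k<n. expectation (\<lambda>\<omega>. norm (A k \<omega>) ^ 4))"
  proof -
    have "norm (expectation T - 1) * norm c \<le> norm (expectation T - 1) * 1" using normc by (intro mult_left_mono) auto
    also have "\<dots> \<le> exp (a / 2) * a\<^sup>2 * (\<Sum>k<n. expectation (\<lambda>\<omega>. norm (A k \<omega>) ^ 4))" using T1 by simp
    also have "\<dots> \<le> exp a * (2 + a)\<^sup>2 * (\<Sum>k<n. expectation (\<lambda>\<omega>. norm (A k \<omega>) ^ 4))"
      using K1 a0 by (intro mult_right_mono mult_mono power_mono sum_nonneg integral_nonneg_AE) auto
    finally show ?thesis by (simp add: mult_ac)
  qed
  finally show ?thesis unfolding S_def c_def by (simp add: distrib_left)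
qed

end

section \<open>Characters of a Steinhaus function\<close>

definition reduced :: "nat \<times> nat \<Rightarrow> nat \<times> nat" where
  "reduced = (\<lambda>(m, n). (m div gcd m n, n div gcd m n))"

lemma reduced_coprime:
  assumes "m > 0" "n > 0" "reduced (m, n) = (a, b)"
  shows "coprime a b" "a > 0" "b > 0"
  using assms div_gcd_coprime[of m n] by (auto simp: reduced_def div_greater_zero_iff gcd_le1_nat gcd_le2_nat)

lemma reduced_eq_1: "m > 0 \<Longrightarrow> n > 0 \<Longrightarrow> reduced (m, n) = (1, 1) \<longleftrightarrow> m = n"
proof
  assume a: "m > 0" "n > 0" "reduced (m, n) = (1, 1)"
  hence "m div gcd m n = 1" "n div gcd m n = 1" by (auto simp: reduced_def)
  thus "m = n" by (metis dvd_mult_div_cancel gcd_dvd1 gcd_dvd2)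
qed (auto simp: reduced_def)

text \<open>The coefficient of \<open>f a * cnj (f b)\<close>, for \<open>r = (a, b)\<close>, when the quadratic variation
  is expanded: the pairs \<open>m, n\<close> over the same prime \<open>p\<close> are collected according to the
  reduced fraction of \<open>m / n\<close>.\<close>
definition ratio_sum :: "(nat \<times> nat) set \<Rightarrow> (nat \<Rightarrow> complex) \<Rightarrow> nat \<times> nat \<Rightarrow> complex" where
  "ratio_sum E c r = (\<Sum>(p, m, n)\<in>{(p, m, n). (p, m) \<in> E \<and> (p, n) \<in> E \<and> reduced (m, n) = r}. c (p * m) * cnj (c (p * n)))"

context steinhaus_phases
begin

text \<open>The completely multiplicative function with values \<open>X p\<close> at the primes, given as a product over
  the prime factorization.\<close>
definition chi :: "nat \<Rightarrow> 'a \<Rightarrow> complex" where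
  "chi n \<omega> = prod_mset (image_mset (\<lambda>p. X p \<omega>) (prime_factorization n))"

lemma chi_mult: "m > 0 \<Longrightarrow> n > 0 \<Longrightarrow> chi (m * n) \<omega> = chi m \<omega> * chi n \<omega>"
  by (simp add: chi_def prime_factorization_mult)

lemma chi_1 [simp]: "chi 1 \<omega> = 1" "chi (Suc 0) \<omega> = 1"
  by (simp_all add: chi_def)

lemma chi_prime: "prime p \<Longrightarrow> chi p \<omega> = X p \<omega>"
  by (simp add: chi_def prime_factorization_prime)

lemma chi_eq_prod: "chi n \<omega> = (\<Prod>p\<in>prime_factors n. X p \<omega> ^ multiplicity p n)"
  unfolding chi_def image_prod_mset_multiplicity
  by (intro prod.cong refl) (auto simp: count_prime_factorization)

lemma chi_eq_prod_superset:
  assumes "n > 0" "finite P" "prime_factors n \<subseteq> P" "P \<subseteq> {p. prime p}"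
  shows "chi n \<omega> = (\<Prod>p\<in>P. X p \<omega> ^ multiplicity p n)"
  unfolding chi_eq_prod
proof (rule prod.mono_neutral_left[OF assms(2,3)], rule ballI)
  fix p assume "p \<in> P - prime_factors n"
  hence "\<not> p dvd n" using assms(1,4) by (auto simp: in_prime_factors_iff)
  thus "X p \<omega> ^ multiplicity p n = 1" by (simp add: not_dvd_imp_multiplicity_0)
qed

lemma norm_chi [simp]: "norm (chi n \<omega>) = 1"
  by (simp add: chi_eq_prod norm_power flip: prod_norm)

lemma chi_cnj: "chi n \<omega> * cnj (chi n \<omega>) = 1"
  by (simp flip: complex_norm_square)

lemma chi_past_measurable:
  assumes "\<And>r. r \<in> prime_factors n \<Longrightarrow> r < p"
  shows "chi n \<in> borel_measurable (past p)"
proof -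
  have "(\<lambda>\<omega>. \<Prod>r\<in>prime_factors n. X r \<omega> ^ multiplicity r n) \<in> borel_measurable (past p)"
    using assms by (intro borel_measurable_prod borel_measurable_power X_past_measurable) auto
  thus ?thesis by (simp add: chi_eq_prod cong: measurable_cong)
qed

lemma chi_bounded_past: "(\<And>r. r \<in> prime_factors n \<Longrightarrow> r < p) \<Longrightarrow> bounded_past p (chi n)"
  unfolding bounded_past_def by (intro conjI chi_past_measurable exI[of _ 1]) auto

lemma chi_measurable: "chi n \<in> borel_measurable M"
proof (rule past_measurable_M[OF chi_past_measurable])
  fix r assume "r \<in> prime_factors n"
  thus "r < Suc n" using dvd_imp_le[of r n] by (cases "n = 0") (auto simp: in_prime_factors_iff)
qed

text \<open>Some prime occurs with different multiplicities in \<open>m\<close> and \<open>n\<close>; its factor in the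
  product over primes has mean zero, and the factors are independent.\<close>
lemma chi_orthogonal:
  assumes mn: "m > 0" "n > 0" "m \<noteq> n"
  shows "expectation (\<lambda>\<omega>. chi m \<omega> * cnj (chi n \<omega>)) = 0"
proof -
  define P where "P = prime_factors m \<union> prime_factors n"
  define Y where "Y = (\<lambda>q \<omega>. X q \<omega> ^ multiplicity q m * cnj (X q \<omega>) ^ multiplicity q n)"
  have P: "finite P" "P \<subseteq> {p. prime p}" by (auto simp: P_def)
  have m: "chi m \<omega> = (\<Prod>q\<in>P. X q \<omega> ^ multiplicity q m)" for \<omega>
    using mn P by (intro chi_eq_prod_superset) (auto simp: P_def)
  have n: "chi n \<omega> = (\<Prod>q\<in>P. X q \<omega> ^ multiplicity q n)" for \<omega>
    using mn P by (intro chi_eq_prod_superset) (auto simp: P_def)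
  have eq: "(\<lambda>\<omega>. chi m \<omega> * cnj (chi n \<omega>)) = (\<lambda>\<omega>. \<Prod>q\<in>P. Y q \<omega>)"
    by (rule ext) (simp add: m n Y_def prod.distrib)
  have ind: "indep_vars (\<lambda>_. borel) Y P"
    unfolding Y_def
  proof (rule indep_vars_compose2[OF indep_vars_subset[OF indep P(2)]])
    show "(\<lambda>z. z ^ multiplicity q m * cnj z ^ multiplicity q n) \<in> borel_measurable borel" for q
      by (intro borel_measurable_continuous_onI continuous_intros)
  qed
  have Ym: "Y q \<in> borel_measurable M" if "q \<in> P" for q
    using ind that by (auto simp: indep_vars_def)
  have Yi: "integrable M (Y q)" if "q \<in> P" for q
    by (rule bounded_integrable[of _ 1]) (use Ym[OF that] in \<open>auto simp: Y_def norm_mult norm_power\<close>)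
  obtain p where p: "prime p" "multiplicity p m \<noteq> multiplicity p n"
    using multiplicity_eq_nat[of m n] mn by blast
  have pP: "p \<in> P"
  proof (rule ccontr)
    assume "p \<notin> P"
    hence "multiplicity p m = 0" "multiplicity p n = 0"
      using p(1) mn by (auto simp: P_def in_prime_factors_iff not_dvd_imp_multiplicity_0)
    thus False using p(2) by simp
  qed
  have Xc: "X p \<omega> * cnj (X p \<omega>) = 1" for \<omega> by (simp flip: complex_norm_square)
  have Xpow: "X p \<omega> ^ k * cnj (X p \<omega>) ^ k = 1" for \<omega> k
    unfolding power_mult_distrib[symmetric] Xc by simp
  have "expectation (Y p) = 0"
  proof (cases "multiplicity p m > multiplicity p n")
    case True
    define k where "k = multiplicity p m - multiplicity p n"
    have k: "multiplicity p m = multiplicity p n + k" "k \<ge> 1" using True by (simp_all add: k_def)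
    have "Y p = (\<lambda>\<omega>. X p \<omega> ^ k)"
    proof (rule ext)
      fix \<omega>
      show "Y p \<omega> = X p \<omega> ^ k" using Xpow[of \<omega> "multiplicity p n"]
        unfolding Y_def k(1) power_add by (simp add: mult.commute mult.left_commute)
    qed
    thus ?thesis using expectation_X_power[OF p(1) k(2)] by simp
  next
    case False
    define k where "k = multiplicity p n - multiplicity p m"
    have k: "multiplicity p n = multiplicity p m + k" "k \<ge> 1" using False p(2) by (simp_all add: k_def)
    have "Y p = (\<lambda>\<omega>. 1 * cnj (X p \<omega>) ^ k)"
    proof (rule ext)
      fix \<omega>
      show "Y p \<omega> = 1 * cnj (X p \<omega>) ^ k" using Xpow[of \<omega> "multiplicity p m"]
        unfolding Y_def k(1) power_add by (simp add: mult.assoc[symmetric])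
    qed
    thus ?thesis using expectation_past_times_cnj_phase(2)[OF p(1) k(2) bounded_past_const[of p 1]] by simp
  qed
  moreover have "expectation (\<lambda>\<omega>. \<Prod>q\<in>P. Y q \<omega>) = (\<Prod>q\<in>P. expectation (Y q))"
    by (rule indep_vars_lebesgue_integral[OF P(1) ind Yi])
  ultimately show ?thesis unfolding eq using pP P(1) by (simp add: prod_zero_iff) blast
qed

definition chi_ratio :: "nat \<times> nat \<Rightarrow> 'a \<Rightarrow> complex" where
  "chi_ratio r \<omega> = chi (fst r) \<omega> * cnj (chi (snd r) \<omega>)"

lemma chi_ratio_measurable: "chi_ratio r \<in> borel_measurable M"
  unfolding chi_ratio_def by (intro borel_measurable_times cnj_measurable chi_measurable)

lemma norm_chi_ratio: "norm (chi_ratio r \<omega>) = 1"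
  by (simp add: chi_ratio_def norm_mult)

text \<open>Two reduced fractions with the same cross products are equal, so that this is orthogonality of
  \<open>chi\<close> at \<open>a * b'\<close> and \<open>a' * b\<close>.\<close>
lemma chi_ratio_orthogonal:
  assumes "coprime a b" "coprime a' b'" "a > 0" "b > 0" "a' > 0" "b' > 0" "(a, b) \<noteq> (a', b')"
  shows "expectation (\<lambda>\<omega>. chi_ratio (a, b) \<omega> * cnj (chi_ratio (a', b') \<omega>)) = 0"
proof -
  have ne: "a * b' \<noteq> b * a'"
  proof
    assume eq: "a * b' = b * a'"
    have "a dvd a'" using assms(1) eq by (metis coprime_dvd_mult_right_iff dvd_triv_left)
    moreover have "a' dvd a" using assms(2) eq by (metis coprime_dvd_mult_left_iff dvd_triv_right)
    ultimately have "a = a'" by (rule dvd_antisym)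
    thus False using eq assms by simp
  qed
  have "chi_ratio (a, b) \<omega> * cnj (chi_ratio (a', b') \<omega>) = chi (a * b') \<omega> * cnj (chi (b * a') \<omega>)" for \<omega>
    using assms by (simp add: chi_ratio_def chi_mult)
  thus ?thesis using chi_orthogonal[of "a * b'" "b * a'"] ne assms by simp
qed

lemma chi_ratio_reduced:
  assumes "m > 0" "n > 0"
  shows "chi m \<omega> * cnj (chi n \<omega>) = chi_ratio (reduced (m, n)) \<omega>"
proof -
  define g where "g = gcd m n"
  have g: "g > 0" "m = g * (m div g)" "n = g * (n div g)" using assms by (auto simp: g_def)
  hence p: "m div g > 0" "n div g > 0" using assms by (metis mult_0_right neq0_conv)+
  have "chi m \<omega> * cnj (chi n \<omega>) = (chi g \<omega> * cnj (chi g \<omega>)) * (chi (m div g) \<omega> * cnj (chi (n div g) \<omega>))"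
    using chi_mult[OF g(1) p(1), of \<omega>] chi_mult[OF g(1) p(2), of \<omega>] g by (simp add: mult_ac)
  thus ?thesis by (simp add: chi_cnj chi_ratio_def reduced_def g_def)
qed

text \<open>The cofactor of \<open>X p\<close> in the normalised sum over \<open>n = p * m\<close> with \<open>(p,
  m)\<close> in \<open>E\<close>.\<close>
definition coefficient :: "nat \<Rightarrow> (nat \<times> nat) set \<Rightarrow> (nat \<Rightarrow> complex) \<Rightarrow> nat \<Rightarrow> 'a \<Rightarrow> complex" where
  "coefficient N E c p \<omega> = 1 / of_real (sqrt (real N)) * (\<Sum>m\<in>E `` {p}. c (p * m) * chi m \<omega>)"

text \<open>Expanding the squares gives a sum of \<open>chi m * cnj (chi m')\<close>, and each term depends on the reduced
  fraction \<open>m / m'\<close> only.  Grouping by this fraction leads to an expansion in orthogonal random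
  variables, to which Parseval applies.  The fraction 1 collects the diagonal \<open>m = m'\<close>.\<close>
lemma quadratic_variation_deviation:
  fixes E :: "(nat \<times> nat) set" and c :: "nat \<Rightarrow> complex"
  assumes E: "finite E" "\<And>p m. (p, m) \<in> E \<Longrightarrow> p < n \<and> m > 0" and c: "\<And>k. norm (c k) = 1" and N: "N > 0"
  defines "R \<equiv> reduced ` (snd ` {(p, m, m'). (p, m) \<in> E \<and> (p, m') \<in> E})"
  shows "expectation (\<lambda>\<omega>. ((\<Sum>p<n. (norm (coefficient N E c p \<omega>))\<^sup>2) - 1)\<^sup>2)
     = (\<Sum>r\<in>R - {(1, 1)}. (norm (ratio_sum E c r))\<^sup>2) / (real N)\<^sup>2 + (real (card E) / real N - 1)\<^sup>2"
proof -
  define Q where "Q = {(p, m, m'). (p, m) \<in> E \<and> (p, m') \<in> E}"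
  have finQ: "finite Q"
  proof (rule finite_subset)
    show "Q \<subseteq> (\<lambda>(e, e'). (fst e, snd e, snd e')) ` (E \<times> E)" by (force simp: Q_def)
  qed (use E(1) in simp)
  define R1 where "R1 = insert (1, 1) R"
  have finR: "finite R1" using finQ by (simp add: R1_def R_def Q_def[symmetric])
  have R1c: "coprime (fst r) (snd r) \<and> fst r > 0 \<and> snd r > 0" if "r \<in> R1" for r
  proof (cases "r = (1, 1)")
    case False
    hence "r \<in> reduced ` (snd ` Q)" using that by (simp add: R1_def R_def Q_def)
    then obtain q where q: "q \<in> Q" "r = reduced (snd q)" by (elim imageE) simp
    obtain p m m' where "q = (p, m, m')" by (cases q) auto
    hence "m > 0" "m' > 0" "reduced (m, m') = (fst r, snd r)" using q E(2) by (auto simp: Q_def)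
    from reduced_coprime[OF this] show ?thesis by blast
  qed simp
  define d where "d = (\<lambda>r. ratio_sum E c r / of_nat N - (if r = (1, 1) then 1 else 0))"
  have V: "complex_of_real ((\<Sum>p<n. (norm (coefficient N E c p \<omega>))\<^sup>2) - 1) = (\<Sum>r\<in>R1. d r * chi_ratio r \<omega>)" for \<omega>
  proof -
    have sq: "complex_of_real ((norm (coefficient N E c p \<omega>))\<^sup>2)
        = 1 / of_nat N * (\<Sum>m\<in>E `` {p}. \<Sum>m'\<in>E `` {p}. c (p * m) * cnj (c (p * m')) * chi_ratio (reduced (m, m')) \<omega>)" for p
    proof -
      have "complex_of_real ((norm (coefficient N E c p \<omega>))\<^sup>2)
         = (1 / of_real (sqrt (real N)))\<^sup>2 * (\<Sum>m\<in>E `` {p}. \<Sum>m'\<in>E `` {p}. (c (p * m) * chi m \<omega>) * cnj (c (p * m') * chi m' \<omega>))"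
      proof -
        define B where "B = (\<Sum>m\<in>E `` {p}. c (p * m) * chi m \<omega>)"
        define s where "s = 1 / complex_of_real (sqrt (real N))"
        have "cnj s = s" by (simp add: s_def)
        hence "complex_of_real ((norm (coefficient N E c p \<omega>))\<^sup>2) = s\<^sup>2 * (B * cnj B)"
          unfolding complex_norm_square coefficient_def B_def[symmetric] s_def[symmetric]
          by (simp add: power2_eq_square)
        also have "B * cnj B = (\<Sum>m\<in>E `` {p}. \<Sum>m'\<in>E `` {p}. (c (p * m) * chi m \<omega>) * cnj (c (p * m') * chi m' \<omega>))"
          unfolding B_def cnj_sum sum_product ..
        finally show ?thesis unfolding s_def .
      qed
      also have "(1 / complex_of_real (sqrt (real N)))\<^sup>2 = 1 / of_nat N"
        by (simp add: power_divide flip: of_real_power)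
      also have "(\<Sum>m\<in>E `` {p}. \<Sum>m'\<in>E `` {p}. (c (p * m) * chi m \<omega>) * cnj (c (p * m') * chi m' \<omega>))
         = (\<Sum>m\<in>E `` {p}. \<Sum>m'\<in>E `` {p}. c (p * m) * cnj (c (p * m')) * chi_ratio (reduced (m, m')) \<omega>)"
      proof (intro sum.cong refl)
        fix m m' assume "m \<in> E `` {p}" "m' \<in> E `` {p}"
        hence "m > 0" "m' > 0" using E(2) by auto
        thus "(c (p * m) * chi m \<omega>) * cnj (c (p * m') * chi m' \<omega>) = c (p * m) * cnj (c (p * m')) * chi_ratio (reduced (m, m')) \<omega>"
          unfolding chi_ratio_reduced[symmetric, OF \<open>m > 0\<close> \<open>m' > 0\<close>] by (simp add: mult_ac)
      qed
      finally show ?thesis .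
    qed
    have finE: "finite (E `` {p})" for p using E(1) by (rule finite_Image)
    have "complex_of_real (\<Sum>p<n. (norm (coefficient N E c p \<omega>))\<^sup>2)
       = 1 / of_nat N * (\<Sum>p<n. \<Sum>m\<in>E `` {p}. \<Sum>m'\<in>E `` {p}. c (p * m) * cnj (c (p * m')) * chi_ratio (reduced (m, m')) \<omega>)"
      unfolding of_real_sum sq sum_distrib_left ..
    also have "(\<Sum>p<n. \<Sum>m\<in>E `` {p}. \<Sum>m'\<in>E `` {p}. c (p * m) * cnj (c (p * m')) * chi_ratio (reduced (m, m')) \<omega>)
        = (\<Sum>(p, m, m')\<in>Q. c (p * m) * cnj (c (p * m')) * chi_ratio (reduced (m, m')) \<omega>)"
    proof -
      have "Q = (SIGMA p:{..<n}. (E `` {p}) \<times> (E `` {p}))" using E(2) by (auto simp: Q_def)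
      moreover have "\<forall>p\<in>{..<n}. finite (E `` {p} \<times> E `` {p})" using finE by blast
      ultimately show ?thesis
        unfolding sum.cartesian_product by (simp only: sum.Sigma[OF finite_lessThan])
    qed
    also have "\<dots> = (\<Sum>q\<in>Q. c (fst q * fst (snd q)) * cnj (c (fst q * snd (snd q))) * chi_ratio (reduced (snd q)) \<omega>)"
      by (intro sum.cong) auto
    also have "\<dots> = (\<Sum>r\<in>R1. \<Sum>q\<in>{q\<in>Q. reduced (snd q) = r}. c (fst q * fst (snd q)) * cnj (c (fst q * snd (snd q))) * chi_ratio (reduced (snd q)) \<omega>)"
      by (rule sum.group[symmetric, OF finQ finR]) (auto simp: R1_def R_def Q_def image_iff)
    also have "\<dots> = (\<Sum>r\<in>R1. ratio_sum E c r * chi_ratio r \<omega>)"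
    proof (rule sum.cong[OF refl])
      fix r
      have "(\<Sum>q\<in>{q\<in>Q. reduced (snd q) = r}. c (fst q * fst (snd q)) * cnj (c (fst q * snd (snd q))) * chi_ratio (reduced (snd q)) \<omega>)
         = (\<Sum>q\<in>{q\<in>Q. reduced (snd q) = r}. c (fst q * fst (snd q)) * cnj (c (fst q * snd (snd q)))) * chi_ratio r \<omega>"
        unfolding sum_distrib_right by (intro sum.cong) auto
      also have "(\<Sum>q\<in>{q\<in>Q. reduced (snd q) = r}. c (fst q * fst (snd q)) * cnj (c (fst q * snd (snd q)))) = ratio_sum E c r"
        unfolding ratio_sum_def by (intro sum.cong) (auto simp: Q_def)
      finally show "(\<Sum>q\<in>{q\<in>Q. reduced (snd q) = r}. c (fst q * fst (snd q)) * cnj (c (fst q * snd (snd q))) * chi_ratio (reduced (snd q)) \<omega>)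
         = ratio_sum E c r * chi_ratio r \<omega>" .
    qed
    finally have "complex_of_real (\<Sum>p<n. (norm (coefficient N E c p \<omega>))\<^sup>2) = (\<Sum>r\<in>R1. ratio_sum E c r / of_nat N * chi_ratio r \<omega>)"
      by (simp add: sum_distrib_left)
    moreover have "(\<Sum>r\<in>R1. (if r = (1, 1) then 1 else 0) * chi_ratio r \<omega>) = 1"
    proof -
      have "(\<Sum>r\<in>R1. (if r = (1, 1) then 1 else 0) * chi_ratio r \<omega>) = (\<Sum>r\<in>R1. if r = (1, 1) then chi_ratio (1, 1) \<omega> else 0)"
        by (intro sum.cong) auto
      also have "\<dots> = 1" using finR by (simp add: R1_def chi_ratio_def)
      finally show ?thesis .
    qed
    ultimately show ?thesis by (simp add: d_def left_diff_distrib sum_subtractf)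
  qed
  have "expectation (\<lambda>\<omega>. ((\<Sum>p<n. (norm (coefficient N E c p \<omega>))\<^sup>2) - 1)\<^sup>2)
      = expectation (\<lambda>\<omega>. (norm (\<Sum>r\<in>R1. d r * chi_ratio r \<omega>))\<^sup>2)"
    unfolding V[symmetric] norm_of_real by simp
  also have "\<dots> = (\<Sum>r\<in>R1. (norm (d r))\<^sup>2)"
  proof (rule expectation_square_orthonormal(2)[OF finR chi_ratio_measurable norm_chi_ratio])
    fix i j assume "i \<in> R1" "j \<in> R1" "i \<noteq> j"
    thus "expectation (\<lambda>\<omega>. chi_ratio i \<omega> * cnj (chi_ratio j \<omega>)) = 0"
      using chi_ratio_orthogonal[of "fst i" "snd i" "fst j" "snd j"] R1c[of i] R1c[of j] by simp
  qed
  also have "R1 = insert (1, 1) (R - {(1, 1)})" by (auto simp: R1_def)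
  also have "(\<Sum>r\<in>insert (1, 1) (R - {(1, 1)}). (norm (d r))\<^sup>2) = (norm (d (1, 1)))\<^sup>2 + (\<Sum>r\<in>R - {(1, 1)}. (norm (d r))\<^sup>2)"
    using finR by (subst sum.insert) (auto simp: R1_def)
  also have "(\<Sum>r\<in>R - {(1, 1)}. (norm (d r))\<^sup>2) = (\<Sum>r\<in>R - {(1, 1)}. (norm (ratio_sum E c r))\<^sup>2) / (real N)\<^sup>2"
    unfolding sum_divide_distrib by (intro sum.cong) (auto simp: d_def norm_divide power_divide)
  also have "ratio_sum E c (1, 1) = of_nat (card E)"
  proof -
    have "ratio_sum E c (1, 1) = (\<Sum>(p, m)\<in>E. c (p * m) * cnj (c (p * m)))"
      unfolding ratio_sum_def
      by (rule sum.reindex_bij_witness[of _ "\<lambda>(p, m). (p, m, m)" "\<lambda>(p, m, m'). (p, m)"])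
         (use E(2) reduced_eq_1 in \<open>force+\<close>)
    also have "\<dots> = (\<Sum>e\<in>E. 1)"
      using c by (intro sum.cong) (auto simp flip: complex_norm_square)
    finally show ?thesis by simp
  qed
  hence "d (1, 1) = complex_of_real (real (card E) / real N - 1)" by (simp add: d_def)
  hence "(norm (d (1, 1)))\<^sup>2 = (real (card E) / real N - 1)\<^sup>2" by (simp only: norm_of_real power2_abs)
  finally show ?thesis by simp
qed

text \<open>The square of the coefficient is a combination of \<open>chi k\<close>, with a coefficient bounded by the
  number of factorisations \<open>k = a * b\<close>; then Parseval applies.\<close>
lemma coefficient_fourth_moment:
  fixes E :: "(nat \<times> nat) set" and c :: "nat \<Rightarrow> complex"
  assumes E: "finite E" "\<And>p m. (p, m) \<in> E \<Longrightarrow> m > 0" and c: "\<And>k. norm (c k) = 1" and N: "N > 0"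
  shows "expectation (\<lambda>\<omega>. norm (coefficient N E c p \<omega>) ^ 4)
     \<le> mult_energy (E `` {p}) / (real N)\<^sup>2"
proof -
  define S where "S = E `` {p}"
  have S: "finite S" "\<And>m. m \<in> S \<Longrightarrow> m > 0" using E by (auto simp: S_def)
  define K where "K = (\<lambda>(a, b). a * b) ` (S \<times> S)"
  define e where "e = (\<lambda>k. \<Sum>(a, b)\<in>{x\<in>S \<times> S. fst x * snd x = k}. c (p * a) * c (p * b))"
  have K: "finite K" "\<And>k. k \<in> K \<Longrightarrow> k > 0" using S by (auto simp: K_def)
  have sq: "(coefficient N E c p \<omega>)\<^sup>2 = (\<Sum>k\<in>K. (e k / of_nat N) * chi k \<omega>)" for \<omega>
  proof -
    have "(coefficient N E c p \<omega>)\<^sup>2 = 1 / of_nat N * (\<Sum>(a, b)\<in>S \<times> S. (c (p * a) * chi a \<omega>) * (c (p * b) * chi b \<omega>))"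
      unfolding coefficient_def S_def[symmetric] power_mult_distrib power2_eq_square[of "sum _ _"] sum_product sum.cartesian_product
      by (simp add: power_divide flip: of_real_power)
    also have "(\<Sum>(a, b)\<in>S \<times> S. (c (p * a) * chi a \<omega>) * (c (p * b) * chi b \<omega>))
       = (\<Sum>x\<in>S \<times> S. c (p * fst x) * c (p * snd x) * chi (fst x * snd x) \<omega>)"
      using S(2) by (intro sum.cong) (auto simp: chi_mult)
    also have "\<dots> = (\<Sum>k\<in>K. \<Sum>x\<in>{x\<in>S \<times> S. fst x * snd x = k}. c (p * fst x) * c (p * snd x) * chi (fst x * snd x) \<omega>)"
      by (rule sum.group[symmetric]) (use S K in \<open>auto simp: K_def\<close>)
    also have "\<dots> = (\<Sum>k\<in>K. e k * chi k \<omega>)"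
      unfolding e_def sum_distrib_right by (intro sum.cong refl) auto
    finally show ?thesis by (simp add: sum_distrib_left)
  qed
  have "expectation (\<lambda>\<omega>. norm (coefficient N E c p \<omega>) ^ 4) = expectation (\<lambda>\<omega>. (norm (\<Sum>k\<in>K. (e k / of_nat N) * chi k \<omega>))\<^sup>2)"
    unfolding sq[symmetric] norm_power by simp
  also have "\<dots> = (\<Sum>k\<in>K. (norm (e k / of_nat N))\<^sup>2)"
    by (rule expectation_square_orthonormal(2)[OF K(1) chi_measurable norm_chi chi_orthogonal]) (use K in auto)
  also have "\<dots> \<le> (\<Sum>k\<in>K. (real (card {x\<in>S \<times> S. fst x * snd x = k}))\<^sup>2 / (real N)\<^sup>2)"
  proof (rule sum_mono)
    fix k
    have "norm (e k) \<le> (\<Sum>x\<in>{x\<in>S \<times> S. fst x * snd x = k}. 1)"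
      unfolding e_def by (rule sum_norm_le) (auto simp: norm_mult c)
    hence "norm (e k) \<le> real (card {x\<in>S \<times> S. fst x * snd x = k})" by simp
    thus "(norm (e k / of_nat N))\<^sup>2 \<le> (real (card {x\<in>S \<times> S. fst x * snd x = k}))\<^sup>2 / (real N)\<^sup>2"
      by (simp add: norm_divide power_divide divide_right_mono power_mono)
  qed
  also have "\<dots> = real (\<Sum>k\<in>K. card ({x\<in>S \<times> S. fst x * snd x = k} \<times> {x\<in>S \<times> S. fst x * snd x = k})) / (real N)\<^sup>2"
    by (simp add: card_cartesian_product power2_eq_square sum_divide_distrib)
  also have "(\<Sum>k\<in>K. card ({x\<in>S \<times> S. fst x * snd x = k} \<times> {x\<in>S \<times> S. fst x * snd x = k}))
      = card (\<Union>k\<in>K. {x\<in>S \<times> S. fst x * snd x = k} \<times> {x\<in>S \<times> S. fst x * snd x = k})"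
    by (rule card_UN_disjoint[symmetric]) (use S K in auto)
  also have "(\<Union>k\<in>K. {x\<in>S \<times> S. fst x * snd x = k} \<times> {x\<in>S \<times> S. fst x * snd x = k})
     = {x \<in> (S \<times> S) \<times> (S \<times> S). fst (fst x) * snd (fst x) = fst (snd x) * snd (snd x)}" (is "?L = ?R")
  proof (rule equalityI; rule subsetI)
    fix x assume "x \<in> ?L"
    then obtain k where "fst x \<in> S \<times> S" "snd x \<in> S \<times> S" "fst (fst x) * snd (fst x) = k" "fst (snd x) * snd (snd x) = k"
      by (elim UN_E SigmaE) simp
    thus "x \<in> ?R" by (simp add: mem_Times_iff)
  next
    fix x assume x: "x \<in> ?R"
    let ?k = "fst (fst x) * snd (fst x)"
    have "?k \<in> K" unfolding K_def using x by (intro image_eqI[of _ _ "fst x"]) (simp_all add: case_prod_beta mem_Times_iff)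
    moreover have "x \<in> {x\<in>S \<times> S. fst x * snd x = ?k} \<times> {x\<in>S \<times> S. fst x * snd x = ?k}"
      using x by (simp add: mem_Times_iff)
    ultimately show "x \<in> ?L" by (rule UN_I)
  qed
  finally show ?thesis by (simp add: S_def)
qed

end

section \<open>Integers with an isolated largest prime factor\<close>

text \<open>The index of the multiplicative block containing \<open>p\<close>.  Blocks have ratio \<open>exp (1 / (ln
  N)^2)\<close>: short enough that few integers have two large prime factors in the same block, and long enough
  for exponential sums over one block.\<close>
definition blk :: "nat \<Rightarrow> nat \<Rightarrow> nat" where
  "blk N p = nat \<lfloor>(ln (real N))\<^sup>2 * ln (real p)\<rfloor>"

text \<open>Logarithm of the lower bound for the largest prime factor.  The exponent \<open>3/4\<close> is less than 1, so
  that few integers are \<open>exp (cut N)\<close>-smooth.  It exceeds the exponent \<open>1/10\<close> of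
  \<open>Lcut\<close> by more than \<open>1/2\<close>, so that the square of the saving in the ratio sums beats
  a factor \<open>ln N\<close>.\<close>
definition cut :: "nat \<Rightarrow> real" where
  "cut N = ln (real N) powr (3/4)"

text \<open>The pairs \<open>(p, m)\<close> for which \<open>n = p * m\<close> has its largest prime factor
  \<open>p\<close> alone in its block.  The comparison of blocks instead of primes makes the condition on
  \<open>m\<close> the same for all \<open>p\<close> of one block.\<close>
definition adm :: "nat \<Rightarrow> (nat \<times> nat) set" where
  "adm N = {(p, m). prime p \<and> 0 < m \<and> p * m \<le> N \<and> (ln (real N))\<^sup>2 * cut N \<le> real (blk N p) \<and>
              (\<forall>r\<in>prime_factors m. blk N r < blk N p)}"

lemma finite_adm: "finite (adm N)"
proof (rule finite_subset)
  show "adm N \<subseteq> {1..N} \<times> {1..N}"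
  proof
    fix x assume "x \<in> adm N"
    then obtain p m where x: "x = (p, m)" "p > 0" "m > 0" "p * m \<le> N" by (auto simp: adm_def prime_gt_0_nat)
    have "p * 1 \<le> p * m" "1 * m \<le> p * m" using x by (intro mult_le_mono; simp)+
    hence "p \<le> N" "m \<le> N" using x(4) by linarith+
    thus "x \<in> {1..N} \<times> {1..N}" using x by simp
  qed
qed simp

lemma blk_bounds:
  assumes "p \<ge> 1"
  shows "real (blk N p) \<le> (ln (real N))\<^sup>2 * ln (real p)" "(ln (real N))\<^sup>2 * ln (real p) < real (blk N p) + 1"
proof -
  have "0 \<le> (ln (real N))\<^sup>2 * ln (real p)" using assms by simp
  thus "real (blk N p) \<le> (ln (real N))\<^sup>2 * ln (real p)" "(ln (real N))\<^sup>2 * ln (real p) < real (blk N p) + 1"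
    unfolding blk_def by linarith+
qed

lemma blk_mono: "1 \<le> p \<Longrightarrow> p \<le> q \<Longrightarrow> blk N p \<le> blk N q"
  unfolding blk_def by (intro nat_mono floor_mono mult_left_mono) auto

lemma cut_le_ln:
  assumes "p \<ge> 1" "(ln (real N))\<^sup>2 * cut N \<le> real (blk N p)" "ln (real N) > 0"
  shows "cut N \<le> ln (real p)" "exp (cut N) \<le> real p"
proof -
  have "(ln (real N))\<^sup>2 * cut N \<le> (ln (real N))\<^sup>2 * ln (real p)" using blk_bounds(1)[OF assms(1)] assms(2) by (rule order_trans[rotated])
  thus "cut N \<le> ln (real p)" using assms(3) by simp
  thus "exp (cut N) \<le> real p" using assms(1) by (simp add: ln_ge_iff)
qed

lemma adm_prime_largest:
  assumes "(p, m) \<in> adm N" "r \<in> prime_factors m"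
  shows "r < p"
proof (rule ccontr)
  assume "\<not> r < p"
  hence "blk N p \<le> blk N r" using assms(1) by (intro blk_mono) (auto simp: adm_def Suc_le_eq dest: prime_gt_0_nat)
  thus False using assms by (auto simp: adm_def)
qed

text \<open>The prime \<open>p\<close> is recovered from the product as its prime factor in the highest block.\<close>
lemma block_prime_unique:
  assumes "prime p" "prime p'" "h > 0" "h' > 0" "p * h = p' * h'"
    "\<forall>r\<in>prime_factors h. blk N r < blk N p" "\<forall>r\<in>prime_factors h'. blk N r < blk N p'"
  shows "p = p' \<and> h = h'"
proof -
  have "p = p'"
  proof (rule ccontr)
    assume ne: "p \<noteq> p'"
    have "p dvd p' * h'" "p' dvd p * h" using assms(5) by (metis dvd_triv_left)+
    hence "p dvd h'" "p' dvd h"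
      using ne assms(1,2) by (metis prime_dvd_mult_iff primes_dvd_imp_eq)+
    hence "blk N p < blk N p'" "blk N p' < blk N p" using assms by (auto simp: in_prime_factors_iff)
    thus False by simp
  qed
  thus ?thesis using assms(1,5) prime_gt_0_nat by auto
qed

text \<open>The index set of the ratio sum at the reduced fraction \<open>a / b\<close>: the pairs \<open>m, m'\<close>
  with this fraction are \<open>a * h, b * h\<close>.\<close>
definition common_cofactors :: "nat \<Rightarrow> nat \<Rightarrow> nat \<Rightarrow> (nat \<times> nat) set" where
  "common_cofactors N a b = {(p, h). 0 < h \<and> (p, a * h) \<in> adm N \<and> (p, b * h) \<in> adm N}"

lemma ratio_sum_eq:
  assumes "coprime a b" "a > 0" "b > 0"
  shows "ratio_sum (adm N) c (a, b) = (\<Sum>(p, h)\<in>common_cofactors N a b. c (p * (a * h)) * cnj (c (p * (b * h))))"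
  unfolding ratio_sum_def
proof (rule sum.reindex_bij_witness[of _ "\<lambda>(p, h). (p, a * h, b * h)" "\<lambda>(p, m, n). (p, gcd m n)"])
  fix x assume "x \<in> {(p, m, n). (p, m) \<in> adm N \<and> (p, n) \<in> adm N \<and> reduced (m, n) = (a, b)}"
  then obtain p m n where x: "x = (p, m, n)" "(p, m) \<in> adm N" "(p, n) \<in> adm N" "m div gcd m n = a" "n div gcd m n = b"
    by (auto simp: reduced_def)
  hence mn: "a * gcd m n = m" "b * gcd m n = n" by (metis dvd_div_mult_self gcd_dvd1, metis dvd_div_mult_self gcd_dvd2)
  have "m > 0" using x by (simp add: adm_def)
  hence g: "gcd m n > 0" by simp
  show "(case case x of (p, m, n) \<Rightarrow> (p, gcd m n) of (p, h) \<Rightarrow> (p, a * h, b * h)) = x" using mn by (simp add: x(1))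
  show "(case x of (p, m, n) \<Rightarrow> (p, gcd m n)) \<in> common_cofactors N a b"
    using x(2,3) g by (simp add: x(1) common_cofactors_def mn)
  show "(case case x of (p, m, n) \<Rightarrow> (p, gcd m n) of (p, h) \<Rightarrow> c (p * (a * h)) * cnj (c (p * (b * h)))) = (case x of (p, m, n) \<Rightarrow> c (p * m) * cnj (c (p * n)))"
    by (simp add: x(1) mn)
next
  fix y assume "y \<in> common_cofactors N a b"
  then obtain p h where y: "y = (p, h)" "h > 0" "(p, a * h) \<in> adm N" "(p, b * h) \<in> adm N" by (auto simp: common_cofactors_def)
  have g: "gcd (a * h) (b * h) = h" using gcd_mult_distrib_nat[of h a b] assms(1) by (simp add: mult.commute coprime_iff_gcd_eq_1)
  show "(case case y of (p, h) \<Rightarrow> (p, a * h, b * h) of (p, m, n) \<Rightarrow> (p, gcd m n)) = y" by (simp add: y(1) g)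
  show "(case y of (p, h) \<Rightarrow> (p, a * h, b * h)) \<in> {(p, m, n). (p, m) \<in> adm N \<and> (p, n) \<in> adm N \<and> reduced (m, n) = (a, b)}"
    using y by (simp add: reduced_def g)
qed

lemma common_cofactors_iff:
  assumes "a > 0" "b > 0"
  shows "(p, h) \<in> common_cofactors N a b \<longleftrightarrow> prime p \<and> h > 0 \<and> p * h \<le> N div max a b \<and>
     (ln (real N))\<^sup>2 * cut N \<le> real (blk N p) \<and> (\<forall>r\<in>prime_factors a \<union> prime_factors b. blk N r < blk N p) \<and>
     (\<forall>r\<in>prime_factors h. blk N r < blk N p)"
proof -
  have "p * (a * h) \<le> N \<and> p * (b * h) \<le> N \<longleftrightarrow> p * h \<le> N div max a b"
  proof -
    have "p * h \<le> N div max a b \<longleftrightarrow> p * h * max a b \<le> N"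
      using assms by (simp add: less_eq_div_iff_mult_less_eq)
    also have "\<dots> \<longleftrightarrow> p * (a * h) \<le> N \<and> p * (b * h) \<le> N"
    proof (cases "a \<le> b")
      case True
      hence "p * (a * h) \<le> p * (b * h)" by simp
      moreover have "p * h * b = p * (b * h)" by (simp add: mult_ac)
      ultimately show ?thesis unfolding max.absorb2[OF True] by linarith
    next
      case False
      hence ba: "b \<le> a" by simp
      hence "p * (b * h) \<le> p * (a * h)" by simp
      moreover have "p * h * a = p * (a * h)" by (simp add: mult_ac)
      ultimately show ?thesis unfolding max.absorb1[OF ba] by linarith
    qed
    finally show ?thesis by blast
  qed
  thus ?thesis using assms
    by (auto simp: common_cofactors_def adm_def prime_factors_product)
qed

lemma finite_common_cofactors:
  assumes "a > 0" "b > 0"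
  shows "finite (common_cofactors N a b)" "real (card (common_cofactors N a b)) \<le> real N / real (max a b)"
proof -
  let ?W = "common_cofactors N a b" and ?Y = "N div max a b"
  have inj: "inj_on (\<lambda>(p, h). p * h) ?W"
  proof (rule inj_onI)
    fix x y assume xy: "x \<in> ?W" "y \<in> ?W" "(case x of (p, h) \<Rightarrow> p * h) = (case y of (p, h) \<Rightarrow> p * h)"
    obtain p h p' h' where e: "x = (p, h)" "y = (p', h')" by (metis prod.collapse)
    have "p = p' \<and> h = h'"
      by (rule block_prime_unique[of _ _ _ _ N]) (use xy in \<open>simp_all add: e common_cofactors_iff[OF assms]\<close>)
    thus "x = y" by (simp add: e)
  qed
  have img: "(\<lambda>(p, h). p * h) ` ?W \<subseteq> {1..?Y}"
    using common_cofactors_iff[OF assms] by (auto simp: prime_gt_0_nat Suc_le_eq)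
  show "finite ?W" using inj_on_finite[OF inj img] by simp
  have "card ?W = card ((\<lambda>(p, h). p * h) ` ?W)" using card_image[OF inj] by simp
  also have "\<dots> \<le> card {1..?Y}" by (rule card_mono[OF _ img]) simp
  finally have "real (card ?W) \<le> real ?Y" by simp
  also have "\<dots> \<le> real N / real (max a b)" by (rule of_nat_div_le_of_nat)
  finally show "real (card ?W) \<le> real N / real (max a b)" .
qed

lemma ratio_sum_trivial:
  assumes "coprime a b" "a > 0" "b > 0" "\<And>k. norm (c k) = 1"
  shows "norm (ratio_sum (adm N) c (a, b)) \<le> real N / real (max a b)"
proof -
  have "norm (ratio_sum (adm N) c (a, b)) \<le> (\<Sum>x\<in>common_cofactors N a b. 1)"
    unfolding ratio_sum_eq[OF assms(1-3)] by (rule sum_norm_le) (auto simp: norm_mult assms(4))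
  thus ?thesis using finite_common_cofactors(2)[OF assms(2,3), of N] by simp
qed

text \<open>Cofactors \<open>h\<close> below this bound are estimated trivially.  It grows faster than every power of
  \<open>ln N\<close>, and its inverse is the error of the rational approximations that come from longer sums
  over \<open>h\<close>; its logarithm is small compared with \<open>cut N\<close>.\<close>
definition Lcut :: "nat \<Rightarrow> real" where
  "Lcut N = exp (ln (real N) powr (1/10))"

text \<open>The obstruction to cancellation in the ratio sum at \<open>a / b\<close>: the coefficients of \<open>g (a * n)
  - g (b * n)\<close> have a common denominator that is at most a power of \<open>ln N\<close>, up to an error
  of about \<open>1 / Lcut N\<close>.\<close>
definition phase_bad :: "real poly \<Rightarrow> nat \<Rightarrow> nat \<Rightarrow> nat \<Rightarrow> nat \<Rightarrow> bool" where
  "phase_bad g N K a b \<longleftrightarrow> (\<exists>q::nat. 1 \<le> q \<and> real q \<le> ln (real N) ^ K \<and>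
     (\<forall>i\<in>{1..degree g}. dist_int (real q * (coeff g i * (real a ^ i - real b ^ i))) \<le> ln (real N) ^ K / Lcut N))"

lemma phase_bad_sym: "phase_bad g N K a b \<longleftrightarrow> phase_bad g N K b a"
proof -
  have "dist_int (real q * (coeff g i * (real a ^ i - real b ^ i))) = dist_int (real q * (coeff g i * (real b ^ i - real a ^ i)))" for q i
    using dist_int_minus[of "real q * (coeff g i * (real a ^ i - real b ^ i))"] by (simp add: algebra_simps)
  thus ?thesis by (simp add: phase_bad_def)
qed

lemma poly_difference:
  "poly g (real (a * n)) - poly g (real (b * n)) = (\<Sum>i\<in>{1..degree g}. (coeff g i * (real a ^ i - real b ^ i)) * real n ^ i)"
proof -
  have "poly g (real (a * n)) - poly g (real (b * n)) = (\<Sum>i\<le>degree g. (coeff g i * (real a ^ i - real b ^ i)) * real n ^ i)"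
    by (simp add: poly_altdef power_mult_distrib algebra_simps sum_subtractf)
  also have "\<dots> = (\<Sum>i\<in>{1..degree g}. (coeff g i * (real a ^ i - real b ^ i)) * real n ^ i)"
    by (rule sum.mono_neutral_right) (auto simp: not_le Suc_le_eq)
  finally show ?thesis .
qed

text \<open>For fixed \<open>h\<close> the primes \<open>p \<le> Y / h\<close> above \<open>exp (cut N)\<close> have
  density at most \<open>5 / cut N\<close> by Chebyshev's bound, and the sum of \<open>1 / h\<close> is about
  \<open>ln (Lcut N)\<close>.\<close>
lemma small_cofactor_count:
  assumes ab: "a > 0" "b > 0" and l: "ln (real N) \<ge> 2"
  shows "real (card {x\<in>common_cofactors N a b. snd x < nat \<lceil>Lcut N\<rceil>})
     \<le> real N / real (max a b) * (5 * (1 + ln (real N) powr (1/10)) / cut N)"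
proof -
  define Y where "Y = N div max a b"
  define X where "X = real N / real (max a b)"
  define Lo where "Lo = nat \<lceil>Lcut N\<rceil>"
  have YX: "real Y \<le> X" unfolding Y_def X_def by (rule of_nat_div_le_of_nat)
  have X0: "X \<ge> 0" by (simp add: X_def)
  have cut1: "cut N \<ge> 1" using l by (auto simp: cut_def intro!: ge_one_powr_ge_zero)
  define P where "P = (\<lambda>h. {p. prime p \<and> p \<le> Y div h \<and> exp (cut N) \<le> real p})"
  have finP: "finite (P h)" for h by (rule finite_subset[of _ "{..Y div h}"]) (auto simp: P_def)
  have P: "real (card (P h)) \<le> 5 * X / cut N * (1 / real h)" if h: "h \<ge> 1" for h
  proof (cases "P h = {}")
    case True
    thus ?thesis using X0 cut1 by simp
  next
    case False
    then obtain p where p: "prime p" "p \<le> Y div h" "exp (cut N) \<le> real p" by (auto simp: P_def)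
    define n where "n = Y div h"
    have pn: "real p \<le> real n" using p by (simp add: n_def)
    have "2 \<le> n" using p(1,2) prime_ge_2_nat[of p] by (simp add: n_def)
    have cl: "cut N \<le> ln (real n)" using p(3) pn \<open>2 \<le> n\<close> by (subst ln_ge_iff) auto
    have "real (card (P h)) * cut N \<le> real (card {p. prime p \<and> p \<le> n}) * ln (real n)"
      using cl cut1 by (intro mult_mono of_nat_mono card_mono) (auto simp: P_def n_def)
    also have "\<dots> \<le> 5 * real n" by (rule chebyshev_prime_count[OF \<open>2 \<le> n\<close>])
    also have "real n \<le> real Y / real h" unfolding n_def by (rule of_nat_div_le_of_nat)
    also have "\<dots> \<le> X / real h" using YX by (intro divide_right_mono) auto
    finally have "real (card (P h)) * cut N \<le> 5 * (X / real h)" by simp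
    thus ?thesis using cut1 h by (simp add: field_simps)
  qed
  have "{x\<in>common_cofactors N a b. snd x < Lo} \<subseteq> (\<lambda>(h, p). (p, h)) ` (SIGMA h:{1..<Lo}. P h)"
  proof
    fix x assume x: "x \<in> {x\<in>common_cofactors N a b. snd x < Lo}"
    obtain p h where e: "x = (p, h)" by (cases x)
    have ph: "prime p" "h > 0" "p * h \<le> Y" "(ln (real N))\<^sup>2 * cut N \<le> real (blk N p)" "h < Lo"
      using x common_cofactors_iff[OF ab] by (auto simp: e Y_def)
    have "p \<ge> 1" using ph(1) prime_ge_1_nat by blast
    hence "exp (cut N) \<le> real p" using cut_le_ln(2)[OF _ ph(4)] l by simp
    moreover have "p \<le> Y div h" using ph by (simp add: less_eq_div_iff_mult_less_eq)
    ultimately have "(h, p) \<in> (SIGMA h:{1..<Lo}. P h)" using ph by (simp add: P_def)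
    thus "x \<in> (\<lambda>(h, p). (p, h)) ` (SIGMA h:{1..<Lo}. P h)" by (rule rev_image_eqI) (simp add: e)
  qed
  hence "card {x\<in>common_cofactors N a b. snd x < Lo} \<le> card ((\<lambda>(h, p). (p, h)) ` (SIGMA h:{1..<Lo}. P h))"
    by (rule card_mono[rotated]) (auto simp: finP)
  also have "\<dots> \<le> card (SIGMA h:{1..<Lo}. P h)" by (rule card_image_le) (auto simp: finP)
  also have "\<dots> = (\<Sum>h\<in>{1..<Lo}. card (P h))" using finP by simp
  finally have "real (card {x\<in>common_cofactors N a b. snd x < Lo}) \<le> (\<Sum>h\<in>{1..<Lo}. real (card (P h)))"
    by (simp flip: of_nat_sum)
  also have "\<dots> \<le> (\<Sum>h\<in>{1..<Lo}. 5 * X / cut N * (1 / real h))" by (intro sum_mono P) auto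
  also have "\<dots> = 5 * X / cut N * (\<Sum>h\<in>{1..<Lo}. 1 / real h)" by (simp add: sum_distrib_left)
  also have "\<dots> \<le> 5 * X / cut N * (1 + ln (real N) powr (1/10))"
  proof (intro mult_left_mono)
    show "(\<Sum>h\<in>{1..<Lo}. 1 / real h) \<le> 1 + ln (real N) powr (1/10)"
    proof (cases "Lo \<ge> 2")
      case True
      have "{1..<Lo} = {1..Lo - 1}" using True by auto
      hence "(\<Sum>h\<in>{1..<Lo}. 1 / real h) \<le> 1 + ln (real (Lo - 1))" using sum_reciprocal_le[of "Lo - 1"] True by simp
      also have "real (Lo - 1) \<le> Lcut N" unfolding Lo_def using True[unfolded Lo_def] by linarith
      hence "ln (real (Lo - 1)) \<le> ln (Lcut N)" using True by (subst ln_le_cancel_iff) (auto simp: Lcut_def)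
      finally show ?thesis by (simp add: Lcut_def)
    next
      case False
      hence "{1..<Lo} = {}" by auto
      thus ?thesis by simp
    qed
  qed (use X0 cut1 in auto)
  also have "\<dots> = X * (5 * (1 + ln (real N) powr (1/10)) / cut N)" by simp
  finally show ?thesis unfolding X_def Lo_def .
qed

section \<open>Cancellation in the ratio sums\<close>

text \<open>The least integer of the \<open>j\<close>-th block.\<close>
definition block_start :: "nat \<Rightarrow> nat \<Rightarrow> nat" where
  "block_start N j = nat \<lceil>exp (real j / (ln (real N))\<^sup>2)\<rceil>"

lemma block_start_ge: "exp (real j / (ln (real N))\<^sup>2) \<le> real (block_start N j)" "block_start N j \<ge> 1"
proof -
  have "0 < exp (real j / (ln (real N))\<^sup>2)" by simp
  thus "block_start N j \<ge> 1" unfolding block_start_def by linarith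
  show "exp (real j / (ln (real N))\<^sup>2) \<le> real (block_start N j)" unfolding block_start_def by linarith
qed

lemma block_start_le_iff: "block_start N j \<le> n \<longleftrightarrow> exp (real j / (ln (real N))\<^sup>2) \<le> real n"
  unfolding block_start_def by (simp add: nat_le_iff ceiling_le_iff)

lemma block_start_mono: "block_start N j \<le> block_start N (Suc j)"
  unfolding block_start_def by (intro nat_mono ceiling_mono) (simp add: divide_right_mono)

lemma blk_eq_iff:
  assumes l: "ln (real N) > 0" and n: "n \<ge> 1"
  shows "blk N n = j \<longleftrightarrow> block_start N j \<le> n \<and> n < block_start N (Suc j)"
proof -
  have K: "(ln (real N))\<^sup>2 > 0" using l by simp
  have "blk N n = j \<longleftrightarrow> real j \<le> (ln (real N))\<^sup>2 * ln (real n) \<and> (ln (real N))\<^sup>2 * ln (real n) < real (Suc j)"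
    using blk_bounds[OF n, of N] by auto
  moreover have "real i \<le> (ln (real N))\<^sup>2 * ln (real n) \<longleftrightarrow> block_start N i \<le> n" for i
  proof -
    have "real i \<le> (ln (real N))\<^sup>2 * ln (real n) \<longleftrightarrow> real i / (ln (real N))\<^sup>2 \<le> ln (real n)"
      using K by (simp add: pos_divide_le_eq mult.commute)
    also have "\<dots> \<longleftrightarrow> exp (real i / (ln (real N))\<^sup>2) \<le> real n" using n by (simp add: ln_ge_iff)
    finally show ?thesis by (simp add: block_start_le_iff)
  qed
  ultimately show ?thesis by (metis not_le)
qed

lemma block_element_le:
  assumes l: "ln (real N) \<ge> 1" and n: "n < block_start N (Suc j)"
  shows "real n \<le> 3 * real (block_start N j)"
proof -
  have "real n < exp (real (Suc j) / (ln (real N))\<^sup>2)" using n block_start_le_iff[of N "Suc j" n] by linarith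
  also have "real (Suc j) / (ln (real N))\<^sup>2 = 1 / (ln (real N))\<^sup>2 + real j / (ln (real N))\<^sup>2" by (simp add: add_divide_distrib)
  also have "exp \<dots> = exp (1 / (ln (real N))\<^sup>2) * exp (real j / (ln (real N))\<^sup>2)" by (rule exp_add)
  also have "\<dots> \<le> 3 * real (block_start N j)"
  proof (intro mult_mono block_start_ge)
    have "1 \<le> (ln (real N))\<^sup>2" using l by (simp add: one_le_power)
    hence "1 / (ln (real N))\<^sup>2 \<le> 1 / 1" by (intro divide_left_mono) auto
    hence "exp (1 / (ln (real N))\<^sup>2) \<le> exp 1" by simp
    thus "exp (1 / (ln (real N))\<^sup>2) \<le> 3" using exp_le by linarith
  qed auto
  finally show ?thesis by simp
qed

lemma block_length_ge:
  assumes l: "ln (real N) > 0" and j: "(ln (real N))\<^sup>2 * cut N \<le> real j"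
  shows "exp (cut N) / (ln (real N))\<^sup>2 - 1 \<le> real (block_start N (Suc j) - block_start N j)"
proof -
  define K where "K = (ln (real N))\<^sup>2"
  have K: "K > 0" using l by (simp add: K_def)
  have "exp (cut N) / K \<le> exp (real j / K) / K"
    using j K unfolding K_def[symmetric] by (intro divide_right_mono) (auto simp: field_simps)
  also have "\<dots> = exp (real j / K) * (1 / K)" by simp
  also have "\<dots> \<le> exp (real j / K) * (exp (1 / K) - 1)"
    using exp_ge_add_one_self[of "1 / K"] by (intro mult_left_mono) (linarith, simp)
  also have "\<dots> = exp (real (Suc j) / K) - exp (real j / K)"
    by (simp add: right_diff_distrib add_divide_distrib exp_add mult.commute)
  also have "\<dots> \<le> real (block_start N (Suc j)) - (real (block_start N j) - 1)"
  proof (intro diff_mono)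
    show "exp (real (Suc j) / K) \<le> real (block_start N (Suc j))" unfolding K_def by (rule block_start_ge)
    have "0 < exp (real j / K)" by simp
    thus "real (block_start N j) - 1 \<le> exp (real j / K)" unfolding block_start_def K_def by linarith
  qed
  finally show ?thesis using block_start_mono[of N j] by (simp add: K_def)
qed

text \<open>The trivial bounds for the blocks add up to a harmonic sum, because \<open>n\<close> varies by at most a
  factor 3 within a block.\<close>
lemma sum_blocks_le:
  assumes l: "ln (real N) \<ge> 1"
  shows "(\<Sum>j\<le>blk N N. real (Y div block_start N j) * real (block_start N (Suc j) - block_start N j))
     \<le> 3 * real Y * (1 + ln (3 * real N))"
proof -
  have N: "N \<ge> 1" using l by (cases N) auto
  have "(\<Sum>j\<le>blk N N. real (Y div block_start N j) * real (block_start N (Suc j) - block_start N j))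
     \<le> (\<Sum>j\<le>blk N N. \<Sum>n\<in>{block_start N j..<block_start N (Suc j)}. 3 * real Y * (1 / real n))"
  proof (rule sum_mono)
    fix j
    let ?u = "block_start N j"
    have "real (Y div ?u) * real (block_start N (Suc j) - ?u) = (\<Sum>n\<in>{?u..<block_start N (Suc j)}. real (Y div ?u))"
      by simp
    also have "\<dots> \<le> (\<Sum>n\<in>{?u..<block_start N (Suc j)}. 3 * real Y * (1 / real n))"
    proof (rule sum_mono)
      fix n assume n: "n \<in> {?u..<block_start N (Suc j)}"
      have u: "?u \<ge> 1" by (rule block_start_ge)
      have n3: "real n \<le> 3 * real ?u" by (rule block_element_le[OF l]) (use n in simp)
      have "real (Y div ?u) \<le> real Y / real ?u" by (rule of_nat_div_le_of_nat)
      also have "\<dots> \<le> real Y * 3 / real n"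
        using n3 u n by (simp add: field_simps mult_left_mono)
      finally show "real (Y div ?u) \<le> 3 * real Y * (1 / real n)" by (simp add: mult.commute)
    qed
    finally show "real (Y div ?u) * real (block_start N (Suc j) - ?u) \<le> (\<Sum>n\<in>{?u..<block_start N (Suc j)}. 3 * real Y * (1 / real n))" .
  qed
  also have "\<dots> = 3 * real Y * (\<Sum>j\<le>blk N N. \<Sum>n\<in>{block_start N j..<block_start N (Suc j)}. 1 / real n)"
    by (simp add: sum_distrib_left)
  also have "(\<Sum>j\<le>J. \<Sum>n\<in>{block_start N j..<block_start N (Suc j)}. 1 / real n) = (\<Sum>n\<in>{block_start N 0..<block_start N (Suc J)}. 1 / real n)" for J
  proof (induction J)
    case (Suc J)
    have "block_start N 0 \<le> block_start N (Suc J)" by (rule lift_Suc_mono_le) (auto intro: block_start_mono)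
    thus ?case using Suc sum.atLeastLessThan_concat[OF _ block_start_mono[of N "Suc J"], of "block_start N 0" "\<lambda>n. 1 / real n"] by simp
  qed simp
  also have "(\<Sum>n\<in>{block_start N 0..<block_start N (Suc (blk N N))}. 1 / real n) \<le> (\<Sum>n\<in>{1..3 * N}. 1 / real n)"
  proof (rule sum_mono2)
    show "{block_start N 0..<block_start N (Suc (blk N N))} \<subseteq> {1..3 * N}"
    proof
      fix n assume n: "n \<in> {block_start N 0..<block_start N (Suc (blk N N))}"
      have "0 < ln (real N)" using l by linarith
      from blk_eq_iff[OF this N] have "block_start N (blk N N) \<le> N" by blast
      moreover have "real n \<le> 3 * real (block_start N (blk N N))" by (rule block_element_le[OF l]) (use n in simp)
      ultimately have "n \<le> 3 * N" by linarith
      moreover have "n \<ge> 1" using n block_start_ge(2)[of N 0] by simp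
      ultimately show "n \<in> {1..3 * N}" by simp
    qed
  qed auto
  also have "\<dots> \<le> 1 + ln (3 * real N)" using sum_reciprocal_le[of "3 * N"] N by simp
  finally show ?thesis by (simp add: mult_left_mono)
qed

text \<open>Within one block of primes, the conditions on \<open>p\<close> and on \<open>h\<close> are independent except
  for \<open>p * h \<le> Y\<close>, and \<open>bilinear_inverse\<close> with \<open>D = (ln N)^3\<close>
  applies: either the sum over the block is smaller than the trivial bound by \<open>D\<close>, or the phase is
  bad.\<close>
lemma large_cofactor_sum:
  "\<exists>C::nat. \<forall>g N a b. degree g = d \<longrightarrow> a > 0 \<longrightarrow> b > 0 \<longrightarrow> ln (real N) \<ge> 2 \<longrightarrow>
     (ln (real N) ^ 3) ^ C \<le> exp (cut N) / (ln (real N))\<^sup>2 - 1 \<longrightarrow> \<not> phase_bad g N (3 * C) a b \<longrightarrow>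
     norm (\<Sum>(p, h)\<in>{x\<in>common_cofactors N a b. \<not> snd x < nat \<lceil>Lcut N\<rceil>}.
        unit_exp (poly g (real (p * (a * h)))) * cnj (unit_exp (poly g (real (p * (b * h))))))
     \<le> real N / real (max a b) * (3 * (1 + ln (3 * real N)) / ln (real N) ^ 3)"
proof -
  obtain C where C0: "bilinear_inverse_with d C"
    using bilinear_inverse[of d] by blast
  note C = C0[rule_format]
  show ?thesis
  proof (rule exI[of _ C], intro allI impI)
    fix g :: "real poly" and N a b :: nat
    assume d: "degree g = d" and ab: "a > 0" "b > 0" and l: "ln (real N) \<ge> 2"
      and NC: "(ln (real N) ^ 3) ^ C \<le> exp (cut N) / (ln (real N))\<^sup>2 - 1" and nb: "\<not> phase_bad g N (3 * C) a b"
    define D where "D = ln (real N) ^ 3"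
    define Y where "Y = N div max a b"
    define Lo where "Lo = nat \<lceil>Lcut N\<rceil>"
    define W where "W = {x\<in>common_cofactors N a b. \<not> snd x < Lo}"
    define \<gamma> where "\<gamma> = (\<lambda>i. coeff g i * (real a ^ i - real b ^ i))"
    define \<Phi> where "\<Phi> = (\<lambda>n. unit_exp (\<Sum>i\<in>{1..d}. \<gamma> i * real n ^ i))"
    have l0: "ln (real N) > 0" "ln (real N) \<ge> 1" using l by auto
    have D2: "D \<ge> 2"
    proof -
      have "(2::real) \<le> 2 ^ 3" by simp
      also have "\<dots> \<le> D" unfolding D_def using l by (intro power_mono) auto
      finally show ?thesis .
    qed
    have "0 < Lcut N" by (simp add: Lcut_def)
    hence Lo1: "Lo \<ge> 1" "Lcut N \<le> real Lo" unfolding Lo_def by linarith+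
    have finW: "finite W" unfolding W_def using finite_common_cofactors[OF ab] by simp
    have phase: "unit_exp (poly g (real (p * (a * h)))) * cnj (unit_exp (poly g (real (p * (b * h))))) = \<Phi> (p * h)" for p h
    proof -
      have "unit_exp (poly g (real (p * (a * h)))) * cnj (unit_exp (poly g (real (p * (b * h)))))
          = unit_exp (poly g (real (a * (p * h))) - poly g (real (b * (p * h))))"
        by (simp only: unit_exp_diff mult.left_commute)
      also have "\<dots> = \<Phi> (p * h)" unfolding poly_difference \<Phi>_def \<gamma>_def d ..
      finally show ?thesis .
    qed
    have Wiff: "(p, h) \<in> W \<longleftrightarrow> prime p \<and> h > 0 \<and> p * h \<le> Y \<and>
     (ln (real N))\<^sup>2 * cut N \<le> real (blk N p) \<and> (\<forall>r\<in>prime_factors a \<union> prime_factors b. blk N r < blk N p) \<and>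
     (\<forall>r\<in>prime_factors h. blk N r < blk N p) \<and> Lo \<le> h" for p h
      unfolding W_def Y_def by (auto simp: common_cofactors_iff[OF ab])
    (* On a block with nonempty contribution the conditions on a and b hold for all its primes, so that they can be dropped. *)
    have block: "norm (\<Sum>x\<in>{x\<in>W. blk N (fst x) = j}. \<Phi> (fst x * snd x)) \<le> real (Y div block_start N j) * real (block_start N (Suc j) - block_start N j) / D" for j
    proof (cases "{x\<in>W. blk N (fst x) = j} = {}")
      case True
      have "(\<Sum>x\<in>{x\<in>W. blk N (fst x) = j}. \<Phi> (fst x * snd x)) = 0" unfolding True by simp
      thus ?thesis using D2 by simp
    next
      case False
      then obtain p0 h0 where ph0: "(p0, h0) \<in> W" "blk N p0 = j" by auto
      have ab_j: "\<forall>r\<in>prime_factors a \<union> prime_factors b. blk N r < j" and jcut: "(ln (real N))\<^sup>2 * cut N \<le> real j"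
        using ph0 Wiff by auto
      define u where "u = block_start N j"
      define Z where "Z = block_start N (Suc j) - block_start N j"
      have u1: "u \<ge> 1" unfolding u_def by (rule block_start_ge)
      have uZ: "u + Z = block_start N (Suc j)" unfolding u_def Z_def using block_start_mono[of N j] by simp
      define P where "P = {p. prime p \<and> blk N p = j}"
      define H where "H = {h\<in>{Lo..Y div u}. \<forall>r\<in>prime_factors h. blk N r < j}"
      have Psub: "P \<subseteq> {u..<u+Z}"
      proof
        fix p assume "p \<in> P"
        hence "p \<ge> 1" "blk N p = j" by (auto simp: P_def Suc_le_eq dest: prime_gt_0_nat)
        thus "p \<in> {u..<u+Z}" unfolding uZ using blk_eq_iff[OF l0(1), of p j] by (simp add: u_def)
      qed
      have hle: "h \<le> Y div u" if "p \<in> P" "p * h \<le> Y" for p h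
      proof -
        have "u * h \<le> p * h" using that(1) Psub by auto
        hence "u * h \<le> Y" using that(2) by linarith
        thus ?thesis using u1 by (simp add: less_eq_div_iff_mult_less_eq mult.commute)
      qed
      have set_eq: "{x\<in>W. blk N (fst x) = j} = (\<lambda>(h, p). (p, h)) ` (SIGMA h:H. {p\<in>P. p * h \<le> Y})"
      proof (rule equalityI; rule subsetI)
        fix x assume x: "x \<in> {x\<in>W. blk N (fst x) = j}"
        obtain p h where e: "x = (p, h)" by (cases x)
        have p: "p \<in> P" "p * h \<le> Y" "Lo \<le> h" "\<forall>r\<in>prime_factors h. blk N r < j" using x Wiff by (auto simp: e P_def)
        hence "(h, p) \<in> (SIGMA h:H. {p\<in>P. p * h \<le> Y})" using hle by (simp add: H_def)
        thus "x \<in> (\<lambda>(h, p). (p, h)) ` (SIGMA h:H. {p\<in>P. p * h \<le> Y})" by (rule rev_image_eqI) (simp add: e)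
      next
        fix x assume "x \<in> (\<lambda>(h, p). (p, h)) ` (SIGMA h:H. {p\<in>P. p * h \<le> Y})"
        then obtain p h where e: "x = (p, h)" "h \<in> H" "p \<in> P" "p * h \<le> Y" by auto
        hence "(p, h) \<in> W" using ab_j jcut Lo1 by (simp add: Wiff H_def P_def)
        thus "x \<in> {x\<in>W. blk N (fst x) = j}" using e by (simp add: P_def)
      qed
      have "(\<Sum>x\<in>{x\<in>W. blk N (fst x) = j}. \<Phi> (fst x * snd x)) = (\<Sum>y\<in>(SIGMA h:H. {p\<in>P. p * h \<le> Y}). \<Phi> (snd y * fst y))"
        unfolding set_eq by (subst sum.reindex) (auto simp: inj_on_def case_prod_beta)
      also have "\<dots> = (\<Sum>h\<in>H. \<Sum>p\<in>{p\<in>P. p * h \<le> Y}. \<Phi> (p * h))"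
      proof -
        have "finite H" by (simp add: H_def)
        moreover have "finite {p\<in>P. p * h \<le> Y}" for h using finite_subset[OF Psub] by simp
        ultimately show ?thesis by (simp add: sum.Sigma case_prod_beta')
      qed
      finally have eq: "(\<Sum>x\<in>{x\<in>W. blk N (fst x) = j}. \<Phi> (fst x * snd x)) = (\<Sum>h\<in>H. \<Sum>p\<in>{p\<in>P. p * h \<le> Y}. \<Phi> (p * h))" .
      have h0: "Lo \<le> h0" "h0 \<le> Y div u" using ph0 Wiff hle[of p0 h0] by (auto simp: P_def)
      show ?thesis
      proof (rule ccontr)
        assume "\<not> ?thesis"
        hence "real (Y div u) * real Z / D < norm (\<Sum>h\<in>H. \<Sum>p\<in>{p\<in>P. p * h \<le> Y}. \<Phi> (p * h))"
          unfolding eq u_def Z_def by simp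
        hence large: "real (Y div u) * real Z \<le> D * norm (\<Sum>h\<in>H. \<Sum>p\<in>{p\<in>P. p * h \<le> Y}. unit_exp (\<Sum>i\<in>{1..d}. \<gamma> i * real (p * h) ^ i))"
          using D2 unfolding \<Phi>_def by (simp add: pos_divide_less_eq mult.commute less_imp_le)
        have ZC: "D ^ C \<le> real Z" using NC block_length_ge[OF l0(1) jcut] unfolding D_def Z_def by linarith
        have Hsub: "H \<subseteq> {Lo..Y div u}" by (auto simp: H_def)
        have LoY: "Lo \<le> Y div u" using h0 by linarith
        obtain q where q: "1 \<le> q" "real q \<le> D ^ C" "\<forall>i\<in>{1..d}. dist_int (real q * \<gamma> i) \<le> D ^ C / real (Y div u)"
          using C[OF D2 Psub Hsub Lo1(1) LoY u1 ZC large] by blast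
        have LY: "Lcut N \<le> real (Y div u)" using Lo1(2) LoY by linarith
        have DC: "D ^ C = ln (real N) ^ (3 * C)" by (simp add: D_def power_mult)
        have "D ^ C / real (Y div u) \<le> D ^ C / Lcut N"
        proof (rule divide_left_mono[OF LY])
          have "0 < real (Y div u)" using LY \<open>0 < Lcut N\<close> by linarith
          thus "0 < real (Y div u) * Lcut N" using \<open>0 < Lcut N\<close> by (rule mult_pos_pos)
        qed (use D2 in simp)
        hence "phase_bad g N (3 * C) a b"
          unfolding phase_bad_def d using q unfolding \<gamma>_def DC by (intro exI[of _ q]) fastforce
        thus False using nb by simp
      qed
    qed
    have blkN: "blk N (fst x) \<le> blk N N" if "x \<in> W" for x
    proof -
      obtain p h where e: "x = (p, h)" by (cases x)
      have p: "prime p" "h > 0" "p * h \<le> Y" using that Wiff by (auto simp: e)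
      have "p * 1 \<le> p * h" using p by (intro mult_le_mono) auto
      also have "\<dots> \<le> N" using p(3) div_le_dividend[of N "max a b"] unfolding Y_def by linarith
      finally show ?thesis using p(1) prime_ge_1_nat by (auto simp: e intro: blk_mono)
    qed
    have "norm (\<Sum>(p, h)\<in>W. unit_exp (poly g (real (p * (a * h)))) * cnj (unit_exp (poly g (real (p * (b * h))))))
       = norm (\<Sum>x\<in>W. \<Phi> (fst x * snd x))"
      by (simp add: phase case_prod_beta del: of_nat_mult)
    also have "(\<Sum>x\<in>W. \<Phi> (fst x * snd x)) = (\<Sum>j\<le>blk N N. \<Sum>x\<in>{x\<in>W. blk N (fst x) = j}. \<Phi> (fst x * snd x))"
      by (rule sum.group[symmetric, OF finW]) (use blkN in auto)
    also have "norm \<dots> \<le> (\<Sum>j\<le>blk N N. real (Y div block_start N j) * real (block_start N (Suc j) - block_start N j) / D)"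
      by (rule sum_norm_le) (rule block)
    also have "\<dots> = (\<Sum>j\<le>blk N N. real (Y div block_start N j) * real (block_start N (Suc j) - block_start N j)) / D"
      by (simp add: sum_divide_distrib)
    also have "\<dots> \<le> (3 * real Y * (1 + ln (3 * real N))) / D"
      using D2 by (intro divide_right_mono sum_blocks_le l0) auto
    also have "\<dots> = real Y * (3 * (1 + ln (3 * real N)) / D)" by simp
    also have "\<dots> \<le> real N / real (max a b) * (3 * (1 + ln (3 * real N)) / D)"
    proof (intro mult_right_mono)
      show "real Y \<le> real N / real (max a b)" unfolding Y_def by (rule of_nat_div_le_of_nat)
      have "N \<ge> 1" using l0 by (cases N) auto
      hence "ln (3 * real N) \<ge> 0" by simp
      thus "0 \<le> 3 * (1 + ln (3 * real N)) / D" using D2 by simp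
    qed
    finally show "norm (\<Sum>(p, h)\<in>{x\<in>common_cofactors N a b. \<not> snd x < nat \<lceil>Lcut N\<rceil>}.
        unit_exp (poly g (real (p * (a * h)))) * cnj (unit_exp (poly g (real (p * (b * h))))))
     \<le> real N / real (max a b) * (3 * (1 + ln (3 * real N)) / ln (real N) ^ 3)"
      unfolding W_def Lo_def D_def .
  qed
qed

section \<open>The Diophantine condition\<close>

text \<open>The non-constant coefficients of \<open>g\<close> are not simultaneously very close to rationals: for a common
  denominator \<open>q\<close> the error decays at most exponentially in an arbitrarily small power of
  \<open>q\<close>.\<close>
abbreviation diophantine_coeffs :: "real poly \<Rightarrow> nat \<Rightarrow> bool" where
  "diophantine_coeffs g d \<equiv>
    \<forall>\<epsilon>>0. \<exists>C>0. \<forall>q::int. q \<noteq> 0 \<longrightarrow>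
     Max ((\<lambda>i. dist_int (of_int q * coeff g i)) ` {1..d}) \<ge> C * exp (- (real_of_int \<bar>q\<bar> powr \<epsilon>))"

text \<open>With \<open>\<epsilon> * K \<le> 1/20\<close>, a denominator \<open>q \<le> (ln N)^K\<close> leaves a distance
  of at least \<open>C * exp (- (ln N)^(1/20))\<close>, which exceeds the inverse of \<open>Lcut N\<close> by
  more than any power of \<open>ln N\<close>.\<close>
lemma diophantine_denominators:
  fixes g :: "real poly"
  assumes dioph: "diophantine_coeffs g d"
    and d: "d \<ge> 1"
  shows "\<forall>\<^sub>F N in sequentially. \<forall>q::nat. 1 \<le> q \<and> real q \<le> ln (real N) ^ K \<longrightarrow>
     (\<exists>i\<in>{1..d}. ln (real N) ^ K / Lcut N < dist_int (real q * coeff g i))"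
proof -
  (* Small enough to turn a power of ln N into a power with exponent at most 1/20, half of the exponent in Lcut. *)
  define \<epsilon> where "\<epsilon> = 1 / (20 * (real K + 1))"
  have \<epsilon>: "\<epsilon> > 0" "real K * \<epsilon> \<le> 1 / 20" by (auto simp: \<epsilon>_def field_simps)
  obtain C where C: "C > 0" "\<And>q::int. q \<noteq> 0 \<Longrightarrow> Max ((\<lambda>i. dist_int (of_int q * coeff g i)) ` {1..d}) \<ge> C * exp (- (real_of_int \<bar>q\<bar> powr \<epsilon>))"
    using dioph \<epsilon>(1) by blast
  have "((\<lambda>x::real. ln x ^ K * exp (ln x powr (1/20) - ln x powr (1/10))) \<longlongrightarrow> 0) at_top"
    by real_asymp
  hence "\<forall>\<^sub>F x::real in at_top. ln x ^ K * exp (ln x powr (1/20) - ln x powr (1/10)) < C"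
    using C(1) by (rule order_tendstoD)
  hence ev: "\<forall>\<^sub>F N in sequentially. ln (real N) ^ K * exp (ln (real N) powr (1/20) - ln (real N) powr (1/10)) < C"
    by (rule eventually_compose_filterlim) (rule filterlim_real_sequentially)
  have "\<forall>\<^sub>F N in sequentially. ln (real N) \<ge> 1" by real_asymp
  with ev show ?thesis
  proof eventually_elim
    case (elim N)
    show ?case
    proof (intro allI impI)
      fix q :: nat assume q: "1 \<le> q \<and> real q \<le> ln (real N) ^ K"
      have "real q powr \<epsilon> \<le> (ln (real N) ^ K) powr \<epsilon>" using q \<epsilon> by (intro powr_mono2) auto
      also have "\<dots> = ln (real N) powr (real K * \<epsilon>)"
        using elim(2) by (simp add: powr_powr flip: powr_realpow)
      also have "\<dots> \<le> ln (real N) powr (1/20)" using elim(2) \<epsilon>(2) by (intro powr_mono) auto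
      finally have qp: "real q powr \<epsilon> \<le> ln (real N) powr (1/20)" .
      have "ln (real N) ^ K / Lcut N = ln (real N) ^ K * exp (ln (real N) powr (1/20) - ln (real N) powr (1/10)) * exp (- (ln (real N) powr (1/20)))"
        by (simp add: Lcut_def exp_diff exp_minus field_simps)
      also have "\<dots> < C * exp (- (ln (real N) powr (1/20)))" using elim(1) by (intro mult_strict_right_mono) auto
      also have "\<dots> \<le> C * exp (- (real q powr \<epsilon>))" using qp C(1) by (intro mult_left_mono) auto
      also have "\<dots> \<le> Max ((\<lambda>i. dist_int (real q * coeff g i)) ` {1..d})" using C(2)[of "int q"] q by simp
      finally have "ln (real N) ^ K / Lcut N < Max ((\<lambda>i. dist_int (real q * coeff g i)) ` {1..d})" .
      moreover have "Max ((\<lambda>i. dist_int (real q * coeff g i)) ` {1..d}) \<in> (\<lambda>i. dist_int (real q * coeff g i)) ` {1..d}"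
        using d by (intro Max_in) auto
      ultimately show "\<exists>i\<in>{1..d}. ln (real N) ^ K / Lcut N < dist_int (real q * coeff g i)" by auto
    qed
  qed
qed

text \<open>Multiplication by all the nonzero integers \<open>a ^ i - b ^ i\<close> turns a denominator of the products
  into one of the \<open>x i\<close>.  This is affordable when \<open>a\<close> is small.\<close>
lemma clear_power_differences:
  fixes x :: "nat \<Rightarrow> real"
  assumes ab: "b < a" and q: "1 \<le> q" "real q \<le> Q" and \<eta>: "\<eta> \<ge> 0"
    and cl: "\<forall>i\<in>{1..d}. dist_int (real q * (x i * (real a ^ i - real b ^ i))) \<le> \<eta>"
  shows "\<exists>r::nat. 1 \<le> r \<and> real r \<le> Q * real a ^ (d * d) \<and> (\<forall>i\<in>{1..d}. dist_int (real r * x i) \<le> real a ^ (d * d) * \<eta>)"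
proof -
  define w where "w = (\<lambda>i. a ^ i - b ^ i)"
  have w1: "w i \<ge> 1" if "i \<ge> 1" for i using ab that power_strict_mono[of b a i] by (simp add: w_def Suc_le_eq)
  have w2: "real (w i) = real a ^ i - real b ^ i" for i
    using ab power_mono[of b a i] by (simp add: w_def of_nat_diff)
  have w3: "w i \<le> a ^ d" if "i \<in> {1..d}" for i
  proof -
    have "w i \<le> a ^ i" by (simp add: w_def)
    also have "\<dots> \<le> a ^ d" using ab that by (intro power_increasing) auto
    finally show ?thesis .
  qed
  have P: "(\<Prod>i\<in>S. w i) \<le> a ^ (d * d)" if "S \<subseteq> {1..d}" for S
  proof -
    have "(\<Prod>i\<in>S. w i) \<le> (\<Prod>i\<in>S. a ^ d)" using that w3 by (intro prod_mono) auto
    also have "\<dots> = a ^ (d * card S)" by (simp add: power_mult)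
    also have "\<dots> \<le> a ^ (d * d)"
      using ab card_mono[OF _ that] by (intro power_increasing mult_le_mono2) auto
    finally show ?thesis .
  qed
  show ?thesis
  proof (intro exI[of _ "q * (\<Prod>i\<in>{1..d}. w i)"] conjI ballI)
    have "(\<Prod>i\<in>{1..d}. w i) > 0" using w1 by (intro prod_pos) (auto simp: Suc_le_eq)
    thus "1 \<le> q * (\<Prod>i\<in>{1..d}. w i)" using q by (simp add: Suc_le_eq)
    have "real (\<Prod>i\<in>{1..d}. w i) \<le> real (a ^ (d * d))" using P[OF order_refl] by (simp only: of_nat_le_iff)
    thus "real (q * (\<Prod>i\<in>{1..d}. w i)) \<le> Q * real a ^ (d * d)"
      unfolding of_nat_mult using q by (intro mult_mono) (auto intro: prod_nonneg)
    fix i assume i: "i \<in> {1..d}"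
    define v where "v = (\<Prod>j\<in>{1..d} - {i}. w j)"
    have "(\<Prod>j\<in>{1..d}. w j) = w i * v" unfolding v_def using i by (intro prod.remove) auto
    hence "real (q * (\<Prod>j\<in>{1..d}. w j)) * x i = real v * (real q * (x i * (real a ^ i - real b ^ i)))"
      by (simp add: w2[symmetric] mult_ac)
    hence "dist_int (real (q * (\<Prod>j\<in>{1..d}. w j)) * x i) \<le> real v * dist_int (real q * (x i * (real a ^ i - real b ^ i)))"
      using dist_int_of_nat_mult by metis
    also have "\<dots> \<le> real (a ^ (d * d)) * \<eta>"
    proof (intro mult_mono)
      have "v \<le> a ^ (d * d)" unfolding v_def by (rule P) auto
      thus "real v \<le> real (a ^ (d * d))" by (simp only: of_nat_le_iff)
    qed (use cl i in auto)
    finally show "dist_int (real (q * (\<Prod>i\<in>{1..d}. w i)) * x i) \<le> real a ^ (d * d) * \<eta>" by simp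
  qed
qed

text \<open>Suppose that too many \<open>b\<close> are bad for \<open>a\<close>.  If \<open>a\<close> is at most a power
  of \<open>ln N\<close>, one bad \<open>b\<close> and \<open>clear_power_differences\<close> give a denominator
  for the coefficients of \<open>g\<close>.  Otherwise many bad \<open>b\<close> share the same
  \<open>q\<close>, and \<open>coefficient_recurrence\<close> in the variable \<open>b\<close> gives one.
  Either way \<open>diophantine_denominators\<close> is contradicted.\<close>
lemma phase_bad_sparse:
  fixes g :: "real poly"
  assumes dioph: "diophantine_coeffs g (degree g)"
    and d: "degree g \<ge> 1"
  shows "\<forall>\<^sub>F N in sequentially. \<forall>a\<ge>1. real (card {b\<in>{1..<a}. phase_bad g N K a b}) \<le> real a / (ln (real N))\<^sup>2"
proof -
  let ?d = "degree g"
  obtain C where C0: "coefficient_recurrence_with ?d C"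
    using coefficient_recurrence[of ?d] by blast
  note C = C0[rule_format]
  (* K3 bounds the denominators produced by recurrence, and also separates small a from large a; K4 covers both cases. *)
  define K3 where "K3 = (K + 2) * C"
  define K4 where "K4 = K3 * (?d * ?d) + K3 + K"
  have ev1: "\<forall>\<^sub>F N in sequentially. ln (real N) \<ge> 2" by real_asymp
  show ?thesis
    using diophantine_denominators[OF dioph d, of K4] ev1
  proof eventually_elim
    case (elim N)
    define l where "l = ln (real N)"
    have l: "l \<ge> 2" using elim(2) by (simp add: l_def)
    note pb = pow_base[OF l]
    have Lpos: "Lcut N > 0" by (simp add: Lcut_def)
    have no: False if "1 \<le> q" "real q \<le> l ^ K4" "\<forall>i\<in>{1..?d}. dist_int (real q * coeff g i) \<le> l ^ K4 / Lcut N" for q :: nat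
    proof -
      have "\<exists>i\<in>{1..?d}. l ^ K4 / Lcut N < dist_int (real q * coeff g i)"
        using elim(1) that(1,2) unfolding l_def by blast
      thus False using that(3) by (meson not_le)
    qed
    show ?case
    proof (intro allI impI)
      fix a :: nat assume a: "1 \<le> a"
      define S where "S = {b\<in>{1..<a}. phase_bad g N K a b}"
      have finS: "finite S" by (simp add: S_def)
      show "real (card {b\<in>{1..<a}. phase_bad g N K a b}) \<le> real a / (ln (real N))\<^sup>2"
      proof (rule ccontr)
        assume "\<not> ?thesis"
        hence big: "real a / l\<^sup>2 < real (card S)" by (simp add: S_def l_def)
        have Sne: "S \<noteq> {}"
        proof
          assume "S = {}"
          hence "real a / l\<^sup>2 < 0" using big by simp
          moreover have "0 \<le> real a / l\<^sup>2" by simp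
          ultimately show False by linarith
        qed
        obtain f where f: "\<And>b. b \<in> S \<Longrightarrow> 1 \<le> f b \<and> real (f b) \<le> l ^ K \<and>
           (\<forall>i\<in>{1..?d}. dist_int (real (f b) * (coeff g i * (real a ^ i - real b ^ i))) \<le> l ^ K / Lcut N)"
        proof -
          have "\<forall>b\<in>S. \<exists>q::nat. 1 \<le> q \<and> real q \<le> l ^ K \<and>
           (\<forall>i\<in>{1..?d}. dist_int (real q * (coeff g i * (real a ^ i - real b ^ i))) \<le> l ^ K / Lcut N)"
            by (auto simp: S_def phase_bad_def l_def)
          from bchoice[OF this] show ?thesis using that by blast
        qed
        show False
        proof (cases "real a \<le> l ^ K3")
          case True
          obtain b where b: "b \<in> S" using Sne by blast
          have ba: "b < a" using b by (simp add: S_def)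
          have fb: "1 \<le> f b" "real (f b) \<le> l ^ K"
            "\<forall>i\<in>{1..?d}. dist_int (real (f b) * (coeff g i * (real a ^ i - real b ^ i))) \<le> l ^ K / Lcut N"
            using f[OF b] by auto
          have \<eta>0: "0 \<le> l ^ K / Lcut N" using pb(2)[of K] Lpos by simp
          obtain r :: nat where r: "1 \<le> r" "real r \<le> l ^ K * real a ^ (?d * ?d)"
             "\<forall>i\<in>{1..?d}. dist_int (real r * coeff g i) \<le> real a ^ (?d * ?d) * (l ^ K / Lcut N)"
            using clear_power_differences[OF ba fb(1,2) \<eta>0 fb(3)] by blast
          have "real a ^ (?d * ?d) \<le> l ^ (K3 * (?d * ?d))" unfolding power_mult[of l K3] using True by (intro power_mono) auto
          hence "l ^ K * real a ^ (?d * ?d) \<le> l ^ K * l ^ (K3 * (?d * ?d))" using pb(2)[of K] by (intro mult_left_mono) auto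
          also have "\<dots> = l ^ (K + K3 * (?d * ?d))" by (simp add: power_add)
          also have "\<dots> \<le> l ^ K4" by (rule pb(3)) (simp add: K4_def)
          finally have le: "l ^ K * real a ^ (?d * ?d) \<le> l ^ K4" .
          have "real a ^ (?d * ?d) * (l ^ K / Lcut N) = (l ^ K * real a ^ (?d * ?d)) / Lcut N" by simp
          also have "\<dots> \<le> l ^ K4 / Lcut N" using le Lpos by (intro divide_right_mono) auto
          finally show False using no[OF r(1)] r(2,3) le by (meson order_trans)
        next
          case False
          obtain q where q: "q \<ge> 1" "real q \<le> l ^ K" "real (card S) \<le> l ^ K * real (card {b\<in>S. f b = q})"
            using pigeonhole_bounded[OF finS Sne, of f "l ^ K"] f by blast
          have "\<exists>r::nat. 1 \<le> r \<and> real r \<le> (l ^ (K + 2)) ^ C \<and>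
             (\<forall>i\<in>{1..?d}. dist_int (real r * (real q * coeff g i)) \<le> (l ^ (K + 2)) ^ C * (l ^ K / Lcut N))"
          proof (rule C)
            have "l ^ 1 \<le> l ^ (K + 2)" by (rule pb(3)) simp
            thus "2 \<le> l ^ (K + 2)" unfolding power_one_right using l by linarith
            show "{b\<in>S. f b = q} \<subseteq> {0..<0 + a}" by (auto simp: S_def)
            have "real a \<le> l\<^sup>2 * real (card S)" using big l by (simp add: field_simps)
            also have "\<dots> \<le> l\<^sup>2 * (l ^ K * real (card {b\<in>S. f b = q}))" using q l by (intro mult_left_mono) auto
            also have "\<dots> = l ^ (K + 2) * real (card {b\<in>S. f b = q})" by (simp add: power_add power2_eq_square mult_ac)
            finally show "real a \<le> l ^ (K + 2) * real (card {b\<in>S. f b = q})" .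
            show "(l ^ (K + 2)) ^ C \<le> real a" using False by (simp only: K3_def power_mult)
            show "0 \<le> l ^ K / Lcut N" using pb(2)[of K] Lpos by simp
            show "dist_int (real q * coeff g i * real s ^ i - real q * coeff g i * real a ^ i) \<le> l ^ K / Lcut N"
              if "i \<in> {1..?d}" "s \<in> {b\<in>S. f b = q}" for i s
            proof -
              have "dist_int (real q * coeff g i * real s ^ i - real q * coeff g i * real a ^ i) =
                 dist_int (- (real q * coeff g i * real s ^ i - real q * coeff g i * real a ^ i))" by (simp only: dist_int_minus)
              also have "- (real q * coeff g i * real s ^ i - real q * coeff g i * real a ^ i) = real q * (coeff g i * (real a ^ i - real s ^ i))"
                by (simp add: algebra_simps)
              finally show ?thesis using f[of s] that by auto
            qed
          qed
          then obtain r :: nat where r: "1 \<le> r" "real r \<le> l ^ K3" "\<forall>i\<in>{1..?d}. dist_int (real r * (real q * coeff g i)) \<le> l ^ K3 * (l ^ K / Lcut N)"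
            unfolding K3_def power_mult by blast
          have le: "l ^ K3 * l ^ K \<le> l ^ K4" unfolding power_add[symmetric] by (rule pb(3)) (simp add: K4_def)
          have "real (r * q) \<le> l ^ K3 * l ^ K" unfolding of_nat_mult using r q pb(2)[of K3] by (intro mult_mono) auto
          hence rq: "real (r * q) \<le> l ^ K4" using le by linarith
          have "l ^ K3 * (l ^ K / Lcut N) \<le> l ^ K4 / Lcut N" using divide_right_mono[OF le, of "Lcut N"] Lpos by simp
          hence "\<forall>i\<in>{1..?d}. dist_int (real (r * q) * coeff g i) \<le> l ^ K4 / Lcut N"
            using r(3) unfolding of_nat_mult mult.assoc by (meson order_trans)
          moreover have "1 \<le> r * q" using r q by simp
          ultimately show False using no[of "r * q"] rq by blast
        qed
      qed
    qed
  qed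
qed

section \<open>The off-diagonal variance\<close>

text \<open>The two summands come from the cofactors below and above \<open>Lcut N\<close>.\<close>
definition off_diagonal_saving :: "nat \<Rightarrow> real" where
  "off_diagonal_saving N = 5 * (1 + ln (real N) powr (1/10)) / cut N + 3 * (1 + ln (3 * real N)) / ln (real N) ^ 3"

lemma ratio_sum_saving:
  fixes g :: "real poly"
  shows "\<exists>K::nat. \<forall>\<^sub>F N in sequentially. \<forall>a b. a > 0 \<longrightarrow> b > 0 \<longrightarrow> coprime a b \<longrightarrow> \<not> phase_bad g N K a b \<longrightarrow>
     norm (ratio_sum (adm N) (\<lambda>n. unit_exp (poly g (real n))) (a, b)) \<le> real N / real (max a b) * off_diagonal_saving N"
proof -
  obtain C :: nat where C0: "\<forall>g' N a b. degree g' = degree g \<longrightarrow> a > 0 \<longrightarrow> b > 0 \<longrightarrow> ln (real N) \<ge> 2 \<longrightarrow>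
     (ln (real N) ^ 3) ^ C \<le> exp (cut N) / (ln (real N))\<^sup>2 - 1 \<longrightarrow> \<not> phase_bad g' N (3 * C) a b \<longrightarrow>
     norm (\<Sum>(p, h)\<in>{x\<in>common_cofactors N a b. \<not> snd x < nat \<lceil>Lcut N\<rceil>}.
        unit_exp (poly g' (real (p * (a * h)))) * cnj (unit_exp (poly g' (real (p * (b * h))))))
     \<le> real N / real (max a b) * (3 * (1 + ln (3 * real N)) / ln (real N) ^ 3)"
    using large_cofactor_sum[of "degree g"] by blast
  note C = C0[rule_format, OF refl]
  have "\<forall>\<^sub>F x::real in at_top. (ln x ^ 3) ^ C \<le> exp (ln x powr (3/4)) / (ln x)\<^sup>2 - 1" by real_asymp
  hence ev1: "\<forall>\<^sub>F N in sequentially. (ln (real N) ^ 3) ^ C \<le> exp (cut N) / (ln (real N))\<^sup>2 - 1"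
    unfolding cut_def by (rule eventually_compose_filterlim) (rule filterlim_real_sequentially)
  have ev2: "\<forall>\<^sub>F N in sequentially. ln (real N) \<ge> 2" by real_asymp
  show ?thesis
  proof (rule exI[of _ "3 * C"])
    show "\<forall>\<^sub>F N in sequentially. \<forall>a b. a > 0 \<longrightarrow> b > 0 \<longrightarrow> coprime a b \<longrightarrow> \<not> phase_bad g N (3 * C) a b \<longrightarrow>
     norm (ratio_sum (adm N) (\<lambda>n. unit_exp (poly g (real n))) (a, b)) \<le> real N / real (max a b) * off_diagonal_saving N"
      using ev1 ev2
    proof eventually_elim
      case (elim N)
      show ?case
      proof (intro allI impI)
        fix a b :: nat assume ab: "a > 0" "b > 0" and cop: "coprime a b" and nb: "\<not> phase_bad g N (3 * C) a b"
        define W where "W = common_cofactors N a b"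
        define Lo where "Lo = nat \<lceil>Lcut N\<rceil>"
        define F where "F = (\<lambda>(p, h). unit_exp (poly g (real (p * (a * h)))) * cnj (unit_exp (poly g (real (p * (b * h))))))"
        have finW: "finite W" unfolding W_def by (rule finite_common_cofactors[OF ab])
        have "ratio_sum (adm N) (\<lambda>n. unit_exp (poly g (real n))) (a, b) = (\<Sum>x\<in>W. F x)"
          unfolding ratio_sum_eq[OF cop ab] W_def F_def ..
        also have "\<dots> = (\<Sum>x\<in>{x\<in>W. snd x < Lo} \<union> {x\<in>W. \<not> snd x < Lo}. F x)" by (rule sum.cong) auto
        also have "\<dots> = (\<Sum>x\<in>{x\<in>W. snd x < Lo}. F x) + (\<Sum>x\<in>{x\<in>W. \<not> snd x < Lo}. F x)"
          by (rule sum.union_disjoint) (use finW in auto)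
        finally have "norm (ratio_sum (adm N) (\<lambda>n. unit_exp (poly g (real n))) (a, b)) \<le> norm (\<Sum>x\<in>{x\<in>W. snd x < Lo}. F x) + norm (\<Sum>x\<in>{x\<in>W. \<not> snd x < Lo}. F x)"
          by (simp add: norm_triangle_ineq)
        also have "norm (\<Sum>x\<in>{x\<in>W. snd x < Lo}. F x) \<le> (\<Sum>x\<in>{x\<in>W. snd x < Lo}. 1)"
          by (rule sum_norm_le) (auto simp: F_def norm_mult)
        also have "\<dots> = real (card {x\<in>W. snd x < Lo})" by simp
        also have "\<dots> \<le> real N / real (max a b) * (5 * (1 + ln (real N) powr (1/10)) / cut N)"
          unfolding W_def Lo_def by (rule small_cofactor_count[OF ab elim(2)])
        also have "norm (\<Sum>x\<in>{x\<in>W. \<not> snd x < Lo}. F x) \<le> real N / real (max a b) * (3 * (1 + ln (3 * real N)) / ln (real N) ^ 3)"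
          unfolding W_def Lo_def F_def by (rule C[OF ab elim(2,1) nb])
        finally show "norm (ratio_sum (adm N) (\<lambda>n. unit_exp (poly g (real n))) (a, b)) \<le> real N / real (max a b) * off_diagonal_saving N"
          by (simp add: off_diagonal_saving_def distrib_left)
      qed
    qed
  qed
qed

text \<open>Each unordered pair is counted at most twice.\<close>
lemma sum_ordered_pairs_le:
  fixes F :: "nat \<times> nat \<Rightarrow> real" and \<Psi> :: "nat \<Rightarrow> nat \<Rightarrow> real"
  assumes R: "R \<subseteq> {1..N} \<times> {1..N}" "\<And>a b. (a, b) \<in> R \<Longrightarrow> a \<noteq> b"
    and F: "\<And>a b. (a, b) \<in> R \<Longrightarrow> F (a, b) \<le> \<Psi> (max a b) (min a b)" and \<Psi>: "\<And>a b. \<Psi> a b \<ge> 0"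
  shows "(\<Sum>r\<in>R. F r) \<le> 2 * (\<Sum>a\<in>{1..N}. \<Sum>b\<in>{1..<a}. \<Psi> a b)"
proof -
  have fin: "finite R" using R(1) by (rule finite_subset) auto
  define T where "T = (SIGMA a:{1..N}. {1..<a})"
  have S: "(\<Sum>a\<in>{1..N}. \<Sum>b\<in>{1..<a}. \<Psi> a b) = (\<Sum>(a, b)\<in>T. \<Psi> a b)" unfolding T_def by (rule sum.Sigma) auto
  have finT: "finite T" by (simp add: T_def)
  have 1: "(\<Sum>r\<in>{r\<in>R. snd r < fst r}. F r) \<le> (\<Sum>(a, b)\<in>T. \<Psi> a b)"
  proof -
    have "(\<Sum>r\<in>{r\<in>R. snd r < fst r}. F r) \<le> (\<Sum>r\<in>{r\<in>R. snd r < fst r}. case r of (a, b) \<Rightarrow> \<Psi> a b)"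
    proof (rule sum_mono)
      fix r assume r: "r \<in> {r\<in>R. snd r < fst r}"
      obtain a b where e: "r = (a, b)" by (cases r)
      show "F r \<le> (case r of (a, b) \<Rightarrow> \<Psi> a b)" using F[of a b] r by (simp add: e max_def min_def)
    qed
    also have "\<dots> \<le> (\<Sum>(a, b)\<in>T. \<Psi> a b)" by (rule sum_mono2[OF finT]) (use R \<Psi> in \<open>auto simp: T_def\<close>)
    finally show ?thesis .
  qed
  have 2: "(\<Sum>r\<in>{r\<in>R. \<not> snd r < fst r}. F r) \<le> (\<Sum>(a, b)\<in>T. \<Psi> a b)"
  proof -
    have "(\<Sum>r\<in>{r\<in>R. \<not> snd r < fst r}. F r) \<le> (\<Sum>r\<in>{r\<in>R. \<not> snd r < fst r}. case (snd r, fst r) of (a, b) \<Rightarrow> \<Psi> a b)"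
    proof (rule sum_mono)
      fix r assume r: "r \<in> {r\<in>R. \<not> snd r < fst r}"
      obtain a b where e: "r = (a, b)" by (cases r)
      have "a \<le> b" using r by (simp add: e)
      thus "F r \<le> (case (snd r, fst r) of (a, b) \<Rightarrow> \<Psi> a b)" using F[of a b] r by (simp add: e max_def min_def)
    qed
    also have "\<dots> = (\<Sum>(a, b)\<in>(\<lambda>r. (snd r, fst r)) ` {r\<in>R. \<not> snd r < fst r}. \<Psi> a b)"
      by (subst sum.reindex) (auto simp: inj_on_def)
    also have "\<dots> \<le> (\<Sum>(a, b)\<in>T. \<Psi> a b)"
    proof (rule sum_mono2[OF finT])
      show "(\<lambda>r. (snd r, fst r)) ` {r\<in>R. \<not> snd r < fst r} \<subseteq> T"
      proof
        fix x assume "x \<in> (\<lambda>r. (snd r, fst r)) ` {r\<in>R. \<not> snd r < fst r}"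
        then obtain a b where ab: "(a, b) \<in> R" "\<not> b < a" "x = (b, a)" by auto
        have "a \<noteq> b" by (rule R(2)[OF ab(1)])
        thus "x \<in> T" using ab R(1) by (auto simp: T_def)
      qed
    qed (use \<Psi> in auto)
    finally show ?thesis .
  qed
  have "R = {r\<in>R. snd r < fst r} \<union> {r\<in>R. \<not> snd r < fst r}" by auto
  hence "(\<Sum>r\<in>R. F r) = (\<Sum>r\<in>{r\<in>R. snd r < fst r} \<union> {r\<in>R. \<not> snd r < fst r}. F r)" by simp
  also have "\<dots> = (\<Sum>r\<in>{r\<in>R. snd r < fst r}. F r) + (\<Sum>r\<in>{r\<in>R. \<not> snd r < fst r}. F r)"
    by (rule sum.union_disjoint) (use fin in auto)
  finally show ?thesis using 1 2 unfolding S by linarith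
qed

text \<open>The reduced fractions that occur in the quadratic variation.\<close>
definition adm_ratios :: "nat \<Rightarrow> (nat \<times> nat) set" where
  "adm_ratios N = reduced ` (snd ` {(p, m, m'). (p, m) \<in> adm N \<and> (p, m') \<in> adm N})"

lemma adm_ratios_bounds:
  assumes "(a, b) \<in> adm_ratios N"
  shows "coprime a b" "a \<in> {1..N}" "b \<in> {1..N}"
proof -
  obtain p m m' where m: "(p, m) \<in> adm N" "(p, m') \<in> adm N" "reduced (m, m') = (a, b)"
    using assms by (auto simp: adm_ratios_def)
  have pos: "m > 0" "m' > 0" using m by (auto simp: adm_def)
  have mN: "m \<le> N" if "(p, m) \<in> adm N" for m
  proof -
    have "1 * m \<le> p * m" using that by (intro mult_le_mono) (auto simp: adm_def Suc_le_eq dest: prime_gt_0_nat)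
    also have "\<dots> \<le> N" using that by (simp add: adm_def)
    finally show ?thesis by simp
  qed
  have "a = m div gcd m m'" "b = m' div gcd m m'" using m(3) by (auto simp: reduced_def)
  hence "a \<le> m" "b \<le> m'" by simp_all
  thus "coprime a b" "a \<in> {1..N}" "b \<in> {1..N}"
    using reduced_coprime[OF pos m(3)] mN[OF m(1)] mN[OF m(2)] by auto
qed

text \<open>The part of the variance of the quadratic variation that comes from fractions other than 1.\<close>
abbreviation off_diagonal :: "nat \<Rightarrow> (nat \<Rightarrow> complex) \<Rightarrow> real" where
  "off_diagonal N c \<equiv>
    (\<Sum>r\<in>adm_ratios N - {(1, 1)}. (norm (ratio_sum (adm N) c r))\<^sup>2) / (real N)\<^sup>2"

text \<open>For the good pairs the squares of \<open>N / max a b\<close> sum to \<open>O(N^2 * ln N)\<close>, and the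
  saving is \<open>(ln N)^(-13/20)\<close>, whose square beats the logarithm.  The bad pairs have density
  \<open>(ln N)^(-2)\<close> for each \<open>a\<close> and are estimated trivially.\<close>
lemma off_diagonal_tendsto_0:
  fixes g :: "real poly"
  assumes dioph: "diophantine_coeffs g (degree g)"
    and d: "degree g \<ge> 1"
  shows "(\<lambda>N. off_diagonal N (\<lambda>n. unit_exp (poly g (real n)))) \<longlonglongrightarrow> 0"
proof -
  obtain K where K: "\<forall>\<^sub>F N in sequentially. \<forall>a b. a > 0 \<longrightarrow> b > 0 \<longrightarrow> coprime a b \<longrightarrow> \<not> phase_bad g N K a b \<longrightarrow>
     norm (ratio_sum (adm N) (\<lambda>n. unit_exp (poly g (real n))) (a, b)) \<le> real N / real (max a b) * off_diagonal_saving N"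
    using ratio_sum_saving[of g] by blast
  define bound where "bound = (\<lambda>N. 2 * ((off_diagonal_saving N)\<^sup>2 + 1 / (ln (real N))\<^sup>2) * (1 + ln (real N)))"
  have "((\<lambda>x::real. 2 * ((5 * (1 + ln x powr (1/10)) / (ln x powr (3/4)) + 3 * (1 + ln (3 * x)) / ln x ^ 3)\<^sup>2 + 1 / (ln x)\<^sup>2) * (1 + ln x)) \<longlongrightarrow> 0) at_top"
    by real_asymp
  hence lim: "bound \<longlonglongrightarrow> 0"
    unfolding bound_def off_diagonal_saving_def cut_def by (rule filterlim_compose) (rule filterlim_real_sequentially)
  have ev2: "\<forall>\<^sub>F N in sequentially. ln (real N) \<ge> 2" by real_asymp
  have "\<forall>\<^sub>F N in sequentially. off_diagonal N (\<lambda>n. unit_exp (poly g (real n))) \<le> bound N"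
    using K phase_bad_sparse[OF dioph d, of K] ev2
  proof eventually_elim
    case (elim N)
    define \<delta> where "\<delta> = (off_diagonal_saving N)\<^sup>2"
    have N: "N \<ge> 1" using elim(3) by (cases N) auto
    (* The bound for |T|^2 at the pair with maximum a and minimum b. *)
    define \<Psi> where "\<Psi> = (\<lambda>a b. (real N / real a)\<^sup>2 * (\<delta> + (if phase_bad g N K a b then 1 else 0)))"
    define T where "T = (\<lambda>r. ratio_sum (adm N) (\<lambda>n. unit_exp (poly g (real n))) r)"
    have \<delta>0: "\<delta> \<ge> 0" by (simp add: \<delta>_def)
    have "(\<Sum>r\<in>adm_ratios N - {(1, 1)}. (norm (T r))\<^sup>2) \<le> 2 * (\<Sum>a\<in>{1..N}. \<Sum>b\<in>{1..<a}. \<Psi> a b)"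
    proof (rule sum_ordered_pairs_le)
      show "adm_ratios N - {(1, 1)} \<subseteq> {1..N} \<times> {1..N}" using adm_ratios_bounds by auto
      show "a \<noteq> b" if "(a, b) \<in> adm_ratios N - {(1, 1)}" for a b
        using adm_ratios_bounds[of a b N] that by auto
      show "\<Psi> a b \<ge> 0" for a b using \<delta>0 by (simp add: \<Psi>_def)
      fix a b assume ab: "(a, b) \<in> adm_ratios N - {(1, 1)}"
      have cop: "coprime a b" "a > 0" "b > 0" using adm_ratios_bounds[of a b N] ab by auto
      have bad_mm: "phase_bad g N K (max a b) (min a b) \<longleftrightarrow> phase_bad g N K a b"
        using phase_bad_sym[of g N K a b] by (simp add: max_def min_def)
      show "(norm (T (a, b)))\<^sup>2 \<le> \<Psi> (max a b) (min a b)"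
      proof (cases "phase_bad g N K a b")
        case True
        have "norm (T (a, b)) \<le> real N / real (max a b)" unfolding T_def by (rule ratio_sum_trivial[OF cop]) simp
        hence "(norm (T (a, b)))\<^sup>2 \<le> (real N / real (max a b))\<^sup>2 * 1" by (simp add: power_mono del: of_nat_max)
        also have "\<dots> \<le> \<Psi> (max a b) (min a b)" unfolding \<Psi>_def bad_mm using True \<delta>0 by (intro mult_left_mono) auto
        finally show ?thesis .
      next
        case False
        have "norm (T (a, b)) \<le> real N / real (max a b) * off_diagonal_saving N"
          using elim(1) cop False unfolding T_def by blast
        hence "(norm (T (a, b)))\<^sup>2 \<le> (real N / real (max a b) * off_diagonal_saving N)\<^sup>2" by (intro power_mono) auto
        hence "(norm (T (a, b)))\<^sup>2 \<le> (real N / real (max a b))\<^sup>2 * (off_diagonal_saving N)\<^sup>2" by (simp only: power_mult_distrib)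
        thus ?thesis unfolding \<Psi>_def bad_mm using False by (simp add: \<delta>_def del: of_nat_max)
      qed
    qed
    also have "(\<Sum>a\<in>{1..N}. \<Sum>b\<in>{1..<a}. \<Psi> a b) \<le> (\<Sum>a\<in>{1..N}. (real N)\<^sup>2 * (\<delta> + 1 / (ln (real N))\<^sup>2) * (1 / real a))"
    proof (rule sum_mono)
      fix a assume a: "a \<in> {1..N}"
      have "(\<Sum>b\<in>{1..<a}. \<Psi> a b) = (real N / real a)\<^sup>2 * (real (a - 1) * \<delta> + real (card {b\<in>{1..<a}. phase_bad g N K a b}))"
        unfolding \<Psi>_def sum_distrib_left[symmetric] sum.distrib by (simp add: sum.If_cases Int_def)
      also have "\<dots> \<le> (real N / real a)\<^sup>2 * (real a * \<delta> + real a / (ln (real N))\<^sup>2)"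
        using elim(2) a \<delta>0 by (intro mult_left_mono add_mono mult_right_mono) auto
      also have "\<dots> = (real N)\<^sup>2 * (\<delta> + 1 / (ln (real N))\<^sup>2) * (1 / real a)"
        using a by (simp add: power2_eq_square field_simps)
      finally show "(\<Sum>b\<in>{1..<a}. \<Psi> a b) \<le> (real N)\<^sup>2 * (\<delta> + 1 / (ln (real N))\<^sup>2) * (1 / real a)" .
    qed
    also have "\<dots> = (real N)\<^sup>2 * (\<delta> + 1 / (ln (real N))\<^sup>2) * (\<Sum>a\<in>{1..N}. 1 / real a)" by (simp add: sum_distrib_left)
    also have "\<dots> \<le> (real N)\<^sup>2 * (\<delta> + 1 / (ln (real N))\<^sup>2) * (1 + ln (real N))"
      using \<delta>0 N by (intro mult_left_mono sum_reciprocal_le) auto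
    finally have "(\<Sum>r\<in>adm_ratios N - {(1, 1)}. (norm (T r))\<^sup>2) \<le> 2 * ((real N)\<^sup>2 * (\<delta> + 1 / (ln (real N))\<^sup>2) * (1 + ln (real N)))"
      by simp
    also have "\<dots> = (real N)\<^sup>2 * bound N" by (simp only: bound_def \<delta>_def mult.assoc mult.commute mult.left_commute)
    finally have "(\<Sum>r\<in>adm_ratios N - {(1, 1)}. (norm (T r))\<^sup>2) \<le> (real N)\<^sup>2 * bound N" .
    thus ?case unfolding T_def using N by (simp add: divide_le_eq mult.commute)
  qed
  moreover have lower: "\<forall>\<^sub>F N in sequentially. 0 \<le> off_diagonal N (\<lambda>n. unit_exp (poly g (real n)))"
    by (intro always_eventually allI divide_nonneg_nonneg sum_nonneg) auto
  ultimately show ?thesis using tendsto_sandwich[OF lower _ tendsto_const lim] by blast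
qed

section \<open>Fourth moments and density of admissible integers\<close>

text \<open>Termwise comparison with a telescoping series.\<close>
lemma inverse_square_telescope:
  assumes "n \<ge> 1"
  shows "1 / (real n)\<^sup>2 \<le> 2 / real n - 2 / (real n + 1)"
proof -
  have "1 / (real n)\<^sup>2 = 2 / (real n * (2 * real n))" by (simp add: power2_eq_square)
  also have "\<dots> \<le> 2 / (real n * (real n + 1))" using assms by (intro divide_left_mono mult_left_mono mult_pos_pos) auto
  also have "\<dots> = 2 / real n - 2 / (real n + 1)" using assms by (simp add: field_simps)
  finally show ?thesis .
qed

lemma sum_inverse_squares_le:
  assumes "m \<ge> 1"
  shows "(\<Sum>n\<in>{m..M}. 1 / (real n)\<^sup>2) \<le> 2 / real m"
proof -
  have "(\<Sum>n\<in>{m..M}. 1 / (real n)\<^sup>2) \<le> 2 / real m - 2 / (real M + 1)" if "m \<le> M"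
    using that
  proof (induction M rule: dec_induct)
    case base
    show ?case using inverse_square_telescope[OF assms] by simp
  next
    case (step k)
    have "1 / (real (Suc k))\<^sup>2 \<le> 2 / (real k + 1) - 2 / (real (Suc k) + 1)"
      using inverse_square_telescope[of "Suc k"] by (simp add: add.commute)
    thus ?case using step by simp
  qed
  moreover have "0 \<le> 2 / (real M + 1)" by simp
  ultimately show ?thesis by (cases "m \<le> M") (linarith, simp)
qed

text \<open>The energy of integers up to \<open>N / p\<close> is \<open>O((N * ln N / p)^2)\<close>, and the sum of
  \<open>1 / p^2\<close> over \<open>p \<ge> exp (cut N)\<close> beats every power of \<open>ln N\<close>.\<close>
lemma adm_energy_tendsto_0:
  "(\<lambda>N. (\<Sum>p\<le>N. mult_energy (adm N `` {p}) / (real N)\<^sup>2)) \<longlonglongrightarrow> 0"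
proof -
  let ?f = "\<lambda>N p. mult_energy (adm N `` {p}) / (real N)\<^sup>2"
  have "((\<lambda>x::real. (1 + ln x)\<^sup>2 * (2 / exp (ln x powr (3/4)))) \<longlongrightarrow> 0) at_top" by real_asymp
  hence lim: "(\<lambda>N. (1 + ln (real N))\<^sup>2 * (2 / exp (cut N))) \<longlonglongrightarrow> 0"
    unfolding cut_def by (rule filterlim_compose) (rule filterlim_real_sequentially)
  have "\<forall>\<^sub>F N in sequentially. ln (real N) \<ge> 2" by real_asymp
  hence "\<forall>\<^sub>F N in sequentially. (\<Sum>p\<le>N. ?f N p) \<le> (1 + ln (real N))\<^sup>2 * (2 / exp (cut N))"
  proof eventually_elim
    case (elim N)
    have N: "N \<ge> 1" using elim by (cases N) auto
    define m where "m = nat \<lceil>exp (cut N)\<rceil>"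
    have m: "exp (cut N) \<le> real m" unfolding m_def by linarith
    hence m1: "m \<ge> 1" using exp_gt_zero[of "cut N"] by (cases m) (auto simp: not_le)
    have "?f N p \<le> (if p \<in> {m..N} then (1 + ln (real N))\<^sup>2 * (1 / (real p)\<^sup>2) else 0)" if p: "p \<in> {..N}" for p
    proof (cases "adm N `` {p} = {}")
      case True
      show ?thesis unfolding True using N by simp
    next
      case False
      then obtain k where k: "(p, k) \<in> adm N" by blast
      have pk: "prime p" "k > 0" "p * k \<le> N" "(ln (real N))\<^sup>2 * cut N \<le> real (blk N p)" using k by (auto simp: adm_def)
      have p1: "p \<ge> 1" using pk(1) prime_ge_1_nat by blast
      have "0 < ln (real N)" using elim by linarith
      from cut_le_ln(2)[OF p1 pk(4) this] have pm: "p \<ge> m" unfolding m_def by (simp add: nat_le_iff ceiling_le_iff)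
      define Y where "Y = N div p"
      have "p * 1 \<le> p * k" using pk by (intro mult_le_mono) auto
      hence "p \<le> N" using pk(3) by linarith
      hence Y1: "Y \<ge> 1" using p1 by (simp add: Y_def less_eq_div_iff_mult_less_eq)
      have sub: "adm N `` {p} \<subseteq> {1..Y}"
        using p1 by (auto simp: adm_def Y_def less_eq_div_iff_mult_less_eq mult.commute Suc_le_eq)
      have YN: "real Y \<le> real N / real p" unfolding Y_def by (rule of_nat_div_le_of_nat)
      have "Y \<le> N" by (simp add: Y_def)
      hence lnY: "ln (real Y) \<le> ln (real N)" using Y1 by (subst ln_le_cancel_iff) auto
      have "real Y * (1 + ln (real Y)) \<le> (real N / real p) * (1 + ln (real N))"
        using YN lnY Y1 by (intro mult_mono) auto
      hence "(real Y * (1 + ln (real Y)))\<^sup>2 \<le> ((real N / real p) * (1 + ln (real N)))\<^sup>2"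
        using Y1 by (intro power_mono) auto
      with multiplicative_energy_le[OF sub Y1]
      have "?f N p \<le> ((real N / real p) * (1 + ln (real N)))\<^sup>2 / (real N)\<^sup>2" by (intro divide_right_mono) auto
      also have "\<dots> = (1 + ln (real N))\<^sup>2 * (1 / (real p)\<^sup>2)" using N by (simp add: power_mult_distrib power_divide)
      finally show ?thesis using pm p by simp
    qed
    hence "(\<Sum>p\<le>N. ?f N p) \<le> (\<Sum>p\<le>N. if p \<in> {m..N} then (1 + ln (real N))\<^sup>2 * (1 / (real p)\<^sup>2) else 0)" by (rule sum_mono)
    also have "\<dots> = (\<Sum>p\<in>{m..N}. (1 + ln (real N))\<^sup>2 * (1 / (real p)\<^sup>2))"
      by (rule sum.mono_neutral_cong_right) auto
    also have "\<dots> = (1 + ln (real N))\<^sup>2 * (\<Sum>p\<in>{m..N}. 1 / (real p)\<^sup>2)" by (simp add: sum_distrib_left)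
    also have "\<dots> \<le> (1 + ln (real N))\<^sup>2 * (2 / real m)" by (intro mult_left_mono sum_inverse_squares_le m1) auto
    also have "\<dots> \<le> (1 + ln (real N))\<^sup>2 * (2 / exp (cut N))" using m m1 by (intro mult_left_mono divide_left_mono mult_pos_pos) auto
    finally show ?case .
  qed
  moreover have lower: "\<forall>\<^sub>F N in sequentially. 0 \<le> (\<Sum>p\<le>N. ?f N p)"
    by (intro always_eventually allI sum_nonneg divide_nonneg_nonneg) auto
  ultimately show ?thesis using tendsto_sandwich[OF lower _ tendsto_const lim] by blast
qed

lemma inj_on_adm: "inj_on (\<lambda>(p, m). p * m) (adm N)"
proof (rule inj_onI)
  fix x y assume xy: "x \<in> adm N" "y \<in> adm N" "(case x of (p, h) \<Rightarrow> p * h) = (case y of (p, h) \<Rightarrow> p * h)"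
  obtain p h p' h' where e: "x = (p, h)" "y = (p', h')" by (metis prod.collapse)
  have "p = p' \<and> h = h'"
    by (rule block_prime_unique[of _ _ _ _ N]) (use xy in \<open>simp_all add: e adm_def\<close>)
  thus "x = y" by (simp add: e)
qed

lemma adm_image_subset: "(\<lambda>(p, m). p * m) ` adm N \<subseteq> {1..N}"
  by (auto simp: adm_def Suc_le_eq dest: prime_gt_0_nat)

text \<open>If the largest prime factor is large enough but not alone in its block, the cofactor has a prime factor
  \<open>r\<close> in the same block, and two numbers of the same block differ by a factor of at most \<open>1 +
  2 / (ln N)^2\<close>.\<close>
lemma not_adm_cases:
  assumes n: "n \<in> {1..N}" "n \<notin> (\<lambda>(p, m). p * m) ` adm N" and l: "ln (real N) \<ge> 2"
  shows "(\<forall>p\<in>prime_factors n. real p \<le> 3 * exp (cut N)) \<or>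
    (\<exists>r p. exp (cut N) \<le> real r \<and> r \<le> p \<and> real p \<le> (1 + 2 / (ln (real N))\<^sup>2) * real r \<and> r * p dvd n)"
proof (cases "prime_factors n = {}")
  case False
  define K where "K = (ln (real N))\<^sup>2"
  have K: "K \<ge> 1" using l by (simp add: K_def one_le_power)
  have K0: "K > 0" using K by linarith
  have l0: "ln (real N) > 0" using l by linarith
  define p where "p = Max (prime_factors n)"
  have p: "p \<in> prime_factors n" unfolding p_def using False by (intro Max_in) auto
  have pmax: "r \<le> p" if "r \<in> prime_factors n" for r unfolding p_def using that by (intro Max_ge) auto
  have pp: "prime p" "p dvd n" "p \<ge> 1" using p by (auto simp: in_prime_factors_iff Suc_le_eq dest: prime_gt_0_nat)
  define m where "m = n div p"
  have nm: "n = p * m" using pp by (simp add: m_def)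
  have m0: "m > 0" using n nm by (cases m) auto
  show ?thesis
  proof (cases "K * cut N \<le> real (blk N p)")
    case False
    have "K * ln (real p) < real (blk N p) + 1" using blk_bounds(2)[OF pp(3), of N] by (simp add: K_def)
    also have "\<dots> < K * cut N + K" using False K by linarith
    finally have "K * ln (real p) < K * (cut N + 1)" by (simp add: distrib_left)
    hence "ln (real p) < cut N + 1" using K0 by simp
    hence "exp (ln (real p)) < exp (cut N + 1)" by simp
    hence "real p < exp (cut N + 1)" using pp(3) by simp
    also have "\<dots> = exp (cut N) * exp 1" by (rule exp_add)
    also have "\<dots> \<le> exp (cut N) * 3" using exp_le by (intro mult_left_mono) auto
    finally have p3: "real p \<le> 3 * exp (cut N)" by simp
    have "\<forall>r\<in>prime_factors n. real r \<le> 3 * exp (cut N)"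
    proof
      fix r assume "r \<in> prime_factors n"
      hence "real r \<le> real p" using pmax by simp
      thus "real r \<le> 3 * exp (cut N)" using p3 by linarith
    qed
    thus ?thesis ..
  next
    case True
    have "(p, m) \<notin> adm N" using n(2) nm by force
    hence "\<exists>r\<in>prime_factors m. \<not> blk N r < blk N p"
      using pp(1) m0 n(1) nm True by (auto simp: adm_def K_def)
    then obtain r where r: "r \<in> prime_factors m" "blk N p \<le> blk N r" by (auto simp: not_less)
    have rr: "prime r" "r dvd m" "r \<ge> 1" using r by (auto simp: in_prime_factors_iff Suc_le_eq dest: prime_gt_0_nat)
    have "r \<in> prime_factors n" using r(1) n(1) nm m0 by (auto simp: in_prime_factors_iff)
    hence rp: "r \<le> p" by (rule pmax)
    have rcut: "exp (cut N) \<le> real r"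
      by (rule cut_le_ln(2)[OF rr(3) _ l0]) (use True r(2) in \<open>simp add: K_def\<close>)
    have "K * ln (real p) < real (blk N p) + 1" using blk_bounds(2)[OF pp(3), of N] by (simp add: K_def)
    also have "\<dots> \<le> K * ln (real r) + 1" using r(2) blk_bounds(1)[OF rr(3), of N] by (simp add: K_def)
    finally have "K * (ln (real p) - ln (real r)) < 1" by (simp add: right_diff_distrib)
    hence "ln (real p) < ln (real r) + 1 / K" using K0 by (simp add: field_simps)
    hence "exp (ln (real p)) < exp (ln (real r) + 1 / K)" by simp
    hence "real p < real r * exp (1 / K)" using pp(3) rr(3) by (simp add: exp_add)
    also have "exp (1 / K) \<le> 1 + 2 / K"
    proof -
      have "1 / K \<le> 1 / 1" using K by (intro divide_left_mono) auto
      hence "exp (1 / K) \<le> 1 + 1 / K + (1 / K)\<^sup>2" using K0 by (intro exp_bound) auto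
      also have "(1 / K)\<^sup>2 \<le> 1 / K"
        unfolding power2_eq_square using mult_left_mono[of "1 / K" 1 "1 / K"] \<open>1 / K \<le> 1 / 1\<close> K0 by simp
      finally show ?thesis by simp
    qed
    hence "real r * exp (1 / K) \<le> (1 + 2 / K) * real r" by (simp add: mult.commute mult_left_mono)
    finally have "real p \<le> (1 + 2 / K) * real r" by simp
    moreover have "r * p dvd n" unfolding nm using rr(2) by (simp add: mult.commute)
    ultimately show ?thesis using rcut rp unfolding K_def by blast
  qed
qed simp

text \<open>By \<open>not_adm_cases\<close> the exceptions are smooth numbers, few by \<open>smooth_count\<close>, or
  multiples of some \<open>r * p\<close> with \<open>p\<close> close to \<open>r\<close>.  The latter number at
  most the sum over \<open>r \<ge> exp (cut N)\<close> of \<open>N / r^2 * (2 * r / (ln N)^2 + 1)\<close>, which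
  is \<open>O(N / ln N)\<close>.\<close>
lemma adm_density: "(\<lambda>N. real (card (adm N)) / real N) \<longlonglongrightarrow> 1"
proof -
  define bound where "bound = (\<lambda>N. (sqrt (real N) + 4 * real N * (2 + cut N + ln 4) / ln (real N)) / real N
       + 2 * (1 + ln (real N)) / (ln (real N))\<^sup>2 + 2 / exp (cut N))"
  have "((\<lambda>x::real. (sqrt x + 4 * x * (2 + ln x powr (3/4) + ln 4) / ln x) / x
       + 2 * (1 + ln x) / (ln x)\<^sup>2 + 2 / exp (ln x powr (3/4))) \<longlongrightarrow> 0) at_top" by real_asymp
  hence "bound \<longlonglongrightarrow> 0"
    unfolding bound_def cut_def by (rule filterlim_compose) (rule filterlim_real_sequentially)
  hence lim: "(\<lambda>N. 1 - bound N) \<longlonglongrightarrow> 1 - 0" by (intro tendsto_intros)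
  have "\<forall>\<^sub>F N in sequentially. ln (real N) \<ge> 2" by real_asymp
  hence "\<forall>\<^sub>F N in sequentially. 1 - bound N \<le> real (card (adm N)) / real N"
  proof eventually_elim
    case (elim N)
    have N2: "N \<ge> 2" using elim by (cases "N < 2") (auto simp: less_2_cases_iff)
    define K where "K = (ln (real N))\<^sup>2"
    have K0: "K > 0" using elim by (simp add: K_def)
    define m where "m = nat \<lceil>exp (cut N)\<rceil>"
    have m: "exp (cut N) \<le> real m" unfolding m_def by linarith
    hence m1: "m \<ge> 1" using exp_gt_zero[of "cut N"] by (cases m) (auto simp: not_le)
    define z where "z = nat \<lfloor>3 * exp (cut N)\<rfloor>"
    have cut0: "cut N \<ge> 0" by (simp add: cut_def)
    have "1 \<le> exp (cut N)" using cut0 by simp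
    hence z: "z \<ge> 1" "real z \<le> 3 * exp (cut N)" unfolding z_def by linarith+
    have lnz: "ln (real z) \<le> 2 + cut N"
    proof -
      have "ln (real z) \<le> ln (3 * exp (cut N))" using z by (subst ln_le_cancel_iff) auto
      also have "\<dots> = ln 3 + cut N" by (simp add: ln_mult)
      also have "ln (3::real) \<le> 2" using ln_le_minus_one[of "3::real"] by simp
      finally show ?thesis by simp
    qed
    define A where "A = (\<lambda>(p, m). p * m) ` adm N"
    define S where "S = {n\<in>{1..N}. \<forall>p\<in>prime_factors n. p \<le> z}"
    (* Candidates for the larger of two primes in one block, when the smaller one is r. *)
    define I where "I = (\<lambda>r. {p. r \<le> p \<and> real p \<le> (1 + 2 / K) * real r})"
    define B where "B = (\<Union>r\<in>{m..N}. \<Union>p\<in>I r. {n\<in>{1..N}. r * p dvd n})"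
    have finI: "finite (I r)" for r
      by (rule finite_subset[of _ "{..nat \<lfloor>(1 + 2 / K) * real r\<rfloor>}"]) (auto simp: I_def le_nat_floor)
    have cI: "real (card (I r)) \<le> 2 * real r / K + 1" for r
    proof -
      have "I r \<subseteq> {r..nat \<lfloor>(1 + 2 / K) * real r\<rfloor>}" by (auto simp: I_def le_nat_floor)
      hence "card (I r) \<le> card {r..nat \<lfloor>(1 + 2 / K) * real r\<rfloor>}" by (rule card_mono[rotated]) simp
      hence c: "real (card (I r)) \<le> real (Suc (nat \<lfloor>(1 + 2 / K) * real r\<rfloor>) - r)" by simp
      have "0 \<le> 2 * real r / K" using K0 by simp
      moreover have "(1 + 2 / K) * real r = real r + 2 * real r / K" by (simp add: distrib_right)
      ultimately have "real (Suc (nat \<lfloor>(1 + 2 / K) * real r\<rfloor>) - r) \<le> 2 * real r / K + 1" by linarith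
      thus ?thesis using c by linarith
    qed
    have "{1..N} - A \<subseteq> S \<union> B"
    proof
      fix n assume n: "n \<in> {1..N} - A"
      hence "n \<in> {1..N}" "n \<notin> (\<lambda>(p, m). p * m) ` adm N" by (auto simp: A_def)
      from not_adm_cases[OF this elim] show "n \<in> S \<union> B"
      proof
        assume "\<forall>p\<in>prime_factors n. real p \<le> 3 * exp (cut N)"
        hence "n \<in> S" using n by (auto simp: S_def z_def le_nat_floor)
        thus ?thesis ..
      next
        assume "\<exists>r p. exp (cut N) \<le> real r \<and> r \<le> p \<and> real p \<le> (1 + 2 / (ln (real N))\<^sup>2) * real r \<and> r * p dvd n"
        then obtain r p where rp: "exp (cut N) \<le> real r" "r \<le> p" "real p \<le> (1 + 2 / K) * real r" "r * p dvd n" by (auto simp: K_def)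
        have "m \<le> r" using rp(1) by (simp add: m_def nat_le_iff ceiling_le_iff)
        moreover have "r \<le> N"
        proof -
          have "r dvd n" using rp(4) by (rule dvd_mult_left)
          thus ?thesis using n dvd_imp_le[of r n] by force
        qed
        moreover have "p \<in> I r" using rp by (simp add: I_def)
        ultimately have "n \<in> B" using rp(4) n unfolding B_def by auto
        thus ?thesis ..
      qed
    qed
    hence "card ({1..N} - A) \<le> card (S \<union> B)" by (rule card_mono[rotated]) (auto simp: S_def B_def finI)
    also have "\<dots> \<le> card S + card B" by (rule card_Un_le)
    also have "card ({1..N} - A) = N - card (adm N)"
      using adm_image_subset[of N] card_image[OF inj_on_adm[of N]] finite_adm[of N]
      by (simp add: A_def card_Diff_subset)
    finally have "real N - real (card (adm N)) \<le> real (card S) + real (card B)" by linarith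
    moreover have "real (card S) \<le> sqrt (real N) + 4 * real N * (2 + cut N + ln 4) / ln (real N)"
    proof -
      have "real (card S) \<le> sqrt (real N) + 4 * real N * (ln (real z) + ln 4) / ln (real N)"
        unfolding S_def by (rule smooth_count[OF N2 z(1)])
      also have "\<dots> \<le> sqrt (real N) + 4 * real N * (2 + cut N + ln 4) / ln (real N)"
        using lnz elim by (intro add_left_mono divide_right_mono mult_left_mono) auto
      finally show ?thesis .
    qed
    moreover have "real (card B) \<le> real N * (2 * (1 + ln (real N)) / K + 2 / exp (cut N))"
    proof -
      have "card B \<le> (\<Sum>r\<in>{m..N}. card (\<Union>p\<in>I r. {n\<in>{1..N}. r * p dvd n}))" unfolding B_def by (rule card_UN_le) simp
      also have "\<dots> \<le> (\<Sum>r\<in>{m..N}. \<Sum>p\<in>I r. card {n\<in>{1..N}. r * p dvd n})" by (intro sum_mono card_UN_le finI)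
      finally have "real (card B) \<le> (\<Sum>r\<in>{m..N}. \<Sum>p\<in>I r. real (card {n\<in>{1..N}. r * p dvd n}))" by (simp flip: of_nat_sum)
      also have "\<dots> \<le> (\<Sum>r\<in>{m..N}. \<Sum>p\<in>I r. real N / (real r)\<^sup>2)"
      proof (intro sum_mono)
        fix r p assume r: "r \<in> {m..N}" and p: "p \<in> I r"
        have r1: "r \<ge> 1" "r \<le> p" using r p m1 by (auto simp: I_def)
        hence rp: "r * r \<le> r * p" "1 \<le> r * p" by (auto simp: Suc_le_eq)
        have "real (card {n\<in>{1..N}. r * p dvd n}) \<le> real N / real (r * p)" by (rule card_multiples_le[OF rp(2)])
        also have "\<dots> \<le> real N / (real r)\<^sup>2"
        proof (rule divide_left_mono)
          have "real (r * r) \<le> real (r * p)" using rp(1) by (simp only: of_nat_le_iff)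
          thus "(real r)\<^sup>2 \<le> real (r * p)" by (simp add: power2_eq_square)
        qed (use r1 in auto)
        finally show "real (card {n\<in>{1..N}. r * p dvd n}) \<le> real N / (real r)\<^sup>2" .
      qed
      also have "\<dots> = (\<Sum>r\<in>{m..N}. real (card (I r)) * (real N / (real r)\<^sup>2))" by simp
      also have "\<dots> \<le> (\<Sum>r\<in>{m..N}. (2 * real r / K + 1) * (real N / (real r)\<^sup>2))"
        by (intro sum_mono mult_right_mono cI) auto
      also have "\<dots> = (\<Sum>r\<in>{m..N}. real N * (2 / K) * (1 / real r) + real N * (1 / (real r)\<^sup>2))"
        using m1 by (intro sum.cong refl) (simp add: field_simps power2_eq_square)
      also have "\<dots> = real N * (2 / K) * (\<Sum>r\<in>{m..N}. 1 / real r) + real N * (\<Sum>r\<in>{m..N}. 1 / (real r)\<^sup>2)"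
        by (simp add: sum.distrib sum_distrib_left)
      also have "\<dots> \<le> real N * (2 / K) * (1 + ln (real N)) + real N * (2 / exp (cut N))"
      proof (intro add_mono mult_left_mono)
        have "(\<Sum>r\<in>{m..N}. 1 / real r) \<le> (\<Sum>r\<in>{1..N}. 1 / real r)" using m1 by (intro sum_mono2) auto
        also have "\<dots> \<le> 1 + ln (real N)" using N2 by (intro sum_reciprocal_le) auto
        finally show "(\<Sum>r\<in>{m..N}. 1 / real r) \<le> 1 + ln (real N)" .
        have "(\<Sum>r\<in>{m..N}. 1 / (real r)\<^sup>2) \<le> 2 / real m" by (rule sum_inverse_squares_le[OF m1])
        also have "\<dots> \<le> 2 / exp (cut N)" using m m1 by (intro divide_left_mono mult_pos_pos) auto
        finally show "(\<Sum>r\<in>{m..N}. 1 / (real r)\<^sup>2) \<le> 2 / exp (cut N)" .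
      qed (use K0 in auto)
      also have "\<dots> = real N * (2 * (1 + ln (real N)) / K + 2 / exp (cut N))" by (simp add: algebra_simps add_divide_distrib)
      finally show ?thesis .
    qed
    ultimately have "real N - real (card (adm N)) \<le> (sqrt (real N) + 4 * real N * (2 + cut N + ln 4) / ln (real N))
        + real N * (2 * (1 + ln (real N)) / K + 2 / exp (cut N))" by linarith
    also have "\<dots> = real N * bound N"
    proof -
      define W where "W = sqrt (real N) + 4 * real N * (2 + cut N + ln 4) / ln (real N)"
      have "real N * (W / real N) = W" using N2 by simp
      thus ?thesis unfolding bound_def K_def W_def[symmetric] distrib_left[of "real N"] by linarith
    qed
    finally have "real N * (1 - bound N) \<le> real (card (adm N))" by (simp add: right_diff_distrib)
    thus ?case using N2 by (simp add: pos_le_divide_eq mult.commute)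
  qed
  moreover have "\<forall>\<^sub>F N in sequentially. real (card (adm N)) / real N \<le> 1"
  proof (rule always_eventually, rule allI)
    fix N
    have "card (adm N) = card ((\<lambda>(p, m). p * m) ` adm N)" using card_image[OF inj_on_adm[of N]] by simp
    also have "\<dots> \<le> card {1..N}" by (rule card_mono[OF _ adm_image_subset]) simp
    finally show "real (card (adm N)) / real N \<le> 1" by (cases "N = 0") auto
  qed
  ultimately show ?thesis using tendsto_sandwich[of "\<lambda>N. 1 - bound N" "\<lambda>N. real (card (adm N)) / real N" sequentially "\<lambda>_. 1" 1] lim
    by simp
qed

section \<open>Characteristic functions of the sums\<close>

context steinhaus_phases
begin

lemma coefficient_bounded_past: "bounded_past p (coefficient N (adm N) c p)"
proof -
  have fin: "finite (adm N `` {p})" using finite_adm by (rule finite_Image)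
  have "bounded_past p (\<lambda>\<omega>. \<Sum>m\<in>S. c (p * m) * chi m \<omega>)" if "S \<subseteq> adm N `` {p}" for S
  proof -
    have "finite S" using that fin by (rule finite_subset)
    thus ?thesis using that
    proof (induction S)
      case empty
      show ?case by (simp add: bounded_past_const)
    next
      case (insert m S)
      have "bounded_past p (chi m)"
        using insert.prems adm_prime_largest[of p m N] by (intro chi_bounded_past) auto
      hence "bounded_past p (\<lambda>\<omega>. c (p * m) * chi m \<omega>)" by (intro bounded_past_mult bounded_past_const)
      from bounded_past_add[OF this insert.IH] insert show ?case by simp
    qed
  qed
  hence "bounded_past p (\<lambda>\<omega>. \<Sum>m\<in>adm N `` {p}. c (p * m) * chi m \<omega>)" by blast
  thus ?thesis unfolding coefficient_def by (intro bounded_past_mult bounded_past_const)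
qed

lemma coefficient_not_prime: "\<not> prime p \<Longrightarrow> coefficient N (adm N) c p \<omega> = 0"
proof -
  assume "\<not> prime p"
  hence "adm N `` {p} = {}" by (auto simp: adm_def)
  thus ?thesis by (simp add: coefficient_def)
qed

definition chi_sum :: "(nat \<Rightarrow> complex) \<Rightarrow> nat \<Rightarrow> 'a \<Rightarrow> complex" where
  "chi_sum c N \<omega> = (\<Sum>n\<in>{1..N}. (c n / of_real (sqrt (real N))) * chi n \<omega>)"

text \<open>The terms from admissible \<open>n = p * m\<close>, arranged by the prime \<open>p\<close>.\<close>
definition martingale_part :: "(nat \<Rightarrow> complex) \<Rightarrow> nat \<Rightarrow> 'a \<Rightarrow> complex" where
  "martingale_part c N \<omega> = (\<Sum>p<Suc N. coefficient N (adm N) c p \<omega> * X p \<omega>)"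

lemma martingale_part_eq:
  "martingale_part c N \<omega> = (\<Sum>n\<in>(\<lambda>(p, m). p * m) ` adm N. (c n / of_real (sqrt (real N))) * chi n \<omega>)"
proof -
  have pN: "p < Suc N" if "(p, m) \<in> adm N" for p m
  proof -
    have "p * 1 \<le> p * m" using that by (intro mult_le_mono) (auto simp: adm_def)
    also have "\<dots> \<le> N" using that by (simp add: adm_def)
    finally show ?thesis by simp
  qed
  have fin: "finite (adm N `` {p})" for p using finite_adm by (rule finite_Image)
  have "martingale_part c N \<omega> = (\<Sum>p<Suc N. \<Sum>m\<in>adm N `` {p}. (c (p * m) / of_real (sqrt (real N))) * chi (p * m) \<omega>)"
    unfolding martingale_part_def
  proof (rule sum.cong[OF refl])
    fix p
    have "coefficient N (adm N) c p \<omega> * X p \<omega> = (\<Sum>m\<in>adm N `` {p}. (c (p * m) / of_real (sqrt (real N))) * (X p \<omega> * chi m \<omega>))"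
      unfolding coefficient_def sum_distrib_left sum_distrib_right by (intro sum.cong refl) (simp add: mult_ac)
    also have "\<dots> = (\<Sum>m\<in>adm N `` {p}. (c (p * m) / of_real (sqrt (real N))) * chi (p * m) \<omega>)"
    proof (rule sum.cong[OF refl])
      fix m assume "m \<in> adm N `` {p}"
      hence "prime p" "m > 0" by (auto simp: adm_def)
      thus "(c (p * m) / of_real (sqrt (real N))) * (X p \<omega> * chi m \<omega>) = (c (p * m) / of_real (sqrt (real N))) * chi (p * m) \<omega>"
        using chi_mult[OF prime_gt_0_nat, of p m \<omega>] chi_prime[of p \<omega>] by simp
    qed
    finally show "coefficient N (adm N) c p \<omega> * X p \<omega> = (\<Sum>m\<in>adm N `` {p}. (c (p * m) / of_real (sqrt (real N))) * chi (p * m) \<omega>)" .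
  qed
  also have "\<dots> = (\<Sum>(p, m)\<in>(SIGMA p:{..<Suc N}. adm N `` {p}). (c (p * m) / of_real (sqrt (real N))) * chi (p * m) \<omega>)"
    by (rule sum.Sigma) (use fin in auto)
  also have "(SIGMA p:{..<Suc N}. adm N `` {p}) = adm N" using pN by auto
  also have "(\<Sum>(p, m)\<in>adm N. (c (p * m) / of_real (sqrt (real N))) * chi (p * m) \<omega>)
      = (\<Sum>n\<in>(\<lambda>(p, m). p * m) ` adm N. (c n / of_real (sqrt (real N))) * chi n \<omega>)"
    by (subst sum.reindex[OF inj_on_adm]) (auto intro!: sum.cong)
  finally show ?thesis .
qed

lemma chi_sum_square:
  assumes S: "finite S" "\<And>n. n \<in> S \<Longrightarrow> n > 0" and c: "\<And>n. norm (c n) = 1"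
  shows "integrable M (\<lambda>\<omega>. (norm (\<Sum>n\<in>S. (c n / of_real (sqrt (real N))) * chi n \<omega>))\<^sup>2)"
    "expectation (\<lambda>\<omega>. (norm (\<Sum>n\<in>S. (c n / of_real (sqrt (real N))) * chi n \<omega>))\<^sup>2) = real (card S) / real N"
proof -
  note os = expectation_square_orthonormal[where d = "\<lambda>n. c n / of_real (sqrt (real N))", OF S(1) chi_measurable norm_chi chi_orthogonal]
  show "integrable M (\<lambda>\<omega>. (norm (\<Sum>n\<in>S. (c n / of_real (sqrt (real N))) * chi n \<omega>))\<^sup>2)" by (rule os(1)) (use S in auto)
  have "expectation (\<lambda>\<omega>. (norm (\<Sum>n\<in>S. (c n / of_real (sqrt (real N))) * chi n \<omega>))\<^sup>2) = (\<Sum>n\<in>S. (norm (c n / of_real (sqrt (real N))))\<^sup>2)"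
    by (rule os(2)) (use S in auto)
  also have "\<dots> = real (card S) / real N" using c by (simp add: norm_divide power_divide)
  finally show "expectation (\<lambda>\<omega>. (norm (\<Sum>n\<in>S. (c n / of_real (sqrt (real N))) * chi n \<omega>))\<^sup>2) = real (card S) / real N" .
qed

lemma chi_combination_measurable: "(\<lambda>\<omega>. \<Sum>n\<in>S. b n * chi n \<omega>) \<in> borel_measurable M"
  by (intro borel_measurable_sum borel_measurable_times chi_measurable) auto

lemma chi_combination_integrable:
  shows "integrable M (\<lambda>\<omega>. norm (\<Sum>n\<in>S. b n * chi n \<omega>))"
proof (rule bounded_integrable)
  show "(\<lambda>\<omega>. norm (\<Sum>n\<in>S. b n * chi n \<omega>)) \<in> borel_measurable M" by (intro norm_measurable chi_combination_measurable)
  show "norm (norm (\<Sum>n\<in>S. b n * chi n \<omega>)) \<le> (\<Sum>n\<in>S. norm (b n))" for \<omega>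
    unfolding real_norm_def abs_norm_cancel by (rule sum_norm_le) (simp add: norm_mult)
qed

text \<open>The difference of the two sums has mean square \<open>1 - card (adm N) / N\<close>, and \<open>cis\<close> has
  Lipschitz constant 1.\<close>
lemma char_chi_sum_close:
  assumes c: "\<And>n. norm (c n) = 1" and N: "N > 0"
  shows "norm (expectation (\<lambda>\<omega>. cis (\<xi> \<bullet> chi_sum c N \<omega>)) - expectation (\<lambda>\<omega>. cis (\<xi> \<bullet> martingale_part c N \<omega>)))
    \<le> norm \<xi> * sqrt (1 - real (card (adm N)) / real N)"
proof -
  let ?b = "\<lambda>n. c n / of_real (sqrt (real N))"
  let ?A = "(\<lambda>(p, m). p * m) ` adm N"
  define U where "U = (\<lambda>\<omega>. \<Sum>n\<in>{1..N} - ?A. ?b n * chi n \<omega>)"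
  have diff: "chi_sum c N \<omega> - martingale_part c N \<omega> = U \<omega>" for \<omega>
    unfolding chi_sum_def martingale_part_eq U_def
    using sum.subset_diff[OF adm_image_subset[of N], of "\<lambda>n. ?b n * chi n \<omega>"] by simp
  have card: "real (card ({1..N} - ?A)) = real N - real (card (adm N))"
  proof -
    have cA: "card ?A = card (adm N)" by (rule card_image[OF inj_on_adm])
    have "card ?A \<le> card {1..N}" by (rule card_mono[OF _ adm_image_subset]) simp
    hence le: "card (adm N) \<le> N" by (simp add: cA)
    have "card ({1..N} - ?A) = N - card (adm N)"
      using card_Diff_subset[OF _ adm_image_subset[of N]] finite_adm cA by simp
    thus ?thesis using le by (simp add: of_nat_diff)
  qed
  have Uint: "integrable M (\<lambda>\<omega>. norm (U \<omega>))" "integrable M (\<lambda>\<omega>. (norm (U \<omega>))\<^sup>2)"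
    unfolding U_def by (rule chi_combination_integrable, rule chi_sum_square(1)) (auto simp: c)
  have U2: "expectation (\<lambda>\<omega>. (norm (U \<omega>))\<^sup>2) = 1 - real (card (adm N)) / real N"
  proof -
    have "expectation (\<lambda>\<omega>. (norm (U \<omega>))\<^sup>2) = real (card ({1..N} - ?A)) / real N"
      unfolding U_def by (rule chi_sum_square(2)) (auto simp: c)
    thus ?thesis unfolding card using N by (simp add: diff_divide_distrib)
  qed
  have ci: "integrable M (\<lambda>\<omega>. cis (\<xi> \<bullet> (\<Sum>n\<in>S. b n * chi n \<omega>)))" for S b
  proof (rule bounded_integrable[of _ 1])
    show "(\<lambda>\<omega>. cis (\<xi> \<bullet> (\<Sum>n\<in>S. b n * chi n \<omega>))) \<in> borel_measurable M"
      by (rule borel_measurable_continuous_on[OF _ chi_combination_measurable]) (intro continuous_intros)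
  qed simp
  have i1: "integrable M (\<lambda>\<omega>. cis (\<xi> \<bullet> chi_sum c N \<omega>))" unfolding chi_sum_def by (rule ci)
  have i2: "integrable M (\<lambda>\<omega>. cis (\<xi> \<bullet> martingale_part c N \<omega>))" unfolding martingale_part_eq by (rule ci)
  have "expectation (\<lambda>\<omega>. cis (\<xi> \<bullet> chi_sum c N \<omega>)) - expectation (\<lambda>\<omega>. cis (\<xi> \<bullet> martingale_part c N \<omega>))
     = expectation (\<lambda>\<omega>. cis (\<xi> \<bullet> chi_sum c N \<omega>) - cis (\<xi> \<bullet> martingale_part c N \<omega>))"
    by (rule Bochner_Integration.integral_diff[symmetric, OF i1 i2])
  also have "norm \<dots> \<le> expectation (\<lambda>\<omega>. norm (cis (\<xi> \<bullet> chi_sum c N \<omega>) - cis (\<xi> \<bullet> martingale_part c N \<omega>)))"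
    by (rule integral_norm_bound)
  also have "\<dots> \<le> expectation (\<lambda>\<omega>. norm \<xi> * norm (U \<omega>))"
  proof (rule integral_mono)
    show "integrable M (\<lambda>\<omega>. norm (cis (\<xi> \<bullet> chi_sum c N \<omega>) - cis (\<xi> \<bullet> martingale_part c N \<omega>)))"
      by (intro integrable_norm Bochner_Integration.integrable_diff i1 i2)
    show "integrable M (\<lambda>\<omega>. norm \<xi> * norm (U \<omega>))" using Uint by simp
    fix \<omega>
    have "norm (cis (\<xi> \<bullet> chi_sum c N \<omega>) - cis (\<xi> \<bullet> martingale_part c N \<omega>)) \<le> \<bar>\<xi> \<bullet> (chi_sum c N \<omega> - martingale_part c N \<omega>)\<bar>"
      unfolding inner_diff_right by (rule norm_cis_diff_le)
    also have "\<dots> \<le> norm \<xi> * norm (U \<omega>)" unfolding diff by (rule Cauchy_Schwarz_ineq2)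
    finally show "norm (cis (\<xi> \<bullet> chi_sum c N \<omega>) - cis (\<xi> \<bullet> martingale_part c N \<omega>)) \<le> norm \<xi> * norm (U \<omega>)" .
  qed
  also have "\<dots> = norm \<xi> * expectation (\<lambda>\<omega>. \<bar>norm (U \<omega>)\<bar>)" by simp
  also have "\<dots> \<le> norm \<xi> * sqrt (expectation (\<lambda>\<omega>. (norm (U \<omega>))\<^sup>2))"
    by (intro mult_left_mono expectation_abs_le_sqrt Uint) auto
  finally show ?thesis unfolding U2 .
qed

lemma char_martingale_part_tendsto:
  fixes c :: "nat \<Rightarrow> complex"
  assumes c: "\<And>n. norm (c n) = 1"
    and off: "(\<lambda>N. off_diagonal N c) \<longlonglongrightarrow> 0"
  shows "(\<lambda>N. expectation (\<lambda>\<omega>. cis (\<xi> \<bullet> martingale_part c N \<omega>))) \<longlonglongrightarrow> of_real (exp (- (norm \<xi>)\<^sup>2 / 4))"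
proof -
  define a where "a = (norm \<xi>)\<^sup>2"
  define K where "K = (2 + a)\<^sup>2 * exp a"
  define A where "A = (\<lambda>N. coefficient N (adm N) c)"
  define V where "V = (\<lambda>N \<omega>. \<Sum>p<Suc N. (norm (A N p \<omega>))\<^sup>2)"
  define dev where "dev = (\<lambda>N. off_diagonal N c + (real (card (adm N)) / real N - 1)\<^sup>2)"
  define en where "en = (\<lambda>N. (\<Sum>p\<le>N. mult_energy (adm N `` {p}) / (real N)\<^sup>2))"
  have "(\<lambda>N. (real (card (adm N)) / real N - 1)\<^sup>2) \<longlonglongrightarrow> (1 - 1)\<^sup>2" by (intro tendsto_intros adm_density)
  hence dev0: "dev \<longlonglongrightarrow> 0" unfolding dev_def using tendsto_add[OF off] by fastforce
  have en0: "en \<longlonglongrightarrow> 0" unfolding en_def by (rule adm_energy_tendsto_0)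
  have Ab: "bounded_past p (A N p)" for N p unfolding A_def by (rule coefficient_bounded_past)
  have Vi: "integrable M (\<lambda>\<omega>. V N \<omega> - 1)" "integrable M (\<lambda>\<omega>. (V N \<omega> - 1)\<^sup>2)" for N
  proof -
    have "bounded_past (Suc N) (\<lambda>\<omega>. \<Sum>p<n. A N p \<omega> * cnj (A N p \<omega>))" if "n \<le> Suc N" for n
      using that
    proof (induction n)
      case (Suc n)
      have "bounded_past (Suc N) (A N n)" using bounded_past_mono[OF _ Ab] Suc.prems by simp
      hence "bounded_past (Suc N) (\<lambda>\<omega>. A N n \<omega> * cnj (A N n \<omega>))" by (intro bounded_past_mult bounded_past_cnj)
      from bounded_past_add[OF Suc.IH this] Suc.prems show ?case by simp
    qed (simp add: bounded_past_const)
    from this[of "Suc N"] have "bounded_past (Suc N) (\<lambda>\<omega>. (\<Sum>p<Suc N. A N p \<omega> * cnj (A N p \<omega>)) + (-1))"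
      by (intro bounded_past_add bounded_past_const) simp
    moreover have "complex_of_real (V N \<omega> - 1) = (\<Sum>p<Suc N. A N p \<omega> * cnj (A N p \<omega>)) + (-1)" for \<omega>
      unfolding V_def of_real_diff of_real_sum complex_norm_square by simp
    ultimately have b: "bounded_past (Suc N) (\<lambda>\<omega>. complex_of_real (V N \<omega> - 1))" by (simp only:)
    have "integrable M (\<lambda>\<omega>. Re (complex_of_real (V N \<omega> - 1)))" by (intro integrable_Re bounded_past_integrable[OF b])
    thus "integrable M (\<lambda>\<omega>. V N \<omega> - 1)" by simp
    have "integrable M (\<lambda>\<omega>. Re (complex_of_real (V N \<omega> - 1) ^ 2))"
      by (intro integrable_Re bounded_past_integrable[OF bounded_past_power[OF b]])
    thus "integrable M (\<lambda>\<omega>. (V N \<omega> - 1)\<^sup>2)" unfolding of_real_power[symmetric] Re_complex_of_real .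
  qed
  have main: "norm (expectation (\<lambda>\<omega>. cis (\<xi> \<bullet> martingale_part c N \<omega>)) - of_real (exp (- a / 4))) \<le> K * (sqrt (dev N) + en N)"
    if N: "N > 0" for N
  proof -
    have "norm (expectation (\<lambda>\<omega>. cis (\<xi> \<bullet> (\<Sum>p<Suc N. A N p \<omega> * X p \<omega>))) - of_real (exp (- a / 4)))
      \<le> K * (expectation (\<lambda>\<omega>. \<bar>V N \<omega> - 1\<bar>) + (\<Sum>p<Suc N. expectation (\<lambda>\<omega>. norm (A N p \<omega>) ^ 4)))"
      unfolding a_def K_def V_def
      by (rule characteristic_function_close_to_gaussian) (use Ab coefficient_not_prime in \<open>auto simp: A_def\<close>)
    also have "\<dots> \<le> K * (sqrt (dev N) + en N)"
    proof (intro mult_left_mono add_mono)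
      have "expectation (\<lambda>\<omega>. \<bar>V N \<omega> - 1\<bar>) \<le> sqrt (expectation (\<lambda>\<omega>. (V N \<omega> - 1)\<^sup>2))"
        by (rule expectation_abs_le_sqrt[OF Vi])
      also have "expectation (\<lambda>\<omega>. (V N \<omega> - 1)\<^sup>2) = dev N"
        unfolding V_def A_def dev_def adm_ratios_def
      proof (rule quadratic_variation_deviation[OF finite_adm _ c N])
        show "p < Suc N \<and> m > 0" if "(p, m) \<in> adm N" for p m
        proof -
          have "p * 1 \<le> p * m" using that by (intro mult_le_mono) (auto simp: adm_def)
          also have "\<dots> \<le> N" using that by (simp add: adm_def)
          finally show ?thesis using that by (simp add: adm_def)
        qed
      qed
      finally show "expectation (\<lambda>\<omega>. \<bar>V N \<omega> - 1\<bar>) \<le> sqrt (dev N)" .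
      show "(\<Sum>p<Suc N. expectation (\<lambda>\<omega>. norm (A N p \<omega>) ^ 4)) \<le> en N"
        unfolding en_def A_def lessThan_Suc_atMost
        by (intro sum_mono coefficient_fourth_moment finite_adm c N) (simp add: adm_def)
      show "0 \<le> K" by (simp add: K_def)
    qed
    finally show ?thesis by (simp add: martingale_part_def A_def)
  qed
  have "(\<lambda>N. K * (sqrt (dev N) + en N)) \<longlonglongrightarrow> K * (sqrt 0 + 0)" by (intro tendsto_intros dev0 en0)
  hence lim: "(\<lambda>N. K * (sqrt (dev N) + en N)) \<longlonglongrightarrow> 0" by simp
  have "\<forall>\<^sub>F N in sequentially. norm (expectation (\<lambda>\<omega>. cis (\<xi> \<bullet> martingale_part c N \<omega>)) - of_real (exp (- a / 4))) \<le> K * (sqrt (dev N) + en N)"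
    using eventually_gt_at_top[of 0] by eventually_elim (rule main)
  from Lim_null_comparison[OF this lim] show ?thesis unfolding a_def by (rule LIM_zero_cancel)
qed

lemma char_chi_sum_tendsto:
  fixes c :: "nat \<Rightarrow> complex"
  assumes c: "\<And>n. norm (c n) = 1"
    and off: "(\<lambda>N. off_diagonal N c) \<longlonglongrightarrow> 0"
  shows "(\<lambda>N. expectation (\<lambda>\<omega>. cis (\<xi> \<bullet> chi_sum c N \<omega>))) \<longlonglongrightarrow> of_real (exp (- (norm \<xi>)\<^sup>2 / 4))"
proof -
  have "(\<lambda>N. norm \<xi> * sqrt (1 - real (card (adm N)) / real N)) \<longlonglongrightarrow> norm \<xi> * sqrt (1 - 1)"
    by (intro tendsto_intros adm_density)
  hence lim: "(\<lambda>N. norm \<xi> * sqrt (1 - real (card (adm N)) / real N)) \<longlonglongrightarrow> 0" by simp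
  have "\<forall>\<^sub>F N in sequentially. norm (expectation (\<lambda>\<omega>. cis (\<xi> \<bullet> chi_sum c N \<omega>)) - expectation (\<lambda>\<omega>. cis (\<xi> \<bullet> martingale_part c N \<omega>)))
    \<le> norm \<xi> * sqrt (1 - real (card (adm N)) / real N)"
    using eventually_gt_at_top[of 0] by eventually_elim (rule char_chi_sum_close[OF c])
  from tendsto_add[OF Lim_null_comparison[OF this lim] char_martingale_part_tendsto[OF c off, of \<xi>]]
  show ?thesis by simp
qed

text \<open>Chebyshev's inequality, as the mean square is at most 1.\<close>
lemma chi_sum_tail:
  assumes c: "\<And>n. norm (c n) = 1" and r: "r > 0"
  shows "prob {\<omega>\<in>space M. r \<le> norm (chi_sum c N \<omega>)} \<le> 1 / r\<^sup>2"
proof -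
  have m: "(\<lambda>\<omega>. chi_sum c N \<omega>) \<in> borel_measurable M" unfolding chi_sum_def by (rule chi_combination_measurable)
  have S: "{\<omega>\<in>space M. r \<le> norm (chi_sum c N \<omega>)} \<in> events" using norm_measurable[OF m] by measurable
  have i: "integrable M (\<lambda>\<omega>. (norm (chi_sum c N \<omega>))\<^sup>2)" unfolding chi_sum_def by (rule chi_sum_square(1)) (auto simp: c)
  have "expectation (\<lambda>\<omega>. (norm (chi_sum c N \<omega>))\<^sup>2) = real (card {1..N}) / real N" unfolding chi_sum_def by (rule chi_sum_square(2)) (auto simp: c)
  hence e: "expectation (\<lambda>\<omega>. (norm (chi_sum c N \<omega>))\<^sup>2) \<le> 1" by simp
  have "prob {\<omega>\<in>space M. r \<le> norm (chi_sum c N \<omega>)} = expectation (indicator {\<omega>\<in>space M. r \<le> norm (chi_sum c N \<omega>)})"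
    using S by simp
  also have "\<dots> \<le> expectation (\<lambda>\<omega>. (norm (chi_sum c N \<omega>))\<^sup>2 / r\<^sup>2)"
  proof (rule integral_mono)
    show "integrable M (indicator {\<omega>\<in>space M. r \<le> norm (chi_sum c N \<omega>)} :: _ \<Rightarrow> real)"
      using S by (intro integrable_real_indicator) (auto simp: emeasure_eq_measure)
    show "integrable M (\<lambda>\<omega>. (norm (chi_sum c N \<omega>))\<^sup>2 / r\<^sup>2)" using i by simp
    fix \<omega>
    have "1 \<le> (norm (chi_sum c N \<omega>))\<^sup>2 / r\<^sup>2" if "r \<le> norm (chi_sum c N \<omega>)"
      using power_mono[OF that, of 2] r by simp
    thus "indicator {\<omega>\<in>space M. r \<le> norm (chi_sum c N \<omega>)} \<omega> \<le> (norm (chi_sum c N \<omega>))\<^sup>2 / r\<^sup>2"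
      by (auto simp: indicator_def)
  qed
  also have "\<dots> = expectation (\<lambda>\<omega>. (norm (chi_sum c N \<omega>))\<^sup>2) / r\<^sup>2" by simp
  also have "\<dots> \<le> 1 / r\<^sup>2" using e by (intro divide_right_mono) auto
  finally show ?thesis .
qed

end

section \<open>Convergence in law\<close>

text \<open>A Steinhaus variable has modulus one only almost surely.  Replacing the exceptional values by 1 makes this
  true everywhere, without changing any law.\<close>
definition unimodular_part :: "complex \<Rightarrow> complex" where
  "unimodular_part z = (if norm z = 1 then z else 1)"

lemma unimodular_part_measurable: "unimodular_part \<in> borel_measurable borel"
proof -
  have "{z \<in> space borel. norm (z::complex) = 1} \<in> sets borel" by measurable
  thus ?thesis unfolding unimodular_part_def[abs_def] by (intro measurable_If measurable_ident_sets measurable_const) auto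
qed

lemma steinhaus_imp_phases:
  assumes "steinhaus M f"
  shows "steinhaus_phases M (\<lambda>p \<omega>. unimodular_part (f p \<omega>))"
proof -
  interpret prob_space M using assms by (simp add: steinhaus_def)
  have ind: "indep_vars (\<lambda>_. borel) f {p. prime p}" and dist: "\<And>p. prime p \<Longrightarrow> distr M borel (f p) = unit_circle_measure"
    using assms by (auto simp: steinhaus_def)
  show ?thesis
  proof
    show "indep_vars (\<lambda>_. borel) (\<lambda>p \<omega>. unimodular_part (f p \<omega>)) {p. prime p}"
      by (rule indep_vars_compose2[OF ind]) (rule unimodular_part_measurable)
    show "norm (unimodular_part (f p \<omega>)) = 1" for p \<omega> by (simp add: unimodular_part_def)
    fix p :: nat assume p: "prime p"
    have fm: "f p \<in> borel_measurable M" using ind p by (auto simp: indep_vars_def)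
    have "distr M borel (\<lambda>\<omega>. unimodular_part (f p \<omega>)) = distr (distr M borel (f p)) borel unimodular_part"
      using distr_distr[OF unimodular_part_measurable fm] by (simp add: comp_def)
    also have "\<dots> = distr (uniform_measure lborel {0..1}) borel (\<lambda>x. unimodular_part (unit_exp x))"
      unfolding dist[OF p] unit_circle_measure_def
      by (subst distr_distr[OF unimodular_part_measurable]) (auto simp: comp_def)
    also have "\<dots> = unit_circle_measure" by (simp add: unimodular_part_def unit_circle_measure_def)
    finally show "distr M borel (\<lambda>\<omega>. unimodular_part (f p \<omega>)) = unit_circle_measure" .
  qed
qed

lemma steinhaus_AE_norm_1:
  assumes "steinhaus M f" "prime p"
  shows "AE \<omega> in M. norm (f p \<omega>) = 1"
proof -
  interpret prob_space M using assms by (simp add: steinhaus_def)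
  have fm: "f p \<in> borel_measurable M" using assms by (auto simp: steinhaus_def indep_vars_def)
  have s: "{z \<in> space borel. norm (z::complex) = 1} \<in> sets borel" by measurable
  have "AE x in uniform_measure lborel {0..1::real}. norm (unit_exp x) = 1" by (simp add: unit_exp_cis)
  hence ae: "AE z in unit_circle_measure. norm z = 1"
    unfolding unit_circle_measure_def by (subst AE_distr_iff) (use s in auto)
  have d: "distr M borel (f p) = unit_circle_measure" using assms by (simp add: steinhaus_def)
  show ?thesis by (rule iffD1[OF AE_distr_iff[OF fm s]], unfold d) (rule ae)
qed

lemma steinhaus_measurable:
  assumes "steinhaus M f" "n > 0"
  shows "f n \<in> borel_measurable M"
proof -
  interpret prob_space M using assms by (simp add: steinhaus_def)
  have "f p \<in> borel_measurable M" if "prime p" for p using assms that by (auto simp: steinhaus_def indep_vars_def)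
  hence "(\<lambda>\<omega>. \<Prod>p\<in>prime_factors n. f p \<omega> ^ multiplicity p n) \<in> borel_measurable M"
    by (intro borel_measurable_prod borel_measurable_power) auto
  thus ?thesis using assms by (subst measurable_cong[where g = "\<lambda>\<omega>. \<Prod>p\<in>prime_factors n. f p \<omega> ^ multiplicity p n"]) (auto simp: steinhaus_def)
qed

theorem corollary3:
  fixes M :: "'a measure" and f :: "nat \<Rightarrow> 'a \<Rightarrow> complex"
    and g :: "real poly" and d :: nat
  assumes "d \<ge> 1" and "degree g = d"
    and "\<forall>\<epsilon>>0. \<exists>C>0. \<forall>q::int. q \<noteq> 0 \<longrightarrow>
           Max ((\<lambda>i. dist_int (of_int q * coeff g i)) ` {1..d})
             \<ge> C * exp (- (real_of_int \<bar>q\<bar> powr \<epsilon>))"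
    and "steinhaus M f"
  shows "converges_in_law M (twisted_sum f g) complex_std_normal"
proof -
  define c where "c = (\<lambda>n. unit_exp (poly g (real n)))"
  have c1: "norm (c n) = 1" for n by (simp add: c_def)
  interpret steinhaus_phases M "\<lambda>p \<omega>. unimodular_part (f p \<omega>)" by (rule steinhaus_imp_phases[OF assms(4)])
  have "AE \<omega> in M. \<forall>p\<in>{p. prime p}. norm (f p \<omega>) = 1"
    using steinhaus_AE_norm_1[OF assms(4)] by (intro AE_ball_countable') auto
  hence AE_eq: "AE \<omega> in M. twisted_sum f g N \<omega> = chi_sum c N \<omega>" for N
  proof (rule AE_mp, intro AE_I2 impI)
    fix \<omega> assume \<omega>: "\<omega> \<in> space M" and one: "\<forall>p\<in>{p. prime p}. norm (f p \<omega>) = 1"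
    have "f n \<omega> = chi n \<omega>" if "n > 0" for n
    proof -
      have "f n \<omega> = (\<Prod>p\<in>prime_factors n. f p \<omega> ^ multiplicity p n)" using assms(4) that \<omega> by (simp add: steinhaus_def)
      also have "\<dots> = chi n \<omega>"
        unfolding chi_eq_prod by (rule prod.cong) (use one in \<open>auto simp: unimodular_part_def\<close>)
      finally show ?thesis .
    qed
    thus "twisted_sum f g N \<omega> = chi_sum c N \<omega>"
      unfolding twisted_sum_def chi_sum_def sum_distrib_left c_def by (intro sum.cong) auto
  qed
  have meas: "twisted_sum f g N \<in> borel_measurable M" for N
    unfolding twisted_sum_def[abs_def]
    by (intro borel_measurable_times borel_measurable_const borel_measurable_sum steinhaus_measurable[OF assms(4)]) auto
  (* The only use of the Diophantine hypothesis. *)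
  have off: "(\<lambda>N. off_diagonal N c) \<longlonglongrightarrow> 0"
    unfolding c_def by (rule off_diagonal_tendsto_0) (use assms in auto)
  have chi_meas: "chi_sum c N \<in> borel_measurable M" for N
    unfolding chi_sum_def[abs_def] by (rule chi_combination_measurable)
  show ?thesis
    unfolding converges_in_law_def
  proof (intro conjI allI impI meas)
    fix h :: "complex \<Rightarrow> real" assume h: "continuous_on UNIV h \<and> bounded (range h)"
    show "(\<lambda>n. \<integral>z. h z \<partial>distr M borel (twisted_sum f g n)) \<longlonglongrightarrow> (\<integral>z. h z \<partial>complex_std_normal)"
    proof (rule weak_convergence_of_characteristic_functions)
      show "prob_space (distr M borel (twisted_sum f g n))" for n by (rule prob_space_distr[OF meas])
      show "prob_space complex_std_normal" by (rule prob_space_complex_std_normal)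
      show "sets complex_std_normal = sets borel" by (simp add: complex_std_normal_def)
      show "continuous_on UNIV h" "bounded (range h)" using h by auto
      show "(\<lambda>n. \<integral>z. cis (\<xi> \<bullet> z) \<partial>distr M borel (twisted_sum f g n)) \<longlonglongrightarrow> (\<integral>z. cis (\<xi> \<bullet> z) \<partial>complex_std_normal)" for \<xi>
      proof -
        have cc: "(\<lambda>z. cis (\<xi> \<bullet> z)) \<in> borel_measurable borel"
          by (intro borel_measurable_continuous_onI continuous_intros)
        have "(\<integral>z. cis (\<xi> \<bullet> z) \<partial>distr M borel (twisted_sum f g n)) = expectation (\<lambda>\<omega>. cis (\<xi> \<bullet> chi_sum c n \<omega>))" for n
        proof -
          have "(\<integral>z. cis (\<xi> \<bullet> z) \<partial>distr M borel (twisted_sum f g n)) = expectation (\<lambda>\<omega>. cis (\<xi> \<bullet> twisted_sum f g n \<omega>))"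
            by (rule integral_distr[OF meas cc])
          also have "\<dots> = expectation (\<lambda>\<omega>. cis (\<xi> \<bullet> chi_sum c n \<omega>))"
          proof (rule integral_cong_AE)
            show "(\<lambda>\<omega>. cis (\<xi> \<bullet> twisted_sum f g n \<omega>)) \<in> borel_measurable M" by (rule measurable_compose[OF meas cc])
            show "(\<lambda>\<omega>. cis (\<xi> \<bullet> chi_sum c n \<omega>)) \<in> borel_measurable M" by (rule measurable_compose[OF chi_meas cc])
            show "AE \<omega> in M. cis (\<xi> \<bullet> twisted_sum f g n \<omega>) = cis (\<xi> \<bullet> chi_sum c n \<omega>)" using AE_eq[of n] by eventually_elim simp
          qed
          finally show ?thesis .
        qed
        thus ?thesis using char_chi_sum_tendsto[OF c1 off, of \<xi>] by (simp add: char_complex_std_normal)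
      qed
      show "\<exists>r. \<forall>n. measure (distr M borel (twisted_sum f g n)) {z. r \<le> norm z} \<le> \<delta>" if \<delta>: "\<delta> > 0" for \<delta>
      proof (rule exI[of _ "1 / sqrt \<delta>"], rule allI)
        fix n
        let ?r = "1 / sqrt \<delta>"
        have r: "?r > 0" using \<delta> by simp
        have "measure (distr M borel (twisted_sum f g n)) {z. ?r \<le> norm z} = prob (twisted_sum f g n -` {z. ?r \<le> norm z} \<inter> space M)"
          by (rule measure_distr[OF meas]) measurable
        also have "\<dots> = prob {\<omega>\<in>space M. ?r \<le> norm (chi_sum c n \<omega>)}"
        proof (rule finite_measure_eq_AE)
          show "AE \<omega> in M. (\<omega> \<in> twisted_sum f g n -` {z. ?r \<le> norm z} \<inter> space M) = (\<omega> \<in> {\<omega>\<in>space M. ?r \<le> norm (chi_sum c n \<omega>)})"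
            using AE_eq[of n] by eventually_elim auto
          show "twisted_sum f g n -` {z. ?r \<le> norm z} \<inter> space M \<in> events" by (rule measurable_sets[OF meas]) measurable
          show "{\<omega>\<in>space M. ?r \<le> norm (chi_sum c n \<omega>)} \<in> events" using norm_measurable[OF chi_meas] by measurable
        qed
        also have "\<dots> \<le> 1 / ?r\<^sup>2" by (rule chi_sum_tail[OF c1 r])
        also have "\<dots> = \<delta>" using \<delta> by (simp add: power_divide)
        finally show "measure (distr M borel (twisted_sum f g n)) {z. ?r \<le> norm z} \<le> \<delta>" .
      qed
    qed simp_all
  qed
qed

end
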